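(* There are homotopy equivalences of complexes of graded $R$-bimodules $$\mathcal{R}\otimes_R\mathcal{R}'\simeq R \qquad\text{and}\qquad \mathcal{R}'\otimes_R\mathcal{R}\simeq R,$$ where $R$ denotes the identity $R$-bimodule, viewed as a complex concentrated in homological degree $0$.
   Context: Let $\mathbf{k}$ be a commutative ring and $R=\mathbf{k}\langle x_1,x_2\rangle/(x_1x_2+x_2x_1)$, graded with $\deg x_1=\deg x_2=2$. Let $s$ be the $\mathbf{k}$-algebra automorphism of $R$ with $s(x_1)=-x_2$, $s(x_2)=-x_1$. The odd Demazure operator is the $\mathbf{k}$-linear map $\partial:R\to R$ with $\partial(1)=0$, $\partial(x_1)=\partial(x_2)=1$ and $\partial(fg)=\partial(f)g+s(f)\partial(g)$. Let $R^s=\ker\partial\subset R$, a graded subring stable under $s$, generated by $x_1-x_2$ and $x_1x_2$. Let $\underline{R}^s$ be the graded $R^s$-bimodule free of rank one on either side on a generator $\underline{1}^s$ of degree $0$, with $f\,\underline{1}^s=\underline{1}^s\,s(f)$ for $f\in R^s$. Grading shift: $M\{n\}_i=M_{i-n}$. Define graded $R$-bimodules $$B=R\otimes_{R^s}R\{-1\},\qquad \underline{B}=R\otimes_{R^s}\underline{R}^s\otimes_{R^s}R\{-1\}.$$ Let $m:B\to R\{-1\}$ be the degree-preserving bimodule map $f\otimes g\mapsto fg$, and let $\underline{\Delta}:R\{1\}\to\underline{B}$ be the degree-preserving bimodule map with $$\underline{\Delta}(1)=-x_2\otimes\underline{1}^s\otimes 1-1\otimes\underline{1}^s\otimes x_1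 .$$ The odd Rouquier complexes are the two-term complexes of graded $R$-bimodules $$\mathcal{R}:\ 0\to B\xrightarrow{\,m\,}R\{-1\}\to 0,\qquad \mathcal{R}':\ 0\to R\{1\}\xrightarrow{\,\underline{\Delta}\,}\underline{B}\to 0,$$ with $B$ and $\underline{B}$ placed in cohomological degree $0$. Homotopy equivalences are taken with respect to degree-preserving bimodule maps. *)

theory Defs
  imports "HOL-Algebra.Algebra"
begin

section \<open>The ring of odd polynomials in two variables\<close>

datatype gen = X1 | X2

definition monomial :: "('k, 'c) ring_scheme \<Rightarrow> 'k \<Rightarrow> gen list \<Rightarrow> gen list \<Rightarrow> 'k" where
  "monomial k a w = (\<lambda>v. if v = w then a else \<zero>\<^bsub>k\<^esub>)"

text \<open>Elements of the free algebra are finitely supported functions from words to coefficients;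
  the coefficient of a word in a product is a sum over all its factorisations into two words.\<close>

definition free_algebra :: "('k, 'c) ring_scheme \<Rightarrow> (gen list \<Rightarrow> 'k) ring" where
  "free_algebra k =
    \<lparr>carrier = {f. (\<forall>w. f w \<in> carrier k) \<and> finite {w. f w \<noteq> \<zero>\<^bsub>k\<^esub>}},
     monoid.mult = (\<lambda>f g w. \<Oplus>\<^bsub>k\<^esub> i \<in> {..length w}. f (take i w) \<otimes>\<^bsub>k\<^esub> g (drop i w)),
     one = monomial k \<one>\<^bsub>k\<^esub> [],
     ring.zero = (\<lambda>w. \<zero>\<^bsub>k\<^esub>),
     ring.add = (\<lambda>f g w. f w \<oplus>\<^bsub>k\<^esub> g w)\<rparr>"

definition odd_ideal :: "('k, 'c) ring_scheme \<Rightarrow> (gen list \<Rightarrow> 'k) set" where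
  "odd_ideal k = genideal (free_algebra k)
     {monomial k \<one>\<^bsub>k\<^esub> [X1, X2] \<oplus>\<^bsub>free_algebra k\<^esub> monomial k \<one>\<^bsub>k\<^esub> [X2, X1]}"

definition odd_ring :: "('k, 'c) ring_scheme \<Rightarrow> (gen list \<Rightarrow> 'k) set ring" where
  "odd_ring k = free_algebra k Quot odd_ideal k"

definition odd_const :: "('k, 'c) ring_scheme \<Rightarrow> 'k \<Rightarrow> (gen list \<Rightarrow> 'k) set" where
  "odd_const k a = odd_ideal k +>\<^bsub>free_algebra k\<^esub> monomial k a []"

definition odd_var :: "('k, 'c) ring_scheme \<Rightarrow> gen \<Rightarrow> (gen list \<Rightarrow> 'k) set" where
  "odd_var k v = odd_ideal k +>\<^bsub>free_algebra k\<^esub> monomial k \<one>\<^bsub>k\<^esub> [v]"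

definition odd_grading :: "('k, 'c) ring_scheme \<Rightarrow> int \<Rightarrow> (gen list \<Rightarrow> 'k) set set" where
  "odd_grading k i = (\<lambda>f. odd_ideal k +>\<^bsub>free_algebra k\<^esub> f) `
     {f \<in> carrier (free_algebra k). \<forall>w. f w \<noteq> \<zero>\<^bsub>k\<^esub> \<longrightarrow> 2 * int (length w) = i}"

definition odd_swap ::
  "('k, 'c) ring_scheme \<Rightarrow> ((gen list \<Rightarrow> 'k) set \<Rightarrow> (gen list \<Rightarrow> 'k) set) \<Rightarrow> bool" where
  "odd_swap k s \<longleftrightarrow>
     s \<in> ring_iso (odd_ring k) (odd_ring k) \<and>
     (\<forall>a \<in> carrier k. s (odd_const k a) = odd_const k a) \<and>
     s (odd_var k X1) = \<ominus>\<^bsub>odd_ring k\<^esub> odd_var k X2 \<and>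
     s (odd_var k X2) = \<ominus>\<^bsub>odd_ring k\<^esub> odd_var k X1"

definition odd_demazure ::
  "('k, 'c) ring_scheme \<Rightarrow> ((gen list \<Rightarrow> 'k) set \<Rightarrow> (gen list \<Rightarrow> 'k) set)
     \<Rightarrow> ((gen list \<Rightarrow> 'k) set \<Rightarrow> (gen list \<Rightarrow> 'k) set) \<Rightarrow> bool" where
  "odd_demazure k s \<delta> \<longleftrightarrow>
     \<delta> \<in> carrier (odd_ring k) \<rightarrow> carrier (odd_ring k) \<and>
     (\<forall>f \<in> carrier (odd_ring k). \<forall>g \<in> carrier (odd_ring k).
        \<delta> (f \<oplus>\<^bsub>odd_ring k\<^esub> g) = \<delta> f \<oplus>\<^bsub>odd_ring k\<^esub> \<delta> g) \<and>
     (\<forall>a \<in> carrier k. \<forall>f \<in> carrier (odd_ring k).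
        \<delta> (odd_const k a \<otimes>\<^bsub>odd_ring k\<^esub> f) = odd_const k a \<otimes>\<^bsub>odd_ring k\<^esub> \<delta> f) \<and>
     \<delta> \<one>\<^bsub>odd_ring k\<^esub> = \<zero>\<^bsub>odd_ring k\<^esub> \<and>
     \<delta> (odd_var k X1) = \<one>\<^bsub>odd_ring k\<^esub> \<and>
     \<delta> (odd_var k X2) = \<one>\<^bsub>odd_ring k\<^esub> \<and>
     (\<forall>f \<in> carrier (odd_ring k). \<forall>g \<in> carrier (odd_ring k).
        \<delta> (f \<otimes>\<^bsub>odd_ring k\<^esub> g) =
          (\<delta> f \<otimes>\<^bsub>odd_ring k\<^esub> g) \<oplus>\<^bsub>odd_ring k\<^esub> (s f \<otimes>\<^bsub>odd_ring k\<^esub> \<delta> g))"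

definition odd_invariants ::
  "('k, 'c) ring_scheme \<Rightarrow> ((gen list \<Rightarrow> 'k) set \<Rightarrow> (gen list \<Rightarrow> 'k) set)
     \<Rightarrow> (gen list \<Rightarrow> 'k) set ring" where
  "odd_invariants k \<delta> = (odd_ring k)
     \<lparr>carrier := {f \<in> carrier (odd_ring k). \<delta> f = \<zero>\<^bsub>odd_ring k\<^esub>}\<rparr>"


section \<open>Graded bimodules\<close>

text \<open>As for the library's \<open>module\<close> record, the additive group of a bimodule is
  given by the additive fields of a ring record, and the fields \<open>mult\<close> and
  \<open>one\<close> are not used. The field \<open>homog\<close> gives the homogeneous components. The rings that act
  are not part of the record: one and the same record may be seen as a bimodule over several rings.\<close>

record ('a, 'm) bimodule = "'m ring" +
  lact :: "'a \<Rightarrow> 'm \<Rightarrow> 'm"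
  ract :: "'m \<Rightarrow> 'a \<Rightarrow> 'm"
  homog :: "int \<Rightarrow> 'm set"

locale graded_bimodule = R?: ring R + M?: abelian_group M
  for R :: "'a ring" (structure) and grR :: "int \<Rightarrow> 'a set"
    and M :: "('a, 'm) bimodule" (structure) +
  assumes lact_closed: "\<lbrakk>a \<in> carrier R; m \<in> carrier M\<rbrakk> \<Longrightarrow> lact M a m \<in> carrier M"
    and ract_closed: "\<lbrakk>a \<in> carrier R; m \<in> carrier M\<rbrakk> \<Longrightarrow> ract M m a \<in> carrier M"
    and lact_add_left: "\<lbrakk>a \<in> carrier R; b \<in> carrier R; m \<in> carrier M\<rbrakk> \<Longrightarrow>
          lact M (a \<oplus>\<^bsub>R\<^esub> b) m = lact M a m \<oplus>\<^bsub>M\<^esub> lact M b m"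
    and lact_add_right: "\<lbrakk>a \<in> carrier R; m \<in> carrier M; n \<in> carrier M\<rbrakk> \<Longrightarrow>
          lact M a (m \<oplus>\<^bsub>M\<^esub> n) = lact M a m \<oplus>\<^bsub>M\<^esub> lact M a n"
    and ract_add_left: "\<lbrakk>a \<in> carrier R; m \<in> carrier M; n \<in> carrier M\<rbrakk> \<Longrightarrow>
          ract M (m \<oplus>\<^bsub>M\<^esub> n) a = ract M m a \<oplus>\<^bsub>M\<^esub> ract M n a"
    and ract_add_right: "\<lbrakk>a \<in> carrier R; b \<in> carrier R; m \<in> carrier M\<rbrakk> \<Longrightarrow>
          ract M m (a \<oplus>\<^bsub>R\<^esub> b) = ract M m a \<oplus>\<^bsub>M\<^esub> ract M m b"
    and lact_assoc: "\<lbrakk>a \<in> carrier R; b \<in> carrier R; m \<in> carrier M\<rbrakk> \<Longrightarrow>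
          lact M (a \<otimes>\<^bsub>R\<^esub> b) m = lact M a (lact M b m)"
    and ract_assoc: "\<lbrakk>a \<in> carrier R; b \<in> carrier R; m \<in> carrier M\<rbrakk> \<Longrightarrow>
          ract M m (a \<otimes>\<^bsub>R\<^esub> b) = ract M (ract M m a) b"
    and lact_ract: "\<lbrakk>a \<in> carrier R; b \<in> carrier R; m \<in> carrier M\<rbrakk> \<Longrightarrow>
          ract M (lact M a m) b = lact M a (ract M m b)"
    and lact_one: "m \<in> carrier M \<Longrightarrow> lact M \<one>\<^bsub>R\<^esub> m = m"
    and ract_one: "m \<in> carrier M \<Longrightarrow> ract M m \<one>\<^bsub>R\<^esub> = m"
    and homog_subgroup: "additive_subgroup (homog M i) M"
    and homog_decomposition: "m \<in> carrier M \<Longrightarrow>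
          \<exists>!c. (\<forall>i. c i \<in> homog M i) \<and> finite {i. c i \<noteq> \<zero>\<^bsub>M\<^esub>} \<and>
               m = (\<Oplus>\<^bsub>M\<^esub> i \<in> {i. c i \<noteq> \<zero>\<^bsub>M\<^esub>}. c i)"
    and lact_homog: "\<lbrakk>a \<in> grR i; m \<in> homog M j\<rbrakk> \<Longrightarrow> lact M a m \<in> homog M (i + j)"
    and ract_homog: "\<lbrakk>a \<in> grR i; m \<in> homog M j\<rbrakk> \<Longrightarrow> ract M m a \<in> homog M (j + i)"

definition bimodule_hom ::
  "'a ring \<Rightarrow> ('a, 'm) bimodule \<Rightarrow> ('a, 'n) bimodule \<Rightarrow> ('m \<Rightarrow> 'n) set" where
  "bimodule_hom R M N = {f \<in> carrier M \<rightarrow> carrier N.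
     (\<forall>x \<in> carrier M. \<forall>y \<in> carrier M. f (x \<oplus>\<^bsub>M\<^esub> y) = f x \<oplus>\<^bsub>N\<^esub> f y) \<and>
     (\<forall>a \<in> carrier R. \<forall>x \<in> carrier M. f (lact M a x) = lact N a (f x)) \<and>
     (\<forall>a \<in> carrier R. \<forall>x \<in> carrier M. f (ract M x a) = ract N (f x) a) \<and>
     (\<forall>i. f ` homog M i \<subseteq> homog N i)}"

definition regular_bimodule :: "'a ring \<Rightarrow> (int \<Rightarrow> 'a set) \<Rightarrow> ('a, 'a) bimodule" where
  "regular_bimodule R grR =
    \<lparr>carrier = carrier R, monoid.mult = undefined, one = undefined, ring.zero = \<zero>\<^bsub>R\<^esub>, ring.add = ring.add R,
     lact = monoid.mult R, ract = monoid.mult R, homog = grR\<rparr>"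

definition shift :: "int \<Rightarrow> ('a, 'm) bimodule \<Rightarrow> ('a, 'm) bimodule" where
  "shift n M = M\<lparr>homog := \<lambda>i. homog M (i - n)\<rparr>"

definition zero_part :: "('a, 'm) bimodule \<Rightarrow> ('a, 'm) bimodule" where
  "zero_part M = M\<lparr>carrier := {\<zero>\<^bsub>M\<^esub>}, homog := \<lambda>i. {\<zero>\<^bsub>M\<^esub>}\<rparr>"

definition direct_sum2 ::
  "('a, 'm) bimodule \<Rightarrow> ('a, 'n) bimodule \<Rightarrow> ('a, 'm \<times> 'n) bimodule" where
  "direct_sum2 M N =
    \<lparr>carrier = carrier M \<times> carrier N, monoid.mult = undefined, one = undefined,
     ring.zero = (\<zero>\<^bsub>M\<^esub>, \<zero>\<^bsub>N\<^esub>),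
     ring.add = (\<lambda>(m, n) (m', n'). (m \<oplus>\<^bsub>M\<^esub> m', n \<oplus>\<^bsub>N\<^esub> n')),
     lact = (\<lambda>a (m, n). (lact M a m, lact N a n)),
     ract = (\<lambda>(m, n) a. (ract M m a, ract N n a)),
     homog = (\<lambda>i. homog M i \<times> homog N i)\<rparr>"

definition direct_sum :: "(int \<Rightarrow> ('a, 'm) bimodule) \<Rightarrow> ('a, int \<Rightarrow> 'm) bimodule" where
  "direct_sum M =
    \<lparr>carrier = {x. (\<forall>i. x i \<in> carrier (M i)) \<and> finite {i. x i \<noteq> \<zero>\<^bsub>M i\<^esub>}},
     monoid.mult = undefined, one = undefined,
     ring.zero = (\<lambda>i. \<zero>\<^bsub>M i\<^esub>),
     ring.add = (\<lambda>x y i. x i \<oplus>\<^bsub>M i\<^esub> y i),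
     lact = (\<lambda>a x i. lact (M i) a (x i)),
     ract = (\<lambda>x a i. ract (M i) (x i) a),
     homog = (\<lambda>j. {x. (\<forall>i. x i \<in> homog (M i) j) \<and> finite {i. x i \<noteq> \<zero>\<^bsub>M i\<^esub>}})\<rparr>"


section \<open>Tensor products of bimodules\<close>

text \<open>The tensor product over \<open>S\<close> is the free abelian group on pairs modulo the usual relations,
  so its elements are cosets. Only the carrier of \<open>S\<close> enters.\<close>

definition tensor_free ::
  "('a, 'm) bimodule \<Rightarrow> ('a, 'n) bimodule \<Rightarrow> ('m \<times> 'n \<Rightarrow>\<^sub>0 int) monoid" where
  "tensor_free M N = free_Abelian_group (carrier M \<times> carrier N)"

definition tensor_relations ::
  "'a ring \<Rightarrow> ('a, 'm) bimodule \<Rightarrow> ('a, 'n) bimodule \<Rightarrow> ('m \<times> 'n \<Rightarrow>\<^sub>0 int) set" where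
  "tensor_relations S M N = generate (tensor_free M N)
    ({frag_of (m \<oplus>\<^bsub>M\<^esub> m', n) - frag_of (m, n) - frag_of (m', n) | m m' n.
        m \<in> carrier M \<and> m' \<in> carrier M \<and> n \<in> carrier N} \<union>
     {frag_of (m, n \<oplus>\<^bsub>N\<^esub> n') - frag_of (m, n) - frag_of (m, n') | m n n'.
        m \<in> carrier M \<and> n \<in> carrier N \<and> n' \<in> carrier N} \<union>
     {frag_of (ract M m r, n) - frag_of (m, lact N r n) | m r n.
        m \<in> carrier M \<and> r \<in> carrier S \<and> n \<in> carrier N})"

definition tensor_group ::
  "'a ring \<Rightarrow> ('a, 'm) bimodule \<Rightarrow> ('a, 'n) bimodule \<Rightarrow> ('m \<times> 'n \<Rightarrow>\<^sub>0 int) set monoid" where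
  "tensor_group S M N = tensor_free M N Mod tensor_relations S M N"

definition tensor_class :: "'a ring \<Rightarrow> ('a, 'm) bimodule \<Rightarrow> ('a, 'n) bimodule
    \<Rightarrow> ('m \<times> 'n \<Rightarrow>\<^sub>0 int) \<Rightarrow> ('m \<times> 'n \<Rightarrow>\<^sub>0 int) set" where
  "tensor_class S M N p = tensor_relations S M N #>\<^bsub>tensor_free M N\<^esub> p"

definition pure_tensor :: "'a ring \<Rightarrow> ('a, 'm) bimodule \<Rightarrow> ('a, 'n) bimodule
    \<Rightarrow> 'm \<Rightarrow> 'n \<Rightarrow> ('m \<times> 'n \<Rightarrow>\<^sub>0 int) set" where
  "pure_tensor S M N m n = tensor_class S M N (frag_of (m, n))"

text \<open>The map \<open>f \<otimes> g\<close> into the tensor product \<open>M' \<otimes>\<^sub>S N'\<close>. As in the library's \<open>FactGroup_hom\<close>,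
  a map that does not depend on the representative is evaluated on a coset by \<open>the_elem\<close>.\<close>

definition tensor_map :: "'a ring \<Rightarrow> ('a, 'm2) bimodule \<Rightarrow> ('a, 'n2) bimodule
    \<Rightarrow> ('m \<Rightarrow> 'm2) \<Rightarrow> ('n \<Rightarrow> 'n2)
    \<Rightarrow> ('m \<times> 'n \<Rightarrow>\<^sub>0 int) set \<Rightarrow> ('m2 \<times> 'n2 \<Rightarrow>\<^sub>0 int) set" where
  "tensor_map S M' N' f g t =
     the_elem ((\<lambda>p. tensor_class S M' N' (frag_extend (\<lambda>(m, n). frag_of (f m, g n)) p)) ` t)"

definition tensor :: "'a ring \<Rightarrow> ('a, 'm) bimodule \<Rightarrow> ('a, 'n) bimodule
    \<Rightarrow> ('a, ('m \<times> 'n \<Rightarrow>\<^sub>0 int) set) bimodule" where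
  "tensor S M N =
    \<lparr>carrier = carrier (tensor_group S M N), monoid.mult = undefined, one = undefined,
     ring.zero = \<one>\<^bsub>tensor_group S M N\<^esub>,
     ring.add = monoid.mult (tensor_group S M N),
     lact = (\<lambda>a. tensor_map S M N (lact M a) id),
     ract = (\<lambda>t a. tensor_map S M N id (\<lambda>n. ract N n a) t),
     homog = (\<lambda>i. generate (tensor_group S M N)
        {pure_tensor S M N m n | m n j l. m \<in> homog M j \<and> n \<in> homog N l \<and> j + l = i})\<rparr>"


section \<open>Complexes of graded bimodules\<close>

record ('a, 'm) cochains =
  obj :: "int \<Rightarrow> ('a, 'm) bimodule"
  diff :: "int \<Rightarrow> 'm \<Rightarrow> 'm"

definition cochain_complex ::
  "'a ring \<Rightarrow> (int \<Rightarrow> 'a set) \<Rightarrow> ('a, 'm) cochains \<Rightarrow> bool" where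
  "cochain_complex R grR C \<longleftrightarrow>
     (\<forall>n. graded_bimodule R grR (obj C n)) \<and>
     (\<forall>n. diff C n \<in> bimodule_hom R (obj C n) (obj C (n + 1))) \<and>
     (\<forall>n. \<forall>x \<in> carrier (obj C n). diff C (n + 1) (diff C n x) = \<zero>\<^bsub>obj C (n + 2)\<^esub>)"

definition cochain_map :: "'a ring \<Rightarrow> ('a, 'm) cochains \<Rightarrow> ('a, 'n) cochains
    \<Rightarrow> (int \<Rightarrow> 'm \<Rightarrow> 'n) \<Rightarrow> bool" where
  "cochain_map R C D f \<longleftrightarrow>
     (\<forall>n. f n \<in> bimodule_hom R (obj C n) (obj D n)) \<and>
     (\<forall>n. \<forall>x \<in> carrier (obj C n). f (n + 1) (diff C n x) = diff D n (f n x))"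

definition cochain_homotopic :: "'a ring \<Rightarrow> ('a, 'm) cochains \<Rightarrow> ('a, 'n) cochains
    \<Rightarrow> (int \<Rightarrow> 'm \<Rightarrow> 'n) \<Rightarrow> (int \<Rightarrow> 'm \<Rightarrow> 'n) \<Rightarrow> bool" where
  "cochain_homotopic R C D f g \<longleftrightarrow>
     (\<exists>h. (\<forall>n. h n \<in> bimodule_hom R (obj C n) (obj D (n - 1))) \<and>
          (\<forall>n. \<forall>x \<in> carrier (obj C n).
             f n x \<ominus>\<^bsub>obj D n\<^esub> g n x =
               diff D (n - 1) (h n x) \<oplus>\<^bsub>obj D n\<^esub> h (n + 1) (diff C n x)))"

definition homotopy_equivalent_complexes :: "'a ring \<Rightarrow> (int \<Rightarrow> 'a set)
    \<Rightarrow> ('a, 'm) cochains \<Rightarrow> ('a, 'n) cochains \<Rightarrow> bool" where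
  "homotopy_equivalent_complexes R grR C D \<longleftrightarrow>
     cochain_complex R grR C \<and> cochain_complex R grR D \<and>
     (\<exists>f g. cochain_map R C D f \<and> cochain_map R D C g \<and>
        cochain_homotopic R C C (\<lambda>n x. g n (f n x)) (\<lambda>n x. x) \<and>
        cochain_homotopic R D D (\<lambda>n x. f n (g n x)) (\<lambda>n x. x))"

definition concentrated :: "('a, 'm) bimodule \<Rightarrow> ('a, 'm) cochains" where
  "concentrated M =
    \<lparr>obj = (\<lambda>i. if i = 0 then M else zero_part M), diff = (\<lambda>i x. \<zero>\<^bsub>M\<^esub>)\<rparr>"

text \<open>The complex \<open>0 \<rightarrow> M \<rightarrow> N \<rightarrow> 0\<close> with \<open>M\<close> in degree \<open>p\<close>. All terms of a complex must have
  elements of one type, so \<open>M\<close> is replaced by \<open>M \<oplus> 0\<close> and \<open>N\<close> by \<open>0 \<oplus> N\<close>.\<close>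

definition two_term :: "int \<Rightarrow> ('a, 'm) bimodule \<Rightarrow> ('a, 'n) bimodule \<Rightarrow> ('m \<Rightarrow> 'n)
    \<Rightarrow> ('a, 'm \<times> 'n) cochains" where
  "two_term p M N d =
    \<lparr>obj = (\<lambda>i. direct_sum2 (if i = p then M else zero_part M)
                           (if i = p + 1 then N else zero_part N)),
     diff = (\<lambda>i (m, n). (\<zero>\<^bsub>M\<^esub>, if i = p then d m else \<zero>\<^bsub>N\<^esub>))\<rparr>"

text \<open>The term of degree \<open>n\<close> is the direct sum over all \<open>i\<close> of \<open>C\<^sup>i \<otimes> D\<^sup>n\<^sup>-\<^sup>i\<close>, and the differential
  is \<open>d (x \<otimes> y) = d x \<otimes> y + (-1)\<^sup>i x \<otimes> d y\<close> for \<open>x\<close> in \<open>C\<^sup>i\<close>.\<close>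

definition tensor_complex :: "'a ring \<Rightarrow> ('a, 'm) cochains \<Rightarrow> ('a, 'n) cochains
    \<Rightarrow> ('a, int \<Rightarrow> ('m \<times> 'n \<Rightarrow>\<^sub>0 int) set) cochains" where
  "tensor_complex S C D =
    \<lparr>obj = (\<lambda>n. direct_sum (\<lambda>i. tensor S (obj C i) (obj D (n - i)))),
     diff = (\<lambda>n x i.
       let T = tensor S (obj C i) (obj D (n + 1 - i));
           u = tensor_map S (obj C i) (obj D (n + 1 - i)) (diff C (i - 1)) id (x (i - 1));
           v = tensor_map S (obj C i) (obj D (n + 1 - i)) id (diff D (n - i)) (x i)
       in u \<oplus>\<^bsub>T\<^esub> (if even i then v else \<ominus>\<^bsub>T\<^esub> v))\<rparr>"


section \<open>The odd Rouquier complexes\<close>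

text \<open>The bimodule over \<open>R\<^sup>s\<close> that is free of rank one on either side on a generator \<open>e\<close> of
  degree \<open>0\<close> with \<open>f e = e s(f)\<close>: the element \<open>g\<close> of \<open>R\<^sup>s\<close> stands for \<open>e g\<close>, so that
  \<open>f \<cdot> (e g) = e (s(f) g)\<close>, and the generator is the unit of the ring.\<close>

definition twisted_invariants ::
  "('k, 'c) ring_scheme \<Rightarrow> ((gen list \<Rightarrow> 'k) set \<Rightarrow> (gen list \<Rightarrow> 'k) set)
     \<Rightarrow> ((gen list \<Rightarrow> 'k) set \<Rightarrow> (gen list \<Rightarrow> 'k) set)
     \<Rightarrow> ((gen list \<Rightarrow> 'k) set, (gen list \<Rightarrow> 'k) set) bimodule" where
  "twisted_invariants k s \<delta> =
    \<lparr>carrier = carrier (odd_invariants k \<delta>), monoid.mult = undefined, one = undefined,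
     ring.zero = \<zero>\<^bsub>odd_ring k\<^esub>, ring.add = ring.add (odd_ring k),
     lact = (\<lambda>f g. s f \<otimes>\<^bsub>odd_ring k\<^esub> g),
     ract = (\<lambda>g f. g \<otimes>\<^bsub>odd_ring k\<^esub> f),
     homog = (\<lambda>i. odd_grading k i \<inter> carrier (odd_invariants k \<delta>))\<rparr>"

abbreviation odd_regular ::
  "('k, 'c) ring_scheme \<Rightarrow> ((gen list \<Rightarrow> 'k) set, (gen list \<Rightarrow> 'k) set) bimodule" where
  "odd_regular k \<equiv> regular_bimodule (odd_ring k) (odd_grading k)"

definition odd_B where
  "odd_B k \<delta> = shift (- 1) (tensor (odd_invariants k \<delta>) (odd_regular k) (odd_regular k))"

definition odd_B_twisted where
  "odd_B_twisted k s \<delta> = shift (- 1)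
     (tensor (odd_invariants k \<delta>)
        (tensor (odd_invariants k \<delta>) (odd_regular k) (twisted_invariants k s \<delta>))
        (odd_regular k))"

text \<open>The element \<open>f \<otimes> e \<otimes> g\<close>.\<close>

definition odd_twisted_pure where
  "odd_twisted_pure k s \<delta> f g =
     pure_tensor (odd_invariants k \<delta>)
       (tensor (odd_invariants k \<delta>) (odd_regular k) (twisted_invariants k s \<delta>))
       (odd_regular k)
       (pure_tensor (odd_invariants k \<delta>) (odd_regular k) (twisted_invariants k s \<delta>)
          f \<one>\<^bsub>odd_ring k\<^esub>)
       g"

text \<open>The map \<open>m\<close>: the additive extension of \<open>f \<otimes> g \<mapsto> f g\<close>, evaluated on a coset.\<close>

definition odd_m ::
  "('k, 'c) ring_scheme \<Rightarrow> ((gen list \<Rightarrow> 'k) set \<times> (gen list \<Rightarrow> 'k) set \<Rightarrow>\<^sub>0 int) set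
     \<Rightarrow> (gen list \<Rightarrow> 'k) set" where
  "odd_m k t = the_elem ((\<lambda>p. \<Oplus>\<^bsub>odd_ring k\<^esub> q \<in> Poly_Mapping.keys p.
     [Poly_Mapping.lookup p q] \<cdot>\<^bsub>odd_ring k\<^esub> (fst q \<otimes>\<^bsub>odd_ring k\<^esub> snd q)) ` t)"

text \<open>The left linear map with \<open>1 \<mapsto> - x\<^sub>2 \<otimes> e \<otimes> 1 - 1 \<otimes> e \<otimes> x\<^sub>1\<close>.\<close>

definition odd_Delta where
  "odd_Delta k s \<delta> f = lact (odd_B_twisted k s \<delta>) f
     (odd_twisted_pure k s \<delta> (\<ominus>\<^bsub>odd_ring k\<^esub> odd_var k X2) \<one>\<^bsub>odd_ring k\<^esub>
      \<ominus>\<^bsub>odd_B_twisted k s \<delta>\<^esub>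
      odd_twisted_pure k s \<delta> \<one>\<^bsub>odd_ring k\<^esub> (odd_var k X1))"

definition odd_rouquier where
  "odd_rouquier k \<delta> = two_term 0 (odd_B k \<delta>) (shift (- 1) (odd_regular k)) (odd_m k)"

definition odd_rouquier' where
  "odd_rouquier' k s \<delta> =
     two_term (- 1) (shift 1 (odd_regular k)) (odd_B_twisted k s \<delta>) (odd_Delta k s \<delta>)"

end

theory Submission imports Defs begin

text \<open>Write \<open>S\<close> for the ring of invariants, \<open>B = R \<otimes>\<^sub>S R\<close>, and \<open>T\<close> for the twisted bimodule
  \<open>R \<otimes>\<^sub>S \<langle>e\<rangle> \<otimes>\<^sub>S R\<close>, where \<open>f e = e s(f)\<close> for invariant \<open>f\<close>; grading shifts are suppressed. All tensor
  products without an index are over \<open>R\<close>. The two products of the odd Rouquier complexes are squares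
  read as complexes in degrees \<open>- 1\<close>, \<open>0\<close>, \<open>1\<close>:

  \<open>B \<otimes> R \<rightarrow> (B \<otimes> T) \<oplus> (R \<otimes> R) \<rightarrow> R \<otimes> T\<close>  and
  \<open>R \<otimes> B \<rightarrow> (R \<otimes> R) \<oplus> (T \<otimes> B) \<rightarrow> T \<otimes> R\<close>.

  The summand \<open>R \<otimes> R\<close> of the middle term is \<open>R\<close>. What has to be shown is that the other middle summand
  splits into a copy of the left term and a copy of the right term, by way of the differentials; these
  three terms then cancel by Gaussian elimination (\<open>eliminate_summand\<close>), whatever the components of
  the differential from and to \<open>R \<otimes> R\<close> may be.

  In the first complex, let \<open>\<alpha>\<close> and \<open>\<gamma>\<close> be the components \<open>B \<otimes> R \<rightarrow> B \<otimes> T \<rightarrow> R \<otimes> T\<close> of the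
  differential, induced by \<open>\<Delta>\<close> and \<open>m\<close>. The splitting consists of two bimodule maps. Since
  \<open>B \<otimes> T\<close> is \<open>R \<otimes>\<^sub>S T\<close>, the map \<open>l (f \<otimes> e \<otimes> g) = s (\<delta> f) g\<close>, which is linear over \<open>S\<close> on the left and
  over \<open>R\<close> on the right, induces \<open>\<kappa> : B \<otimes> T \<rightarrow> R \<otimes>\<^sub>S R = B \<otimes> R\<close>. Inserting \<open>1\<close> gives
  \<open>\<sigma> : R \<otimes> T \<rightarrow> B \<otimes> T\<close> with \<open>\<gamma> \<sigma> = 1\<close>. The identity
  \<open>s (\<delta> (x x\<^sub>2)) + s (\<delta> x) x\<^sub>1 = x\<close> says \<open>\<kappa> \<alpha> = - 1\<close>; \<open>\<delta> 1 = 0\<close> says \<open>\<kappa> \<sigma> = 0\<close>; and the fact that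
  \<open>g - x\<^sub>2 \<delta> g\<close> is invariant implies that \<open>1 + \<alpha> \<kappa>\<close> has its image in the image of \<open>\<sigma>\<close>. Together these
  give the splitting (\<open>rouquier_tensor_inverse\<close>). The second complex is treated in the same way with the
  map \<open>f \<otimes> e \<otimes> g \<mapsto> f \<delta> g\<close>, the identity \<open>x\<^sub>2 \<delta> x + \<delta> (x\<^sub>1 x) = x\<close> and the invariant
  \<open>g - x\<^sub>1 \<delta> g\<close> (\<open>inverse_tensor_rouquier\<close>).

  The larger part of the work is to make tensor products of graded bimodules usable: their
  universal property, their grading, and the description of the tensor product of two two-term
  complexes as a square. The grading rests on \<open>grading_decomposition\<close>: decompositions into homogeneous
  parts are unique as soon as the projections to the parts exist as additive maps, and on a tensor
  product such maps are supplied by the universal property.\<close>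

section \<open>Additive maps and gradings of abelian groups\<close>

text \<open>Rings, bimodules and mere abelian groups are all ring records here, and an additive map refers to
  nothing but their carriers and additions.\<close>

definition add_hom :: "('m, 'c) ring_scheme \<Rightarrow> ('n, 'd) ring_scheme \<Rightarrow> ('m \<Rightarrow> 'n) \<Rightarrow> bool" where
  "add_hom M N f \<longleftrightarrow> f \<in> carrier M \<rightarrow> carrier N \<and>
     (\<forall>x \<in> carrier M. \<forall>y \<in> carrier M. f (x \<oplus>\<^bsub>M\<^esub> y) = f x \<oplus>\<^bsub>N\<^esub> f y)"

lemma add_homI:
  "\<lbrakk>\<And>x. x \<in> carrier M \<Longrightarrow> f x \<in> carrier N;
    \<And>x y. \<lbrakk>x \<in> carrier M; y \<in> carrier M\<rbrakk> \<Longrightarrow> f (x \<oplus>\<^bsub>M\<^esub> y) = f x \<oplus>\<^bsub>N\<^esub> f y\<rbrakk> \<Longrightarrow> add_hom M N f"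
  by (auto simp: add_hom_def)

lemma add_hom_closed: "add_hom M N f \<Longrightarrow> x \<in> carrier M \<Longrightarrow> f x \<in> carrier N"
  by (auto simp: add_hom_def)

lemma add_hom_add:
  "add_hom M N f \<Longrightarrow> x \<in> carrier M \<Longrightarrow> y \<in> carrier M \<Longrightarrow> f (x \<oplus>\<^bsub>M\<^esub> y) = f x \<oplus>\<^bsub>N\<^esub> f y"
  by (auto simp: add_hom_def)

lemma (in abelian_group) idem_add_zero: "x \<in> carrier G \<Longrightarrow> x \<oplus> x = x \<Longrightarrow> x = \<zero>"
  using add.l_cancel_one by auto

lemma (in abelian_group) a_inv_zero: "\<ominus> \<zero> = \<zero>"
  by (rule minus_equality) auto

lemma (in abelian_group) diff_swap:
  assumes "a \<in> carrier G" "b \<in> carrier G" "c \<in> carrier G" "d \<in> carrier G" "a \<ominus> b = c \<ominus> d"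
  shows "\<ominus> d \<ominus> a = \<ominus> b \<ominus> c"
proof -
  have "a = (a \<ominus> b) \<oplus> b" using assms(1,2) by (simp add: minus_eq a_assoc l_neg)
  then have "d \<oplus> a = b \<oplus> c" using assms(2-4) unfolding assms(5) by (simp add: minus_eq a_ac r_neg)
  then have "\<ominus> (d \<oplus> a) = \<ominus> (b \<oplus> c)" by simp
  then show ?thesis using assms(1-4) by (simp add: minus_eq minus_add)
qed

lemma add_hom_zero:
  assumes "abelian_group M" "abelian_group N" "add_hom M N f"
  shows "f \<zero>\<^bsub>M\<^esub> = \<zero>\<^bsub>N\<^esub>"
proof -
  interpret M: abelian_group M by fact
  interpret N: abelian_group N by fact
  show ?thesis
    using add_hom_add[OF assms(3), of "\<zero>\<^bsub>M\<^esub>" "\<zero>\<^bsub>M\<^esub>"] add_hom_closed[OF assms(3), of "\<zero>\<^bsub>M\<^esub>"]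
    by (auto intro: N.idem_add_zero)
qed

lemma add_hom_minus:
  assumes "abelian_group M" "abelian_group N" "add_hom M N f" "x \<in> carrier M"
  shows "f (\<ominus>\<^bsub>M\<^esub> x) = \<ominus>\<^bsub>N\<^esub> f x"
proof -
  interpret M: abelian_group M by fact
  interpret N: abelian_group N by fact
  have "f (\<ominus>\<^bsub>M\<^esub> x) \<oplus>\<^bsub>N\<^esub> f x = \<zero>\<^bsub>N\<^esub>"
    using add_hom_add[OF assms(3), of "\<ominus>\<^bsub>M\<^esub> x" x] add_hom_zero[OF assms(1-3)] assms(4)
    by (simp add: M.l_neg)
  then show ?thesis
    using add_hom_closed[OF assms(3)] assms(4) N.minus_equality by simp
qed

lemma add_hom_finsum:
  assumes "abelian_group M" "abelian_group N" "add_hom M N f" "finite I" "g \<in> I \<rightarrow> carrier M"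
  shows "f (\<Oplus>\<^bsub>M\<^esub> i \<in> I. g i) = (\<Oplus>\<^bsub>N\<^esub> i \<in> I. f (g i))"
proof -
  interpret M: abelian_group M by fact
  interpret N: abelian_group N by fact
  show ?thesis using assms(4,5)
  proof (induction I rule: finite_induct)
    case empty
    then show ?case by (simp add: add_hom_zero[OF assms(1-3)])
  next
    case (insert i I)
    have "(\<lambda>i. f (g i)) \<in> I \<rightarrow> carrier N" "f (g i) \<in> carrier N"
      using insert.prems add_hom_closed[OF assms(3)] by auto
    with insert show ?case by (simp add: add_hom_add[OF assms(3)] Pi_def)
  qed
qed

lemma add_hom_comp: "add_hom M N f \<Longrightarrow> add_hom N L g \<Longrightarrow> add_hom M L (\<lambda>x. g (f x))"
  by (simp add: add_hom_def Pi_iff)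

lemma add_hom_plus:
  assumes "abelian_group N" "add_hom M N f" "add_hom M N g"
  shows "add_hom M N (\<lambda>x. f x \<oplus>\<^bsub>N\<^esub> g x)"
proof -
  interpret N: abelian_group N by fact
  show ?thesis using assms(2,3)
    by (intro add_homI) (simp_all add: add_hom_closed add_hom_add N.a_ac)
qed

lemma add_hom_neg:
  assumes "abelian_group N" "add_hom M N f"
  shows "add_hom M N (\<lambda>x. \<ominus>\<^bsub>N\<^esub> f x)"
proof -
  interpret N: abelian_group N by fact
  show ?thesis using assms(2)
    by (intro add_homI) (simp_all add: add_hom_closed add_hom_add N.minus_add)
qed

lemma add_hom_zero_map: "abelian_group N \<Longrightarrow> add_hom M N (\<lambda>x. \<zero>\<^bsub>N\<^esub>)"
  by (simp add: add_hom_def abelian_group_def abelian_monoid.zero_closed abelian_monoid.l_zero)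

lemma add_hom_id: "add_hom M M (\<lambda>x. x)"
  by (simp add: add_hom_def)

text \<open>Closure under sums alone is demanded: the generating sets below all contain the negatives
  of their elements.\<close>

definition add_generates :: "('m, 'c) ring_scheme \<Rightarrow> 'm set \<Rightarrow> bool" where
  "add_generates M G \<longleftrightarrow>
     (\<forall>U. G \<subseteq> U \<longrightarrow> (\<forall>x \<in> carrier M \<inter> U. \<forall>y \<in> carrier M \<inter> U. x \<oplus>\<^bsub>M\<^esub> y \<in> U) \<longrightarrow> carrier M \<subseteq> U)"

lemma add_generates_induct [consumes 2, case_names gen add]:
  assumes "add_generates M G" "x \<in> carrier M"
    and "\<And>g. g \<in> G \<Longrightarrow> P g"
    and "\<And>x y. \<lbrakk>x \<in> carrier M; y \<in> carrier M; P x; P y\<rbrakk> \<Longrightarrow> P (x \<oplus>\<^bsub>M\<^esub> y)"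
  shows "P x"
proof -
  have "carrier M \<subseteq> Collect P"
    using assms(1)[unfolded add_generates_def, rule_format, of "Collect P"] assms(3,4) by blast
  with assms(2) show ?thesis by blast
qed

lemma add_generatesI:
  assumes "\<And>P x. \<lbrakk>\<And>g. g \<in> G \<Longrightarrow> P g; \<And>x y. \<lbrakk>x \<in> carrier M; y \<in> carrier M; P x; P y\<rbrakk> \<Longrightarrow> P (x \<oplus>\<^bsub>M\<^esub> y);
      x \<in> carrier M\<rbrakk> \<Longrightarrow> P x"
  shows "add_generates M G"
  unfolding add_generates_def
proof (intro allI impI subsetI)
  fix U x
  assume "G \<subseteq> U" "\<forall>x\<in>carrier M \<inter> U. \<forall>y\<in>carrier M \<inter> U. x \<oplus>\<^bsub>M\<^esub> y \<in> U" "x \<in> carrier M"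
  then show "x \<in> U" using assms[of "\<lambda>x. x \<in> U" x] by blast
qed

text \<open>The condition under the unique existence quantifier in the definition of a graded bimodule.\<close>

definition decomposes :: "('m, 'c) ring_scheme \<Rightarrow> (int \<Rightarrow> 'm set) \<Rightarrow> 'm \<Rightarrow> (int \<Rightarrow> 'm) \<Rightarrow> bool" where
  "decomposes M H m c \<longleftrightarrow> (\<forall>i. c i \<in> H i) \<and> finite {i. c i \<noteq> \<zero>\<^bsub>M\<^esub>} \<and>
     m = (\<Oplus>\<^bsub>M\<^esub> i \<in> {i. c i \<noteq> \<zero>\<^bsub>M\<^esub>}. c i)"

lemma additive_subgroup_zero: "additive_subgroup H M \<Longrightarrow> \<zero>\<^bsub>M\<^esub> \<in> H"
  by (rule additive_subgroup.zero_closed)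

lemma additive_subgroup_add: "additive_subgroup H M \<Longrightarrow> x \<in> H \<Longrightarrow> y \<in> H \<Longrightarrow> x \<oplus>\<^bsub>M\<^esub> y \<in> H"
  by (rule additive_subgroup.a_closed)

lemma additive_subgroup_carrier: "additive_subgroup H M \<Longrightarrow> x \<in> H \<Longrightarrow> x \<in> carrier M"
  by (rule additive_subgroup.a_Hcarr)

lemma additive_subgroup_minus:
  assumes "additive_subgroup H M" "x \<in> H" shows "\<ominus>\<^bsub>M\<^esub> x \<in> H"
  using subgroup.m_inv_closed[OF additive_subgroup.a_subgroup[OF assms(1)] assms(2)]
  by (simp add: a_inv_def)

lemma additive_subgroupI:
  assumes "abelian_group M" "H \<subseteq> carrier M" "\<zero>\<^bsub>M\<^esub> \<in> H"
    "\<And>x y. x \<in> H \<Longrightarrow> y \<in> H \<Longrightarrow> x \<oplus>\<^bsub>M\<^esub> y \<in> H" "\<And>x. x \<in> H \<Longrightarrow> \<ominus>\<^bsub>M\<^esub> x \<in> H"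
  shows "additive_subgroup H M"
proof -
  interpret M: abelian_group M by fact
  show ?thesis
    by (intro additive_subgroup.intro M.add.subgroupI) (use assms in \<open>auto simp: a_inv_def\<close>)
qed

lemma decomposes_superset:
  assumes "abelian_group M" "\<And>i. c i \<in> carrier M" "finite F" "{i. c i \<noteq> \<zero>\<^bsub>M\<^esub>} \<subseteq> F"
  shows "(\<Oplus>\<^bsub>M\<^esub> i \<in> {i. c i \<noteq> \<zero>\<^bsub>M\<^esub>}. c i) = (\<Oplus>\<^bsub>M\<^esub> i \<in> F. c i)"
proof -
  interpret M: abelian_group M by fact
  show ?thesis
    by (rule M.add.finprod_mono_neutral_cong_left) (use assms in auto)
qed

lemma decomposes_homog:
  assumes M: "abelian_group M" and H: "\<And>i. additive_subgroup (H i) M" and x: "x \<in> H j"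
  shows "decomposes M H x (\<lambda>i. if i = j then x else \<zero>\<^bsub>M\<^esub>)"
proof -
  interpret M: abelian_group M by fact
  let ?c = "\<lambda>i. if i = j then x else \<zero>\<^bsub>M\<^esub>"
  note xM = additive_subgroup_carrier[OF H x]
  have "(\<Oplus>\<^bsub>M\<^esub> i \<in> {i. ?c i \<noteq> \<zero>\<^bsub>M\<^esub>}. ?c i) = (\<Oplus>\<^bsub>M\<^esub> i \<in> {j}. ?c i)"
    by (rule decomposes_superset) (use M xM in auto)
  also have "\<dots> = x" using xM by simp
  finally show ?thesis
    using x additive_subgroup_zero[OF H] by (auto simp: decomposes_def)
qed

lemma decomposes_add:
  assumes M: "abelian_group M" and H: "\<And>i. additive_subgroup (H i) M"
    and c: "decomposes M H x c" and d: "decomposes M H y d"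
  shows "decomposes M H (x \<oplus>\<^bsub>M\<^esub> y) (\<lambda>i. c i \<oplus>\<^bsub>M\<^esub> d i)"
proof -
  interpret M: abelian_group M by fact
  let ?e = "\<lambda>i. c i \<oplus>\<^bsub>M\<^esub> d i"
  let ?F = "{i. c i \<noteq> \<zero>\<^bsub>M\<^esub>} \<union> {i. d i \<noteq> \<zero>\<^bsub>M\<^esub>}"
  have F: "finite ?F" using c d by (simp add: decomposes_def)
  have cc: "c i \<in> carrier M" "d i \<in> carrier M" for i
    using c d additive_subgroup_carrier[OF H] unfolding decomposes_def by blast+
  have sub: "{i. ?e i \<noteq> \<zero>\<^bsub>M\<^esub>} \<subseteq> ?F" by auto
  have "x = (\<Oplus>\<^bsub>M\<^esub> i \<in> {i. c i \<noteq> \<zero>\<^bsub>M\<^esub>}. c i)" "y = (\<Oplus>\<^bsub>M\<^esub> i \<in> {i. d i \<noteq> \<zero>\<^bsub>M\<^esub>}. d i)"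
    using c d unfolding decomposes_def by blast+
  then have "x \<oplus>\<^bsub>M\<^esub> y = (\<Oplus>\<^bsub>M\<^esub> i \<in> ?F. c i) \<oplus>\<^bsub>M\<^esub> (\<Oplus>\<^bsub>M\<^esub> i \<in> ?F. d i)"
    using decomposes_superset[OF M, of c ?F] decomposes_superset[OF M, of d ?F] cc F by simp
  also have "\<dots> = (\<Oplus>\<^bsub>M\<^esub> i \<in> ?F. ?e i)"
    by (rule M.finsum_addf[symmetric]) (use cc in auto)
  also have "\<dots> = (\<Oplus>\<^bsub>M\<^esub> i \<in> {i. ?e i \<noteq> \<zero>\<^bsub>M\<^esub>}. ?e i)"
    by (rule decomposes_superset[symmetric]) (use cc F sub M in auto)
  finally show ?thesis
    using c d additive_subgroup_add[OF H] finite_subset[OF sub F] by (auto simp: decomposes_def)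
qed

text \<open>A grading is recognised by its projections: if additive maps \<open>pr i\<close> are the identity on
  the \<open>i\<close>-th component and vanish on the others, applying \<open>pr i\<close> to a decomposition recovers its
  \<open>i\<close>-th term, so decompositions are unique.\<close>

lemma grading_decomposition:
  assumes M: "abelian_group M" and H: "\<And>i. additive_subgroup (H i) M"
    and gen: "add_generates M (\<Union>i. H i)"
    and pr: "\<And>i. add_hom M M (pr i)"
    and pr_same: "\<And>i x. x \<in> H i \<Longrightarrow> pr i x = x"
    and pr_other: "\<And>i j x. x \<in> H j \<Longrightarrow> j \<noteq> i \<Longrightarrow> pr i x = \<zero>\<^bsub>M\<^esub>"
    and m: "m \<in> carrier M"
  shows "\<exists>!c. decomposes M H m c"
proof (rule ex_ex1I)
  interpret M: abelian_group M by fact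
  note Hc = additive_subgroup_carrier[OF H]
  show "\<exists>c. decomposes M H m c" using gen m
  proof (induction m rule: add_generates_induct)
    case (gen g)
    then show ?case using decomposes_homog[where H = H, OF M H] by blast
  next
    case (add x y)
    then show ?case using decomposes_add[where H = H, OF M H] by blast
  qed
  have "c i = pr i m" if c: "decomposes M H m c" for c i
  proof -
    let ?F = "insert i {i. c i \<noteq> \<zero>\<^bsub>M\<^esub>}"
    have F: "finite ?F" using c by (simp add: decomposes_def)
    have ch: "c j \<in> H j" for j using c by (simp add: decomposes_def)
    note cc = Hc[OF ch]
    have "m = (\<Oplus>\<^bsub>M\<^esub> j \<in> {i. c i \<noteq> \<zero>\<^bsub>M\<^esub>}. c j)" using c by (simp add: decomposes_def)
    also have "\<dots> = (\<Oplus>\<^bsub>M\<^esub> j \<in> ?F. c j)" by (rule decomposes_superset) (use cc F M in auto)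
    finally have "pr i m = (\<Oplus>\<^bsub>M\<^esub> j \<in> ?F. pr i (c j))"
      using add_hom_finsum[OF M M pr F, of c] cc by auto
    also have "\<dots> = (\<Oplus>\<^bsub>M\<^esub> j \<in> ?F. if j = i then c j else \<zero>\<^bsub>M\<^esub>)"
      by (rule M.finsum_cong') (use cc pr_same[OF ch] pr_other[OF ch] in auto)
    also have "\<dots> = c i"
      using M.add.finprod_singleton_swap[of i ?F c] F cc by simp
    finally show ?thesis by simp
  qed
  then show "c = d" if "decomposes M H m c" "decomposes M H m d" for c d
    using that by (metis ext)
qed

definition component :: "('m, 'c) ring_scheme \<Rightarrow> (int \<Rightarrow> 'm set) \<Rightarrow> int \<Rightarrow> 'm \<Rightarrow> 'm" where
  "component M H i m = (THE c. decomposes M H m c) i"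

locale graded_group = abelian_group M for M :: "('m, 'c) ring_scheme" (structure) +
  fixes H :: "int \<Rightarrow> 'm set"
  assumes H_subgroup: "additive_subgroup (H i) M"
    and H_decomposition: "m \<in> carrier M \<Longrightarrow> \<exists>!c. decomposes M H m c"
begin

lemma H_closed: "x \<in> H i \<Longrightarrow> x \<in> carrier M"
  using additive_subgroup_carrier[OF H_subgroup] by blast

lemma component_decomposes: "m \<in> carrier M \<Longrightarrow> decomposes M H m (\<lambda>i. component M H i m)"
  unfolding component_def using theI'[OF H_decomposition] by auto

lemma component_eqI: "m \<in> carrier M \<Longrightarrow> decomposes M H m c \<Longrightarrow> component M H i m = c i"
  using H_decomposition component_decomposes by blast

lemma component_homog: "m \<in> carrier M \<Longrightarrow> component M H i m \<in> H i"
  using component_decomposes by (simp add: decomposes_def)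

lemma component_closed: "m \<in> carrier M \<Longrightarrow> component M H i m \<in> carrier M"
  using component_homog H_closed by blast

lemma component_finite: "m \<in> carrier M \<Longrightarrow> finite {i. component M H i m \<noteq> \<zero>}"
  using component_decomposes by (simp add: decomposes_def)

lemma component_sum:
  "m \<in> carrier M \<Longrightarrow> (\<Oplus> i \<in> {i. component M H i m \<noteq> \<zero>}. component M H i m) = m"
  using component_decomposes by (simp add: decomposes_def)

lemma component_add_hom: "add_hom M M (component M H i)"
proof (rule add_homI)
  fix x y assume xy: "x \<in> carrier M" "y \<in> carrier M"
  show "component M H i (x \<oplus> y) = component M H i x \<oplus> component M H i y"
    using component_eqI[OF _ decomposes_add[OF abelian_group_axioms H_subgroup component_decomposes component_decomposes]] xy by simp
qed (rule component_closed)

lemma component_of_homog: "x \<in> H j \<Longrightarrow> component M H i x = (if i = j then x else \<zero>)"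
  using component_eqI[OF H_closed decomposes_homog[OF abelian_group_axioms H_subgroup]] by simp

lemma H_generates: "add_generates M (\<Union>i. H i)"
proof (rule add_generatesI)
  fix P x assume H: "\<And>g. g \<in> (\<Union>i. H i) \<Longrightarrow> P g"
    and add: "\<And>x y. \<lbrakk>x \<in> carrier M; y \<in> carrier M; P x; P y\<rbrakk> \<Longrightarrow> P (x \<oplus> y)"
    and x: "x \<in> carrier M"
  have "P (\<Oplus> i \<in> I. component M H i x)" if "finite I" for I using that
  proof (induction I rule: finite_induct)
    case empty
    have "\<zero> \<in> H 0" by (rule additive_subgroup_zero[OF H_subgroup])
    then show ?case using H by auto
  next
    case (insert i I)
    have "(\<lambda>i. component M H i x) \<in> I \<rightarrow> carrier M" using component_closed[OF x] by blast
    moreover have "P (component M H i x)" using H component_homog[OF x] by blast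
    ultimately show ?case using insert component_closed[OF x] by (auto intro!: add)
  qed
  from this[OF component_finite[OF x]] show "P x" by (simp only: component_sum[OF x])
qed

lemma homog_induct [consumes 1, case_names homog add]:
  assumes "x \<in> carrier M" "\<And>i x. x \<in> H i \<Longrightarrow> P x"
    "\<And>x y. \<lbrakk>x \<in> carrier M; y \<in> carrier M; P x; P y\<rbrakk> \<Longrightarrow> P (x \<oplus> y)"
  shows "P x"
  using H_generates assms(1) by (rule add_generates_induct) (use assms in auto)

end

lemma graded_groupI:
  assumes "abelian_group M" "\<And>i. additive_subgroup (H i) M" "add_generates M (\<Union>i. H i)"
    "\<And>i. add_hom M M (pr i)" "\<And>i x. x \<in> H i \<Longrightarrow> pr i x = x"
    "\<And>i j x. x \<in> H j \<Longrightarrow> j \<noteq> i \<Longrightarrow> pr i x = \<zero>\<^bsub>M\<^esub>"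
  shows "graded_group M H"
proof -
  interpret abelian_group M by fact
  show ?thesis
    by (intro graded_group.intro graded_group_axioms.intro grading_decomposition[where pr = pr])
      (use assms in auto)
qed

section \<open>Graded bimodules over two rings\<close>

text \<open>The twisted bimodule is assembled from pieces on which different rings act on the two sides,
  so the notion of a graded bimodule is needed for a pair of rings.\<close>

locale gr_bimod = P: ring P + Q: ring Q + graded_group M "homog M"
  for P :: "'a ring" and grP :: "int \<Rightarrow> 'a set" and Q :: "'a ring" and grQ :: "int \<Rightarrow> 'a set"
    and M :: "('a, 'm) bimodule" +
  assumes grP_closed: "a \<in> grP i \<Longrightarrow> a \<in> carrier P"
    and grQ_closed: "a \<in> grQ i \<Longrightarrow> a \<in> carrier Q"
    and lact_closed: "\<lbrakk>a \<in> carrier P; m \<in> carrier M\<rbrakk> \<Longrightarrow> lact M a m \<in> carrier M"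
    and ract_closed: "\<lbrakk>a \<in> carrier Q; m \<in> carrier M\<rbrakk> \<Longrightarrow> ract M m a \<in> carrier M"
    and lact_add_left: "\<lbrakk>a \<in> carrier P; b \<in> carrier P; m \<in> carrier M\<rbrakk> \<Longrightarrow>
          lact M (a \<oplus>\<^bsub>P\<^esub> b) m = lact M a m \<oplus>\<^bsub>M\<^esub> lact M b m"
    and lact_add_right: "\<lbrakk>a \<in> carrier P; m \<in> carrier M; n \<in> carrier M\<rbrakk> \<Longrightarrow>
          lact M a (m \<oplus>\<^bsub>M\<^esub> n) = lact M a m \<oplus>\<^bsub>M\<^esub> lact M a n"
    and ract_add_left: "\<lbrakk>a \<in> carrier Q; m \<in> carrier M; n \<in> carrier M\<rbrakk> \<Longrightarrow>
          ract M (m \<oplus>\<^bsub>M\<^esub> n) a = ract M m a \<oplus>\<^bsub>M\<^esub> ract M n a"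
    and ract_add_right: "\<lbrakk>a \<in> carrier Q; b \<in> carrier Q; m \<in> carrier M\<rbrakk> \<Longrightarrow>
          ract M m (a \<oplus>\<^bsub>Q\<^esub> b) = ract M m a \<oplus>\<^bsub>M\<^esub> ract M m b"
    and lact_assoc: "\<lbrakk>a \<in> carrier P; b \<in> carrier P; m \<in> carrier M\<rbrakk> \<Longrightarrow>
          lact M (a \<otimes>\<^bsub>P\<^esub> b) m = lact M a (lact M b m)"
    and ract_assoc: "\<lbrakk>a \<in> carrier Q; b \<in> carrier Q; m \<in> carrier M\<rbrakk> \<Longrightarrow>
          ract M m (a \<otimes>\<^bsub>Q\<^esub> b) = ract M (ract M m a) b"
    and lact_ract: "\<lbrakk>a \<in> carrier P; b \<in> carrier Q; m \<in> carrier M\<rbrakk> \<Longrightarrow>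
          ract M (lact M a m) b = lact M a (ract M m b)"
    and lact_one: "m \<in> carrier M \<Longrightarrow> lact M \<one>\<^bsub>P\<^esub> m = m"
    and ract_one: "m \<in> carrier M \<Longrightarrow> ract M m \<one>\<^bsub>Q\<^esub> = m"
    and lact_homog: "\<lbrakk>a \<in> grP i; m \<in> homog M j\<rbrakk> \<Longrightarrow> lact M a m \<in> homog M (i + j)"
    and ract_homog: "\<lbrakk>a \<in> grQ i; m \<in> homog M j\<rbrakk> \<Longrightarrow> ract M m a \<in> homog M (j + i)"
begin

lemma is_abelian_group: "abelian_group M" ..

lemma lact_add_hom: "a \<in> carrier P \<Longrightarrow> add_hom M M (lact M a)"
  by (intro add_homI lact_closed lact_add_right)

lemma ract_add_hom: "a \<in> carrier Q \<Longrightarrow> add_hom M M (\<lambda>m. ract M m a)"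
  by (intro add_homI ract_closed ract_add_left)

lemma lact_zero: "a \<in> carrier P \<Longrightarrow> lact M a \<zero>\<^bsub>M\<^esub> = \<zero>\<^bsub>M\<^esub>"
  using add_hom_zero[OF is_abelian_group is_abelian_group lact_add_hom] .

lemma ract_zero: "a \<in> carrier Q \<Longrightarrow> ract M \<zero>\<^bsub>M\<^esub> a = \<zero>\<^bsub>M\<^esub>"
  using add_hom_zero[OF is_abelian_group is_abelian_group ract_add_hom] .

lemma lact_minus: "a \<in> carrier P \<Longrightarrow> m \<in> carrier M \<Longrightarrow> lact M a (\<ominus>\<^bsub>M\<^esub> m) = \<ominus>\<^bsub>M\<^esub> lact M a m"
  using add_hom_minus[OF is_abelian_group is_abelian_group lact_add_hom] .

lemma ract_minus: "a \<in> carrier Q \<Longrightarrow> m \<in> carrier M \<Longrightarrow> ract M (\<ominus>\<^bsub>M\<^esub> m) a = \<ominus>\<^bsub>M\<^esub> ract M m a"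
  using add_hom_minus[OF is_abelian_group is_abelian_group ract_add_hom] .

lemma homog_zero: "\<zero>\<^bsub>M\<^esub> \<in> homog M i"
  by (rule additive_subgroup_zero[OF H_subgroup])

end

lemma gr_bimod_imp_graded_bimodule:
  assumes "gr_bimod R gr R gr M"
  shows "graded_bimodule R gr M"
proof -
  interpret gr_bimod R gr R gr M by fact
  show ?thesis
    by (intro graded_bimodule.intro graded_bimodule_axioms.intro P.ring_axioms is_abelian_group
        H_subgroup H_decomposition[unfolded decomposes_def] lact_closed ract_closed lact_add_left
        lact_add_right ract_add_left ract_add_right lact_assoc ract_assoc lact_ract lact_one ract_one
        lact_homog ract_homog)
qed

lemma gr_bimod_restrict:
  assumes "gr_bimod P grP Q grQ M" "ring P'" "ring Q'"
    and "carrier P' \<subseteq> carrier P" "carrier Q' \<subseteq> carrier Q"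
    and "monoid.mult P' = monoid.mult P" "monoid.mult Q' = monoid.mult Q"
    and "ring.add P' = ring.add P" "ring.add Q' = ring.add Q" "monoid.one P' = monoid.one P" "monoid.one Q' = monoid.one Q"
    and "\<And>i. grP' i \<subseteq> grP i \<inter> carrier P'" "\<And>i. grQ' i \<subseteq> grQ i \<inter> carrier Q'"
  shows "gr_bimod P' grP' Q' grQ' M"
proof -
  interpret gr_bimod P grP Q grQ M by fact
  note [simp] = assms(6-11)
  have P: "a \<in> carrier P" if "a \<in> carrier P'" for a using that assms(4) by blast
  have Q: "a \<in> carrier Q" if "a \<in> carrier Q'" for a using that assms(5) by blast
  show ?thesis
    by (intro gr_bimod.intro gr_bimod_axioms.intro assms(2,3) graded_group_axioms)
      (use subsetD[OF assms(12)] subsetD[OF assms(13)] lact_homog ract_homog in \<open>auto simp: P Q lact_closed ract_closed lact_add_left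
        lact_add_right ract_add_left ract_add_right lact_assoc ract_assoc lact_ract lact_one ract_one\<close>)
qed

text \<open>Maps of degree \<open>d\<close>: between unshifted bimodules the differential \<open>\<Delta>\<close> has degree \<open>2\<close> and the
  maps \<open>\<kappa>\<close> contracting it have degree \<open>- 2\<close>; they preserve degrees only between the shifted ones.\<close>

definition gr_hom ::
  "'a ring \<Rightarrow> 'a ring \<Rightarrow> int \<Rightarrow> ('a, 'm) bimodule \<Rightarrow> ('a, 'n) bimodule \<Rightarrow> ('m \<Rightarrow> 'n) set" where
  "gr_hom P Q d M N = {f. add_hom M N f \<and>
     (\<forall>a \<in> carrier P. \<forall>x \<in> carrier M. f (lact M a x) = lact N a (f x)) \<and>
     (\<forall>a \<in> carrier Q. \<forall>x \<in> carrier M. f (ract M x a) = ract N (f x) a) \<and>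
     (\<forall>i. \<forall>x \<in> homog M i. f x \<in> homog N (i + d))}"

lemma bimodule_hom_eq_gr_hom: "bimodule_hom R M N = gr_hom R R 0 M N"
  by (fastforce simp: bimodule_hom_def gr_hom_def add_hom_def)

lemma gr_homI:
  "\<lbrakk>add_hom M N f;
    \<And>a x. \<lbrakk>a \<in> carrier P; x \<in> carrier M\<rbrakk> \<Longrightarrow> f (lact M a x) = lact N a (f x);
    \<And>a x. \<lbrakk>a \<in> carrier Q; x \<in> carrier M\<rbrakk> \<Longrightarrow> f (ract M x a) = ract N (f x) a;
    \<And>i x. x \<in> homog M i \<Longrightarrow> f x \<in> homog N (i + d)\<rbrakk> \<Longrightarrow> f \<in> gr_hom P Q d M N"
  by (auto simp: gr_hom_def)

lemma gr_hom_add_hom: "f \<in> gr_hom P Q d M N \<Longrightarrow> add_hom M N f"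
  and gr_hom_closed: "f \<in> gr_hom P Q d M N \<Longrightarrow> x \<in> carrier M \<Longrightarrow> f x \<in> carrier N"
  and gr_hom_add: "f \<in> gr_hom P Q d M N \<Longrightarrow> x \<in> carrier M \<Longrightarrow> y \<in> carrier M \<Longrightarrow>
        f (x \<oplus>\<^bsub>M\<^esub> y) = f x \<oplus>\<^bsub>N\<^esub> f y"
  and gr_hom_lact: "f \<in> gr_hom P Q d M N \<Longrightarrow> a \<in> carrier P \<Longrightarrow> x \<in> carrier M \<Longrightarrow>
        f (lact M a x) = lact N a (f x)"
  and gr_hom_ract: "f \<in> gr_hom P Q d M N \<Longrightarrow> a \<in> carrier Q \<Longrightarrow> x \<in> carrier M \<Longrightarrow>
        f (ract M x a) = ract N (f x) a"
  and gr_hom_homog: "f \<in> gr_hom P Q d M N \<Longrightarrow> x \<in> homog M i \<Longrightarrow> f x \<in> homog N (i + d)"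
  by (auto simp: gr_hom_def add_hom_def)

lemma gr_hom_comp:
  assumes "f \<in> gr_hom P Q d M N" "g \<in> gr_hom P Q e N L"
  shows "(\<lambda>x. g (f x)) \<in> gr_hom P Q (d + e) M L"
proof (rule gr_homI)
  show "add_hom M L (\<lambda>x. g (f x))"
    by (rule add_hom_comp[OF gr_hom_add_hom[OF assms(1)] gr_hom_add_hom[OF assms(2)]])
  fix i x assume "x \<in> homog M i"
  then show "g (f x) \<in> homog L (i + (d + e))"
    using gr_hom_homog[OF assms(2) gr_hom_homog[OF assms(1)], of x i] by (simp add: add.assoc)
qed (simp_all add: gr_hom_closed[OF assms(1)] gr_hom_lact[OF assms(1)] gr_hom_lact[OF assms(2)]
    gr_hom_ract[OF assms(1)] gr_hom_ract[OF assms(2)])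

lemma gr_hom_id: "(\<lambda>x. x) \<in> gr_hom P Q 0 M M"
  by (auto intro: gr_homI add_hom_id)

lemma gr_hom_zero:
  assumes "gr_bimod P grP Q grQ M" "gr_bimod P grP Q grQ N" "f \<in> gr_hom P Q d M N"
  shows "f \<zero>\<^bsub>M\<^esub> = \<zero>\<^bsub>N\<^esub>"
proof -
  interpret M: gr_bimod P grP Q grQ M by fact
  interpret N: gr_bimod P grP Q grQ N by fact
  show ?thesis by (rule add_hom_zero[OF M.is_abelian_group N.is_abelian_group gr_hom_add_hom[OF assms(3)]])
qed

lemma gr_hom_zero_map:
  assumes "gr_bimod P grP Q grQ N"
  shows "(\<lambda>x. \<zero>\<^bsub>N\<^esub>) \<in> gr_hom P Q d M N"
proof -
  interpret gr_bimod P grP Q grQ N by fact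
  show ?thesis
    by (intro gr_homI add_hom_zero_map) (auto simp: lact_zero ract_zero homog_zero is_abelian_group)
qed

lemma gr_hom_plus:
  assumes "gr_bimod P grP Q grQ N" "f \<in> gr_hom P Q d M N" "g \<in> gr_hom P Q d M N"
  shows "(\<lambda>x. f x \<oplus>\<^bsub>N\<^esub> g x) \<in> gr_hom P Q d M N"
proof -
  interpret gr_bimod P grP Q grQ N by fact
  show ?thesis
  proof (intro gr_homI add_hom_plus)
    fix i x assume "x \<in> homog M i"
    then show "f x \<oplus>\<^bsub>N\<^esub> g x \<in> homog N (i + d)"
      by (intro additive_subgroup_add[OF H_subgroup] gr_hom_homog[OF assms(2)] gr_hom_homog[OF assms(3)])
  qed (use assms in \<open>auto simp: gr_hom_add_hom is_abelian_group gr_hom_lact gr_hom_ract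
      gr_hom_closed lact_add_right ract_add_left\<close>)
qed

lemma gr_hom_neg:
  assumes "gr_bimod P grP Q grQ N" "f \<in> gr_hom P Q d M N"
  shows "(\<lambda>x. \<ominus>\<^bsub>N\<^esub> f x) \<in> gr_hom P Q d M N"
proof -
  interpret gr_bimod P grP Q grQ N by fact
  show ?thesis
  proof (intro gr_homI add_hom_neg)
    fix i x assume "x \<in> homog M i"
    then show "\<ominus>\<^bsub>N\<^esub> f x \<in> homog N (i + d)"
      by (intro additive_subgroup_minus[OF H_subgroup] gr_hom_homog[OF assms(2)])
  qed (use assms in \<open>auto simp: gr_hom_add_hom is_abelian_group gr_hom_lact gr_hom_ract
      gr_hom_closed lact_minus ract_minus\<close>)
qed

subsection \<open>Groups with the same addition\<close>

text \<open>Shifted, regular and twisted bimodules have the carrier and the addition of another record, from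
  which their group structure and grading are transported.\<close>

lemma a_inv_cong:
  "carrier M' = carrier M \<Longrightarrow> ring.zero M' = ring.zero M \<Longrightarrow> ring.add M' = ring.add M \<Longrightarrow> a_inv M' = a_inv M"
  by (simp add: a_inv_def m_inv_def fun_eq_iff)

lemma abelian_group_cong:
  assumes "carrier M' = carrier M" "ring.zero M' = ring.zero M" "ring.add M' = ring.add M" "abelian_group M"
  shows "abelian_group M'"
  by (rule abelian_groupI) (use abelian_groupE[OF assms(4)] assms(1-3) in auto)

lemma additive_subgroup_cong:
  assumes "carrier M' = carrier M" "ring.zero M' = ring.zero M" "ring.add M' = ring.add M"
    "abelian_group M" "additive_subgroup H M"
  shows "additive_subgroup H M'"
  by (rule additive_subgroupI[OF abelian_group_cong[OF assms(1-4)]])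
    (use assms additive_subgroup_carrier additive_subgroup_zero additive_subgroup_add
      additive_subgroup_minus in \<open>fastforce simp: a_inv_cong[OF assms(1-3)]\<close>)+

lemma graded_group_cong_shift:
  assumes "carrier M' = carrier M" "ring.zero M' = ring.zero M" "ring.add M' = ring.add M" "graded_group M H"
  shows "graded_group M' (\<lambda>i. H (i - n))"
proof -
  interpret graded_group M H by fact
  show ?thesis
  proof (rule graded_groupI[where pr = "\<lambda>i. component M H (i - n)"])
    show "abelian_group M'" using abelian_group_cong assms(1-3) abelian_group_axioms by blast
    show "additive_subgroup (H (i - n)) M'" for i
      using additive_subgroup_cong assms(1-3) abelian_group_axioms H_subgroup by blast
    have "(\<Union>i. H (i - n)) = (\<Union>i. H i)"
      by (metis surj_diff_right image_image)
    then show "add_generates M' (\<Union>i. H (i - n))"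
      using H_generates assms(1-3) by (simp add: add_generates_def)
    show "add_hom M' M' (component M H (i - n))" for i
      using component_add_hom assms(1-3) by (simp add: add_hom_def)
  qed (auto simp: component_of_homog assms)
qed

subsection \<open>Shifts and direct sums\<close>

lemma shift_simps [simp]:
  "carrier (shift n M) = carrier M" "ring.zero (shift n M) = ring.zero M" "ring.add (shift n M) = ring.add M"
  "lact (shift n M) = lact M" "ract (shift n M) = ract M" "homog (shift n M) i = homog M (i - n)"
  by (simp_all add: shift_def)

lemma a_inv_shift [simp]: "a_inv (shift n M) = a_inv M"
  by (rule a_inv_cong) simp_all

lemma shift_zero [simp]: "shift 0 M = M"
  by (simp add: shift_def)

lemma add_hom_shift [simp]: "add_hom (shift a M) (shift b N) f = add_hom M N f"
  by (simp add: add_hom_def)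

lemma gr_bimod_shift:
  assumes "gr_bimod P grP Q grQ M"
  shows "gr_bimod P grP Q grQ (shift n M)"
proof -
  interpret gr_bimod P grP Q grQ M by fact
  have "graded_group (shift n M) (homog (shift n M))"
    using graded_group_cong_shift[of "shift n M" M, OF _ _ _ graded_group_axioms, of n]
    by (simp add: shift_def)
  moreover have "lact M a m \<in> homog M (i + j - n)" if "a \<in> grP i" "m \<in> homog M (j - n)" for a m i j
    using lact_homog[OF that] by (simp add: algebra_simps)
  moreover have "ract M m a \<in> homog M (j + i - n)" if "a \<in> grQ i" "m \<in> homog M (j - n)" for a m i j
    using ract_homog[OF that] by (simp add: algebra_simps)
  ultimately show ?thesis
    by (intro gr_bimod.intro gr_bimod_axioms.intro P.ring_axioms Q.ring_axioms)
      (simp_all add: grP_closed grQ_closed lact_closed ract_closed lact_add_left lact_add_right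
        ract_add_left ract_add_right lact_assoc ract_assoc lact_ract lact_one ract_one)
qed

lemma gr_hom_shift: "gr_hom P Q d (shift m M) (shift n N) = gr_hom P Q (d + m - n) M N"
proof -
  have "(\<forall>i. \<forall>x\<in>homog M (i - m). f x \<in> homog N (i + d - n)) \<longleftrightarrow>
    (\<forall>i. \<forall>x\<in>homog M i. f x \<in> homog N (i + (d + m - n)))" for f
  proof (safe, goal_cases)
    case (1 i x)
    from 1(1)[rule_format, of x "i + m"] 1(2) show ?case by (simp add: algebra_simps)
  next
    case (2 i x)
    from 2(1)[rule_format, of x "i - m"] 2(2) show ?case by (simp add: algebra_simps)
  qed
  then show ?thesis by (auto simp: gr_hom_def add_hom_def)
qed

lemma gr_hom_shift_source: "gr_hom P Q d (shift m M) N = gr_hom P Q (d + m) M N"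
  using gr_hom_shift[of P Q d m M 0 N] by simp

lemma zero_part_simps [simp]:
  "carrier (zero_part M) = {\<zero>\<^bsub>M\<^esub>}" "ring.zero (zero_part M) = ring.zero M" "ring.add (zero_part M) = ring.add M"
  "lact (zero_part M) = lact M" "ract (zero_part M) = ract M" "homog (zero_part M) i = {\<zero>\<^bsub>M\<^esub>}"
  by (simp_all add: zero_part_def)

lemma gr_bimod_zero_part:
  assumes "gr_bimod P grP Q grQ M"
  shows "gr_bimod P grP Q grQ (zero_part M)"
proof -
  interpret gr_bimod P grP Q grQ M by fact
  have ab: "abelian_group (zero_part M)" by (rule abelian_groupI) auto
  interpret Z: abelian_group "zero_part M" by fact
  have neg: "\<ominus>\<^bsub>zero_part M\<^esub> \<zero>\<^bsub>M\<^esub> = \<zero>\<^bsub>M\<^esub>" using Z.a_inv_closed by auto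
  have "graded_group (zero_part M) (homog (zero_part M))"
  proof (rule graded_groupI[where pr = "\<lambda>i x. \<zero>\<^bsub>M\<^esub>"])
    show "additive_subgroup (homog (zero_part M) i) (zero_part M)" for i
      by (rule additive_subgroupI[OF ab]) (auto simp: neg)
    show "add_generates (zero_part M) (\<Union>i. homog (zero_part M) i)"
      by (auto simp: add_generates_def)
  qed (auto simp: ab add_hom_def)
  then show ?thesis
    by (intro gr_bimod.intro gr_bimod_axioms.intro P.ring_axioms Q.ring_axioms)
      (auto simp: lact_zero ract_zero grP_closed grQ_closed)
qed

lemma direct_sum2_simps [simp]:
  "carrier (direct_sum2 M N) = carrier M \<times> carrier N"
  "ring.zero (direct_sum2 M N) = (\<zero>\<^bsub>M\<^esub>, \<zero>\<^bsub>N\<^esub>)"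
  "ring.add (direct_sum2 M N) (m, n) (m', n') = (m \<oplus>\<^bsub>M\<^esub> m', n \<oplus>\<^bsub>N\<^esub> n')"
  "lact (direct_sum2 M N) a (m, n) = (lact M a m, lact N a n)"
  "ract (direct_sum2 M N) (m, n) a = (ract M m a, ract N n a)"
  "homog (direct_sum2 M N) i = homog M i \<times> homog N i"
  by (simp_all add: direct_sum2_def)

lemma gr_bimod_direct_sum2:
  assumes "gr_bimod P grP Q grQ M" "gr_bimod P grP Q grQ N"
  shows "gr_bimod P grP Q grQ (direct_sum2 M N)"
proof -
  interpret M: gr_bimod P grP Q grQ M by fact
  interpret N: gr_bimod P grP Q grQ N by fact
  let ?D = "direct_sum2 M N"
  have ab: "abelian_group ?D"
  proof (rule abelian_groupI)
    fix x assume "x \<in> carrier ?D"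
    then show "\<exists>y\<in>carrier ?D. y \<oplus>\<^bsub>?D\<^esub> x = \<zero>\<^bsub>?D\<^esub>"
      by (intro bexI[of _ "(\<ominus>\<^bsub>M\<^esub> fst x, \<ominus>\<^bsub>N\<^esub> snd x)"]) (auto simp: M.l_neg N.l_neg)
  qed (auto simp: M.a_ac N.a_ac)
  interpret D: abelian_group ?D by fact
  have neg: "\<ominus>\<^bsub>?D\<^esub> (x, y) = (\<ominus>\<^bsub>M\<^esub> x, \<ominus>\<^bsub>N\<^esub> y)" if "x \<in> carrier M" "y \<in> carrier N" for x y
    by (rule D.minus_equality) (use that in \<open>auto simp: M.l_neg N.l_neg\<close>)
  have hM: "\<zero>\<^bsub>M\<^esub> \<in> homog M i" and hN: "\<zero>\<^bsub>N\<^esub> \<in> homog N i" for i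
    by (rule M.homog_zero N.homog_zero)+
  have "graded_group ?D (homog ?D)"
  proof (rule graded_groupI[where pr = "\<lambda>i (x, y). (component M (homog M) i x, component N (homog N) i y)"])
    show "additive_subgroup (homog ?D i) ?D" for i
      by (rule additive_subgroupI[OF ab])
        (auto simp: neg M.H_closed N.H_closed hM hN additive_subgroup_add[OF M.H_subgroup]
          additive_subgroup_add[OF N.H_subgroup] additive_subgroup_minus[OF M.H_subgroup]
          additive_subgroup_minus[OF N.H_subgroup])
    show "add_generates ?D (\<Union>i. homog ?D i)"
    proof (rule add_generatesI)
      fix U x
      assume H: "\<And>g. g \<in> (\<Union>i. homog ?D i) \<Longrightarrow> U g"
        and sums: "\<And>x y. \<lbrakk>x \<in> carrier ?D; y \<in> carrier ?D; U x; U y\<rbrakk> \<Longrightarrow> U (x \<oplus>\<^bsub>?D\<^esub> y)"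
        and x: "x \<in> carrier ?D"
      have 1: "U (m, \<zero>\<^bsub>N\<^esub>)" if "m \<in> carrier M" for m using that
      proof (induction m rule: M.homog_induct)
        case (homog i x) then show ?case by (intro H) (auto simp: hN)
      next
        case (add x y) then show ?case
          using sums[of "(x, \<zero>\<^bsub>N\<^esub>)" "(y, \<zero>\<^bsub>N\<^esub>)"]
          by simp
      qed
      have 2: "U (\<zero>\<^bsub>M\<^esub>, n)" if "n \<in> carrier N" for n using that
      proof (induction n rule: N.homog_induct)
        case (homog i x) then show ?case by (intro H) (auto simp: hM)
      next
        case (add x y) then show ?case
          using sums[of "(\<zero>\<^bsub>M\<^esub>, x)" "(\<zero>\<^bsub>M\<^esub>, y)"]
          by simp
      qed
      obtain m n where "x = (m, n)" "m \<in> carrier M" "n \<in> carrier N" using x by auto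
      then show "U x" using sums[OF _ _ 1 2, of m n] by simp
    qed
    show "add_hom ?D ?D (\<lambda>(x, y). (component M (homog M) i x, component N (homog N) i y))" for i
      using M.component_add_hom[of i] N.component_add_hom[of i] by (auto simp: add_hom_def)
  qed (auto simp: ab M.component_of_homog N.component_of_homog)
  then show ?thesis
    by (intro gr_bimod.intro gr_bimod_axioms.intro M.P.ring_axioms M.Q.ring_axioms)
      (auto simp: M.grP_closed M.grQ_closed M.lact_closed M.ract_closed M.lact_add_left M.lact_add_right M.ract_add_left
        M.ract_add_right M.lact_assoc M.ract_assoc M.lact_ract M.lact_one M.ract_one
        M.lact_homog M.ract_homog
        N.lact_closed N.ract_closed N.lact_add_left N.lact_add_right N.ract_add_left
        N.ract_add_right N.lact_assoc N.ract_assoc N.lact_ract N.lact_one N.ract_one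
        N.lact_homog N.ract_homog)
qed

lemma direct_sum_simps [simp]:
  "carrier (direct_sum M) = {x. (\<forall>i. x i \<in> carrier (M i)) \<and> finite {i. x i \<noteq> \<zero>\<^bsub>M i\<^esub>}}"
  "ring.zero (direct_sum M) = (\<lambda>i. \<zero>\<^bsub>M i\<^esub>)"
  "ring.add (direct_sum M) x y = (\<lambda>i. x i \<oplus>\<^bsub>M i\<^esub> y i)"
  "lact (direct_sum M) a x = (\<lambda>i. lact (M i) a (x i))"
  "ract (direct_sum M) x a = (\<lambda>i. ract (M i) (x i) a)"
  "homog (direct_sum M) j = {x. (\<forall>i. x i \<in> homog (M i) j) \<and> finite {i. x i \<noteq> \<zero>\<^bsub>M i\<^esub>}}"
  by (simp_all add: direct_sum_def)

definition summand :: "(int \<Rightarrow> ('a, 'm) bimodule) \<Rightarrow> int \<Rightarrow> 'm \<Rightarrow> int \<Rightarrow> 'm" where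
  "summand M i x = (\<lambda>j. if j = i then x else \<zero>\<^bsub>M j\<^esub>)"

lemma direct_sum_induct [consumes 2, case_names summand add]:
  assumes M: "\<And>i. abelian_group (M i)" and x: "x \<in> carrier (direct_sum M)"
    and single: "\<And>i m. m \<in> carrier (M i) \<Longrightarrow> U (summand M i m)"
    and add: "\<And>x y. \<lbrakk>x \<in> carrier (direct_sum M); y \<in> carrier (direct_sum M); U x; U y\<rbrakk> \<Longrightarrow>
        U (x \<oplus>\<^bsub>direct_sum M\<^esub> y)"
  shows "U x"
proof -
  interpret M: abelian_group "M i" for i by (rule M)
  \<comment> \<open>Induction on a finite set that contains the support, splitting off one entry at a time.\<close>
  have "U x" if "finite F" "\<And>i. x i \<in> carrier (M i)" "{i. x i \<noteq> \<zero>\<^bsub>M i\<^esub>} \<subseteq> F" for F x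
    using that
  proof (induction F arbitrary: x rule: finite_induct)
    case empty
    then have "x = summand M 0 \<zero>\<^bsub>M 0\<^esub>" by (auto simp: summand_def)
    with single[of "\<zero>\<^bsub>M 0\<^esub>" 0] show ?case by simp
  next
    case (insert i F)
    let ?y = "x(i := \<zero>\<^bsub>M i\<^esub>)"
    have x: "x = summand M i (x i) \<oplus>\<^bsub>direct_sum M\<^esub> ?y"
      using insert.prems by (auto simp: summand_def)
    have fin: "finite {i. ?y i \<noteq> \<zero>\<^bsub>M i\<^esub>}" "finite {j. summand M i (x i) j \<noteq> \<zero>\<^bsub>M j\<^esub>}"
      using insert.prems insert.hyps(1)
      by (auto simp: summand_def intro!: finite_subset[OF _ insert.hyps(1)])
    show ?case
    proof (subst x, rule add)
      show "U ?y" by (rule insert.IH) (use insert.prems in auto)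
      show "summand M i (x i) \<in> carrier (direct_sum M)" "?y \<in> carrier (direct_sum M)"
        using fin insert.prems by (auto simp: summand_def)
    qed (use insert.prems single in auto)
  qed
  then show ?thesis using x by auto
qed

lemma gr_bimod_direct_sum:
  assumes M: "\<And>i. gr_bimod P grP Q grQ (M i)"
  shows "gr_bimod P grP Q grQ (direct_sum M)"
proof -
  interpret M: gr_bimod P grP Q grQ "M i" for i by (rule M)
  let ?D = "direct_sum M"
  have fin2: "finite {i. x i \<oplus>\<^bsub>M i\<^esub> y i \<noteq> \<zero>\<^bsub>M i\<^esub>}"
    if "finite {i. x i \<noteq> \<zero>\<^bsub>M i\<^esub>}" "finite {i. y i \<noteq> \<zero>\<^bsub>M i\<^esub>}" for x y
    by (rule finite_subset[OF _ finite_UnI[OF that]]) auto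
  have fin1: "finite {i. f i (x i) \<noteq> \<zero>\<^bsub>M i\<^esub>}"
    if "finite {i. x i \<noteq> \<zero>\<^bsub>M i\<^esub>}" "\<And>i. f i \<zero>\<^bsub>M i\<^esub> = \<zero>\<^bsub>M i\<^esub>" for f x
    by (rule finite_subset[OF _ that(1)]) (use that(2) in auto)
  have ab: "abelian_group ?D"
  proof (rule abelian_groupI)
    fix x assume x: "x \<in> carrier ?D"
    show "\<exists>y\<in>carrier ?D. y \<oplus>\<^bsub>?D\<^esub> x = \<zero>\<^bsub>?D\<^esub>"
      by (rule bexI[of _ "\<lambda>i. \<ominus>\<^bsub>M i\<^esub> x i"])
        (use x fin1[of x "\<lambda>i. a_inv (M i)"] in \<open>auto simp: M.l_neg\<close>)
  qed (auto simp: M.a_ac fin2)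
  interpret D: abelian_group ?D by fact
  have neg: "\<ominus>\<^bsub>?D\<^esub> x = (\<lambda>i. \<ominus>\<^bsub>M i\<^esub> x i)" if "x \<in> carrier ?D" for x
    by (rule D.minus_equality)
      (use that fin1[of x "\<lambda>i. a_inv (M i)"] in \<open>auto simp: M.l_neg\<close>)
  have c0: "component (M i) (homog (M i)) j \<zero>\<^bsub>M i\<^esub> = \<zero>\<^bsub>M i\<^esub>" for i j
    using M.component_of_homog[OF M.homog_zero, of i j] by (simp split: if_splits)
  have "graded_group ?D (homog ?D)"
  proof (rule graded_groupI[where pr = "\<lambda>j x i. component (M i) (homog (M i)) j (x i)"])
    show "additive_subgroup (homog ?D j) ?D" for j
    proof (rule additive_subgroupI[OF ab])
      show sub: "homog ?D j \<subseteq> carrier ?D" using M.H_closed by auto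
      fix x assume x: "x \<in> homog ?D j"
      then have "x \<in> carrier ?D" using sub by blast
      then show "\<ominus>\<^bsub>?D\<^esub> x \<in> homog ?D j"
        using x fin1[of x "\<lambda>i. a_inv (M i)"]
        by (auto simp: neg additive_subgroup_minus[OF M.H_subgroup])
    qed (auto simp: M.homog_zero additive_subgroup_add[OF M.H_subgroup] fin2)
    show "add_generates ?D (\<Union>i. homog ?D i)"
    proof (rule add_generatesI)
      fix U x
      assume H: "\<And>g. g \<in> (\<Union>i. homog ?D i) \<Longrightarrow> U g"
        and sums: "\<And>x y. \<lbrakk>x \<in> carrier ?D; y \<in> carrier ?D; U x; U y\<rbrakk> \<Longrightarrow> U (x \<oplus>\<^bsub>?D\<^esub> y)"
        and x: "x \<in> carrier ?D"
      have sc: "summand M i m \<in> carrier ?D" if "m \<in> carrier (M i)" for i m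
        using that by (auto simp: summand_def intro: finite_subset[of _ "{i}"])
      show "U x" using M.is_abelian_group x
      proof (induction x rule: direct_sum_induct)
        case (summand i m)
        then show ?case
        proof (induction m rule: M.homog_induct)
          case (homog j m)
          then have "summand M i m \<in> homog ?D j"
            by (auto simp: summand_def M.homog_zero intro: finite_subset[of _ "{i}"])
          then show ?case using H by blast
        next
          case (add m n)
          have "summand M i (m \<oplus>\<^bsub>M i\<^esub> n) = summand M i m \<oplus>\<^bsub>?D\<^esub> summand M i n"
            by (auto simp: summand_def)
          with add show ?case using sc
            by (metis sums)
        qed
      qed (rule sums)
    qed
    show "add_hom ?D ?D (\<lambda>x i. component (M i) (homog (M i)) j (x i))" for j
    proof (rule add_homI)
      fix x y assume "x \<in> carrier ?D" "y \<in> carrier ?D"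
      then show "(\<lambda>i. component (M i) (homog (M i)) j ((x \<oplus>\<^bsub>?D\<^esub> y) i)) =
        (\<lambda>i. component (M i) (homog (M i)) j (x i)) \<oplus>\<^bsub>?D\<^esub> (\<lambda>i. component (M i) (homog (M i)) j (y i))"
        by (auto simp: add_hom_add[OF M.component_add_hom])
    qed (auto simp: M.component_closed intro: fin1 c0)
  next
    fix i x assume "x \<in> homog ?D i"
    then have "component (M l) (homog (M l)) i (x l) = x l" for l
      using M.component_of_homog[of "x l" l i i] by simp
    then show "(\<lambda>l. component (M l) (homog (M l)) i (x l)) = x" by simp
  next
    fix i j x assume "x \<in> homog ?D j" "j \<noteq> i"
    then have "component (M l) (homog (M l)) i (x l) = \<zero>\<^bsub>M l\<^esub>" for l
      using M.component_of_homog[of "x l" l j i] by simp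
    then show "(\<lambda>l. component (M l) (homog (M l)) i (x l)) = \<zero>\<^bsub>?D\<^esub>" by simp
  qed (rule ab)
  then show ?thesis
    by (intro gr_bimod.intro gr_bimod_axioms.intro M.P.ring_axioms M.Q.ring_axioms)
      (auto simp: M.grP_closed M.grQ_closed M.lact_closed M.ract_closed M.lact_add_left M.lact_add_right M.ract_add_left
        M.ract_add_right M.lact_assoc M.ract_assoc M.lact_ract M.lact_one M.ract_one
        M.lact_homog M.ract_homog intro: fin1 M.lact_zero M.ract_zero
        M.lact_zero[OF M.grP_closed] M.ract_zero[OF M.grQ_closed])
qed

lemma summand_hom:
  assumes M: "\<And>i. gr_bimod P grP Q grQ (M i)"
  shows "summand M i \<in> gr_hom P Q 0 (M i) (direct_sum M)"
proof -
  interpret M: gr_bimod P grP Q grQ "M l" for l by (rule M)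
  have fin: "finite {j. summand M i x j \<noteq> \<zero>\<^bsub>M j\<^esub>}" for x
    by (rule finite_subset[of _ "{i}"]) (auto simp: summand_def)
  show ?thesis
  proof (rule gr_homI)
    show "add_hom (M i) (direct_sum M) (summand M i)"
      by (rule add_homI) (use fin in \<open>auto simp: summand_def\<close>)
  qed (use fin in \<open>auto simp: summand_def M.lact_zero M.ract_zero M.homog_zero\<close>)
qed

lemma direct_sum_proj_hom: "(\<lambda>x. x i) \<in> gr_hom P Q 0 (direct_sum M) (M i)"
  by (rule gr_homI) (auto intro: add_homI)

section \<open>Tensor products of graded bimodules\<close>

text \<open>The extension of \<open>\<phi>\<close> to formal combinations of pairs, evaluated on a coset; for multiplication in
  \<open>R\<close> this is the map \<open>m\<close> literally.\<close>

definition tensor_lift :: "('t, 'c) ring_scheme \<Rightarrow> ('m \<Rightarrow> 'n \<Rightarrow> 't) \<Rightarrow> ('m \<times> 'n \<Rightarrow>\<^sub>0 int) set \<Rightarrow> 't" where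
  "tensor_lift T \<phi> t = the_elem ((\<lambda>p. \<Oplus>\<^bsub>T\<^esub> q \<in> Poly_Mapping.keys p.
     add_pow T (Poly_Mapping.lookup p q) (\<phi> (fst q) (snd q))) ` t)"

lemma (in abelian_group) add_pow_int:
  fixes i j :: int
  assumes "x \<in> carrier G"
  shows "add_pow G i x \<in> carrier G" "add_pow G (i + j) x = add_pow G i x \<oplus> add_pow G j x"
    "add_pow G (0 :: int) x = \<zero>" "add_pow G (1 :: int) x = x"
  using group.int_pow_closed[OF a_group, of x i] group.int_pow_mult[OF a_group, of x i j]
    int_pow_0[of "add_monoid G" x] group.int_pow_1[OF a_group, of x] assms
  by (simp_all add: add_pow_def)

lemma free_extension_hom:
  fixes T :: "('t, 'c) ring_scheme" and \<phi> :: "'q \<Rightarrow> 't"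
  assumes "abelian_group T" "\<And>q. q \<in> B \<Longrightarrow> \<phi> q \<in> carrier T"
  shows "(\<lambda>p. \<Oplus>\<^bsub>T\<^esub> q \<in> Poly_Mapping.keys p. add_pow T (Poly_Mapping.lookup p q) (\<phi> q))
    \<in> hom (free_Abelian_group B) (add_monoid T)"
proof -
  interpret T: abelian_group T by fact
  let ?L = "\<lambda>p. \<Oplus>\<^bsub>T\<^esub> q \<in> Poly_Mapping.keys p. add_pow T (Poly_Mapping.lookup p q) (\<phi> q)"
  have L: "?L p = (\<Oplus>\<^bsub>T\<^esub> q \<in> K. add_pow T (Poly_Mapping.lookup p q) (\<phi> q))"
    if "finite K" "Poly_Mapping.keys p \<subseteq> K" "K \<subseteq> B" for p :: "'q \<Rightarrow>\<^sub>0 int" and K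
    by (rule T.add.finprod_mono_neutral_cong_left)
      (use that in \<open>auto simp: in_keys_iff intro!: T.add_pow_int assms(2)\<close>)
  show ?thesis
  proof (rule homI)
    fix p q assume "p \<in> carrier (free_Abelian_group B)" "q \<in> carrier (free_Abelian_group B)"
    then have K: "Poly_Mapping.keys p \<union> Poly_Mapping.keys q \<subseteq> B" by simp
    let ?K = "Poly_Mapping.keys p \<union> Poly_Mapping.keys q"
    have "?L (p + q) = (\<Oplus>\<^bsub>T\<^esub> r \<in> ?K. add_pow T (Poly_Mapping.lookup (p + q) r) (\<phi> r))"
      by (rule L) (use K keys_add[of p q] in auto)
    also have "\<dots> = (\<Oplus>\<^bsub>T\<^esub> r \<in> ?K. add_pow T (Poly_Mapping.lookup p r) (\<phi> r) \<oplus>\<^bsub>T\<^esub>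
        add_pow T (Poly_Mapping.lookup q r) (\<phi> r))"
      by (rule T.finsum_cong') (use K assms(2) in \<open>auto simp: lookup_add T.add_pow_int subset_iff\<close>)
    also have "\<dots> = ?L p \<oplus>\<^bsub>T\<^esub> ?L q"
      using L[of ?K p] L[of ?K q] K assms(2)
      by (subst T.finsum_addf) (auto simp: T.add_pow_int subset_iff)
    finally show "?L (p \<otimes>\<^bsub>free_Abelian_group B\<^esub> q) = ?L p \<otimes>\<^bsub>add_monoid T\<^esub> ?L q" by simp
  qed (use assms(2) in \<open>auto simp: T.add_pow_int subset_iff intro!: T.finsum_closed\<close>)
qed

text \<open>Homogeneous elements are required to generate the middle ring \<open>S\<close>, so that the balancing relations
  follow from homogeneous ones and the tensor product inherits a grading.\<close>

locale tensor_pair = M: gr_bimod P grP S grS M + N: gr_bimod S grS Q grQ N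
  for P :: "'a ring" and grP and S :: "'a ring" and grS and Q :: "'a ring" and grQ
    and M :: "('a, 'm) bimodule" and N :: "('a, 'n) bimodule" +
  assumes S_generated: "add_generates S (\<Union>i. grS i)"
begin

abbreviation T where "T \<equiv> tensor S M N"
abbreviation F where "F \<equiv> tensor_free M N"
abbreviation pt where "pt \<equiv> pure_tensor S M N"

definition gens where "gens =
    ({frag_of (m \<oplus>\<^bsub>M\<^esub> m', n) - frag_of (m, n) - frag_of (m', n) | m m' n.
        m \<in> carrier M \<and> m' \<in> carrier M \<and> n \<in> carrier N} \<union>
     {frag_of (m, n \<oplus>\<^bsub>N\<^esub> n') - frag_of (m, n) - frag_of (m, n') | m n n'.
        m \<in> carrier M \<and> n \<in> carrier N \<and> n' \<in> carrier N} \<union>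
     {frag_of (ract M m r, n) - frag_of (m, lact N r n) | m r n.
        m \<in> carrier M \<and> r \<in> carrier S \<and> n \<in> carrier N})"

lemma relations_eq: "tensor_relations S M N = generate F gens"
  by (simp add: tensor_relations_def gens_def)

lemma free_comm_group: "comm_group F"
  by (simp add: tensor_free_def abelian_free_Abelian_group)

lemma free_group: "group F"
  by (simp add: tensor_free_def)

lemma free_diff: "p \<in> carrier F \<Longrightarrow> q \<in> carrier F \<Longrightarrow> p - q \<in> carrier F"
  using keys_diff[of p q] by (auto simp: tensor_free_def)

lemma free_pure: "m \<in> carrier M \<Longrightarrow> n \<in> carrier N \<Longrightarrow> frag_of (m, n) \<in> carrier F"
  by (simp add: tensor_free_def)

lemma gens_closed: "gens \<subseteq> carrier F"
  unfolding gens_def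
  by (auto intro!: free_diff free_pure simp: M.ract_closed N.lact_closed)

lemma relations_subgroup: "subgroup (tensor_relations S M N) F"
  unfolding relations_eq by (rule group.generate_is_subgroup[OF free_group gens_closed])

lemma relations_normal: "normal (tensor_relations S M N) F"
  using comm_group.subgroup_imp_normal[OF free_comm_group relations_subgroup] .

lemma class_add: "p \<in> carrier F \<Longrightarrow> q \<in> carrier F \<Longrightarrow>
    tensor_class S M N p \<oplus>\<^bsub>T\<^esub> tensor_class S M N q = tensor_class S M N (p + q)"
  using normal.rcos_sum[OF relations_normal]
  by (simp add: tensor_def tensor_class_def tensor_group_def FactGroup_def) (simp add: tensor_free_def)

lemma carrier_T: "carrier T = tensor_class S M N ` carrier F"
  by (simp add: tensor_def tensor_group_def tensor_class_def carrier_FactGroup)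

lemma class_eqI:
  assumes "p \<in> carrier F" "q \<in> carrier F" "p - q \<in> tensor_relations S M N"
  shows "tensor_class S M N p = tensor_class S M N q"
proof -
  let ?R = "tensor_relations S M N"
  have "?R #>\<^bsub>F\<^esub> p = ?R #>\<^bsub>F\<^esub> ((p - q) \<otimes>\<^bsub>F\<^esub> q)" by (simp add: tensor_free_def)
  also have "\<dots> = ?R #>\<^bsub>F\<^esub> (p - q) #>\<^bsub>F\<^esub> q"
    using group.coset_mult_assoc[OF free_group subgroup.subset[OF relations_subgroup]
        free_diff[OF assms(1,2)] assms(2)] by simp
  also have "?R #>\<^bsub>F\<^esub> (p - q) = ?R"
    by (rule group.coset_join2[OF free_group free_diff[OF assms(1,2)] relations_subgroup assms(3)])
  finally show ?thesis by (simp add: tensor_class_def)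
qed

lemma tensor_group_comm: "comm_group (tensor_group S M N)"
  using comm_group.abelian_FactGroup[OF free_comm_group relations_subgroup]
  by (simp add: tensor_group_def)

lemma T_abelian: "abelian_group T"
proof -
  interpret G: comm_group "tensor_group S M N" by (rule tensor_group_comm)
  show ?thesis
    by (rule abelian_groupI) (auto simp: tensor_def G.m_ac G.l_inv_ex)
qed

sublocale T: abelian_group T by (rule T_abelian)

lemma zero_T: "\<zero>\<^bsub>T\<^esub> = tensor_class S M N 0"
proof -
  have "tensor_class S M N 0 = tensor_relations S M N"
    using group.coset_mult_one[OF free_group subgroup.subset[OF relations_subgroup]]
    by (simp add: tensor_class_def tensor_free_def)
  then show ?thesis by (simp add: tensor_def tensor_group_def FactGroup_def)
qed

lemma pure_closed: "m \<in> carrier M \<Longrightarrow> n \<in> carrier N \<Longrightarrow> pt m n \<in> carrier T"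
  by (simp add: carrier_T pure_tensor_def free_pure)

lemma free_zero: "0 \<in> carrier F" and free_add: "p \<in> carrier F \<Longrightarrow> q \<in> carrier F \<Longrightarrow> p + q \<in> carrier F"
  using keys_add[of p q] by (auto simp: tensor_free_def)

lemma gens_in_relations: "g \<in> gens \<Longrightarrow> g \<in> tensor_relations S M N"
  unfolding relations_eq by (rule generate.incl)

lemma pure_add_left:
  assumes "m \<in> carrier M" "m' \<in> carrier M" "n \<in> carrier N"
  shows "pt (m \<oplus>\<^bsub>M\<^esub> m') n = pt m n \<oplus>\<^bsub>T\<^esub> pt m' n"
proof -
  have "frag_of (m \<oplus>\<^bsub>M\<^esub> m', n) - (frag_of (m, n) + frag_of (m', n)) \<in> tensor_relations S M N"
    unfolding diff_diff_eq[symmetric] by (rule gens_in_relations) (use assms in \<open>auto simp: gens_def\<close>)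
  then show ?thesis using assms
    by (simp add: pure_tensor_def class_add free_pure) (intro class_eqI free_pure free_add; simp)
qed

lemma pure_add_right:
  assumes "m \<in> carrier M" "n \<in> carrier N" "n' \<in> carrier N"
  shows "pt m (n \<oplus>\<^bsub>N\<^esub> n') = pt m n \<oplus>\<^bsub>T\<^esub> pt m n'"
proof -
  have "frag_of (m, n \<oplus>\<^bsub>N\<^esub> n') - (frag_of (m, n) + frag_of (m, n')) \<in> tensor_relations S M N"
    unfolding diff_diff_eq[symmetric] by (rule gens_in_relations) (use assms in \<open>auto simp: gens_def\<close>)
  then show ?thesis using assms
    by (simp add: pure_tensor_def class_add free_pure) (intro class_eqI free_pure free_add; simp)
qed

lemma pure_balanced:
  assumes "m \<in> carrier M" "r \<in> carrier S" "n \<in> carrier N"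
  shows "pt (ract M m r) n = pt m (lact N r n)"
  unfolding pure_tensor_def
  by (intro class_eqI free_pure gens_in_relations)
    (use assms in \<open>auto simp: gens_def M.ract_closed N.lact_closed\<close>)

lemma pure_add_hom_left: "n \<in> carrier N \<Longrightarrow> add_hom M T (\<lambda>m. pt m n)"
  by (intro add_homI pure_closed pure_add_left)

lemma pure_add_hom_right: "m \<in> carrier M \<Longrightarrow> add_hom N T (pt m)"
  by (intro add_homI pure_closed pure_add_right)

lemma pure_zero_left: "n \<in> carrier N \<Longrightarrow> pt \<zero>\<^bsub>M\<^esub> n = \<zero>\<^bsub>T\<^esub>"
  using add_hom_zero[OF M.is_abelian_group T_abelian pure_add_hom_left] .

lemma pure_zero_right: "m \<in> carrier M \<Longrightarrow> pt m \<zero>\<^bsub>N\<^esub> = \<zero>\<^bsub>T\<^esub>"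
  using add_hom_zero[OF N.is_abelian_group T_abelian pure_add_hom_right] .

lemma pure_minus_left: "m \<in> carrier M \<Longrightarrow> n \<in> carrier N \<Longrightarrow> pt (\<ominus>\<^bsub>M\<^esub> m) n = \<ominus>\<^bsub>T\<^esub> pt m n"
  using add_hom_minus[OF M.is_abelian_group T_abelian pure_add_hom_left] .

lemma pure_minus_right: "m \<in> carrier M \<Longrightarrow> n \<in> carrier N \<Longrightarrow> pt m (\<ominus>\<^bsub>N\<^esub> n) = \<ominus>\<^bsub>T\<^esub> pt m n"
  using add_hom_minus[OF N.is_abelian_group T_abelian pure_add_hom_right] .

text \<open>The integer coefficients of a formal combination are absorbed by
  \<open>- (m \<otimes> n) = (- m) \<otimes> n\<close>, so sums of pure tensors exhaust the tensor product. The induction on a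
  combination \<open>p\<close> carries \<open>- p\<close> along because the library rule passes from \<open>a\<close>, \<open>b\<close> to \<open>a - b\<close>.\<close>

lemma tensor_induct [consumes 1, case_names pure add]:
  assumes t: "t \<in> carrier T"
    and pure: "\<And>m n. \<lbrakk>m \<in> carrier M; n \<in> carrier N\<rbrakk> \<Longrightarrow> U (pt m n)"
    and add: "\<And>x y. \<lbrakk>x \<in> carrier T; y \<in> carrier T; U x; U y\<rbrakk> \<Longrightarrow> U (x \<oplus>\<^bsub>T\<^esub> y)"
  shows "U t"
proof -
  obtain p where p: "p \<in> carrier F" "t = tensor_class S M N p" using t carrier_T by auto
  from p(1) have "Poly_Mapping.keys p \<subseteq> carrier M \<times> carrier N" by (simp add: tensor_free_def)
  then have "p \<in> carrier F \<and> U (tensor_class S M N p) \<and> U (tensor_class S M N (- p))"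
  proof (induction p rule: frag_induction)
    case zero
    have "tensor_class S M N 0 = pt \<zero>\<^bsub>M\<^esub> \<zero>\<^bsub>N\<^esub>" using pure_zero_left[of "\<zero>\<^bsub>N\<^esub>"] zero_T by simp
    then show ?case using pure[of "\<zero>\<^bsub>M\<^esub>" "\<zero>\<^bsub>N\<^esub>"] by (simp add: free_zero)
  next
    case (one q)
    obtain m n where q: "q = (m, n)" "m \<in> carrier M" "n \<in> carrier N" using one by auto
    have f: "frag_of q \<in> carrier F" "- frag_of q \<in> carrier F"
      using free_pure q free_diff[OF free_zero, of "frag_of q"] by auto
    have "tensor_class S M N (- frag_of q) \<oplus>\<^bsub>T\<^esub> pt m n = \<zero>\<^bsub>T\<^esub>"
      using class_add[OF f(2,1)] q by (simp add: pure_tensor_def zero_T)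
    then have "tensor_class S M N (- frag_of q) = pt (\<ominus>\<^bsub>M\<^esub> m) n"
      using T.minus_equality[of "tensor_class S M N (- frag_of q)" "pt m n"] q pure_minus_left
        pure_closed f carrier_T by auto
    then show ?case using f pure q by (simp add: pure_tensor_def)
  next
    case (diff a b)
    then have "- a \<in> carrier F" "- b \<in> carrier F"
      using free_diff[OF free_zero, of a] free_diff[OF free_zero, of b] by auto
    with diff show ?case
      using class_add[of a "- b"] class_add[of "- a" b] carrier_T free_diff
        add[of "tensor_class S M N a" "tensor_class S M N (- b)"]
        add[of "tensor_class S M N (- a)" "tensor_class S M N b"] by auto
  qed
  then show ?thesis using p by simp
qed

lemma add_hom_eqI:
  assumes "add_hom T L f" "add_hom T L g"
    and "\<And>m n. \<lbrakk>m \<in> carrier M; n \<in> carrier N\<rbrakk> \<Longrightarrow> f (pt m n) = g (pt m n)" "t \<in> carrier T"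
  shows "f t = g t"
  using assms(4) by (induction t rule: tensor_induct) (simp_all add: assms add_hom_add[OF assms(1)] add_hom_add[OF assms(2)])

lemma tensor_trivial:
  assumes "carrier M = {\<zero>\<^bsub>M\<^esub>} \<or> carrier N = {\<zero>\<^bsub>N\<^esub>}"
  shows "carrier T = {\<zero>\<^bsub>T\<^esub>}"
proof -
  have "t = \<zero>\<^bsub>T\<^esub>" if "t \<in> carrier T" for t using that
  proof (induction t rule: tensor_induct)
    case (pure m n)
    with assms have "m = \<zero>\<^bsub>M\<^esub> \<or> n = \<zero>\<^bsub>N\<^esub>" by auto
    with pure show ?case by (auto simp: pure_zero_left pure_zero_right)
  qed simp
  then show ?thesis by auto
qed

text \<open>A homomorphism on the free group that kills the defining relations is constant on each
  coset, so evaluating it on a coset by \<open>the_elem\<close> is legitimate.\<close>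

lemma coset_evaluation:
  assumes L: "abelian_group L" and h: "h \<in> hom F (add_monoid L)" and g: "\<And>g. g \<in> gens \<Longrightarrow> h g = \<zero>\<^bsub>L\<^esub>"
    and p: "p \<in> carrier F"
  shows "the_elem (h ` tensor_class S M N p) = h p"
proof -
  interpret L: abelian_group L by fact
  interpret h: group_hom F "add_monoid L" h
    by (intro group_hom.intro group_hom_axioms.intro free_group L.a_group h)
  have "tensor_relations S M N \<subseteq> kernel F (add_monoid L) h"
    unfolding relations_eq
    by (rule group.generate_subgroup_incl[OF free_group _ h.subgroup_kernel])
      (use g gens_closed in \<open>auto simp: kernel_def\<close>)
  then have r: "h r = \<zero>\<^bsub>L\<^esub>" "r \<in> carrier F" if "r \<in> tensor_relations S M N" for r
    using that by (auto simp: kernel_def)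
  have 0: "0 \<in> tensor_relations S M N"
    using subgroup.one_closed[OF relations_subgroup] by (simp add: tensor_free_def)
  have hp: "h p \<in> carrier L" using h.hom_closed[OF p] by simp
  have "h (r + p) = h p" if "r \<in> tensor_relations S M N" for r
    using h.hom_mult[OF r(2)[OF that] p] r(1)[OF that] hp by (simp add: tensor_free_def)
  then have "h ` tensor_class S M N p = {h p}"
    using 0 by (force simp: tensor_class_def r_coset_def tensor_free_def)
  then show ?thesis by simp
qed

lemma coset_evaluation_add_hom:
  assumes L: "abelian_group L" and h: "h \<in> hom F (add_monoid L)" and g: "\<And>g. g \<in> gens \<Longrightarrow> h g = \<zero>\<^bsub>L\<^esub>"
  shows "add_hom T L (\<lambda>t. the_elem (h ` t))"
proof (rule add_homI)
  have hc: "h p \<in> carrier L" if "p \<in> carrier F" for p using h that by (auto simp: hom_def Pi_iff)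
  fix x assume "x \<in> carrier T"
  then obtain p where p: "p \<in> carrier F" "x = tensor_class S M N p" using carrier_T by auto
  then show "the_elem (h ` x) \<in> carrier L" using coset_evaluation[OF L h g p(1)] hc by simp
  fix y assume "y \<in> carrier T"
  then obtain q where q: "q \<in> carrier F" "y = tensor_class S M N q" using carrier_T by auto
  have "h (p + q) = h p \<oplus>\<^bsub>L\<^esub> h q"
    using hom_mult[OF h p(1) q(1)] by (simp add: tensor_free_def)
  then show "the_elem (h ` (x \<oplus>\<^bsub>T\<^esub> y)) = the_elem (h ` x) \<oplus>\<^bsub>L\<^esub> the_elem (h ` y)"
    using p q coset_evaluation[OF L h g] by (simp add: class_add free_add)
qed

lemma hom_gens_zero:
  assumes L: "abelian_group L" and h: "h \<in> hom F (add_monoid L)"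
    and add_left: "\<And>m m' n. \<lbrakk>m \<in> carrier M; m' \<in> carrier M; n \<in> carrier N\<rbrakk> \<Longrightarrow>
       h (frag_of (m \<oplus>\<^bsub>M\<^esub> m', n)) = h (frag_of (m, n)) \<oplus>\<^bsub>L\<^esub> h (frag_of (m', n))"
    and add_right: "\<And>m n n'. \<lbrakk>m \<in> carrier M; n \<in> carrier N; n' \<in> carrier N\<rbrakk> \<Longrightarrow>
       h (frag_of (m, n \<oplus>\<^bsub>N\<^esub> n')) = h (frag_of (m, n)) \<oplus>\<^bsub>L\<^esub> h (frag_of (m, n'))"
    and balanced: "\<And>m r n. \<lbrakk>m \<in> carrier M; r \<in> carrier S; n \<in> carrier N\<rbrakk> \<Longrightarrow>
       h (frag_of (ract M m r, n)) = h (frag_of (m, lact N r n))"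
    and g: "g \<in> gens"
  shows "h g = \<zero>\<^bsub>L\<^esub>"
proof -
  interpret L: abelian_group L by fact
  have hc: "h p \<in> carrier L" if "p \<in> carrier F" for p using h that by (auto simp: hom_def Pi_iff)
  have eq: "h (p - q) = h p \<ominus>\<^bsub>L\<^esub> h q" if "p \<in> carrier F" "q \<in> carrier F" for p q
  proof -
    have "h (p - q) \<oplus>\<^bsub>L\<^esub> h q = h p"
      using hom_mult[OF h free_diff[OF that] that(2)] by (simp add: tensor_free_def)
    then show ?thesis using hc free_diff that
      by (metis L.add.inv_solve_right a_minus_def)
  qed
  have z: "(a \<oplus>\<^bsub>L\<^esub> b) \<ominus>\<^bsub>L\<^esub> a \<ominus>\<^bsub>L\<^esub> b = \<zero>\<^bsub>L\<^esub>" if "a \<in> carrier L" "b \<in> carrier L" for a b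
    using that by (simp add: a_minus_def L.a_assoc L.a_lcomm[of b "\<ominus>\<^bsub>L\<^esub> a"] L.r_neg)
  from g show ?thesis unfolding gens_def
    by (auto simp: eq free_pure free_diff M.ract_closed N.lact_closed hc z add_left add_right balanced
        a_minus_def[of L a a for a] L.r_neg)
qed

text \<open>The universal property, for maps into any abelian group.\<close>

lemma tensor_lift_add:
  fixes L :: "('l, 'd) ring_scheme"
  assumes L: "abelian_group L"
    and closed: "\<And>m n. \<lbrakk>m \<in> carrier M; n \<in> carrier N\<rbrakk> \<Longrightarrow> \<phi> m n \<in> carrier L"
    and add_left: "\<And>m m' n. \<lbrakk>m \<in> carrier M; m' \<in> carrier M; n \<in> carrier N\<rbrakk> \<Longrightarrow>
       \<phi> (m \<oplus>\<^bsub>M\<^esub> m') n = \<phi> m n \<oplus>\<^bsub>L\<^esub> \<phi> m' n"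
    and add_right: "\<And>m n n'. \<lbrakk>m \<in> carrier M; n \<in> carrier N; n' \<in> carrier N\<rbrakk> \<Longrightarrow>
       \<phi> m (n \<oplus>\<^bsub>N\<^esub> n') = \<phi> m n \<oplus>\<^bsub>L\<^esub> \<phi> m n'"
    and balanced: "\<And>m r n. \<lbrakk>m \<in> carrier M; r \<in> carrier S; n \<in> carrier N\<rbrakk> \<Longrightarrow>
       \<phi> (ract M m r) n = \<phi> m (lact N r n)"
  shows "add_hom T L (tensor_lift L \<phi>)"
    and "\<And>m n. \<lbrakk>m \<in> carrier M; n \<in> carrier N\<rbrakk> \<Longrightarrow> tensor_lift L \<phi> (pt m n) = \<phi> m n"
proof -
  interpret L: abelian_group L by fact
  define h :: "('m \<times> 'n \<Rightarrow>\<^sub>0 int) \<Rightarrow> 'l"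
    where "h = (\<lambda>p. \<Oplus>\<^bsub>L\<^esub> q \<in> Poly_Mapping.keys p. add_pow L (Poly_Mapping.lookup p q) (\<phi> (fst q) (snd q)))"
  have lift: "tensor_lift L \<phi> = (\<lambda>t. the_elem (h ` t))"
    by (simp add: fun_eq_iff tensor_lift_def h_def)
  have h: "h \<in> hom F (add_monoid L)"
    unfolding h_def tensor_free_def by (rule free_extension_hom[OF L]) (use closed in auto)
  have hp: "h (frag_of (m, n)) = \<phi> m n" if "m \<in> carrier M" "n \<in> carrier N" for m n
    using closed[OF that] by (simp add: h_def L.add_pow_int)
  have g: "h g = \<zero>\<^bsub>L\<^esub>" if "g \<in> gens" for g
    by (rule hom_gens_zero[OF L h _ _ _ that])
      (simp_all add: hp add_left add_right balanced M.ract_closed N.lact_closed)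
  show "add_hom T L (tensor_lift L \<phi>)"
    unfolding lift by (rule coset_evaluation_add_hom[OF L h g])
  fix m n assume "m \<in> carrier M" "n \<in> carrier N"
  then show "tensor_lift L \<phi> (pt m n) = \<phi> m n"
    unfolding lift pure_tensor_def using coset_evaluation[OF L h g free_pure] hp by simp
qed

text \<open>Compatibility with the middle ring is all that is assumed here, because the two actions on a
  tensor product are themselves maps of this kind and have to be understood before it is known to be a
  bimodule.\<close>

lemma tensor_map_add:
  assumes T': "tensor_pair P' grP' S grS Q' grQ' M' N'"
    and f: "add_hom M M' f" "\<And>m r. \<lbrakk>m \<in> carrier M; r \<in> carrier S\<rbrakk> \<Longrightarrow> f (ract M m r) = ract M' (f m) r"
    and g: "add_hom N N' g" "\<And>n r. \<lbrakk>n \<in> carrier N; r \<in> carrier S\<rbrakk> \<Longrightarrow> g (lact N r n) = lact N' r (g n)"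
  shows "add_hom T (tensor S M' N') (tensor_map S M' N' f g)"
    and "\<And>m n. \<lbrakk>m \<in> carrier M; n \<in> carrier N\<rbrakk> \<Longrightarrow>
       tensor_map S M' N' f g (pt m n) = pure_tensor S M' N' (f m) (g n)"
proof -
  interpret T': tensor_pair P' grP' S grS Q' grQ' M' N' by fact
  define e where "e = frag_extend (\<lambda>(m, n). frag_of (f m, g n))"
  define h where "h = (\<lambda>p. tensor_class S M' N' (e p))"
  have map: "tensor_map S M' N' f g = (\<lambda>t. the_elem (h ` t))"
    by (simp add: fun_eq_iff tensor_map_def h_def e_def)
  note fc = add_hom_closed[OF f(1)] and gc = add_hom_closed[OF g(1)]
  have e: "e p \<in> carrier T'.F" if p: "p \<in> carrier F" for p
  proof -
    have "q \<in> carrier M' \<times> carrier N'" if q: "q \<in> Poly_Mapping.keys (e p)" for q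
    proof -
      obtain x where "x \<in> Poly_Mapping.keys p" "q = (f (fst x), g (snd x))"
        using q subsetD[OF keys_frag_extend[of "\<lambda>(m, n). frag_of (f m, g n)" p], of q]
        unfolding e_def case_prod_unfold by auto
      moreover from this p have "fst x \<in> carrier M" "snd x \<in> carrier N"
        by (auto simp: tensor_free_def)
      ultimately show ?thesis using fc gc by simp
    qed
    then show ?thesis by (auto simp: tensor_free_def)
  qed
  have h: "h \<in> hom F (add_monoid T'.T)"
  proof (rule homI)
    fix p q assume pq: "p \<in> carrier F" "q \<in> carrier F"
    have "e (p + q) = e p + e q" by (simp add: e_def frag_extend_add)
    then show "h (p \<otimes>\<^bsub>F\<^esub> q) = h p \<otimes>\<^bsub>add_monoid T'.T\<^esub> h q"
      using T'.class_add[OF e e] pq by (simp add: h_def) (simp add: tensor_free_def)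
  qed (use e in \<open>auto simp: h_def T'.carrier_T\<close>)
  have hp: "h (frag_of (m, n)) = T'.pt (f m) (g n)" for m n
    by (simp add: h_def e_def pure_tensor_def)
  have gz: "h x = \<zero>\<^bsub>T'.T\<^esub>" if "x \<in> gens" for x
    by (rule hom_gens_zero[OF T'.T_abelian h _ _ _ that])
      (simp_all add: hp f g add_hom_add[OF f(1)] add_hom_add[OF g(1)] fc gc
        T'.pure_add_left T'.pure_add_right T'.pure_balanced)
  show "add_hom T T'.T (tensor_map S M' N' f g)"
    unfolding map by (rule coset_evaluation_add_hom[OF T'.T_abelian h gz])
  fix m n assume "m \<in> carrier M" "n \<in> carrier N"
  then show "tensor_map S M' N' f g (pt m n) = T'.pt (f m) (g n)"
    unfolding map using coset_evaluation[OF T'.T_abelian h gz free_pure] hp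
    by (simp add: pure_tensor_def)
qed

subsection \<open>The tensor product is a graded bimodule\<close>

lemma tensor_lact: "lact T a = tensor_map S M N (lact M a) id"
  and tensor_ract: "ract T t a = tensor_map S M N id (\<lambda>n. ract N n a) t"
  and tensor_homog: "homog T i = generate (tensor_group S M N)
        {pt m n | m n j l. m \<in> homog M j \<and> n \<in> homog N l \<and> j + l = i}"
  by (simp_all add: tensor_def)

lemma lact_T_add_hom: "a \<in> carrier P \<Longrightarrow> add_hom T T (lact T a)"
  and lact_pure: "a \<in> carrier P \<Longrightarrow> m \<in> carrier M \<Longrightarrow> n \<in> carrier N \<Longrightarrow> lact T a (pt m n) = pt (lact M a m) n"
  using tensor_map_add[OF tensor_pair_axioms M.lact_add_hom _ add_hom_id]
  by (simp_all add: tensor_lact M.lact_ract id_def)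

lemma ract_T_add_hom: "a \<in> carrier Q \<Longrightarrow> add_hom T T (\<lambda>t. ract T t a)"
  and ract_pure: "a \<in> carrier Q \<Longrightarrow> m \<in> carrier M \<Longrightarrow> n \<in> carrier N \<Longrightarrow> ract T (pt m n) a = pt m (ract N n a)"
  using tensor_map_add[OF tensor_pair_axioms add_hom_id _ N.ract_add_hom]
  by (simp_all add: tensor_ract N.lact_ract id_def)

lemma tensor_group_inv: "m_inv (tensor_group S M N) x = \<ominus>\<^bsub>T\<^esub> x"
  by (simp add: a_inv_def tensor_def m_inv_def)

text \<open>With a subgroup \<open>V\<close> of the target as a parameter, this one rule shows that a map preserves degrees
  (\<open>V\<close> a homogeneous part) and that it vanishes on a part (\<open>V = {0}\<close>).\<close>

lemma homog_T_induct:
  assumes f: "add_hom T L f" and V: "additive_subgroup V L" and L: "abelian_group L"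
    and pure: "\<And>m n j l. \<lbrakk>m \<in> homog M j; n \<in> homog N l; j + l = i\<rbrakk> \<Longrightarrow> f (pt m n) \<in> V"
    and t: "t \<in> homog T i"
  shows "f t \<in> V"
proof -
  have "t \<in> carrier T \<and> f t \<in> V"
    using t unfolding tensor_homog
  proof (induction rule: generate.induct)
    case one
    have "\<one>\<^bsub>tensor_group S M N\<^esub> = \<zero>\<^bsub>T\<^esub>" by (simp add: tensor_def)
    then show ?case using add_hom_zero[OF T_abelian L f] additive_subgroup_zero[OF V] by simp
  next
    case (incl h)
    then show ?case using pure pure_closed M.H_closed N.H_closed by auto
  next
    case (inv h)
    then obtain m n j l where h: "h = pt m n" "m \<in> homog M j" "n \<in> homog N l" "j + l = i" by blast
    then have c: "h \<in> carrier T" using pure_closed M.H_closed N.H_closed by auto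
    show ?case using pure[OF h(2-4)] h(1) c add_hom_minus[OF T_abelian L f c] additive_subgroup_minus[OF V]
      by (simp add: tensor_group_inv)
  next
    case (eng h1 h2)
    have "h1 \<otimes>\<^bsub>tensor_group S M N\<^esub> h2 = h1 \<oplus>\<^bsub>T\<^esub> h2" by (simp add: tensor_def)
    with eng show ?case using additive_subgroup_add[OF V] add_hom_add[OF f] by simp
  qed
  then show ?thesis ..
qed

lemma homog_T_subgroup: "additive_subgroup (homog T i) T"
proof -
  let ?X = "{pt m n | m n j l. m \<in> homog M j \<and> n \<in> homog N l \<and> j + l = i}"
  interpret G: comm_group "tensor_group S M N" by (rule tensor_group_comm)
  have "?X \<subseteq> carrier (tensor_group S M N)"
    using pure_closed M.H_closed N.H_closed by (auto simp: tensor_def)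
  from G.generate_is_subgroup[OF this] interpret H: subgroup "homog T i" "tensor_group S M N"
    unfolding tensor_homog .
  show ?thesis
  proof (rule additive_subgroupI[OF T_abelian])
    show "homog T i \<subseteq> carrier T" using H.subset by (simp add: tensor_def)
    show "\<zero>\<^bsub>T\<^esub> \<in> homog T i" using H.one_closed by (simp add: tensor_def)
    show "x \<oplus>\<^bsub>T\<^esub> y \<in> homog T i" if "x \<in> homog T i" "y \<in> homog T i" for x y
      using H.m_closed[OF that] by (simp add: tensor_def)
    show "\<ominus>\<^bsub>T\<^esub> x \<in> homog T i" if "x \<in> homog T i" for x
      using H.m_inv_closed[OF that] by (simp add: tensor_group_inv)
  qed
qed

lemma homog_pure: "m \<in> homog M j \<Longrightarrow> n \<in> homog N l \<Longrightarrow> pt m n \<in> homog T (j + l)"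
  unfolding tensor_homog by (rule generate.incl) blast

text \<open>The degree \<open>i\<close> part of a pure tensor. It respects the balancing relations because \<open>S\<close> is
  generated by homogeneous elements: for homogeneous \<open>m\<close>, \<open>n\<close> and \<open>r\<close> both \<open>m r \<otimes> n\<close> and
  \<open>m \<otimes> r n\<close> are concentrated in the sum of the three degrees.\<close>

definition part where
  "part i m n = (\<Oplus>\<^bsub>T\<^esub> j \<in> {j. component M (homog M) j m \<noteq> \<zero>\<^bsub>M\<^esub>}.
     pt (component M (homog M) j m) (component N (homog N) (i - j) n))"

lemma part_superset:
  assumes "m \<in> carrier M" "n \<in> carrier N" "finite J" "{j. component M (homog M) j m \<noteq> \<zero>\<^bsub>M\<^esub>} \<subseteq> J"
  shows "part i m n = (\<Oplus>\<^bsub>T\<^esub> j \<in> J.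
     pt (component M (homog M) j m) (component N (homog N) (i - j) n))"
  unfolding part_def
  by (rule T.add.finprod_mono_neutral_cong_left)
    (use assms in \<open>auto simp: pure_zero_left N.component_closed M.component_closed intro!: pure_closed\<close>)

lemma part_closed: "m \<in> carrier M \<Longrightarrow> n \<in> carrier N \<Longrightarrow> part i m n \<in> carrier T"
  unfolding part_def by (intro T.finsum_closed) (auto intro!: pure_closed M.component_closed N.component_closed)

lemma part_add_left:
  assumes "m \<in> carrier M" "m' \<in> carrier M" "n \<in> carrier N"
  shows "part i (m \<oplus>\<^bsub>M\<^esub> m') n = part i m n \<oplus>\<^bsub>T\<^esub> part i m' n"
proof -
  let ?c = "component M (homog M)"
  let ?J = "{j. ?c j m \<noteq> \<zero>\<^bsub>M\<^esub>} \<union> {j. ?c j m' \<noteq> \<zero>\<^bsub>M\<^esub>}"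
  note add = add_hom_add[OF M.component_add_hom assms(1,2)]
  have J: "finite ?J" using M.component_finite assms by simp
  have sub: "{j. ?c j (m \<oplus>\<^bsub>M\<^esub> m') \<noteq> \<zero>\<^bsub>M\<^esub>} \<subseteq> ?J" by (auto simp: add)
  have "part i (m \<oplus>\<^bsub>M\<^esub> m') n = (\<Oplus>\<^bsub>T\<^esub> j \<in> ?J. pt (?c j (m \<oplus>\<^bsub>M\<^esub> m')) (component N (homog N) (i - j) n))"
    by (rule part_superset) (use assms J sub in auto)
  also have "\<dots> = (\<Oplus>\<^bsub>T\<^esub> j \<in> ?J. pt (?c j m) (component N (homog N) (i - j) n) \<oplus>\<^bsub>T\<^esub>
      pt (?c j m') (component N (homog N) (i - j) n))"
    by (rule T.finsum_cong')
      (use assms in \<open>auto simp: add pure_add_left M.component_closed N.component_closed pure_closed\<close>)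
  also have "\<dots> = part i m n \<oplus>\<^bsub>T\<^esub> part i m' n"
    by (subst T.finsum_addf)
      (use assms J in \<open>auto simp: part_superset[of _ _ ?J] intro!: pure_closed M.component_closed N.component_closed\<close>)
  finally show ?thesis .
qed

lemma part_add_right:
  assumes "m \<in> carrier M" "n \<in> carrier N" "n' \<in> carrier N"
  shows "part i m (n \<oplus>\<^bsub>N\<^esub> n') = part i m n \<oplus>\<^bsub>T\<^esub> part i m n'"
  unfolding part_def using assms
  by (subst T.finsum_addf[symmetric])
    (auto simp: add_hom_add[OF N.component_add_hom] pure_add_right M.component_closed N.component_closed
      intro!: pure_closed T.finsum_cong' M.component_finite)

lemma part_homog:
  assumes m: "m \<in> homog M a" and n: "n \<in> homog N b"
  shows "part i m n = (if i = a + b then pt m n else \<zero>\<^bsub>T\<^esub>)"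
proof -
  note c = M.H_closed[OF m] N.H_closed[OF n]
  have "part i m n = (\<Oplus>\<^bsub>T\<^esub> j \<in> {a}. pt (component M (homog M) j m) (component N (homog N) (i - j) n))"
    by (rule part_superset) (use c m in \<open>auto simp: M.component_of_homog\<close>)
  also have "\<dots> = pt m (if i - a = b then n else \<zero>\<^bsub>N\<^esub>)"
    using m n c by (simp add: M.component_of_homog N.component_of_homog pure_closed)
  finally show ?thesis using c by (auto simp: pure_zero_right)
qed

lemma part_balanced:
  assumes "m \<in> carrier M" "r \<in> carrier S" "n \<in> carrier N"
  shows "part i (ract M m r) n = part i m (lact N r n)"
  using assms(1)
proof (induction m rule: M.homog_induct)
  case (homog a m)
  note m = M.H_closed[OF homog]
  show ?case using assms(3)
  proof (induction n rule: N.homog_induct)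
    case (homog b n)
    note n = N.H_closed[OF this]
    show ?case using S_generated assms(2)
    proof (induction r rule: add_generates_induct)
      case (gen r)
      then obtain l where r: "r \<in> grS l" by blast
      have "r \<in> carrier S" by (rule M.grQ_closed[OF r])
      then show ?case
        using part_homog[OF M.ract_homog[OF r \<open>m \<in> homog M a\<close>] \<open>n \<in> homog N b\<close>]
          part_homog[OF \<open>m \<in> homog M a\<close> N.lact_homog[OF r \<open>n \<in> homog N b\<close>]] pure_balanced[OF m _ n]
        by (simp add: algebra_simps)
    next
      case (add x y)
      then show ?case using m n
        by (simp add: M.ract_add_right N.lact_add_left part_add_left part_add_right M.ract_closed N.lact_closed)
    qed
  next
    case (add x y)
    then show ?case using m assms(2)
      by (simp add: N.lact_add_right part_add_right M.ract_closed N.lact_closed)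
  qed
next
  case (add x y)
  then show ?case using assms(2,3)
    by (simp add: M.ract_add_left part_add_left M.ract_closed N.lact_closed)
qed

text \<open>The projections to the homogeneous parts are the extensions of \<open>part\<close> by the universal property.\<close>

lemma graded_group_T: "graded_group T (homog T)"
proof (rule graded_groupI[where pr = "\<lambda>i. tensor_lift T (part i)"])
  note lift = tensor_lift_add[OF T_abelian part_closed part_add_left part_add_right part_balanced]
  show pr: "add_hom T T (tensor_lift T (part i))" for i by (rule lift)
  show "add_generates T (\<Union>i. homog T i)"
  proof (rule add_generatesI)
    fix U t
    assume H: "\<And>g. g \<in> (\<Union>i. homog T i) \<Longrightarrow> U g"
      and sums: "\<And>x y. \<lbrakk>x \<in> carrier T; y \<in> carrier T; U x; U y\<rbrakk> \<Longrightarrow> U (x \<oplus>\<^bsub>T\<^esub> y)"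
      and t: "t \<in> carrier T"
    have 1: "U (pt m n)" if "m \<in> homog M a" "n \<in> carrier N" for m n a using that(2)
    proof (induction n rule: N.homog_induct)
      case (homog b n) then show ?case using H homog_pure[OF that(1)] by blast
    next
      case (add x y) then show ?case
        using that(1) by (simp add: pure_add_right M.H_closed pure_closed sums)
    qed
    have 2: "U (pt m n)" if "m \<in> carrier M" "n \<in> carrier N" for m n using that(1)
    proof (induction m rule: M.homog_induct)
      case (homog a m) then show ?case using 1 that(2) by blast
    next
      case (add x y) then show ?case
        using that(2) by (simp add: pure_add_left pure_closed sums)
    qed
    show "U t" using t by (induction t rule: tensor_induct) (simp_all add: 2 sums)
  qed
  have "tensor_lift T (part i) t \<ominus>\<^bsub>T\<^esub> t \<in> {\<zero>\<^bsub>T\<^esub>}" if "t \<in> homog T i" for i t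
    by (rule homog_T_induct[OF _ _ T_abelian _ that])
      (auto simp: a_minus_def lift(2) part_homog M.H_closed N.H_closed T.r_neg T.a_inv_zero pure_closed
        intro!: add_hom_plus add_hom_neg T_abelian pr add_hom_id additive_subgroupI)
  then show "tensor_lift T (part i) t = t" if "t \<in> homog T i" for i t
    using that additive_subgroup_carrier[OF homog_T_subgroup that] add_hom_closed[OF pr]
    by (metis T.minus_eq T.minus_minus T.minus_equality T.a_inv_closed singletonD)
  have "tensor_lift T (part i) t \<in> {\<zero>\<^bsub>T\<^esub>}" if "t \<in> homog T j" "j \<noteq> i" for i j t
    by (rule homog_T_induct[OF pr _ T_abelian _ that(1)])
      (use that(2) in \<open>auto simp: lift(2) part_homog M.H_closed N.H_closed T.a_inv_zero
        intro!: T_abelian additive_subgroupI\<close>)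
  then show "tensor_lift T (part i) t = \<zero>\<^bsub>T\<^esub>" if "t \<in> homog T j" "j \<noteq> i" for i j t
    using that by blast
qed (rule T_abelian homog_T_subgroup)+

text \<open>The axioms on the two actions are equations between additive maps, so that pure tensors suffice.\<close>

theorem gr_bimod_T: "gr_bimod P grP Q grQ T"
proof -
  note eqI = add_hom_eqI[where L = T]
  have PP: "a \<oplus>\<^bsub>P\<^esub> b \<in> carrier P" "a \<otimes>\<^bsub>P\<^esub> b \<in> carrier P" if "a \<in> carrier P" "b \<in> carrier P" for a b
    using that by auto
  have QQ: "a \<oplus>\<^bsub>Q\<^esub> b \<in> carrier Q" "a \<otimes>\<^bsub>Q\<^esub> b \<in> carrier Q" if "a \<in> carrier Q" "b \<in> carrier Q" for a b
    using that by auto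
  note simps = lact_pure ract_pure PP QQ M.lact_closed N.ract_closed
  note homs = lact_T_add_hom ract_T_add_hom add_hom_plus[OF T_abelian]
    add_hom_comp[OF lact_T_add_hom lact_T_add_hom] add_hom_comp[OF ract_T_add_hom ract_T_add_hom]
    add_hom_comp[OF lact_T_add_hom ract_T_add_hom] add_hom_comp[OF ract_T_add_hom lact_T_add_hom] add_hom_id
  show ?thesis
  proof (intro gr_bimod.intro gr_bimod_axioms.intro M.P.ring_axioms N.Q.ring_axioms graded_group_T
      add_hom_closed[OF lact_T_add_hom] add_hom_closed[OF ract_T_add_hom]
      add_hom_add[OF lact_T_add_hom] add_hom_add[OF ract_T_add_hom])
    fix a b t assume abt: "a \<in> carrier P" "b \<in> carrier P" "t \<in> carrier T"
    show "lact T (a \<oplus>\<^bsub>P\<^esub> b) t = lact T a t \<oplus>\<^bsub>T\<^esub> lact T b t"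
      by (rule eqI[where f = "lact T (a \<oplus>\<^bsub>P\<^esub> b)"])
        (use abt in \<open>simp_all add: homs simps M.lact_add_left pure_add_left\<close>)
    show "lact T (a \<otimes>\<^bsub>P\<^esub> b) t = lact T a (lact T b t)"
      by (rule eqI[where f = "lact T (a \<otimes>\<^bsub>P\<^esub> b)"])
        (use abt in \<open>simp_all add: homs simps M.lact_assoc\<close>)
  next
    fix a b t assume abt: "a \<in> carrier Q" "b \<in> carrier Q" "t \<in> carrier T"
    show "ract T t (a \<oplus>\<^bsub>Q\<^esub> b) = ract T t a \<oplus>\<^bsub>T\<^esub> ract T t b"
      by (rule eqI[where f = "\<lambda>t. ract T t (a \<oplus>\<^bsub>Q\<^esub> b)"])
        (use abt in \<open>simp_all add: homs simps N.ract_add_right pure_add_right\<close>)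
    show "ract T t (a \<otimes>\<^bsub>Q\<^esub> b) = ract T (ract T t a) b"
      by (rule eqI[where f = "\<lambda>t. ract T t (a \<otimes>\<^bsub>Q\<^esub> b)"])
        (use abt in \<open>simp_all add: homs simps N.ract_assoc\<close>)
  next
    fix a b t assume abt: "a \<in> carrier P" "b \<in> carrier Q" "t \<in> carrier T"
    show "ract T (lact T a t) b = lact T a (ract T t b)"
      by (rule eqI[where f = "\<lambda>t. ract T (lact T a t) b"])
        (use abt in \<open>simp_all add: homs simps\<close>)
  next
    fix t assume t: "t \<in> carrier T"
    show "lact T \<one>\<^bsub>P\<^esub> t = t"
      by (rule eqI[where f = "lact T \<one>\<^bsub>P\<^esub>" and g = "\<lambda>t. t"]) (simp_all add: homs simps M.lact_one t)
    show "ract T t \<one>\<^bsub>Q\<^esub> = t"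
      by (rule eqI[where f = "\<lambda>t. ract T t \<one>\<^bsub>Q\<^esub>" and g = "\<lambda>t. t"]) (simp_all add: homs simps N.ract_one t)
  next
    fix a i t j assume a: "a \<in> grP i" and t: "t \<in> homog T j"
    note aP = M.grP_closed[OF a]
    show "lact T a t \<in> homog T (i + j)"
    proof (rule homog_T_induct[OF lact_T_add_hom[OF aP] homog_T_subgroup T_abelian _ t])
      fix m n c d assume "m \<in> homog M c" "n \<in> homog N d" "c + d = j"
      then show "lact T a (pt m n) \<in> homog T (i + j)"
        using homog_pure[OF M.lact_homog[OF a], of m c n d]
        by (auto simp: lact_pure aP M.H_closed N.H_closed add.assoc)
    qed
  next
    fix a i t j assume a: "a \<in> grQ i" and t: "t \<in> homog T j"
    note aQ = N.grQ_closed[OF a]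
    show "ract T t a \<in> homog T (j + i)"
    proof (rule homog_T_induct[OF ract_T_add_hom[OF aQ] homog_T_subgroup T_abelian _ t])
      fix m n c d assume "m \<in> homog M c" "n \<in> homog N d" "c + d = j"
      then show "ract T (pt m n) a \<in> homog T (j + i)"
        using homog_pure[OF _ N.ract_homog[OF a], of m c n d]
        by (auto simp: ract_pure aQ M.H_closed N.H_closed add.assoc)
    qed
  qed (auto intro: M.grP_closed N.grQ_closed)
qed

lemma tensor_lift_hom:
  assumes L: "gr_bimod P grP Q grQ L"
    and closed: "\<And>m n. \<lbrakk>m \<in> carrier M; n \<in> carrier N\<rbrakk> \<Longrightarrow> \<phi> m n \<in> carrier L"
    and add_left: "\<And>m m' n. \<lbrakk>m \<in> carrier M; m' \<in> carrier M; n \<in> carrier N\<rbrakk> \<Longrightarrow>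
       \<phi> (m \<oplus>\<^bsub>M\<^esub> m') n = \<phi> m n \<oplus>\<^bsub>L\<^esub> \<phi> m' n"
    and add_right: "\<And>m n n'. \<lbrakk>m \<in> carrier M; n \<in> carrier N; n' \<in> carrier N\<rbrakk> \<Longrightarrow>
       \<phi> m (n \<oplus>\<^bsub>N\<^esub> n') = \<phi> m n \<oplus>\<^bsub>L\<^esub> \<phi> m n'"
    and balanced: "\<And>m r n. \<lbrakk>m \<in> carrier M; r \<in> carrier S; n \<in> carrier N\<rbrakk> \<Longrightarrow>
       \<phi> (ract M m r) n = \<phi> m (lact N r n)"
    and left: "\<And>a m n. \<lbrakk>a \<in> carrier P; m \<in> carrier M; n \<in> carrier N\<rbrakk> \<Longrightarrow>
       \<phi> (lact M a m) n = lact L a (\<phi> m n)"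
    and right: "\<And>a m n. \<lbrakk>a \<in> carrier Q; m \<in> carrier M; n \<in> carrier N\<rbrakk> \<Longrightarrow>
       \<phi> m (ract N n a) = ract L (\<phi> m n) a"
    and homog: "\<And>m n i j. \<lbrakk>m \<in> homog M i; n \<in> homog N j\<rbrakk> \<Longrightarrow> \<phi> m n \<in> homog L (i + j + d)"
  shows "tensor_lift L \<phi> \<in> gr_hom P Q d T L"
    and "\<And>m n. \<lbrakk>m \<in> carrier M; n \<in> carrier N\<rbrakk> \<Longrightarrow> tensor_lift L \<phi> (pt m n) = \<phi> m n"
proof -
  interpret L: gr_bimod P grP Q grQ L by fact
  note lift = tensor_lift_add[where \<phi> = \<phi>, OF L.is_abelian_group closed add_left add_right balanced]
  show "tensor_lift L \<phi> (pt m n) = \<phi> m n" if "m \<in> carrier M" "n \<in> carrier N" for m n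
    by (rule lift(2)) (use that in auto)
  show "tensor_lift L \<phi> \<in> gr_hom P Q d T L"
  proof (rule gr_homI)
    show hom: "add_hom T L (tensor_lift L \<phi>)" by (rule lift(1))
    fix a t assume at: "a \<in> carrier P" "t \<in> carrier T"
    show "tensor_lift L \<phi> (lact T a t) = lact L a (tensor_lift L \<phi> t)"
      by (rule add_hom_eqI[OF add_hom_comp[OF lact_T_add_hom hom] add_hom_comp[OF hom L.lact_add_hom]])
        (use at in \<open>simp_all add: lact_pure lift(2) M.lact_closed left\<close>)
  next
    note hom = lift(1)
    fix a t assume at: "a \<in> carrier Q" "t \<in> carrier T"
    show "tensor_lift L \<phi> (ract T t a) = ract L (tensor_lift L \<phi> t) a"
      by (rule add_hom_eqI[OF add_hom_comp[OF ract_T_add_hom hom] add_hom_comp[OF hom L.ract_add_hom]])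
        (use at in \<open>simp_all add: ract_pure lift(2) N.ract_closed right\<close>)
  next
    fix i t assume t: "t \<in> homog T i"
    show "tensor_lift L \<phi> t \<in> homog L (i + d)"
      by (rule homog_T_induct[OF lift(1) L.H_subgroup L.is_abelian_group _ t])
        (use homog in \<open>auto simp: lift(2) M.H_closed N.H_closed\<close>)
  qed
qed

lemma tensor_map_hom:
  assumes T': "tensor_pair P grP S grS Q grQ M' N'"
    and f: "f \<in> gr_hom P S c M M'" and g: "g \<in> gr_hom S Q d N N'"
  shows "tensor_map S M' N' f g \<in> gr_hom P Q (c + d) T (tensor S M' N')"
    and "\<And>m n. \<lbrakk>m \<in> carrier M; n \<in> carrier N\<rbrakk> \<Longrightarrow>
       tensor_map S M' N' f g (pt m n) = pure_tensor S M' N' (f m) (g n)"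
proof -
  interpret T': tensor_pair P grP S grS Q grQ M' N' by fact
  let ?h = "tensor_map S M' N' f g"
  note map = tensor_map_add[OF T' gr_hom_add_hom[OF f] gr_hom_ract[OF f] gr_hom_add_hom[OF g] gr_hom_lact[OF g]]
  show "?h (pt m n) = T'.pt (f m) (g n)" if "m \<in> carrier M" "n \<in> carrier N" for m n
    by (rule map(2)) (use that in auto)
  have fc: "f m \<in> carrier M'" if "m \<in> carrier M" for m using gr_hom_closed[OF f that] .
  have gc: "g n \<in> carrier N'" if "n \<in> carrier N" for n using gr_hom_closed[OF g that] .
  show "?h \<in> gr_hom P Q (c + d) T T'.T"
  proof (rule gr_homI)
    show "add_hom T T'.T ?h" by (rule map(1))
    fix a t assume at: "a \<in> carrier P" "t \<in> carrier T"
    show "?h (lact T a t) = lact T'.T a (?h t)"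
      by (rule add_hom_eqI[OF add_hom_comp[OF lact_T_add_hom map(1)] add_hom_comp[OF map(1) T'.lact_T_add_hom]])
        (use at in \<open>simp_all add: lact_pure T'.lact_pure map(2) M.lact_closed fc gc gr_hom_lact[OF f]\<close>)
  next
    fix a t assume at: "a \<in> carrier Q" "t \<in> carrier T"
    show "?h (ract T t a) = ract T'.T (?h t) a"
      by (rule add_hom_eqI[OF add_hom_comp[OF ract_T_add_hom map(1)] add_hom_comp[OF map(1) T'.ract_T_add_hom]])
        (use at in \<open>simp_all add: ract_pure T'.ract_pure map(2) N.ract_closed fc gc gr_hom_ract[OF g]\<close>)
  next
    fix i t assume t: "t \<in> homog T i"
    show "?h t \<in> homog T'.T (i + (c + d))"
    proof (rule homog_T_induct[OF map(1) T'.homog_T_subgroup T'.T_abelian _ t])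
      fix m n j l assume mn: "m \<in> homog M j" "n \<in> homog N l" "j + l = i"
      have i: "i + (c + d) = (j + c) + (l + d)" using mn by simp
      show "?h (pt m n) \<in> homog T'.T (i + (c + d))"
        unfolding i using T'.homog_pure[OF gr_hom_homog[OF f mn(1)] gr_hom_homog[OF g mn(2)]] mn
        by (simp add: map(2) M.H_closed N.H_closed)
    qed
  qed
qed

lemma gr_hom_eqI:
  assumes "f \<in> gr_hom P Q d T L" "g \<in> gr_hom P Q e T L"
    and "\<And>m n. \<lbrakk>m \<in> carrier M; n \<in> carrier N\<rbrakk> \<Longrightarrow> f (pt m n) = g (pt m n)" "t \<in> carrier T"
  shows "f t = g t"
  by (rule add_hom_eqI[OF gr_hom_add_hom[OF assms(1)] gr_hom_add_hom[OF assms(2)] assms(3,4)])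

end

lemma pure_tensor_shift: "pure_tensor S (shift a M) (shift b N) = pure_tensor S M N"
  by (simp add: fun_eq_iff pure_tensor_def tensor_class_def tensor_relations_def tensor_free_def)

text \<open>An equality of records and not just an isomorphism, because degrees enter only in the field
  \<open>homog\<close>. All computations can therefore be made with unshifted bimodules.\<close>

lemma tensor_shift: "tensor S (shift a M) (shift b N) = shift (a + b) (tensor S M N)"
proof -
  have free: "tensor_free (shift a M) (shift b N) = tensor_free M N"
    by (simp add: tensor_free_def)
  have rel: "tensor_relations S (shift a M) (shift b N) = tensor_relations S M N"
    by (simp add: tensor_relations_def free)
  have grp: "tensor_group S (shift a M) (shift b N) = tensor_group S M N"
    by (simp add: tensor_group_def free rel)
  have cls: "tensor_class S (shift a M) (shift b N) = tensor_class S M N"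
    by (simp add: fun_eq_iff tensor_class_def free rel)
  have pure: "pure_tensor S (shift a M) (shift b N) = pure_tensor S M N"
    by (simp add: fun_eq_iff pure_tensor_def cls)
  have map: "tensor_map S (shift a M) (shift b N) = tensor_map S M N"
    by (simp add: fun_eq_iff tensor_map_def cls)
  have "(\<exists>j l. m \<in> homog M (j - a) \<and> n \<in> homog N (l - b) \<and> j + l = i) \<longleftrightarrow>
      (\<exists>j l. m \<in> homog M j \<and> n \<in> homog N l \<and> j + l = i - (a + b))" for m n i
  proof safe
    fix j l assume "m \<in> homog M (j - a)" "n \<in> homog N (l - b)" "i = j + l"
    then show "\<exists>j' l'. m \<in> homog M j' \<and> n \<in> homog N l' \<and> j' + l' = j + l - (a + b)"
      by (intro exI[of _ "j - a"] exI[of _ "l - b"]) simp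
  next
    fix j l assume *: "m \<in> homog M j" "n \<in> homog N l" "j + l = i - (a + b)"
    then show "\<exists>j l. m \<in> homog M (j - a) \<and> n \<in> homog N (l - b) \<and> j + l = i"
      by (intro exI[of _ "j + a"] exI[of _ "l + b"]) simp
  qed
  then have gen: "{pure_tensor S M N m n | m n j l. m \<in> homog M (j - a) \<and> n \<in> homog N (l - b) \<and> j + l = i} =
      {pure_tensor S M N m n | m n j l. m \<in> homog M j \<and> n \<in> homog N l \<and> j + l = i - (a + b)}" for i
    by blast
  show ?thesis
    by (simp add: tensor_def shift_simps[abs_def] grp pure map gen[simplified] shift_def[of "a + b"])
qed

subsection \<open>Ring extensions\<close>

text \<open>That \<open>R\<close> is a graded bimodule over itself expresses that it is a graded ring; \<open>S\<close> is a graded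
  subring.\<close>

locale graded_extension =
  fixes R :: "'a ring" and gr :: "int \<Rightarrow> 'a set" and S :: "'a ring" and grS :: "int \<Rightarrow> 'a set"
  assumes regular: "gr_bimod R gr R gr (regular_bimodule R gr)"
    and R_generated: "add_generates R (\<Union>i. gr i)"
    and S_ring: "ring S"
    and S_sub: "carrier S \<subseteq> carrier R" "monoid.mult S = monoid.mult R" "ring.add S = ring.add R"
      "monoid.one S = monoid.one R"
    and grS: "\<And>i. grS i \<subseteq> gr i \<inter> carrier S"
    and S_generated: "add_generates S (\<Union>i. grS i)"
    and one_homog: "\<one>\<^bsub>R\<^esub> \<in> gr 0"
begin

abbreviation A where "A \<equiv> regular_bimodule R gr"

sublocale R: ring R using gr_bimod.axioms(1)[OF regular] .

sublocale A: gr_bimod R gr R gr A by (rule regular)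

lemma regular_simps [simp]:
  "carrier A = carrier R" "ring.zero A = \<zero>\<^bsub>R\<^esub>" "ring.add A = ring.add R"
  "lact A = monoid.mult R" "ract A = monoid.mult R" "homog A = gr"
  by (simp_all add: regular_bimodule_def)

lemma gr_closed: "a \<in> gr i \<Longrightarrow> a \<in> carrier R"
  by (rule A.grP_closed)

lemma S_closed: "r \<in> carrier S \<Longrightarrow> r \<in> carrier R"
  using S_sub by blast

lemma restrict_left:
  assumes "gr_bimod R gr Q grQ M"
  shows "gr_bimod S grS Q grQ M"
proof -
  interpret gr_bimod R gr Q grQ M by fact
  show ?thesis
    by (rule gr_bimod_restrict[OF assms S_ring Q.ring_axioms]) (use S_sub grS grQ_closed in auto)
qed

lemma restrict_right:
  assumes "gr_bimod P grP R gr M"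
  shows "gr_bimod P grP S grS M"
proof -
  interpret gr_bimod P grP R gr M by fact
  show ?thesis
    by (rule gr_bimod_restrict[OF assms P.ring_axioms S_ring]) (use S_sub grS grP_closed in auto)
qed

lemma tensor_pair_S: "gr_bimod P grP S grS M \<Longrightarrow> gr_bimod S grS Q grQ N \<Longrightarrow> tensor_pair P grP S grS Q grQ M N"
  by (simp add: tensor_pair_def tensor_pair_axioms_def S_generated)

lemma tensor_pair_R: "gr_bimod P grP R gr M \<Longrightarrow> gr_bimod R gr Q grQ N \<Longrightarrow> tensor_pair P grP R gr Q grQ M N"
  by (simp add: tensor_pair_def tensor_pair_axioms_def R_generated)

text \<open>The canonical map \<open>(M \<otimes>\<^sub>S R) \<otimes>\<^sub>R N \<rightarrow> M \<otimes>\<^sub>S N\<close> and its mirror image. After composition with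
  it, a map on \<open>N\<close> that is linear over \<open>S\<close> only can be applied to the second factor of
  \<open>(M \<otimes>\<^sub>S R) \<otimes>\<^sub>R N\<close>.\<close>

lemma tensor_cancel_left:
  assumes M: "gr_bimod P grP S grS M" and N: "gr_bimod R gr Q grQ N"
  shows "\<exists>c \<in> gr_hom P Q 0 (tensor R (tensor S M A) N) (tensor S M N).
    \<forall>m \<in> carrier M. \<forall>a \<in> carrier R. \<forall>n \<in> carrier N.
      c (pure_tensor R (tensor S M A) N (pure_tensor S M A m a) n) = pure_tensor S M N m (lact N a n)"
proof -
  interpret M: gr_bimod P grP S grS M by fact
  interpret N: gr_bimod R gr Q grQ N by fact
  interpret MA: tensor_pair P grP S grS R gr M A
    by (rule tensor_pair_S[OF M restrict_left[OF regular]])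
  interpret MAN: tensor_pair P grP R gr Q grQ MA.T N
    by (rule tensor_pair_R[OF MA.gr_bimod_T N])
  interpret MN: tensor_pair P grP S grS Q grQ M N
    by (rule tensor_pair_S[OF M restrict_left[OF N]])
  define \<phi> where "\<phi> t n = tensor_lift MN.T (\<lambda>m a. MN.pt m (lact N a n)) t" for t n
  note lift = MA.tensor_lift_add[where L = MN.T and \<phi> = "\<lambda>m a. MN.pt m (lact N a n)" for n, OF MN.T_abelian]
  have hom: "add_hom MA.T MN.T (\<lambda>t. \<phi> t n)"
    and pure: "\<And>m a. m \<in> carrier M \<Longrightarrow> a \<in> carrier R \<Longrightarrow> \<phi> (MA.pt m a) n = MN.pt m (lact N a n)"
    if n: "n \<in> carrier N" for n
    using lift[of n] n S_sub
    by (auto simp: \<phi>_def MN.pure_closed N.lact_closed MN.pure_add_left MN.pure_add_right N.lact_add_left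
        MN.pure_balanced N.lact_assoc S_closed)
  note eqI = MA.add_hom_eqI[where L = MN.T]
  have closed: "\<phi> t n \<in> carrier MN.T" if "t \<in> carrier MA.T" "n \<in> carrier N" for t n
    by (rule add_hom_closed[OF hom[OF that(2)] that(1)])
  have add_right: "\<phi> t (n \<oplus>\<^bsub>N\<^esub> n') = \<phi> t n \<oplus>\<^bsub>MN.T\<^esub> \<phi> t n'"
    if t: "t \<in> carrier MA.T" and n: "n \<in> carrier N" "n' \<in> carrier N" for t n n'
    by (rule eqI[OF hom add_hom_plus[OF MN.T_abelian hom hom] _ t])
      (use n in \<open>simp_all add: pure N.lact_add_right MN.pure_add_right N.lact_closed\<close>)
  have balanced: "\<phi> (ract MA.T t a) n = \<phi> t (lact N a n)"
    if t: "t \<in> carrier MA.T" and n: "a \<in> carrier R" "n \<in> carrier N" for t a n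
    by (rule eqI[OF add_hom_comp[OF MA.ract_T_add_hom hom] hom _ t])
      (use n in \<open>simp_all add: pure N.lact_closed MA.ract_pure N.lact_assoc\<close>)
  have left: "\<phi> (lact MA.T p t) n = lact MN.T p (\<phi> t n)"
    if t: "t \<in> carrier MA.T" and n: "p \<in> carrier P" "n \<in> carrier N" for t p n
    by (rule eqI[OF add_hom_comp[OF MA.lact_T_add_hom hom] add_hom_comp[OF hom MN.lact_T_add_hom] _ t])
      (use n in \<open>simp_all add: pure N.lact_closed M.lact_closed MA.lact_pure MN.lact_pure\<close>)
  have right: "\<phi> t (ract N n q) = ract MN.T (\<phi> t n) q"
    if t: "t \<in> carrier MA.T" and n: "q \<in> carrier Q" "n \<in> carrier N" for t q n
    by (rule eqI[OF hom add_hom_comp[OF hom MN.ract_T_add_hom] _ t])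
      (use n in \<open>simp_all add: pure N.ract_closed N.lact_closed MN.ract_pure N.lact_ract\<close>)
  have homog: "\<phi> t n \<in> homog MN.T (i + j + 0)"
    if t: "t \<in> homog MA.T i" and n: "n \<in> homog N j" for t n i j
  proof (rule MA.homog_T_induct[OF hom[OF N.H_closed[OF n]] MN.homog_T_subgroup MN.T_abelian _ t])
    fix m a k l assume *: "m \<in> homog M k" "a \<in> homog A l" "k + l = i"
    then show "\<phi> (MA.pt m a) n \<in> homog MN.T (i + j + 0)"
      using MN.homog_pure[OF *(1) N.lact_homog[of a l n j]] n pure[OF N.H_closed[OF n] M.H_closed gr_closed]
      by (auto simp: algebra_simps)
  qed
  note lift2 = MAN.tensor_lift_hom[where \<phi> = \<phi> and d = 0, OF MN.gr_bimod_T closed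
      add_hom_add[OF hom] add_right balanced left right homog]
  have "tensor_lift MN.T \<phi> \<in> gr_hom P Q 0 MAN.T MN.T" by (rule lift2(1)) auto
  moreover have "tensor_lift MN.T \<phi> (MAN.pt t n) = \<phi> t n" if "t \<in> carrier MA.T" "n \<in> carrier N" for t n
    by (rule lift2(2)) (use that in auto)
  ultimately show ?thesis
    by (intro bexI[of _ "tensor_lift MN.T \<phi>"]) (auto simp: pure MA.pure_closed)
qed

lemma tensor_cancel_right:
  assumes M: "gr_bimod S grS Q grQ M" and N: "gr_bimod P grP R gr N"
  shows "\<exists>c \<in> gr_hom P Q 0 (tensor R N (tensor S A M)) (tensor S N M).
    \<forall>m \<in> carrier M. \<forall>a \<in> carrier R. \<forall>n \<in> carrier N.
      c (pure_tensor R N (tensor S A M) n (pure_tensor S A M a m)) = pure_tensor S N M (ract N n a) m"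
proof -
  interpret M: gr_bimod S grS Q grQ M by fact
  interpret N: gr_bimod P grP R gr N by fact
  interpret AM: tensor_pair R gr S grS Q grQ A M
    by (rule tensor_pair_S[OF restrict_right[OF regular] M])
  interpret NAM: tensor_pair P grP R gr Q grQ N AM.T
    by (rule tensor_pair_R[OF N AM.gr_bimod_T])
  interpret NM: tensor_pair P grP S grS Q grQ N M
    by (rule tensor_pair_S[OF restrict_right[OF N] M])
  define \<phi> where "\<phi> n t = tensor_lift NM.T (\<lambda>a m. NM.pt (ract N n a) m) t" for n t
  note lift = AM.tensor_lift_add[where L = NM.T and \<phi> = "\<lambda>a m. NM.pt (ract N n a) m" for n, OF NM.T_abelian]
  have hom: "add_hom AM.T NM.T (\<phi> n)"
    and pure: "\<And>m a. m \<in> carrier M \<Longrightarrow> a \<in> carrier R \<Longrightarrow> \<phi> n (AM.pt a m) = NM.pt (ract N n a) m"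
    if n: "n \<in> carrier N" for n
    using lift[of n] n S_sub
    by (auto simp: \<phi>_def[abs_def] NM.pure_closed N.ract_closed NM.pure_add_left NM.pure_add_right N.ract_add_right
        NM.pure_balanced N.ract_assoc S_closed)
  note eqI = AM.add_hom_eqI[where L = NM.T]
  have closed: "\<phi> n t \<in> carrier NM.T" if "n \<in> carrier N" "t \<in> carrier AM.T" for t n
    by (rule add_hom_closed[OF hom[OF that(1)] that(2)])
  have add_left: "\<phi> (n \<oplus>\<^bsub>N\<^esub> n') t = \<phi> n t \<oplus>\<^bsub>NM.T\<^esub> \<phi> n' t"
    if n: "n \<in> carrier N" "n' \<in> carrier N" and t: "t \<in> carrier AM.T" for t n n'
    by (rule eqI[OF hom add_hom_plus[OF NM.T_abelian hom hom] _ t])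
      (use n in \<open>simp_all add: pure N.ract_add_left NM.pure_add_left N.ract_closed\<close>)
  have balanced: "\<phi> (ract N n a) t = \<phi> n (lact AM.T a t)"
    if n: "n \<in> carrier N" "a \<in> carrier R" and t: "t \<in> carrier AM.T" for t a n
    by (rule eqI[OF hom add_hom_comp[OF AM.lact_T_add_hom hom] _ t])
      (use n in \<open>simp_all add: pure N.ract_closed AM.lact_pure N.ract_assoc\<close>)
  have left: "\<phi> (lact N p n) t = lact NM.T p (\<phi> n t)"
    if n: "p \<in> carrier P" "n \<in> carrier N" and t: "t \<in> carrier AM.T" for t p n
    by (rule eqI[OF hom add_hom_comp[OF hom NM.lact_T_add_hom] _ t])
      (use n in \<open>simp_all add: pure N.lact_closed N.ract_closed NM.lact_pure N.lact_ract\<close>)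
  have right: "\<phi> n (ract AM.T t q) = ract NM.T (\<phi> n t) q"
    if n: "q \<in> carrier Q" "n \<in> carrier N" and t: "t \<in> carrier AM.T" for t q n
    by (rule eqI[OF add_hom_comp[OF AM.ract_T_add_hom hom] add_hom_comp[OF hom NM.ract_T_add_hom] _ t])
      (use n in \<open>simp_all add: pure M.ract_closed N.ract_closed AM.ract_pure NM.ract_pure\<close>)
  have homog: "\<phi> n t \<in> homog NM.T (j + i + 0)"
    if n: "n \<in> homog N j" and t: "t \<in> homog AM.T i" for t n i j
  proof (rule AM.homog_T_induct[OF hom[OF N.H_closed[OF n]] NM.homog_T_subgroup NM.T_abelian _ t])
    fix m a k l assume *: "a \<in> homog A l" "m \<in> homog M k" "l + k = i"
    then show "\<phi> n (AM.pt a m) \<in> homog NM.T (j + i + 0)"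
      using NM.homog_pure[OF N.ract_homog[of a l n j] *(2)] n pure[OF N.H_closed[OF n] M.H_closed gr_closed]
      by (auto simp: algebra_simps)
  qed
  note lift2 = NAM.tensor_lift_hom[where \<phi> = \<phi> and d = 0, OF NM.gr_bimod_T closed
      add_left add_hom_add[OF hom] balanced left right homog]
  have "tensor_lift NM.T \<phi> \<in> gr_hom P Q 0 NAM.T NM.T" by (rule lift2(1)) auto
  moreover have "tensor_lift NM.T \<phi> (NAM.pt n t) = \<phi> n t" if "n \<in> carrier N" "t \<in> carrier AM.T" for t n
    by (rule lift2(2)) (use that in auto)
  ultimately show ?thesis
    by (intro bexI[of _ "tensor_lift NM.T \<phi>"]) (auto simp: pure AM.pure_closed)
qed

text \<open>The unit isomorphisms of the tensor product over \<open>R\<close>: first the actions, then their inverses, which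
  insert \<open>1\<close>.\<close>

lemma tensor_unit_left:
  assumes N: "gr_bimod R gr Q grQ N"
  shows "\<exists>c \<in> gr_hom R Q 0 (tensor R A N) N.
    \<forall>a \<in> carrier R. \<forall>n \<in> carrier N. c (pure_tensor R A N a n) = lact N a n"
proof -
  interpret N: gr_bimod R gr Q grQ N by fact
  interpret AN: tensor_pair R gr R gr Q grQ A N by (rule tensor_pair_R[OF regular N])
  have lift: "tensor_lift N (lact N) \<in> gr_hom R Q 0 AN.T N"
    by (rule AN.tensor_lift_hom[OF N])
      (use N.lact_homog in \<open>auto simp: N.lact_closed N.lact_add_left N.lact_add_right N.lact_assoc N.lact_ract\<close>)
  have pure: "tensor_lift N (lact N) (AN.pt a n) = lact N a n" if "a \<in> carrier R" "n \<in> carrier N" for a n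
    by (rule AN.tensor_lift_hom[OF N, where d = 0])
      (use N.lact_homog that in \<open>auto simp: N.lact_closed N.lact_add_left N.lact_add_right N.lact_assoc N.lact_ract\<close>)
  show ?thesis using lift pure by blast
qed

lemma tensor_unit_right:
  assumes N: "gr_bimod P grP R gr N"
  shows "\<exists>c \<in> gr_hom P R 0 (tensor R N A) N.
    \<forall>n \<in> carrier N. \<forall>a \<in> carrier R. c (pure_tensor R N A n a) = ract N n a"
proof -
  interpret N: gr_bimod P grP R gr N by fact
  interpret NA: tensor_pair P grP R gr R gr N A by (rule tensor_pair_R[OF N regular])
  have lift: "tensor_lift N (ract N) \<in> gr_hom P R 0 NA.T N"
    by (rule NA.tensor_lift_hom[OF N])
      (use N.ract_homog in \<open>auto simp: N.ract_closed N.ract_add_left N.ract_add_right N.ract_assoc N.lact_ract\<close>)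
  have pure: "tensor_lift N (ract N) (NA.pt n a) = ract N n a" if "a \<in> carrier R" "n \<in> carrier N" for a n
    by (rule NA.tensor_lift_hom[OF N, where d = 0])
      (use N.ract_homog that in \<open>auto simp: N.ract_closed N.ract_add_left N.ract_add_right N.ract_assoc N.lact_ract\<close>)
  show ?thesis using lift pure by blast
qed

lemma insert_one_right:
  assumes N: "gr_bimod P grP R gr N"
  shows "(\<lambda>n. pure_tensor R N A n \<one>\<^bsub>R\<^esub>) \<in> gr_hom P R 0 N (tensor R N A)"
proof -
  interpret N: gr_bimod P grP R gr N by fact
  interpret NA: tensor_pair P grP R gr R gr N A by (rule tensor_pair_R[OF N regular])
  show ?thesis
    using NA.homog_pure[of _ _ "\<one>\<^bsub>R\<^esub>" 0] one_homog
    by (intro gr_homI NA.pure_add_hom_left)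
      (simp_all add: NA.lact_pure NA.ract_pure, use NA.pure_balanced[of _ _ "\<one>\<^bsub>R\<^esub>"] in simp)
qed

lemma insert_one_left:
  assumes N: "gr_bimod R gr Q grQ N"
  shows "pure_tensor R A N \<one>\<^bsub>R\<^esub> \<in> gr_hom R Q 0 N (tensor R A N)"
proof -
  interpret N: gr_bimod R gr Q grQ N by fact
  interpret AN: tensor_pair R gr R gr Q grQ A N by (rule tensor_pair_R[OF regular N])
  show ?thesis
    using AN.homog_pure[of "\<one>\<^bsub>R\<^esub>" 0] one_homog
    by (intro gr_homI AN.pure_add_hom_right)
      (simp_all add: AN.lact_pure AN.ract_pure, use AN.pure_balanced[of "\<one>\<^bsub>R\<^esub>"] in simp)
qed

end

section \<open>Complexes of graded bimodules\<close>

locale gr_complex =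
  fixes R :: "'a ring" and gr :: "int \<Rightarrow> 'a set" and K :: "('a, 'm) cochains"
  assumes bimod: "gr_bimod R gr R gr (obj K n)"
    and diff: "diff K n \<in> gr_hom R R 0 (obj K n) (obj K (n + 1))"
    and diff_diff: "x \<in> carrier (obj K n) \<Longrightarrow> diff K (n + 1) (diff K n x) = \<zero>\<^bsub>obj K (n + 2)\<^esub>"
begin

lemma is_cochain_complex: "cochain_complex R gr K"
  by (simp add: cochain_complex_def gr_bimod_imp_graded_bimodule bimod bimodule_hom_eq_gr_hom diff diff_diff)

end

subsection \<open>Contraction onto a bimodule in degree zero\<close>

text \<open>The homotopy equivalence is \<open>f x = p (x + d (h0 x))\<close> and \<open>g a = i a + h1 (d (i a))\<close> in degree \<open>0\<close>;
  the correction terms turn \<open>p\<close> and \<open>i\<close> into cochain maps. Then \<open>f g = 1\<close>, and the last hypothesis,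
  in which \<open>y\<close> stands for \<open>x + d (h0 x)\<close>, is the degree \<open>0\<close> part of \<open>g f - 1 = d h + h d\<close>.\<close>

lemma (in gr_complex) contract_to_degree_zero:
  fixes A :: "('a, 'b) bimodule"
  assumes A: "gr_bimod R gr R gr A"
    and trivial: "\<And>n. n \<notin> {-1, 0, 1} \<Longrightarrow> carrier (obj K n) = {\<zero>\<^bsub>obj K n\<^esub>}"
    and h0: "h0 \<in> gr_hom R R 0 (obj K 0) (obj K (-1))"
    and h1: "h1 \<in> gr_hom R R 0 (obj K 1) (obj K 0)"
    and p: "p \<in> gr_hom R R 0 (obj K 0) A" and i: "i \<in> gr_hom R R 0 A (obj K 0)"
    and h0_d: "\<And>x. x \<in> carrier (obj K (-1)) \<Longrightarrow> h0 (diff K (-1) x) = \<ominus>\<^bsub>obj K (-1)\<^esub> x"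
    and d_h1: "\<And>x. x \<in> carrier (obj K 1) \<Longrightarrow> diff K 0 (h1 x) = \<ominus>\<^bsub>obj K 1\<^esub> x"
    and h0_h1: "\<And>x. x \<in> carrier (obj K 1) \<Longrightarrow> h0 (h1 x) = \<zero>\<^bsub>obj K (-1)\<^esub>"
    and h0_i: "\<And>a. a \<in> carrier A \<Longrightarrow> h0 (i a) = \<zero>\<^bsub>obj K (-1)\<^esub>"
    and p_h1: "\<And>x. x \<in> carrier (obj K 1) \<Longrightarrow> p (h1 x) = \<zero>\<^bsub>A\<^esub>"
    and p_i: "\<And>a. a \<in> carrier A \<Longrightarrow> p (i a) = a"
    and i_p: "\<And>x y. \<lbrakk>x \<in> carrier (obj K 0); y = x \<oplus>\<^bsub>obj K 0\<^esub> diff K (-1) (h0 x)\<rbrakk> \<Longrightarrow>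
      i (p y) \<oplus>\<^bsub>obj K 0\<^esub> h1 (diff K 0 (i (p y))) = y \<oplus>\<^bsub>obj K 0\<^esub> h1 (diff K 0 x)"
  shows "homotopy_equivalent_complexes R gr K (concentrated A)"
proof -
  interpret A: gr_bimod R gr R gr A by fact
  interpret K: gr_bimod R gr R gr "obj K n" for n by (rule bimod)
  let ?D = "concentrated A"
  have d1: "diff K (-1) \<in> gr_hom R R 0 (obj K (-1)) (obj K 0)" using diff[of "-1"] by simp
  have d0: "diff K 0 \<in> gr_hom R R 0 (obj K 0) (obj K 1)" using diff[of 0] by simp
  define f0 where "f0 x = p (x \<oplus>\<^bsub>obj K 0\<^esub> diff K (-1) (h0 x))" for x
  define g0 where "g0 a = i a \<oplus>\<^bsub>obj K 0\<^esub> h1 (diff K 0 (i a))" for a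
  define f where "f n = (if n = 0 then f0 else (\<lambda>x. \<zero>\<^bsub>A\<^esub>))" for n :: int
  define g where "g n = (if n = 0 then g0 else (\<lambda>x. \<zero>\<^bsub>obj K n\<^esub>))" for n :: int
  define h where "h n = (if n = 0 then h0 else if n = 1 then h1 else (\<lambda>x. \<zero>\<^bsub>obj K (n - 1)\<^esub>))" for n :: int
  note cl = gr_hom_closed[OF h0] gr_hom_closed[OF h1] gr_hom_closed[OF p] gr_hom_closed[OF i]
    gr_hom_closed[OF d1] gr_hom_closed[OF d0]
  have f0: "f0 \<in> gr_hom R R 0 (obj K 0) A"
    using gr_hom_comp[OF gr_hom_plus[OF bimod gr_hom_id gr_hom_comp[OF h0 d1, simplified]] p]
    by (simp add: f0_def[abs_def])
  have g0: "g0 \<in> gr_hom R R 0 A (obj K 0)"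
    using gr_hom_plus[OF bimod i gr_hom_comp[OF gr_hom_comp[OF i d0] h1, simplified]]
    by (simp add: g0_def[abs_def])
  have obj_D: "gr_bimod R gr R gr (obj ?D n)" for n
    by (simp add: concentrated_def A gr_bimod_zero_part)
  have D_zero: "\<zero>\<^bsub>obj ?D n\<^esub> = \<zero>\<^bsub>A\<^esub>" for n by (simp add: concentrated_def)
  have D_diff: "diff ?D n = (\<lambda>x. \<zero>\<^bsub>A\<^esub>)" for n by (simp add: concentrated_def fun_eq_iff)
  have D_trivial: "carrier (obj ?D n) = {\<zero>\<^bsub>A\<^esub>}" if "n \<noteq> 0" for n using that by (simp add: concentrated_def)
  have D_0: "obj ?D 0 = A" by (simp add: concentrated_def)
  interpret D: gr_complex R gr ?D
  proof (rule gr_complex.intro)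
    show "diff ?D n \<in> gr_hom R R 0 (obj ?D n) (obj ?D (n + 1))" for n
      using gr_hom_zero_map[OF obj_D, of "n + 1"] by (simp add: D_diff D_zero)
  qed (simp_all add: obj_D D_diff D_zero)
  interpret DD: gr_bimod R gr R gr "obj ?D n" for n by (rule obj_D)
  have f: "f n \<in> gr_hom R R 0 (obj K n) (obj ?D n)" for n
    using f0 gr_hom_zero_map[OF obj_D, of n] by (auto simp: f_def D_0 D_zero)
  have g: "g n \<in> gr_hom R R 0 (obj ?D n) (obj K n)" for n
    using g0 gr_hom_zero_map[OF bimod, of n] by (auto simp: g_def D_0)
  have h: "h n \<in> gr_hom R R 0 (obj K n) (obj K (n - 1))" for n
    using h0 h1 gr_hom_zero_map[OF bimod, of "n - 1"] by (auto simp: h_def)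
  note zeros = add_hom_zero[OF K.is_abelian_group K.is_abelian_group gr_hom_add_hom]
  have dz: "diff K n \<zero>\<^bsub>obj K n\<^esub> = \<zero>\<^bsub>obj K (n + 1)\<^esub>" for n using zeros[OF diff] .
  have hz: "h n \<zero>\<^bsub>obj K n\<^esub> = \<zero>\<^bsub>obj K (n - 1)\<^esub>" for n using zeros[OF h] .
  have pz: "p \<zero>\<^bsub>obj K 0\<^esub> = \<zero>\<^bsub>A\<^esub>"
    by (rule add_hom_zero[OF K.is_abelian_group A.is_abelian_group gr_hom_add_hom[OF p]])
  have f0_d: "f0 (diff K (-1) x) = \<zero>\<^bsub>A\<^esub>" if x: "x \<in> carrier (obj K (-1))" for x
  proof -
    have "diff K (-1) (\<ominus>\<^bsub>obj K (-1)\<^esub> x) = \<ominus>\<^bsub>obj K 0\<^esub> diff K (-1) x"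
      using add_hom_minus[OF K.is_abelian_group K.is_abelian_group gr_hom_add_hom[OF d1] x] .
    then show ?thesis using x cl by (simp add: f0_def h0_d K.r_neg pz)
  qed
  have d_g0: "diff K 0 (g0 a) = \<zero>\<^bsub>obj K 1\<^esub>" if a: "a \<in> carrier A" for a
    using a cl by (simp add: g0_def gr_hom_add[OF d0] d_h1 K.r_neg)
  have f0_g0: "f0 (g0 a) = a" if a: "a \<in> carrier A" for a
  proof -
    have "h0 (g0 a) = \<zero>\<^bsub>obj K (-1)\<^esub>"
      using a cl by (simp add: g0_def gr_hom_add[OF h0] h0_i h0_h1)
    then have "f0 (g0 a) = p (g0 a)"
      using a gr_hom_closed[OF g0 a] dz[of "-1"] by (simp add: f0_def)
    then show ?thesis using a cl by (simp add: g0_def gr_hom_add[OF p] p_h1 p_i)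
  qed
  have g0_f0: "g0 (f0 x) \<ominus>\<^bsub>obj K 0\<^esub> x = diff K (-1) (h0 x) \<oplus>\<^bsub>obj K 0\<^esub> h1 (diff K 0 x)"
    if x: "x \<in> carrier (obj K 0)" for x
  proof -
    have "g0 (f0 x) = x \<oplus>\<^bsub>obj K 0\<^esub> diff K (-1) (h0 x) \<oplus>\<^bsub>obj K 0\<^esub> h1 (diff K 0 x)"
      using i_p[OF x refl] by (simp add: g0_def f0_def)
    then show ?thesis using x cl by (simp add: K.minus_eq K.a_ac K.r_neg1 K.r_neg2)
  qed
  have "cochain_map R K ?D f"
    unfolding cochain_map_def bimodule_hom_eq_gr_hom
  proof (intro conjI allI ballI f)
    fix n x assume x: "x \<in> carrier (obj K n)"
    show "f (n + 1) (diff K n x) = diff ?D n (f n x)"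
    proof (cases "n = -1")
      case True
      then show ?thesis using f0_d x by (simp add: f_def D_diff)
    next
      case False
      then have "n + 1 \<noteq> 0" by simp
      then show ?thesis by (simp add: f_def D_diff)
    qed
  qed
  moreover have "cochain_map R ?D K g"
    unfolding cochain_map_def bimodule_hom_eq_gr_hom
  proof (intro conjI allI ballI g)
    fix n x assume x: "x \<in> carrier (obj ?D n)"
    have gz: "g m \<zero>\<^bsub>A\<^esub> = \<zero>\<^bsub>obj K m\<^esub>" for m
      using add_hom_zero[OF DD.is_abelian_group K.is_abelian_group gr_hom_add_hom[OF g[of m]]]
      by (simp add: D_zero)
    show "g (n + 1) (diff ?D n x) = diff K n (g n x)"
    proof (cases "n = 0")
      case True
      then show ?thesis using x d_g0 gz[of 1] by (simp add: D_diff D_0 g_def)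
    next
      case False
      then show ?thesis using x gz dz by (simp add: D_trivial D_diff)
    qed
  qed
  moreover have "cochain_homotopic R K K (\<lambda>n x. g n (f n x)) (\<lambda>n x. x)"
    unfolding cochain_homotopic_def bimodule_hom_eq_gr_hom
  proof (intro exI[of _ h] conjI allI ballI h)
    fix n x assume x: "x \<in> carrier (obj K n)"
    have sub: "\<zero>\<^bsub>obj K n\<^esub> \<ominus>\<^bsub>obj K n\<^esub> x = \<ominus>\<^bsub>obj K n\<^esub> x" using x by (simp add: K.minus_eq)
    consider "n = 0" | "n = -1" | "n = 1" | "n \<notin> {-1, 0, 1}" by blast
    then show "g n (f n x) \<ominus>\<^bsub>obj K n\<^esub> x = diff K (n - 1) (h n x) \<oplus>\<^bsub>obj K n\<^esub> h (n + 1) (diff K n x)"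
    proof cases
      case 1
      then show ?thesis using g0_f0 x by (simp add: f_def g_def h_def)
    next
      case 2
      have "h 0 (diff K (-1) x) = \<ominus>\<^bsub>obj K (-1)\<^esub> x" using 2 x h0_d by (simp add: h_def)
      then show ?thesis using 2 x sub dz[of "-2"] by (simp add: g_def h_def)
    next
      case 3
      then show ?thesis using x d_h1 sub by (simp add: g_def h_def)
    next
      case 4
      then have x0: "x = \<zero>\<^bsub>obj K n\<^esub>" using x trivial by blast
      have "g n (f n x) = \<zero>\<^bsub>obj K n\<^esub>" using 4 by (simp add: g_def)
      moreover have "diff K (n - 1) (h n x) = \<zero>\<^bsub>obj K n\<^esub>" using dz[of "n - 1"] hz x0 by simp
      moreover have "h (n + 1) (diff K n x) = \<zero>\<^bsub>obj K n\<^esub>" using hz[of "n + 1"] dz x0 by simp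
      ultimately show ?thesis using sub x0 by (simp add: K.a_inv_zero)
    qed
  qed
  moreover have "cochain_homotopic R ?D ?D (\<lambda>n x. f n (g n x)) (\<lambda>n x. x)"
    unfolding cochain_homotopic_def bimodule_hom_eq_gr_hom
  proof (intro exI[of _ "\<lambda>n x. \<zero>\<^bsub>A\<^esub>"] conjI allI ballI)
    show "(\<lambda>x. \<zero>\<^bsub>A\<^esub>) \<in> gr_hom R R 0 (obj ?D n) (obj ?D (n - 1))" for n
      using gr_hom_zero_map[OF obj_D, of "n - 1"] by (simp add: D_zero)
    fix n x assume x: "x \<in> carrier (obj ?D n)"
    have "f n (g n x) = x" using x f0_g0 by (cases "n = 0") (simp_all add: f_def g_def D_0 D_trivial)
    then show "f n (g n x) \<ominus>\<^bsub>obj ?D n\<^esub> x = diff ?D (n - 1) \<zero>\<^bsub>A\<^esub> \<oplus>\<^bsub>obj ?D n\<^esub> \<zero>\<^bsub>A\<^esub>"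
      using x DD.l_zero[OF DD.zero_closed, of n] by (simp add: DD.minus_eq DD.r_neg D_diff D_zero)
  qed
  ultimately show ?thesis
    unfolding homotopy_equivalent_complexes_def
    using is_cochain_complex D.is_cochain_complex by blast
qed

text \<open>Gaussian elimination. The complex has the form \<open>L \<rightarrow> U \<oplus> A \<rightarrow> W\<close>, the maps \<open>EL\<close>, \<open>EU\<close>, \<open>EA\<close>, \<open>EW\<close>
  and \<open>PU\<close>, \<open>PA\<close>, \<open>PW\<close> being the embeddings and projections. The hypotheses on \<open>\<kappa>\<close> and \<open>\<sigma>\<close> make
  \<open>U\<close> the direct sum of \<open>a(L)\<close> and \<open>\<sigma>(W)\<close>, on which \<open>\<kappa>\<close> and \<open>c\<close> invert \<open>- a\<close> and \<open>\<sigma>\<close>: indeed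
  \<open>u = - a (\<kappa> u) + (u + a (\<kappa> u))\<close>, and the second term lies in \<open>\<sigma>(W)\<close>. So \<open>L\<close> and \<open>W\<close> cancel against
  \<open>U\<close>. The composite \<open>c a\<close> need not vanish; it is \<open>- e b\<close> because \<open>d d = 0\<close>.\<close>

lemma (in gr_complex) eliminate_summand:
  fixes A :: "('a, 'b) bimodule" and L :: "('a, 'l) bimodule" and U :: "('a, 'u) bimodule"
    and W :: "('a, 'w) bimodule"
  assumes A: "gr_bimod R gr R gr A" and L: "gr_bimod R gr R gr L"
    and U: "gr_bimod R gr R gr U" and W: "gr_bimod R gr R gr W"
    and trivial: "\<And>n. n \<notin> {-1, 0, 1} \<Longrightarrow> carrier (obj K n) = {\<zero>\<^bsub>obj K n\<^esub>}"
    and EL: "EL \<in> gr_hom R R 0 L (obj K (-1))"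
    and EL_surj: "\<And>x. x \<in> carrier (obj K (-1)) \<Longrightarrow> \<exists>l \<in> carrier L. x = EL l"
    and EU: "EU \<in> gr_hom R R 0 U (obj K 0)" and PU: "PU \<in> gr_hom R R 0 (obj K 0) U"
    and EA: "EA \<in> gr_hom R R 0 A (obj K 0)" and PA: "PA \<in> gr_hom R R 0 (obj K 0) A"
    and EW: "EW \<in> gr_hom R R 0 W (obj K 1)" and PW: "PW \<in> gr_hom R R 0 (obj K 1) W"
    and PU_EU: "\<And>u. u \<in> carrier U \<Longrightarrow> PU (EU u) = u" and PA_EA: "\<And>a. a \<in> carrier A \<Longrightarrow> PA (EA a) = a"
    and PU_EA: "\<And>a. a \<in> carrier A \<Longrightarrow> PU (EA a) = \<zero>\<^bsub>U\<^esub>" and PA_EU: "\<And>u. u \<in> carrier U \<Longrightarrow> PA (EU u) = \<zero>\<^bsub>A\<^esub>"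
    and split: "\<And>x. x \<in> carrier (obj K 0) \<Longrightarrow> x = EU (PU x) \<oplus>\<^bsub>obj K 0\<^esub> EA (PA x)"
    and PW_EW: "\<And>w. w \<in> carrier W \<Longrightarrow> PW (EW w) = w" and EW_PW: "\<And>x. x \<in> carrier (obj K 1) \<Longrightarrow> EW (PW x) = x"
    and a: "a \<in> gr_hom R R 0 L U" and b: "b \<in> gr_hom R R 0 L A"
    and c: "c \<in> gr_hom R R 0 U W" and e: "e \<in> gr_hom R R 0 A W"
    and d_EL: "\<And>l. l \<in> carrier L \<Longrightarrow> diff K (-1) (EL l) = EU (a l) \<oplus>\<^bsub>obj K 0\<^esub> EA (b l)"
    and d_EU: "\<And>u. u \<in> carrier U \<Longrightarrow> diff K 0 (EU u) = EW (c u)"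
    and d_EA: "\<And>v. v \<in> carrier A \<Longrightarrow> diff K 0 (EA v) = EW (e v)"
    and \<kappa>: "\<kappa> \<in> gr_hom R R 0 U L" and \<sigma>: "\<sigma> \<in> gr_hom R R 0 W U"
    and \<kappa>_a: "\<And>l. l \<in> carrier L \<Longrightarrow> \<kappa> (a l) = \<ominus>\<^bsub>L\<^esub> l"
    and c_\<sigma>: "\<And>w. w \<in> carrier W \<Longrightarrow> c (\<sigma> w) = w"
    and \<kappa>_\<sigma>: "\<And>w. w \<in> carrier W \<Longrightarrow> \<kappa> (\<sigma> w) = \<zero>\<^bsub>L\<^esub>"
    and exact: "\<And>u y. \<lbrakk>u \<in> carrier U; y = u \<oplus>\<^bsub>U\<^esub> a (\<kappa> u)\<rbrakk> \<Longrightarrow> \<sigma> (c y) = y"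
  shows "homotopy_equivalent_complexes R gr K (concentrated A)"
proof -
  interpret A: gr_bimod R gr R gr A by fact
  interpret L: gr_bimod R gr R gr L by fact
  interpret U: gr_bimod R gr R gr U by fact
  interpret W: gr_bimod R gr R gr W by fact
  interpret K: gr_bimod R gr R gr "obj K n" for n by (rule bimod)
  have d1: "diff K (-1) \<in> gr_hom R R 0 (obj K (-1)) (obj K 0)" using diff[of "-1"] by simp
  have d0: "diff K 0 \<in> gr_hom R R 0 (obj K 0) (obj K 1)" using diff[of 0] by simp
  note cl [simp] = gr_hom_closed[OF EL] gr_hom_closed[OF EU] gr_hom_closed[OF PU] gr_hom_closed[OF EA]
    gr_hom_closed[OF PA] gr_hom_closed[OF EW] gr_hom_closed[OF PW] gr_hom_closed[OF a] gr_hom_closed[OF b]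
    gr_hom_closed[OF c] gr_hom_closed[OF e] gr_hom_closed[OF \<kappa>] gr_hom_closed[OF \<sigma>]
    gr_hom_closed[OF d1] gr_hom_closed[OF d0]
  note add [simp] = gr_hom_add[OF EL] gr_hom_add[OF EU] gr_hom_add[OF PU] gr_hom_add[OF EA]
    gr_hom_add[OF PA] gr_hom_add[OF EW] gr_hom_add[OF PW] gr_hom_add[OF a] gr_hom_add[OF b]
    gr_hom_add[OF c] gr_hom_add[OF e] gr_hom_add[OF \<kappa>] gr_hom_add[OF \<sigma>]
    gr_hom_add[OF d1] gr_hom_add[OF d0]
  note am [simp] = add_hom_minus[OF U.is_abelian_group K.is_abelian_group gr_hom_add_hom[OF EU]]
    add_hom_minus[OF W.is_abelian_group K.is_abelian_group gr_hom_add_hom[OF EW]]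
    add_hom_minus[OF K.is_abelian_group A.is_abelian_group gr_hom_add_hom[OF PA]]
    add_hom_minus[OF K.is_abelian_group U.is_abelian_group gr_hom_add_hom[OF PU]]
    add_hom_minus[OF K.is_abelian_group K.is_abelian_group gr_hom_add_hom[OF d0]]
    add_hom_minus[OF L.is_abelian_group K.is_abelian_group gr_hom_add_hom[OF EL]]
    add_hom_minus[OF U.is_abelian_group L.is_abelian_group gr_hom_add_hom[OF \<kappa>]]
    add_hom_minus[OF W.is_abelian_group U.is_abelian_group gr_hom_add_hom[OF \<sigma>]]
  note az [simp] = add_hom_zero[OF U.is_abelian_group K.is_abelian_group gr_hom_add_hom[OF EU]]
    add_hom_zero[OF A.is_abelian_group K.is_abelian_group gr_hom_add_hom[OF EA]]
    add_hom_zero[OF L.is_abelian_group K.is_abelian_group gr_hom_add_hom[OF EL]]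
    add_hom_zero[OF U.is_abelian_group L.is_abelian_group gr_hom_add_hom[OF \<kappa>]]
    A.a_inv_zero K.a_inv_zero L.a_inv_zero U.a_inv_zero
  note [simp] = PU_EU PA_EA PU_EA PA_EU PW_EW EW_PW d_EL d_EU d_EA \<kappa>_a c_\<sigma> \<kappa>_\<sigma>
  define h0 where "h0 x = EL (\<kappa> (PU x))" for x
  define h1 where "h1 x = \<ominus>\<^bsub>obj K 0\<^esub> EU (\<sigma> (PW x))" for x
  have h0: "h0 \<in> gr_hom R R 0 (obj K 0) (obj K (-1))"
    using gr_hom_comp[OF gr_hom_comp[OF PU \<kappa>] EL] by (simp add: h0_def[abs_def])
  have h1: "h1 \<in> gr_hom R R 0 (obj K 1) (obj K 0)"
    using gr_hom_neg[OF bimod gr_hom_comp[OF gr_hom_comp[OF PW \<sigma>] EU]] by (simp add: h1_def[abs_def])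
  have eb: "e (b l) = \<ominus>\<^bsub>W\<^esub> c (a l)" if l: "l \<in> carrier L" for l
  proof -
    have "EW (e (b l) \<oplus>\<^bsub>W\<^esub> c (a l)) = \<zero>\<^bsub>obj K 1\<^esub>"
      using diff_diff[of "EL l" "-1"] l by (simp add: K.a_comm)
    then have "PW (EW (e (b l) \<oplus>\<^bsub>W\<^esub> c (a l))) = \<zero>\<^bsub>W\<^esub>"
      using add_hom_zero[OF K.is_abelian_group W.is_abelian_group gr_hom_add_hom[OF PW]] by simp
    then show ?thesis using l W.minus_equality[of "e (b l)" "c (a l)"] by simp
  qed
  show ?thesis
  proof (rule contract_to_degree_zero[OF A trivial h0 h1 PA EA])
    fix x assume "x \<in> carrier (obj K (-1))"
    then obtain l where "l \<in> carrier L" "x = EL l" using EL_surj by blast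
    then show "h0 (diff K (-1) x) = \<ominus>\<^bsub>obj K (-1)\<^esub> x" by (simp add: h0_def)
  next
    fix x y assume x: "x \<in> carrier (obj K 0)" and y: "y = x \<oplus>\<^bsub>obj K 0\<^esub> diff K (-1) (h0 x)"
    define u v where "u = PU x" and "v = PA x"
    have uv: "u \<in> carrier U" "v \<in> carrier A" using x by (simp_all add: u_def v_def)
    have xe: "x = EU u \<oplus>\<^bsub>obj K 0\<^esub> EA v" using split[OF x] by (simp add: u_def v_def)
    define u' v' where "u' = u \<oplus>\<^bsub>U\<^esub> a (\<kappa> u)" and "v' = v \<oplus>\<^bsub>A\<^esub> b (\<kappa> u)"
    have uv': "u' \<in> carrier U" "v' \<in> carrier A" using uv by (simp_all add: u'_def v'_def)
    have ye: "y = EU u' \<oplus>\<^bsub>obj K 0\<^esub> EA v'"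
      using uv unfolding y h0_def xe by (simp add: u'_def v'_def K.a_ac)
    have cu: "c u' = c u \<oplus>\<^bsub>W\<^esub> c (a (\<kappa> u))" using uv by (simp add: u'_def)
    have su: "\<sigma> (c u') = u'" by (rule exact[OF uv(1) u'_def])
    have eq: "e v' = e v \<ominus>\<^bsub>W\<^esub> c (a (\<kappa> u))" using uv by (simp add: v'_def eb W.minus_eq)
    have "c u \<oplus>\<^bsub>W\<^esub> e v = c u' \<oplus>\<^bsub>W\<^esub> e v'"
      using uv unfolding cu eq by (simp add: W.minus_eq W.a_ac W.r_neg W.r_neg1 W.r_neg2)
    then have "\<sigma> (c u \<oplus>\<^bsub>W\<^esub> e v) = u' \<oplus>\<^bsub>U\<^esub> \<sigma> (e v')" using uv' su by simp
    moreover have "PW (diff K 0 x) = c u \<oplus>\<^bsub>W\<^esub> e v" using uv by (simp add: xe)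
    ultimately have "h1 (diff K 0 x) = \<ominus>\<^bsub>obj K 0\<^esub> EU u' \<ominus>\<^bsub>obj K 0\<^esub> EU (\<sigma> (e v'))"
      using uv' by (simp add: h1_def K.minus_add K.minus_eq)
    moreover have "PA y = v'" using uv' by (simp add: ye)
    moreover have "h1 (diff K 0 (EA v')) = \<ominus>\<^bsub>obj K 0\<^esub> EU (\<sigma> (e v'))" using uv' by (simp add: h1_def)
    ultimately show "EA (PA y) \<oplus>\<^bsub>obj K 0\<^esub> h1 (diff K 0 (EA (PA y))) = y \<oplus>\<^bsub>obj K 0\<^esub> h1 (diff K 0 x)"
      using uv' by (simp add: ye K.minus_eq K.a_ac K.r_neg1 K.r_neg2)
  qed (simp_all add: h0_def h1_def)
qed

subsection \<open>The tensor product of two complexes\<close>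

text \<open>The entries of the product are \<open>C\<^sup>i \<otimes> D\<^sup>j\<close>, and the differential is put together from two
  commuting partial differentials \<open>d_left\<close> and \<open>d_right\<close>.\<close>

locale complex_pair = C: gr_complex R gr C + D: gr_complex R gr D
  for R :: "'a ring" and gr and C :: "('a, 'm) cochains" and D :: "('a, 'n) cochains" +
  assumes R_generated: "add_generates R (\<Union>i. gr i)"
begin

abbreviation K where "K \<equiv> tensor_complex R C D"

definition term_at where "term_at i j = tensor R (obj C i) (obj D j)"

definition d_left where "d_left i j = tensor_map R (obj C (i + 1)) (obj D j) (diff C i) id"

definition d_right where "d_right i j = tensor_map R (obj C i) (obj D (j + 1)) id (diff D j)"

definition sgn where "sgn i M y = (if even i then y else \<ominus>\<^bsub>M\<^esub> y)"
  for i :: int and M :: "('x, 'y) ring_scheme"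

lemma pair: "tensor_pair R gr R gr R gr (obj C i) (obj D j)"
  by (simp add: tensor_pair_def tensor_pair_axioms_def C.bimod D.bimod R_generated)

lemma term_bimod: "gr_bimod R gr R gr (term_at i j)"
  unfolding term_at_def by (rule tensor_pair.gr_bimod_T[OF pair])

lemma obj_K: "obj K n = direct_sum (\<lambda>i. term_at i (n - i))"
  by (simp add: tensor_complex_def term_at_def)

lemma bimod_K: "gr_bimod R gr R gr (obj K n)"
  unfolding obj_K by (rule gr_bimod_direct_sum[OF term_bimod])

lemma d_left_hom: "d_left i j \<in> gr_hom R R 0 (term_at i j) (term_at (i + 1) j)"
  and d_left_pure: "m \<in> carrier (obj C i) \<Longrightarrow> n \<in> carrier (obj D j) \<Longrightarrow>
    d_left i j (pure_tensor R (obj C i) (obj D j) m n) = pure_tensor R (obj C (i + 1)) (obj D j) (diff C i m) n"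
  using tensor_pair.tensor_map_hom[OF pair[of i j] pair[of "i + 1" j] C.diff gr_hom_id]
  by (simp_all add: d_left_def term_at_def id_def)

lemma d_right_hom: "d_right i j \<in> gr_hom R R 0 (term_at i j) (term_at i (j + 1))"
  and d_right_pure: "m \<in> carrier (obj C i) \<Longrightarrow> n \<in> carrier (obj D j) \<Longrightarrow>
    d_right i j (pure_tensor R (obj C i) (obj D j) m n) = pure_tensor R (obj C i) (obj D (j + 1)) m (diff D j n)"
  using tensor_pair.tensor_map_hom[OF pair[of i j] pair[of i "j + 1"] gr_hom_id D.diff]
  by (simp_all add: d_right_def term_at_def id_def)

lemma d_left_left: "t \<in> carrier (term_at i j) \<Longrightarrow> d_left (i + 1) j (d_left i j t) = \<zero>\<^bsub>term_at (i + 2) j\<^esub>"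
proof -
  assume t: "t \<in> carrier (term_at i j)"
  interpret T: tensor_pair R gr R gr R gr "obj C i" "obj D j" by (rule pair)
  interpret T2: tensor_pair R gr R gr R gr "obj C (i + 2)" "obj D j" by (rule pair)
  have hom: "d_left (i + 1) j \<in> gr_hom R R 0 (term_at (i + 1) j) (term_at (i + 2) j)"
    using d_left_hom[of "i + 1" j] by (simp only: add.assoc one_add_one)
  show ?thesis
    by (rule T.gr_hom_eqI[OF gr_hom_comp[OF d_left_hom hom, unfolded term_at_def[of i]]
          gr_hom_zero_map[OF term_bimod] _ t[unfolded term_at_def]])
      (simp only: d_left_pure gr_hom_closed[OF C.diff] C.diff_diff T2.pure_zero_left term_at_def
        add.assoc one_add_one)
qed

lemma d_right_right: "t \<in> carrier (term_at i j) \<Longrightarrow> d_right i (j + 1) (d_right i j t) = \<zero>\<^bsub>term_at i (j + 2)\<^esub>"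
proof -
  assume t: "t \<in> carrier (term_at i j)"
  interpret T: tensor_pair R gr R gr R gr "obj C i" "obj D j" by (rule pair)
  interpret T2: tensor_pair R gr R gr R gr "obj C i" "obj D (j + 2)" by (rule pair)
  have hom: "d_right i (j + 1) \<in> gr_hom R R 0 (term_at i (j + 1)) (term_at i (j + 2))"
    using d_right_hom[of i "j + 1"] by (simp only: add.assoc one_add_one)
  show ?thesis
    by (rule T.gr_hom_eqI[OF gr_hom_comp[OF d_right_hom hom, unfolded term_at_def[of i j]]
          gr_hom_zero_map[OF term_bimod] _ t[unfolded term_at_def]])
      (simp only: d_right_pure gr_hom_closed[OF D.diff] D.diff_diff T2.pure_zero_right term_at_def
        add.assoc one_add_one)
qed

lemma d_left_right: "t \<in> carrier (term_at i j) \<Longrightarrow> d_right (i + 1) j (d_left i j t) = d_left i (j + 1) (d_right i j t)"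
proof -
  assume t: "t \<in> carrier (term_at i j)"
  interpret T: tensor_pair R gr R gr R gr "obj C i" "obj D j" by (rule pair)
  show ?thesis
    by (rule T.gr_hom_eqI[OF gr_hom_comp[OF d_left_hom d_right_hom, of i j, unfolded term_at_def[of i j]]
          gr_hom_comp[OF d_right_hom d_left_hom, of i j, unfolded term_at_def[of i j]] _ t[unfolded term_at_def]])
      (simp add: d_left_pure d_right_pure gr_hom_closed[OF D.diff] gr_hom_closed[OF C.diff])
qed

lemma diff_K: "diff K n x i = d_left (i - 1) (n + 1 - i) (x (i - 1))
    \<oplus>\<^bsub>term_at i (n + 1 - i)\<^esub> sgn i (term_at i (n + 1 - i)) (d_right i (n - i) (x i))"
proof -
  have e: "n - i + 1 = n + 1 - i" by simp
  show ?thesis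
    by (simp add: tensor_complex_def Let_def d_left_def d_right_def term_at_def sgn_def e)
qed

text \<open>The two components of the differential, with indices in the form in which they compose.\<close>

lemma left_hom: "d_left (i - 1) (n + 1 - i) \<in> gr_hom R R 0 (term_at (i - 1) (n - (i - 1))) (term_at i (n + 1 - i))"
proof -
  have "n - (i - 1) = n + 1 - i" "i - 1 + 1 = i" by simp_all
  then show ?thesis using d_left_hom[of "i - 1" "n + 1 - i"] by (simp only:)
qed

lemma right_hom: "(\<lambda>y. sgn i (term_at i (n + 1 - i)) (d_right i (n - i) y))
    \<in> gr_hom R R 0 (term_at i (n - i)) (term_at i (n + 1 - i))"
proof -
  have "n - i + 1 = n + 1 - i" by simp
  then show ?thesis
    using d_right_hom[of i "n - i"] gr_hom_neg[OF term_bimod d_right_hom[of i "n - i"]]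
    by (cases "even i") (simp_all only: sgn_def if_True if_False)
qed

lemma diff_K_hom: "diff K n \<in> gr_hom R R 0 (obj K n) (obj K (n + 1))"
proof -
  interpret T: gr_bimod R gr R gr "term_at i j" for i j by (rule term_bimod)
  let ?l = "\<lambda>i. d_left (i - 1) (n + 1 - i)"
  let ?r = "\<lambda>i y. sgn i (term_at i (n + 1 - i)) (d_right i (n - i) y)"
  note l = left_hom[of _ n] and r = right_hom[of _ n]
  have fin: "finite {i. diff K n x i \<noteq> \<zero>\<^bsub>term_at i (n + 1 - i)\<^esub>}" if "finite {i. x i \<noteq> \<zero>\<^bsub>term_at i (n - i)\<^esub>}" for x
  proof (rule finite_subset)
    let ?J = "{i. x i \<noteq> \<zero>\<^bsub>term_at i (n - i)\<^esub>}"
    show "finite (?J \<union> (\<lambda>i. i + 1) ` ?J)" using that by simp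
    have "diff K n x i = \<zero>\<^bsub>term_at i (n + 1 - i)\<^esub>" if "i \<notin> ?J" "i \<notin> (\<lambda>i. i + 1) ` ?J" for i
    proof -
      have "i - 1 \<notin> ?J"
      proof
        assume "i - 1 \<in> ?J"
        then have "(i - 1) + 1 \<in> (\<lambda>i. i + 1) ` ?J" by (rule imageI)
        then show False using that(2) by simp
      qed
      then have x: "x i = \<zero>\<^bsub>term_at i (n - i)\<^esub>" "x (i - 1) = \<zero>\<^bsub>term_at (i - 1) (n - (i - 1))\<^esub>"
        using that(1) by auto
      have "?l i (x (i - 1)) = \<zero>\<^bsub>term_at i (n + 1 - i)\<^esub>"
        unfolding x by (rule add_hom_zero[OF T.is_abelian_group T.is_abelian_group gr_hom_add_hom[OF l]])
      moreover have "?r i (x i) = \<zero>\<^bsub>term_at i (n + 1 - i)\<^esub>"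
        unfolding x by (rule add_hom_zero[OF T.is_abelian_group T.is_abelian_group gr_hom_add_hom[OF r]])
      ultimately show ?thesis by (simp add: diff_K)
    qed
    then show "{i. diff K n x i \<noteq> \<zero>\<^bsub>term_at i (n + 1 - i)\<^esub>} \<subseteq> ?J \<union> (\<lambda>i. i + 1) ` ?J" by blast
  qed
  have comp: "(\<lambda>x. diff K n x i) = (\<lambda>x. ?l i (x (i - 1)) \<oplus>\<^bsub>term_at i (n + 1 - i)\<^esub> ?r i (x i))" for i
    by (simp add: diff_K)
  have xi: "x i \<in> carrier (term_at i (n - i))" if "x \<in> carrier (obj K n)" for x i
    using that by (simp add: obj_K)
  note lc = gr_hom_closed[OF l xi] and rc = gr_hom_closed[OF r xi]
  show ?thesis
  proof (rule gr_homI)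
    show "add_hom (obj K n) (obj K (n + 1)) (diff K n)"
    proof (rule add_homI)
      fix x assume x: "x \<in> carrier (obj K n)"
      have "diff K n x i \<in> carrier (term_at i (n + 1 - i))" for i
        unfolding diff_K by (intro T.a_closed lc[OF x] rc[OF x])
      then show "diff K n x \<in> carrier (obj K (n + 1))" using fin x by (simp add: obj_K)
      fix y assume y: "y \<in> carrier (obj K n)"
      have "diff K n (x \<oplus>\<^bsub>obj K n\<^esub> y) i = diff K n x i \<oplus>\<^bsub>term_at i (n + 1 - i)\<^esub> diff K n y i" for i
        unfolding diff_K using lc[OF x] rc[OF x] lc[OF y] rc[OF y] 
        by (simp add: obj_K gr_hom_add[OF l xi[OF x] xi[OF y]] gr_hom_add[OF r xi[OF x] xi[OF y]] T.a_ac)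
      then show "diff K n (x \<oplus>\<^bsub>obj K n\<^esub> y) = diff K n x \<oplus>\<^bsub>obj K (n + 1)\<^esub> diff K n y"
        by (simp add: obj_K[of "n + 1"] fun_eq_iff)
    qed
  next
    fix a x assume a: "a \<in> carrier R" and x: "x \<in> carrier (obj K n)"
    have "diff K n (lact (obj K n) a x) i = lact (term_at i (n + 1 - i)) a (diff K n x i)" for i
      unfolding diff_K using lc[OF x] rc[OF x] a
      by (simp add: obj_K gr_hom_lact[OF l a xi[OF x]] gr_hom_lact[OF r a xi[OF x]] T.lact_add_right)
    then show "diff K n (lact (obj K n) a x) = lact (obj K (n + 1)) a (diff K n x)"
      by (simp add: obj_K[of "n + 1"] fun_eq_iff)
    have "diff K n (ract (obj K n) x a) i = ract (term_at i (n + 1 - i)) (diff K n x i) a" for i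
      unfolding diff_K using lc[OF x] rc[OF x] a
      by (simp add: obj_K gr_hom_ract[OF l a xi[OF x]] gr_hom_ract[OF r a xi[OF x]] T.ract_add_left)
    then show "diff K n (ract (obj K n) x a) = ract (obj K (n + 1)) (diff K n x) a"
      by (simp add: obj_K[of "n + 1"] fun_eq_iff)
  next
    fix j x assume "x \<in> homog (obj K n) j"
    then have x: "x i \<in> homog (term_at i (n - i)) j" "finite {i. x i \<noteq> \<zero>\<^bsub>term_at i (n - i)\<^esub>}" for i
      by (simp_all add: obj_K)
    have "diff K n x i \<in> homog (term_at i (n + 1 - i)) j" for i
      unfolding diff_K
      using additive_subgroup_add[OF T.H_subgroup gr_hom_homog[OF l x(1)] gr_hom_homog[OF r x(1)], of i]
      by simp
    then show "diff K n x \<in> homog (obj K (n + 1)) (j + 0)"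
      using fin x(2) by (simp add: obj_K)
  qed
qed

text \<open>Each partial differential squares to zero. The two mixed terms carry the signs of \<open>i - 1\<close> and \<open>i\<close>
  and cancel.\<close>

lemma diff_diff_K:
  assumes x: "x \<in> carrier (obj K n)"
  shows "diff K (n + 1) (diff K n x) = \<zero>\<^bsub>obj K (n + 2)\<^esub>"
proof -
  interpret T: gr_bimod R gr R gr "term_at i j" for i j by (rule term_bimod)
  have "diff K (n + 1) (diff K n x) i = \<zero>\<^bsub>term_at i (n + 2 - i)\<^esub>" for i
  proof -
    \<comment> \<open>Indices are normalised by hand, so that sources and targets of the maps agree syntactically.\<close>
    define m where "m = n - i"
    have index: "i - 2 + 1 = i - 1" "i - 1 - 1 = i - 2" by simp_all
    let ?T = "term_at i (m + 2)"
    have n: "n - i = m" "n + 1 - i = m + 1" "n + 1 + 1 - i = m + 2" "n + 2 - i = m + 2"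
      "n - (i - 1) = m + 1" "n + 1 - (i - 1) = m + 2" "n - (i - 1 - 1) = m + 2" "n - (i - 2) = m + 2"
      by (simp_all add: m_def)
    have xc: "x i \<in> carrier (term_at i m)" "x (i - 1) \<in> carrier (term_at (i - 1) (m + 1))"
      "x (i - 2) \<in> carrier (term_at (i - 2) (m + 2))"
      using x n by (auto simp: obj_K simp del: diff_diff_eq2 diff_diff_eq)
        (metis n(1,5,8))+
    note ll = d_left_left[of "x (i - 2)" "i - 2" "m + 2", unfolded index diff_add_cancel]
      and rr = d_right_right[of "x i" i m] and lr = d_left_right[of "x (i - 1)" "i - 1" "m + 1", unfolded diff_add_cancel add.assoc one_add_one]
    have l1: "d_left (i - 1) (m + 2) \<in> gr_hom R R 0 (term_at (i - 1) (m + 2)) ?T"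
      and l2: "d_left (i - 2) (m + 2) \<in> gr_hom R R 0 (term_at (i - 2) (m + 2)) (term_at (i - 1) (m + 2))"
      and l3: "d_left (i - 1) (m + 1) \<in> gr_hom R R 0 (term_at (i - 1) (m + 1)) (term_at i (m + 1))"
      and r1: "d_right i (m + 1) \<in> gr_hom R R 0 (term_at i (m + 1)) ?T"
      and r2: "d_right i m \<in> gr_hom R R 0 (term_at i m) (term_at i (m + 1))"
      and r3: "d_right (i - 1) (m + 1) \<in> gr_hom R R 0 (term_at (i - 1) (m + 1)) (term_at (i - 1) (m + 2))"
      using d_left_hom[of "i - 1" "m + 2"] d_left_hom[of "i - 2" "m + 2"] d_left_hom[of "i - 1" "m + 1"]
        d_right_hom[of i "m + 1"] d_right_hom[of i m] d_right_hom[of "i - 1" "m + 1"]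
      by (simp_all only: add.assoc one_add_one diff_add_cancel index)
    note cl = gr_hom_closed[OF l1] gr_hom_closed[OF l2] gr_hom_closed[OF l3]
      gr_hom_closed[OF r1] gr_hom_closed[OF r2] gr_hom_closed[OF r3]
    note neg = add_hom_minus[OF T.is_abelian_group T.is_abelian_group gr_hom_add_hom]
    have "diff K (n + 1) (diff K n x) i = d_left (i - 1) (m + 2) (d_left (i - 2) (m + 2) (x (i - 2))
        \<oplus>\<^bsub>term_at (i - 1) (m + 2)\<^esub> sgn (i - 1) (term_at (i - 1) (m + 2)) (d_right (i - 1) (m + 1) (x (i - 1))))
      \<oplus>\<^bsub>?T\<^esub> sgn i ?T (d_right i (m + 1) (d_left (i - 1) (m + 1) (x (i - 1))
        \<oplus>\<^bsub>term_at i (m + 1)\<^esub> sgn i (term_at i (m + 1)) (d_right i m (x i))))"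
      by (simp only: diff_K n index)
    also have "\<dots> = \<zero>\<^bsub>?T\<^esub>"
      using xc cl ll rr lr
      by (simp add: sgn_def gr_hom_add[OF l1] gr_hom_add[OF r1] neg[OF l1] neg[OF r1] T.l_neg T.r_neg T.minus_minus T.a_inv_zero)
    finally show ?thesis by (simp add: n)
  qed
  then show ?thesis by (simp add: obj_K fun_eq_iff)
qed

sublocale K: gr_complex R gr K
  by (rule gr_complex.intro[OF bimod_K diff_K_hom diff_diff_K])

definition in_K where "in_K n = summand (\<lambda>i. term_at i (n - i))"

lemma in_K_hom: "in_K n i \<in> gr_hom R R 0 (term_at i (n - i)) (obj K n)"
  unfolding in_K_def obj_K by (rule summand_hom[OF term_bimod])

lemma diff_in_K:
  assumes t: "t \<in> carrier (term_at i j)" and n: "n = i + j"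
  shows "diff K n (in_K n i t) = in_K (n + 1) (i + 1) (d_left i j t) \<oplus>\<^bsub>obj K (n + 1)\<^esub>
    in_K (n + 1) i (sgn i (term_at i (j + 1)) (d_right i j t))"
proof
  interpret T: gr_bimod R gr R gr "term_at a b" for a b by (rule term_bimod)
  fix l
  have j: "n - i = j" "n + 1 - i = j + 1" "n + 1 - (i + 1) = j" using n by simp_all
  have dl: "d_left i j t \<in> carrier (term_at (i + 1) j)" by (rule gr_hom_closed[OF d_left_hom t])
  have dr: "sgn i (term_at i (j + 1)) (d_right i j t) \<in> carrier (term_at i (j + 1))"
    using gr_hom_closed[OF d_right_hom t] by (simp add: sgn_def)
  have zl: "d_left (l - 1) (n + 1 - l) \<zero>\<^bsub>term_at (l - 1) (n - (l - 1))\<^esub> = \<zero>\<^bsub>term_at l (n + 1 - l)\<^esub>"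
    by (rule gr_hom_zero[OF term_bimod term_bimod left_hom])
  have zr: "sgn l (term_at l (n + 1 - l)) (d_right l (n - l) \<zero>\<^bsub>term_at l (n - l)\<^esub>) = \<zero>\<^bsub>term_at l (n + 1 - l)\<^esub>"
    by (rule gr_hom_zero[OF term_bimod term_bimod right_hom])
  consider "l = i" | "l = i + 1" | "l \<noteq> i" "l \<noteq> i + 1" by blast
  then show "diff K n (in_K n i t) l = (in_K (n + 1) (i + 1) (d_left i j t) \<oplus>\<^bsub>obj K (n + 1)\<^esub>
    in_K (n + 1) i (sgn i (term_at i (j + 1)) (d_right i j t))) l"
  proof cases
    case 1
    then show ?thesis using zl dr by (simp add: diff_K obj_K in_K_def summand_def j)
  next
    case 2
    then show ?thesis using zr dl by (simp add: diff_K obj_K in_K_def summand_def j)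
  next
    case 3
    then have "l - 1 \<noteq> i" by simp
    with 3 show ?thesis using zl zr by (simp add: diff_K obj_K in_K_def summand_def)
  qed
qed

lemma term_trivial:
  "carrier (obj C i) = {\<zero>\<^bsub>obj C i\<^esub>} \<or> carrier (obj D j) = {\<zero>\<^bsub>obj D j\<^esub>} \<Longrightarrow> carrier (term_at i j) = {\<zero>\<^bsub>term_at i j\<^esub>}"
  unfolding term_at_def by (rule tensor_pair.tensor_trivial[OF pair])

text \<open>In a two-term complex each bimodule is padded by a zero summand, so an entry of the tensor complex
  is only isomorphic to the tensor product of the bimodules that were given. The maps \<open>u\<close> and \<open>v\<close> are
  the paddings of the two factors; \<open>E\<close> and \<open>P\<close> lead from the unpadded tensor product to the complex and
  back.\<close>

lemma component_embedding:
  assumes U: "gr_bimod R gr R gr U" and V: "gr_bimod R gr R gr V" and n: "n = i + j"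
    and u: "u \<in> gr_hom R R 0 U (obj C i)" and u': "u' \<in> gr_hom R R 0 (obj C i) U"
    and v: "v \<in> gr_hom R R 0 V (obj D j)" and v': "v' \<in> gr_hom R R 0 (obj D j) V"
    and inv: "\<And>x. x \<in> carrier U \<Longrightarrow> u' (u x) = x" "\<And>x. x \<in> carrier (obj C i) \<Longrightarrow> u (u' x) = x"
      "\<And>x. x \<in> carrier V \<Longrightarrow> v' (v x) = x" "\<And>x. x \<in> carrier (obj D j) \<Longrightarrow> v (v' x) = x"
  defines "E \<equiv> \<lambda>t. in_K n i (tensor_map R (obj C i) (obj D j) u v t)"
    and "P \<equiv> \<lambda>x. tensor_map R U V u' v' (x i)"
  shows "E \<in> gr_hom R R 0 (tensor R U V) (obj K n)" "P \<in> gr_hom R R 0 (obj K n) (tensor R U V)"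
    and "\<And>t. t \<in> carrier (tensor R U V) \<Longrightarrow> P (E t) = t"
    and "\<And>x. x \<in> carrier (obj K n) \<Longrightarrow> E (P x) = in_K n i (x i)"
proof -
  have j: "n - i = j" using n by simp
  have UV: "tensor_pair R gr R gr R gr U V"
    by (simp add: tensor_pair_def tensor_pair_axioms_def U V R_generated)
  interpret UV: tensor_pair R gr R gr R gr U V by (rule UV)
  interpret CD: tensor_pair R gr R gr R gr "obj C i" "obj D j" by (rule pair)
  note e = UV.tensor_map_hom[OF pair u v] and p = CD.tensor_map_hom[OF UV u' v']
  have ep: "tensor_map R U V u' v' (tensor_map R (obj C i) (obj D j) u v t) = t" if "t \<in> carrier UV.T" for t
    by (rule UV.gr_hom_eqI[OF gr_hom_comp[OF e(1) p(1)] gr_hom_id _ that])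
      (simp add: e(2) p(2) gr_hom_closed[OF u] gr_hom_closed[OF v] inv)
  have pe: "tensor_map R (obj C i) (obj D j) u v (tensor_map R U V u' v' t) = t" if "t \<in> carrier CD.T" for t
    by (rule CD.gr_hom_eqI[OF gr_hom_comp[OF p(1) e(1)] gr_hom_id _ that])
      (simp add: e(2) p(2) gr_hom_closed[OF u'] gr_hom_closed[OF v'] inv)
  show "E \<in> gr_hom R R 0 (tensor R U V) (obj K n)"
    using gr_hom_comp[OF e(1) in_K_hom[of n i, unfolded j term_at_def]] by (simp add: E_def)
  have proj: "(\<lambda>x. x i) \<in> gr_hom R R 0 (obj K n) CD.T"
    using direct_sum_proj_hom[of i R R "\<lambda>i. term_at i (n - i)"] by (simp add: obj_K j) (simp add: term_at_def)
  show "P \<in> gr_hom R R 0 (obj K n) (tensor R U V)"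
    using gr_hom_comp[OF proj p(1)] by (simp add: P_def)
  show "P (E t) = t" if "t \<in> carrier (tensor R U V)" for t
    using ep[OF that] by (simp add: P_def E_def in_K_def summand_def)
  show "E (P x) = in_K n i (x i)" if "x \<in> carrier (obj K n)" for x
    using pe[OF gr_hom_closed[OF proj that]] by (simp add: P_def E_def)
qed

end

subsection \<open>Two-term complexes\<close>

locale two_term_complex =
  fixes R :: "'a ring" and gr and p :: int and M :: "('a, 'm) bimodule" and N :: "('a, 'n) bimodule" and d
  assumes M: "gr_bimod R gr R gr M" and N: "gr_bimod R gr R gr N" and d: "d \<in> gr_hom R R 0 M N"
begin

abbreviation C where "C \<equiv> two_term p M N d"

definition in1 where "in1 m = (m, \<zero>\<^bsub>N\<^esub>)"
definition in2 where "in2 n = (\<zero>\<^bsub>M\<^esub>, n)"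

sublocale M: gr_bimod R gr R gr M by (rule M)
sublocale N: gr_bimod R gr R gr N by (rule N)

lemma obj_C: "obj C i = direct_sum2 (if i = p then M else zero_part M) (if i = p + 1 then N else zero_part N)"
  by (simp add: two_term_def)

lemma obj_bimod: "gr_bimod R gr R gr (obj C i)"
  unfolding obj_C by (intro gr_bimod_direct_sum2) (simp_all add: M N gr_bimod_zero_part)

lemma zero_obj: "\<zero>\<^bsub>obj C i\<^esub> = (\<zero>\<^bsub>M\<^esub>, \<zero>\<^bsub>N\<^esub>)"
  by (simp add: obj_C)

lemma d_zero: "d \<zero>\<^bsub>M\<^esub> = \<zero>\<^bsub>N\<^esub>"
  by (rule gr_hom_zero[OF M N d])

lemma obj_p: "obj C p = direct_sum2 M (zero_part N)" and obj_p1: "obj C (p + 1) = direct_sum2 (zero_part M) N"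
  by (simp_all add: obj_C)

lemma in1_hom: "in1 \<in> gr_hom R R 0 M (obj C p)" and fst_hom: "fst \<in> gr_hom R R 0 (obj C p) M"
  and in2_hom: "in2 \<in> gr_hom R R 0 N (obj C (p + 1))" and snd_hom: "snd \<in> gr_hom R R 0 (obj C (p + 1)) N"
  unfolding obj_p obj_p1
  by (rule gr_homI; auto simp: in1_def in2_def M.lact_zero N.lact_zero M.ract_zero N.ract_zero intro!: add_homI)+

lemma in_inverse: "fst (in1 m) = m" "snd (in2 n) = n"
  "x \<in> carrier (obj C p) \<Longrightarrow> in1 (fst x) = x" "y \<in> carrier (obj C (p + 1)) \<Longrightarrow> in2 (snd y) = y"
  by (auto simp: in1_def in2_def obj_p obj_p1)

lemma diff_in1: "diff C p (in1 m) = in2 (d m)" and diff_in2: "diff C (p + 1) (in2 n) = \<zero>\<^bsub>obj C i\<^esub>"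
  by (simp_all add: two_term_def in1_def in2_def)

lemma trivial: "i \<noteq> p \<Longrightarrow> i \<noteq> p + 1 \<Longrightarrow> carrier (obj C i) = {\<zero>\<^bsub>obj C i\<^esub>}"
  by (simp add: obj_C)

lemma diff_hom: "diff C i \<in> gr_hom R R 0 (obj C i) (obj C (i + 1))"
proof (cases "i = p")
  case True
  have "diff C p = (\<lambda>x. in2 (d (fst x)))" by (simp add: two_term_def in2_def case_prod_unfold)
  then show ?thesis using gr_hom_comp[OF gr_hom_comp[OF fst_hom d] in2_hom] True by simp
next
  case False
  have "diff C i = (\<lambda>x. \<zero>\<^bsub>obj C (i + 1)\<^esub>)" using False by (simp add: two_term_def case_prod_unfold)
  then show ?thesis using gr_hom_zero_map[OF obj_bimod] by simp
qed

sublocale C: gr_complex R gr C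
  by (rule gr_complex.intro[OF obj_bimod diff_hom]) (auto simp: zero_obj two_term_def d_zero)

end

text \<open>The condition on \<open>q\<close> puts the tensor product in degrees \<open>- 1\<close>, \<open>0\<close>, \<open>1\<close>. It is the square

  \<open>M \<otimes> M' \<rightarrow> M \<otimes> N'\<close> (\<open>\<alpha>\<close>), \<open>M \<otimes> M' \<rightarrow> N \<otimes> M'\<close> (\<open>\<beta>\<close>), \<open>M \<otimes> N' \<rightarrow> N \<otimes> N'\<close> (\<open>\<gamma>\<close>),
  \<open>N \<otimes> M' \<rightarrow> N \<otimes> N'\<close> (\<open>\<eta>\<close>)

  up to signs. The maps \<open>F1\<close> to \<open>F4\<close> pad the corners \<open>M \<otimes> M'\<close>, \<open>M \<otimes> N'\<close>, \<open>N \<otimes> M'\<close>, \<open>N \<otimes> N'\<close>, in this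
  order, \<open>E1\<close> to \<open>E4\<close> embed them in the complex, and \<open>P1\<close> to \<open>P4\<close> lead back.\<close>

locale two_term_pair = C: two_term_complex R gr p M N d + D: two_term_complex R gr q M' N' d'
  for R :: "'a ring" and gr and p :: int and M :: "('a, 'm) bimodule" and N :: "('a, 'n) bimodule" and d
    and q :: int and M' :: "('a, 'u) bimodule" and N' :: "('a, 'v) bimodule" and d' +
  assumes R_gen: "add_generates R (\<Union>i. gr i)" and degrees: "q = - 1 - p"
begin

sublocale CD: complex_pair R gr C.C D.C
  by (intro complex_pair.intro C.C.gr_complex_axioms D.C.gr_complex_axioms complex_pair_axioms.intro R_gen)

abbreviation K where "K \<equiv> tensor_complex R C.C D.C"

definition \<alpha> where "\<alpha> = tensor_map R M N' id d'"
definition \<beta> where "\<beta> = tensor_map R N M' d id"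
definition \<gamma> where "\<gamma> = tensor_map R N N' d id"
definition \<eta> where "\<eta> = tensor_map R N N' id d'"

definition F1 where "F1 = tensor_map R (obj C.C p) (obj D.C q) C.in1 D.in1"
definition F2 where "F2 = tensor_map R (obj C.C p) (obj D.C (q + 1)) C.in1 D.in2"
definition F3 where "F3 = tensor_map R (obj C.C (p + 1)) (obj D.C q) C.in2 D.in1"
definition F4 where "F4 = tensor_map R (obj C.C (p + 1)) (obj D.C (q + 1)) C.in2 D.in2"

definition E1 where "E1 t = CD.in_K (- 1) p (F1 t)"
definition E2 where "E2 t = CD.in_K 0 p (F2 t)"
definition E3 where "E3 t = CD.in_K 0 (p + 1) (F3 t)"
definition E4 where "E4 t = CD.in_K 1 (p + 1) (F4 t)"
definition P1 where "P1 x = tensor_map R M M' fst fst (x p)"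
definition P2 where "P2 x = tensor_map R M N' fst snd (x p)"
definition P3 where "P3 x = tensor_map R N M' snd fst (x (p + 1))"
definition P4 where "P4 x = tensor_map R N N' snd snd (x (p + 1))"

lemma pairs: "tensor_pair R gr R gr R gr M M'" "tensor_pair R gr R gr R gr M N'"
  "tensor_pair R gr R gr R gr N M'" "tensor_pair R gr R gr R gr N N'"
  by (simp_all add: tensor_pair_def tensor_pair_axioms_def C.M C.N D.M D.N R_gen)

lemmas bimods = pairs[THEN tensor_pair.gr_bimod_T]

sublocale MM: tensor_pair R gr R gr R gr M M' by (rule pairs)
sublocale MN: tensor_pair R gr R gr R gr M N' by (rule pairs)
sublocale NM: tensor_pair R gr R gr R gr N M' by (rule pairs)
sublocale NN: tensor_pair R gr R gr R gr N N' by (rule pairs)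

lemma degree_sums: "- 1 = p + q" "0 = p + (q + 1)" "0 = p + 1 + q" "1 = p + 1 + (q + 1)"
  by (simp_all add: degrees)

lemma E1_hom: "E1 \<in> gr_hom R R 0 MM.T (obj K (- 1))" and P1_hom: "P1 \<in> gr_hom R R 0 (obj K (- 1)) MM.T"
  and E1_P1: "x \<in> carrier (obj K (- 1)) \<Longrightarrow> E1 (P1 x) = CD.in_K (- 1) p (x p)"
  using CD.component_embedding[where n = "- 1" and i = p and j = q, OF C.M D.M degree_sums(1) C.in1_hom C.fst_hom D.in1_hom D.fst_hom
    C.in_inverse(1,3) D.in_inverse(1,3)]
  by (simp_all add: E1_def[abs_def] F1_def P1_def[abs_def])

lemma E2_hom: "E2 \<in> gr_hom R R 0 MN.T (obj K 0)" and P2_hom: "P2 \<in> gr_hom R R 0 (obj K 0) MN.T"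
  and P2_E2: "t \<in> carrier MN.T \<Longrightarrow> P2 (E2 t) = t"
  and E2_P2: "x \<in> carrier (obj K 0) \<Longrightarrow> E2 (P2 x) = CD.in_K 0 p (x p)"
  using CD.component_embedding[where n = 0 and i = p and j = "q + 1", OF C.M D.N degree_sums(2) C.in1_hom C.fst_hom D.in2_hom D.snd_hom
    C.in_inverse(1,3) D.in_inverse(2,4)]
  by (simp_all add: E2_def[abs_def] F2_def P2_def[abs_def])

lemma E3_hom: "E3 \<in> gr_hom R R 0 NM.T (obj K 0)" and P3_hom: "P3 \<in> gr_hom R R 0 (obj K 0) NM.T"
  and P3_E3: "t \<in> carrier NM.T \<Longrightarrow> P3 (E3 t) = t"
  and E3_P3: "x \<in> carrier (obj K 0) \<Longrightarrow> E3 (P3 x) = CD.in_K 0 (p + 1) (x (p + 1))"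
  using CD.component_embedding[where n = 0 and i = "p + 1" and j = q, OF C.N D.M degree_sums(3) C.in2_hom C.snd_hom D.in1_hom D.fst_hom
    C.in_inverse(2,4) D.in_inverse(1,3)]
  by (simp_all add: E3_def[abs_def] F3_def P3_def[abs_def])

lemma E4_hom: "E4 \<in> gr_hom R R 0 NN.T (obj K 1)" and P4_hom: "P4 \<in> gr_hom R R 0 (obj K 1) NN.T"
  and P4_E4: "t \<in> carrier NN.T \<Longrightarrow> P4 (E4 t) = t"
  and E4_P4: "x \<in> carrier (obj K 1) \<Longrightarrow> E4 (P4 x) = CD.in_K 1 (p + 1) (x (p + 1))"
  using CD.component_embedding[where n = 1 and i = "p + 1" and j = "q + 1", OF C.N D.N degree_sums(4) C.in2_hom C.snd_hom D.in2_hom D.snd_hom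
    C.in_inverse(2,4) D.in_inverse(2,4)]
  by (simp_all add: E4_def[abs_def] F4_def P4_def[abs_def])

lemma alpha_hom: "\<alpha> \<in> gr_hom R R 0 MM.T MN.T"
  and alpha_pure: "m \<in> carrier M \<Longrightarrow> n \<in> carrier M' \<Longrightarrow> \<alpha> (MM.pt m n) = MN.pt m (d' n)"
  using MM.tensor_map_hom[OF pairs(2) gr_hom_id D.d] by (simp_all add: \<alpha>_def id_def)

lemma beta_hom: "\<beta> \<in> gr_hom R R 0 MM.T NM.T"
  and beta_pure: "m \<in> carrier M \<Longrightarrow> n \<in> carrier M' \<Longrightarrow> \<beta> (MM.pt m n) = NM.pt (d m) n"
  using MM.tensor_map_hom[OF pairs(3) C.d gr_hom_id] by (simp_all add: \<beta>_def id_def)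

lemma gamma_hom: "\<gamma> \<in> gr_hom R R 0 MN.T NN.T"
  and gamma_pure: "m \<in> carrier M \<Longrightarrow> n \<in> carrier N' \<Longrightarrow> \<gamma> (MN.pt m n) = NN.pt (d m) n"
  using MN.tensor_map_hom[OF pairs(4) C.d gr_hom_id] by (simp_all add: \<gamma>_def id_def)

lemma eta_hom: "\<eta> \<in> gr_hom R R 0 NM.T NN.T"
  and eta_pure: "m \<in> carrier N \<Longrightarrow> n \<in> carrier M' \<Longrightarrow> \<eta> (NM.pt m n) = NN.pt m (d' n)"
  using NM.tensor_map_hom[OF pairs(4) gr_hom_id D.d] by (simp_all add: \<eta>_def id_def)

lemma F1_hom: "F1 \<in> gr_hom R R 0 MM.T (CD.term_at p q)"
  and F1_pure: "m \<in> carrier M \<Longrightarrow> n \<in> carrier M' \<Longrightarrow>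
    F1 (MM.pt m n) = pure_tensor R (obj C.C p) (obj D.C q) (C.in1 m) (D.in1 n)"
  using MM.tensor_map_hom[OF CD.pair C.in1_hom D.in1_hom] by (simp_all add: F1_def CD.term_at_def)

lemma F2_hom: "F2 \<in> gr_hom R R 0 MN.T (CD.term_at p (q + 1))"
  and F2_pure: "m \<in> carrier M \<Longrightarrow> n \<in> carrier N' \<Longrightarrow>
    F2 (MN.pt m n) = pure_tensor R (obj C.C p) (obj D.C (q + 1)) (C.in1 m) (D.in2 n)"
  using MN.tensor_map_hom[OF CD.pair C.in1_hom D.in2_hom] by (simp_all add: F2_def CD.term_at_def)

lemma F3_hom: "F3 \<in> gr_hom R R 0 NM.T (CD.term_at (p + 1) q)"
  and F3_pure: "m \<in> carrier N \<Longrightarrow> n \<in> carrier M' \<Longrightarrow>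
    F3 (NM.pt m n) = pure_tensor R (obj C.C (p + 1)) (obj D.C q) (C.in2 m) (D.in1 n)"
  using NM.tensor_map_hom[OF CD.pair C.in2_hom D.in1_hom] by (simp_all add: F3_def CD.term_at_def)

lemma F4_hom: "F4 \<in> gr_hom R R 0 NN.T (CD.term_at (p + 1) (q + 1))"
  and F4_pure: "m \<in> carrier N \<Longrightarrow> n \<in> carrier N' \<Longrightarrow>
    F4 (NN.pt m n) = pure_tensor R (obj C.C (p + 1)) (obj D.C (q + 1)) (C.in2 m) (D.in2 n)"
  using NN.tensor_map_hom[OF CD.pair C.in2_hom D.in2_hom] by (simp_all add: F4_def CD.term_at_def)

lemmas E_F = E1_def E2_def E3_def E4_def

lemma in_C: "m \<in> carrier M \<Longrightarrow> C.in1 m \<in> carrier (obj C.C p)" "n \<in> carrier N \<Longrightarrow> C.in2 n \<in> carrier (obj C.C (p + 1))"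
  "m' \<in> carrier M' \<Longrightarrow> D.in1 m' \<in> carrier (obj D.C q)" "n' \<in> carrier N' \<Longrightarrow> D.in2 n' \<in> carrier (obj D.C (q + 1))"
  using gr_hom_closed[OF C.in1_hom] gr_hom_closed[OF C.in2_hom] gr_hom_closed[OF D.in1_hom]
    gr_hom_closed[OF D.in2_hom] by blast+

lemma F1_left: "t \<in> carrier MM.T \<Longrightarrow> CD.d_left p q (F1 t) = F3 (\<beta> t)"
  by (rule MM.gr_hom_eqI[OF gr_hom_comp[OF F1_hom CD.d_left_hom] gr_hom_comp[OF beta_hom F3_hom]])
    (simp_all add: F1_pure F3_pure beta_pure CD.d_left_pure in_C C.diff_in1 gr_hom_closed[OF C.d])

lemma F1_right: "t \<in> carrier MM.T \<Longrightarrow> CD.d_right p q (F1 t) = F2 (\<alpha> t)"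
  by (rule MM.gr_hom_eqI[OF gr_hom_comp[OF F1_hom CD.d_right_hom] gr_hom_comp[OF alpha_hom F2_hom]])
    (simp_all add: F1_pure F2_pure alpha_pure CD.d_right_pure in_C D.diff_in1 gr_hom_closed[OF D.d])

lemma F2_left: "t \<in> carrier MN.T \<Longrightarrow> CD.d_left p (q + 1) (F2 t) = F4 (\<gamma> t)"
  by (rule MN.gr_hom_eqI[OF gr_hom_comp[OF F2_hom CD.d_left_hom] gr_hom_comp[OF gamma_hom F4_hom]])
    (simp_all add: F2_pure F4_pure gamma_pure CD.d_left_pure in_C C.diff_in1 gr_hom_closed[OF C.d])

lemma F3_right: "t \<in> carrier NM.T \<Longrightarrow> CD.d_right (p + 1) q (F3 t) = F4 (\<eta> t)"
  by (rule NM.gr_hom_eqI[OF gr_hom_comp[OF F3_hom CD.d_right_hom] gr_hom_comp[OF eta_hom F4_hom]])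
    (simp_all add: F3_pure F4_pure eta_pure CD.d_right_pure in_C D.diff_in1 gr_hom_closed[OF D.d])

lemma F2_right: "t \<in> carrier MN.T \<Longrightarrow> CD.d_right p (q + 1) (F2 t) = \<zero>\<^bsub>CD.term_at p (q + 1 + 1)\<^esub>"
proof -
  interpret T: tensor_pair R gr R gr R gr "obj C.C p" "obj D.C (q + 1 + 1)" by (rule CD.pair)
  show "t \<in> carrier MN.T \<Longrightarrow> ?thesis"
    by (rule MN.gr_hom_eqI[OF gr_hom_comp[OF F2_hom CD.d_right_hom] gr_hom_zero_map[OF CD.term_bimod]])
      (simp_all only: F2_pure CD.d_right_pure in_C D.diff_in2[of _ "q + 1 + 1"] T.pure_zero_right CD.term_at_def)
qed

lemma F3_left: "t \<in> carrier NM.T \<Longrightarrow> CD.d_left (p + 1) q (F3 t) = \<zero>\<^bsub>CD.term_at (p + 1 + 1) q\<^esub>"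
proof -
  interpret T: tensor_pair R gr R gr R gr "obj C.C (p + 1 + 1)" "obj D.C q" by (rule CD.pair)
  show "t \<in> carrier NM.T \<Longrightarrow> ?thesis"
    by (rule NM.gr_hom_eqI[OF gr_hom_comp[OF F3_hom CD.d_left_hom] gr_hom_zero_map[OF CD.term_bimod]])
      (simp_all only: F3_pure CD.d_left_pure in_C C.diff_in2[of _ "p + 1 + 1"] T.pure_zero_left CD.term_at_def)
qed

lemma in_K_term_hom: "n = i + j \<Longrightarrow> CD.in_K n i \<in> gr_hom R R 0 (CD.term_at i j) (obj K n)"
  using CD.in_K_hom[of n i] by simp

lemma in_K_term_zero: "n = i + j \<Longrightarrow> CD.in_K n i \<zero>\<^bsub>CD.term_at i j\<^esub> = \<zero>\<^bsub>obj K n\<^esub>"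
  by (rule gr_hom_zero[OF CD.term_bimod CD.bimod_K in_K_term_hom])

sublocale K0: gr_bimod R gr R gr "obj K n" for n by (rule CD.bimod_K)

lemma sgn_F2: "t \<in> carrier MN.T \<Longrightarrow> CD.in_K 0 p (CD.sgn p (CD.term_at p (q + 1)) (F2 t)) =
    CD.sgn p (obj K 0) (E2 t)"
  using gr_hom_closed[OF F2_hom, of t]
    add_hom_minus[OF gr_bimod.is_abelian_group[OF CD.term_bimod] K0.is_abelian_group
      gr_hom_add_hom[OF in_K_term_hom[OF degree_sums(2)]]]
  by (simp add: CD.sgn_def E_F)

lemma sgn_F4: "t \<in> carrier NN.T \<Longrightarrow> CD.in_K 1 (p + 1) (CD.sgn (p + 1) (CD.term_at (p + 1) (q + 1)) (F4 t)) =
    CD.sgn (p + 1) (obj K 1) (E4 t)"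
  using gr_hom_closed[OF F4_hom, of t]
    add_hom_minus[OF gr_bimod.is_abelian_group[OF CD.term_bimod] K0.is_abelian_group
      gr_hom_add_hom[OF in_K_term_hom[OF degree_sums(4)]]]
  by (simp add: CD.sgn_def E_F)

lemma diff_E1: "t \<in> carrier MM.T \<Longrightarrow>
    diff K (- 1) (E1 t) = E3 (\<beta> t) \<oplus>\<^bsub>obj K 0\<^esub> CD.sgn p (obj K 0) (E2 (\<alpha> t))"
proof -
  assume t: "t \<in> carrier MM.T"
  have n: "- 1 + 1 = (0 :: int)" by simp
  show ?thesis
    using CD.diff_in_K[OF gr_hom_closed[OF F1_hom t] degree_sums(1)]
    by (simp only: n E_F(1,3) F1_left[OF t] F1_right[OF t] sgn_F2[OF gr_hom_closed[OF alpha_hom t]])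
qed

lemma diff_E2: "t \<in> carrier MN.T \<Longrightarrow> diff K 0 (E2 t) = E4 (\<gamma> t)"
proof -
  assume t: "t \<in> carrier MN.T"
  have n: "1 = p + (q + 1 + 1)" by (simp add: degrees)
  have z: "CD.sgn p (CD.term_at p (q + 1 + 1)) \<zero>\<^bsub>CD.term_at p (q + 1 + 1)\<^esub> = \<zero>\<^bsub>CD.term_at p (q + 1 + 1)\<^esub>"
    using abelian_group.a_inv_zero[OF gr_bimod.is_abelian_group[OF CD.term_bimod]] by (simp only: CD.sgn_def if_cancel)
  have "diff K 0 (CD.in_K 0 p (F2 t)) = CD.in_K (0 + 1) (p + 1) (CD.d_left p (q + 1) (F2 t)) \<oplus>\<^bsub>obj K (0 + 1)\<^esub>
      CD.in_K (0 + 1) p (CD.sgn p (CD.term_at p (q + 1 + 1)) (CD.d_right p (q + 1) (F2 t)))"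
    by (rule CD.diff_in_K[OF gr_hom_closed[OF F2_hom t] degree_sums(2)])
  also have "\<dots> = CD.in_K 1 (p + 1) (F4 (\<gamma> t)) \<oplus>\<^bsub>obj K 1\<^esub> \<zero>\<^bsub>obj K 1\<^esub>"
    by (simp only: F2_left[OF t] F2_right[OF t] z in_K_term_zero[OF n] add_0)
  also have "\<dots> = E4 (\<gamma> t)"
    using gr_hom_closed[OF E4_hom gr_hom_closed[OF gamma_hom t]] by (simp add: E_F)
  finally show ?thesis by (simp add: E_F)
qed

lemma diff_E3: "t \<in> carrier NM.T \<Longrightarrow> diff K 0 (E3 t) = CD.sgn (p + 1) (obj K 1) (E4 (\<eta> t))"
proof -
  assume t: "t \<in> carrier NM.T"
  have n: "1 = p + 1 + 1 + q" by (simp add: degrees)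
  have "diff K 0 (CD.in_K 0 (p + 1) (F3 t)) = CD.in_K (0 + 1) (p + 1 + 1) (CD.d_left (p + 1) q (F3 t)) \<oplus>\<^bsub>obj K (0 + 1)\<^esub>
      CD.in_K (0 + 1) (p + 1) (CD.sgn (p + 1) (CD.term_at (p + 1) (q + 1)) (CD.d_right (p + 1) q (F3 t)))"
    by (rule CD.diff_in_K[OF gr_hom_closed[OF F3_hom t] degree_sums(3)])
  also have "\<dots> = \<zero>\<^bsub>obj K 1\<^esub> \<oplus>\<^bsub>obj K 1\<^esub> CD.sgn (p + 1) (obj K 1) (E4 (\<eta> t))"
    by (simp only: F3_left[OF t] F3_right[OF t] in_K_term_zero[OF n] sgn_F4[OF gr_hom_closed[OF eta_hom t]] add_0)
  also have "\<dots> = CD.sgn (p + 1) (obj K 1) (E4 (\<eta> t))"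
    using gr_hom_closed[OF E4_hom gr_hom_closed[OF eta_hom t]] by (simp add: CD.sgn_def)
  finally show ?thesis by (simp add: E_F)
qed

lemma K_entry_zero:
  assumes "x \<in> carrier (obj K n)" "i \<noteq> p \<and> i \<noteq> p + 1 \<or> n - i \<noteq> q \<and> n - i \<noteq> q + 1"
  shows "x i = \<zero>\<^bsub>CD.term_at i (n - i)\<^esub>"
proof -
  have "x i \<in> carrier (CD.term_at i (n - i))" using assms(1) by (simp add: CD.obj_K)
  moreover have "carrier (CD.term_at i (n - i)) = {\<zero>\<^bsub>CD.term_at i (n - i)\<^esub>}"
    by (rule CD.term_trivial) (use assms(2) C.trivial D.trivial in blast)
  ultimately show ?thesis by simp
qed

lemma K_trivial:
  assumes "n \<notin> {-1, 0, 1}"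
  shows "carrier (obj K n) = {\<zero>\<^bsub>obj K n\<^esub>}"
proof -
  have "x = \<zero>\<^bsub>obj K n\<^esub>" if "x \<in> carrier (obj K n)" for x
  proof
    fix i
    have "i \<noteq> p \<and> i \<noteq> p + 1 \<or> n - i \<noteq> q \<and> n - i \<noteq> q + 1" using assms degrees by auto
    then show "x i = \<zero>\<^bsub>obj K n\<^esub> i" using K_entry_zero[OF that] by (simp add: CD.obj_K)
  qed
  then show ?thesis by auto
qed

lemma entry_closed: "x \<in> carrier (obj K n) \<Longrightarrow> x i \<in> carrier (CD.term_at i (n - i))"
  by (simp add: CD.obj_K)

lemma E1_P1_id: "x \<in> carrier (obj K (- 1)) \<Longrightarrow> E1 (P1 x) = x"
proof -
  assume x: "x \<in> carrier (obj K (- 1))"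
  have "x i = \<zero>\<^bsub>CD.term_at i (- 1 - i)\<^esub>" if "i \<noteq> p" for i
    by (rule K_entry_zero[OF x]) (use that degrees in auto)
  then show ?thesis unfolding E1_P1[OF x] by (auto simp: CD.in_K_def summand_def fun_eq_iff)
qed

lemma E4_P4_id: "x \<in> carrier (obj K 1) \<Longrightarrow> E4 (P4 x) = x"
proof -
  assume x: "x \<in> carrier (obj K 1)"
  have "x i = \<zero>\<^bsub>CD.term_at i (1 - i)\<^esub>" if "i \<noteq> p + 1" for i
    by (rule K_entry_zero[OF x]) (use that degrees in auto)
  then show ?thesis unfolding E4_P4[OF x] by (auto simp: CD.in_K_def summand_def fun_eq_iff)
qed

lemma E2_P2_E3_P3: "x \<in> carrier (obj K 0) \<Longrightarrow> x = E2 (P2 x) \<oplus>\<^bsub>obj K 0\<^esub> E3 (P3 x)"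
proof -
  assume x: "x \<in> carrier (obj K 0)"
  interpret T: gr_bimod R gr R gr "CD.term_at a b" for a b by (rule CD.term_bimod)
  have z: "x i = \<zero>\<^bsub>CD.term_at i (0 - i)\<^esub>" if "i \<noteq> p" "i \<noteq> p + 1" for i
    by (rule K_entry_zero[OF x]) (use that in auto)
  have "x i = (CD.in_K 0 p (x p) \<oplus>\<^bsub>obj K 0\<^esub> CD.in_K 0 (p + 1) (x (p + 1))) i" for i
    using z[of i] entry_closed[OF x, of i] by (auto simp: CD.in_K_def summand_def CD.obj_K)
  then show ?thesis unfolding E2_P2[OF x] E3_P3[OF x] by blast
qed

lemma P3_E2: "t \<in> carrier MN.T \<Longrightarrow> P3 (E2 t) = \<zero>\<^bsub>NM.T\<^esub>"
proof -
  assume t: "t \<in> carrier MN.T"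
  have q: "0 - (p + 1) = q" by (simp add: degrees)
  have "E2 t (p + 1) = \<zero>\<^bsub>CD.term_at (p + 1) (0 - (p + 1))\<^esub>"
    by (simp add: E_F CD.in_K_def summand_def)
  then have "E2 t (p + 1) = \<zero>\<^bsub>CD.term_at (p + 1) q\<^esub>" unfolding q .
  moreover have "tensor_map R N M' snd fst \<in> gr_hom R R 0 (CD.term_at (p + 1) q) NM.T"
    using tensor_pair.tensor_map_hom(1)[OF CD.pair pairs(3) C.snd_hom D.fst_hom] by (simp add: CD.term_at_def)
  ultimately show ?thesis
    using gr_hom_zero[OF CD.term_bimod bimods(3)] by (simp add: P3_def)
qed

lemma P2_E3: "t \<in> carrier NM.T \<Longrightarrow> P2 (E3 t) = \<zero>\<^bsub>MN.T\<^esub>"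
proof -
  assume t: "t \<in> carrier NM.T"
  have q: "0 - p = q + 1" by (simp add: degrees)
  have "E3 t p = \<zero>\<^bsub>CD.term_at p (0 - p)\<^esub>"
    by (simp add: E_F CD.in_K_def summand_def)
  then have "E3 t p = \<zero>\<^bsub>CD.term_at p (q + 1)\<^esub>" unfolding q .
  moreover have "tensor_map R M N' fst snd \<in> gr_hom R R 0 (CD.term_at p (q + 1)) MN.T"
    using tensor_pair.tensor_map_hom(1)[OF CD.pair pairs(2) C.fst_hom D.snd_hom] by (simp add: CD.term_at_def)
  ultimately show ?thesis
    using gr_hom_zero[OF CD.term_bimod bimods(2)] by (simp add: P2_def)
qed

text \<open>Elimination with \<open>L = M \<otimes> M'\<close>, \<open>U = M \<otimes> N'\<close> and \<open>W = N \<otimes> N'\<close>; what remains is the corner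
  \<open>N \<otimes> M'\<close>, identified with \<open>A\<close> by \<open>z\<close>. As \<open>p\<close> is even, the sign is on the edge \<open>\<eta>\<close> at the corner that
  is kept, and \<open>\<alpha>\<close> and \<open>\<gamma>\<close> enter without signs.\<close>

theorem contract_even:
  fixes A :: "('a, 'b) bimodule"
  assumes p: "even p" and A: "gr_bimod R gr R gr A"
    and z: "z \<in> gr_hom R R 0 NM.T A" and z': "z' \<in> gr_hom R R 0 A NM.T"
    and inv: "\<And>a. a \<in> carrier A \<Longrightarrow> z (z' a) = a" "\<And>t. t \<in> carrier NM.T \<Longrightarrow> z' (z t) = t"
    and \<kappa>: "\<kappa> \<in> gr_hom R R 0 MN.T MM.T" and \<sigma>: "\<sigma> \<in> gr_hom R R 0 NN.T MN.T"
    and \<kappa>_\<alpha>: "\<And>t. t \<in> carrier MM.T \<Longrightarrow> \<kappa> (\<alpha> t) = \<ominus>\<^bsub>MM.T\<^esub> t"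
    and \<gamma>_\<sigma>: "\<And>t. t \<in> carrier NN.T \<Longrightarrow> \<gamma> (\<sigma> t) = t"
    and \<kappa>_\<sigma>: "\<And>t. t \<in> carrier NN.T \<Longrightarrow> \<kappa> (\<sigma> t) = \<zero>\<^bsub>MM.T\<^esub>"
    and exact: "\<And>t y. \<lbrakk>t \<in> carrier MN.T; y = t \<oplus>\<^bsub>MN.T\<^esub> \<alpha> (\<kappa> t)\<rbrakk> \<Longrightarrow> \<sigma> (\<gamma> y) = y"
  shows "homotopy_equivalent_complexes R gr K (concentrated A)"
proof (rule CD.K.eliminate_summand[OF A bimods(1,2,4) K_trivial E1_hom _ E2_hom P2_hom _ _ E4_hom P4_hom
    P2_E2 _ _ _ _ P4_E4 E4_P4_id alpha_hom _ gamma_hom _ _ diff_E2 _ \<kappa> \<sigma> \<kappa>_\<alpha> \<gamma>_\<sigma> \<kappa>_\<sigma> exact])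
  interpret A: gr_bimod R gr R gr A by (rule A)
  note zc = gr_hom_closed[OF z] gr_hom_closed[OF z'] gr_hom_closed[OF P3_hom] gr_hom_closed[OF beta_hom]
    gr_hom_closed[OF alpha_hom] gr_hom_closed[OF E2_hom] gr_hom_closed[OF E3_hom]
  show "\<exists>l\<in>carrier MM.T. x = E1 l" if "x \<in> carrier (obj K (- 1))" for x
    using E1_P1_id[OF that] gr_hom_closed[OF P1_hom that] by force
  show "(\<lambda>a. E3 (z' a)) \<in> gr_hom R R 0 A (obj K 0)" using gr_hom_comp[OF z' E3_hom] by simp
  show "(\<lambda>x. z (P3 x)) \<in> gr_hom R R 0 (obj K 0) A" using gr_hom_comp[OF P3_hom z] by simp
  show "z (P3 (E3 (z' a))) = a" "P2 (E3 (z' a)) = \<zero>\<^bsub>MN.T\<^esub>" if "a \<in> carrier A" for a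
    using that by (simp_all add: zc P3_E3 P2_E3 inv)
  show "z (P3 (E2 u)) = \<zero>\<^bsub>A\<^esub>" if "u \<in> carrier MN.T" for u
    using that gr_hom_zero[OF bimods(3) A z] by (simp add: P3_E2)
  show "x = E2 (P2 x) \<oplus>\<^bsub>obj K 0\<^esub> E3 (z' (z (P3 x)))" if "x \<in> carrier (obj K 0)" for x
    using E2_P2_E3_P3[OF that] inv(2)[OF zc(3)[OF that]] by simp
  show "(\<lambda>t. z (\<beta> t)) \<in> gr_hom R R 0 MM.T A" using gr_hom_comp[OF beta_hom z] by simp
  show "(\<lambda>a. \<ominus>\<^bsub>NN.T\<^esub> \<eta> (z' a)) \<in> gr_hom R R 0 A NN.T"
    using gr_hom_neg[OF bimods(4) gr_hom_comp[OF z' eta_hom]] by simp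
  show "diff K (- 1) (E1 l) = E2 (\<alpha> l) \<oplus>\<^bsub>obj K 0\<^esub> E3 (z' (z (\<beta> l)))" if "l \<in> carrier MM.T" for l
    using that p by (simp add: diff_E1 CD.sgn_def zc inv K0.a_comm)
  show "diff K 0 (E3 (z' v)) = E4 (\<ominus>\<^bsub>NN.T\<^esub> \<eta> (z' v))" if "v \<in> carrier A" for v
    using that p add_hom_minus[OF NN.T_abelian K0.is_abelian_group gr_hom_add_hom[OF E4_hom]]
    by (simp add: diff_E3 CD.sgn_def zc gr_hom_closed[OF eta_hom])
qed

text \<open>Here the corner \<open>M \<otimes> N'\<close> is kept. As \<open>p\<close> is odd, the sign is on \<open>\<alpha>\<close>, so that the edges \<open>\<beta>\<close> and
  \<open>\<eta>\<close> of the corner to be eliminated enter without signs.\<close>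

theorem contract_odd:
  fixes A :: "('a, 'b) bimodule"
  assumes p: "odd p" and A: "gr_bimod R gr R gr A"
    and z: "z \<in> gr_hom R R 0 MN.T A" and z': "z' \<in> gr_hom R R 0 A MN.T"
    and inv: "\<And>a. a \<in> carrier A \<Longrightarrow> z (z' a) = a" "\<And>t. t \<in> carrier MN.T \<Longrightarrow> z' (z t) = t"
    and \<kappa>: "\<kappa> \<in> gr_hom R R 0 NM.T MM.T" and \<sigma>: "\<sigma> \<in> gr_hom R R 0 NN.T NM.T"
    and \<kappa>_\<beta>: "\<And>t. t \<in> carrier MM.T \<Longrightarrow> \<kappa> (\<beta> t) = \<ominus>\<^bsub>MM.T\<^esub> t"
    and \<eta>_\<sigma>: "\<And>t. t \<in> carrier NN.T \<Longrightarrow> \<eta> (\<sigma> t) = t"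
    and \<kappa>_\<sigma>: "\<And>t. t \<in> carrier NN.T \<Longrightarrow> \<kappa> (\<sigma> t) = \<zero>\<^bsub>MM.T\<^esub>"
    and exact: "\<And>t y. \<lbrakk>t \<in> carrier NM.T; y = t \<oplus>\<^bsub>NM.T\<^esub> \<beta> (\<kappa> t)\<rbrakk> \<Longrightarrow> \<sigma> (\<eta> y) = y"
  shows "homotopy_equivalent_complexes R gr K (concentrated A)"
proof (rule CD.K.eliminate_summand[OF A bimods(1,3,4) K_trivial E1_hom _ E3_hom P3_hom _ _ E4_hom P4_hom
    P3_E3 _ _ _ _ P4_E4 E4_P4_id beta_hom _ eta_hom _ _ _ _ \<kappa> \<sigma> \<kappa>_\<beta> \<eta>_\<sigma> \<kappa>_\<sigma> exact])
  interpret A: gr_bimod R gr R gr A by (rule A)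
  note zc = gr_hom_closed[OF z] gr_hom_closed[OF z'] gr_hom_closed[OF P2_hom] gr_hom_closed[OF beta_hom]
    gr_hom_closed[OF alpha_hom] gr_hom_closed[OF E2_hom] gr_hom_closed[OF E3_hom] gr_hom_closed[OF P3_hom]
  show "\<exists>l\<in>carrier MM.T. x = E1 l" if "x \<in> carrier (obj K (- 1))" for x
    using E1_P1_id[OF that] gr_hom_closed[OF P1_hom that] by force
  show "(\<lambda>a. E2 (z' a)) \<in> gr_hom R R 0 A (obj K 0)" using gr_hom_comp[OF z' E2_hom] by simp
  show "(\<lambda>x. z (P2 x)) \<in> gr_hom R R 0 (obj K 0) A" using gr_hom_comp[OF P2_hom z] by simp
  show "z (P2 (E2 (z' a))) = a" "P3 (E2 (z' a)) = \<zero>\<^bsub>NM.T\<^esub>" if "a \<in> carrier A" for a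
    using that by (simp_all add: zc P2_E2 P3_E2 inv)
  show "z (P2 (E3 u)) = \<zero>\<^bsub>A\<^esub>" if "u \<in> carrier NM.T" for u
    using that gr_hom_zero[OF bimods(2) A z] by (simp add: P2_E3)
  show "x = E3 (P3 x) \<oplus>\<^bsub>obj K 0\<^esub> E2 (z' (z (P2 x)))" if x: "x \<in> carrier (obj K 0)" for x
    using E2_P2_E3_P3[OF x] inv(2)[OF zc(3)[OF x]] K0.a_comm[OF zc(6)[OF zc(3)[OF x]] zc(7)[OF zc(8)[OF x]]]
    by simp
  show "(\<lambda>t. z (\<ominus>\<^bsub>MN.T\<^esub> \<alpha> t)) \<in> gr_hom R R 0 MM.T A"
    using gr_hom_comp[OF gr_hom_neg[OF bimods(2) alpha_hom] z] by simp
  show "(\<lambda>a. \<gamma> (z' a)) \<in> gr_hom R R 0 A NN.T" using gr_hom_comp[OF z' gamma_hom] by simp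
  show "diff K (- 1) (E1 l) = E3 (\<beta> l) \<oplus>\<^bsub>obj K 0\<^esub> E2 (z' (z (\<ominus>\<^bsub>MN.T\<^esub> \<alpha> l)))" if "l \<in> carrier MM.T" for l
    using that p add_hom_minus[OF MN.T_abelian K0.is_abelian_group gr_hom_add_hom[OF E2_hom]]
    by (simp add: diff_E1 CD.sgn_def zc inv)
  show "diff K 0 (E3 u) = E4 (\<eta> u)" if "u \<in> carrier NM.T" for u
    using that p by (simp add: diff_E3 CD.sgn_def)
  show "diff K 0 (E2 (z' v)) = E4 (\<gamma> (z' v))" if "v \<in> carrier A" for v
    using that by (simp add: diff_E2 zc)
qed

end

section \<open>The free algebra on two generators\<close>

text \<open>Summation over the pairs with sum at most \<open>n\<close>, by diagonals and by rows. Associativity of the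
  product of the free algebra is an instance.\<close>

lemma (in abelian_monoid) finsum_triangle:
  fixes n :: nat
  assumes "\<And>i j. i + j \<le> n \<Longrightarrow> F i j \<in> carrier G"
  shows "(\<Oplus>i\<in>{..n}. \<Oplus>j\<in>{..i}. F j (i - j)) = (\<Oplus>j\<in>{..n}. \<Oplus>l\<in>{..n - j}. F j l)"
  using assms
proof (induction n)
  case 0
  then show ?case by simp
next
  case (Suc n)
  have c1: "(\<lambda>j. F j (i - j)) \<in> {..i} \<rightarrow> carrier G" if "i \<le> Suc n" for i
    using Suc.prems that by auto
  have c2: "(\<lambda>l. F j l) \<in> {..m} \<rightarrow> carrier G" if "j + m \<le> Suc n" for j m
    using Suc.prems that by auto
  have step: "(\<Oplus>l\<in>{..Suc n - j}. F j l) = F j (Suc n - j) \<oplus> (\<Oplus>l\<in>{..n - j}. F j l)" if "j \<le> n" for j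
  proof -
    have "Suc n - j = Suc (n - j)" using that by simp
    then show ?thesis using c2[of j "Suc (n - j)"] that by (simp only: finsum_Suc)
  qed
  have "(\<Oplus>i\<in>{..Suc n}. \<Oplus>j\<in>{..i}. F j (i - j)) =
      (\<Oplus>j\<in>{..Suc n}. F j (Suc n - j)) \<oplus> (\<Oplus>i\<in>{..n}. \<Oplus>j\<in>{..i}. F j (i - j))"
    using c1 by (simp add: finsum_Suc Pi_def)
  also have "\<dots> = (F (Suc n) 0 \<oplus> (\<Oplus>j\<in>{..n}. F j (Suc n - j))) \<oplus> (\<Oplus>j\<in>{..n}. \<Oplus>l\<in>{..n - j}. F j l)"
    using Suc.IH Suc.prems c1[of "Suc n"] by (simp add: finsum_Suc)
  also have "\<dots> = F (Suc n) 0 \<oplus> (\<Oplus>j\<in>{..n}. F j (Suc n - j) \<oplus> (\<Oplus>l\<in>{..n - j}. F j l))"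
    using Suc.prems by (subst finsum_addf) (auto simp: a_assoc Pi_def intro!: finsum_closed)
  also have "(\<Oplus>j\<in>{..n}. F j (Suc n - j) \<oplus> (\<Oplus>l\<in>{..n - j}. F j l)) = (\<Oplus>j\<in>{..n}. \<Oplus>l\<in>{..Suc n - j}. F j l)"
    by (rule finsum_cong') (use step Suc.prems in \<open>auto intro!: finsum_closed\<close>)
  also have "F (Suc n) 0 \<oplus> \<dots> = (\<Oplus>j\<in>{..Suc n}. \<Oplus>l\<in>{..Suc n - j}. F j l)"
    using Suc.prems by (simp add: finsum_Suc Pi_def)
  finally show ?case .
qed

locale odd_base = k: cring k for k :: "('k, 'c) ring_scheme"
begin

abbreviation FA where "FA \<equiv> free_algebra k"
abbreviation mono where "mono \<equiv> monomial k"

lemma FA_simps: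
  "f \<in> carrier FA \<longleftrightarrow> (\<forall>w. f w \<in> carrier k) \<and> finite {w. f w \<noteq> \<zero>\<^bsub>k\<^esub>}"
  "(f \<otimes>\<^bsub>FA\<^esub> g) w = (\<Oplus>\<^bsub>k\<^esub> i \<in> {..length w}. f (take i w) \<otimes>\<^bsub>k\<^esub> g (drop i w))"
  "\<one>\<^bsub>FA\<^esub> = mono \<one>\<^bsub>k\<^esub> []" "\<zero>\<^bsub>FA\<^esub> = (\<lambda>w. \<zero>\<^bsub>k\<^esub>)" "(f \<oplus>\<^bsub>FA\<^esub> g) = (\<lambda>w. f w \<oplus>\<^bsub>k\<^esub> g w)"
  by (simp_all add: free_algebra_def)

lemma FA_closed: "f \<in> carrier FA \<Longrightarrow> f w \<in> carrier k"
  by (simp add: FA_simps)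

lemma mono_closed: "a \<in> carrier k \<Longrightarrow> mono a w \<in> carrier FA"
  by (auto simp: FA_simps monomial_def)

lemma conv_closed: "f \<in> carrier FA \<Longrightarrow> g \<in> carrier FA \<Longrightarrow> f \<otimes>\<^bsub>FA\<^esub> g \<in> carrier FA"
proof -
  assume f: "f \<in> carrier FA" and g: "g \<in> carrier FA"
  let ?S = "\<lambda>f. {w. f w \<noteq> \<zero>\<^bsub>k\<^esub>}"
  have "(f \<otimes>\<^bsub>FA\<^esub> g) w = \<zero>\<^bsub>k\<^esub>" if "w \<notin> (\<lambda>(u, v). u @ v) ` (?S f \<times> ?S g)" for w
  proof -
    have "f (take i w) \<otimes>\<^bsub>k\<^esub> g (drop i w) = \<zero>\<^bsub>k\<^esub>" for i
    proof -
      have "f (take i w) = \<zero>\<^bsub>k\<^esub> \<or> g (drop i w) = \<zero>\<^bsub>k\<^esub>"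
      proof (rule ccontr)
        assume "\<not> ?thesis"
        then have "(take i w, drop i w) \<in> ?S f \<times> ?S g" by simp
        then show False using that by (metis (no_types, lifting) append_take_drop_id case_prod_conv image_eqI)
      qed
      then show ?thesis using FA_closed[OF f] FA_closed[OF g] by auto
    qed
    then show ?thesis by (simp add: FA_simps)
  qed
  then have "?S (f \<otimes>\<^bsub>FA\<^esub> g) \<subseteq> (\<lambda>(u, v). u @ v) ` (?S f \<times> ?S g)" by blast
  then have "finite (?S (f \<otimes>\<^bsub>FA\<^esub> g))"
    by (rule finite_subset) (use f g in \<open>simp add: FA_simps\<close>)
  then show ?thesis
    using FA_closed[OF f] FA_closed[OF g] unfolding FA_simps(1)
    by (auto simp: FA_simps(2) intro!: k.finsum_closed)
qed

lemma mono_mult_left: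
  assumes a: "a \<in> carrier k" and f: "f \<in> carrier FA"
  shows "(mono a u \<otimes>\<^bsub>FA\<^esub> f) w = (if take (length u) w = u then a \<otimes>\<^bsub>k\<^esub> f (drop (length u) w) else \<zero>\<^bsub>k\<^esub>)"
proof -
  note fc = FA_closed[OF f]
  have eq: "mono a u (take i w) \<otimes>\<^bsub>k\<^esub> f (drop i w) =
      (if length u = i then (if take i w = u then a \<otimes>\<^bsub>k\<^esub> f (drop i w) else \<zero>\<^bsub>k\<^esub>) else \<zero>\<^bsub>k\<^esub>)"
    if "i \<le> length w" for i
    using that a fc by (auto simp: monomial_def)
  have "(mono a u \<otimes>\<^bsub>FA\<^esub> f) w = (\<Oplus>\<^bsub>k\<^esub> i \<in> {..length w}.
      if length u = i then (if take i w = u then a \<otimes>\<^bsub>k\<^esub> f (drop i w) else \<zero>\<^bsub>k\<^esub>) else \<zero>\<^bsub>k\<^esub>)"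
    unfolding FA_simps(2) by (rule k.finsum_cong') (use a fc eq in auto)
  also have "\<dots> = (if take (length u) w = u then a \<otimes>\<^bsub>k\<^esub> f (drop (length u) w) else \<zero>\<^bsub>k\<^esub>)"
  proof (cases "length u \<le> length w")
    case True
    then show ?thesis using a fc by (subst k.finsum_singleton) auto
  next
    case False
    then have "take (length u) w \<noteq> u" by auto
    with False show ?thesis by (auto intro!: k.add.finprod_one_eqI)
  qed
  finally show ?thesis .
qed

lemma mono_mult_right:
  assumes a: "a \<in> carrier k" and f: "f \<in> carrier FA"
  shows "(f \<otimes>\<^bsub>FA\<^esub> mono a u) w = (if length u \<le> length w \<and> drop (length w - length u) w = u
    then f (take (length w - length u) w) \<otimes>\<^bsub>k\<^esub> a else \<zero>\<^bsub>k\<^esub>)"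
proof -
  note fc = FA_closed[OF f]
  let ?j = "length w - length u"
  have eq: "f (take i w) \<otimes>\<^bsub>k\<^esub> mono a u (drop i w) =
      (if ?j = i then (if length u \<le> length w \<and> drop i w = u then f (take i w) \<otimes>\<^bsub>k\<^esub> a else \<zero>\<^bsub>k\<^esub>) else \<zero>\<^bsub>k\<^esub>)"
    if "i \<le> length w" for i
    using that a fc by (auto simp: monomial_def)
  have "(f \<otimes>\<^bsub>FA\<^esub> mono a u) w = (\<Oplus>\<^bsub>k\<^esub> i \<in> {..length w}.
      if ?j = i then (if length u \<le> length w \<and> drop i w = u then f (take i w) \<otimes>\<^bsub>k\<^esub> a else \<zero>\<^bsub>k\<^esub>) else \<zero>\<^bsub>k\<^esub>)"
    unfolding FA_simps(2) by (rule k.finsum_cong') (use a fc eq in auto)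
  also have "\<dots> = (if length u \<le> length w \<and> drop ?j w = u then f (take ?j w) \<otimes>\<^bsub>k\<^esub> a else \<zero>\<^bsub>k\<^esub>)"
    using a fc by (subst k.finsum_singleton) auto
  finally show ?thesis .
qed

lemma mono_mult_mono:
  assumes "a \<in> carrier k" "b \<in> carrier k"
  shows "mono a u \<otimes>\<^bsub>FA\<^esub> mono b v = mono (a \<otimes>\<^bsub>k\<^esub> b) (u @ v)"
proof
  fix w
  have "take (length u) w = u \<and> drop (length u) w = v \<longleftrightarrow> w = u @ v"
    by (metis append_eq_conv_conj)
  then show "(mono a u \<otimes>\<^bsub>FA\<^esub> mono b v) w = mono (a \<otimes>\<^bsub>k\<^esub> b) (u @ v) w"
    using assms by (auto simp: mono_mult_left mono_closed) (auto simp: monomial_def)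
qed

lemma FA_ring: "ring FA"
proof (rule ringI)
  show "abelian_group FA"
  proof (rule abelian_groupI)
    fix f assume f: "f \<in> carrier FA"
    have "{w. \<ominus>\<^bsub>k\<^esub> f w \<noteq> \<zero>\<^bsub>k\<^esub>} \<subseteq> {w. f w \<noteq> \<zero>\<^bsub>k\<^esub>}" by auto
    then have "finite {w. \<ominus>\<^bsub>k\<^esub> f w \<noteq> \<zero>\<^bsub>k\<^esub>}" using f finite_subset by (auto simp: FA_simps)
    then show "\<exists>g\<in>carrier FA. g \<oplus>\<^bsub>FA\<^esub> f = \<zero>\<^bsub>FA\<^esub>"
      using f by (intro bexI[of _ "\<lambda>w. \<ominus>\<^bsub>k\<^esub> f w"]) (auto simp: FA_simps k.l_neg)
    fix g assume g: "g \<in> carrier FA"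
    have "{w. f w \<oplus>\<^bsub>k\<^esub> g w \<noteq> \<zero>\<^bsub>k\<^esub>} \<subseteq> {w. f w \<noteq> \<zero>\<^bsub>k\<^esub>} \<union> {w. g w \<noteq> \<zero>\<^bsub>k\<^esub>}" by auto
    then have "finite {w. f w \<oplus>\<^bsub>k\<^esub> g w \<noteq> \<zero>\<^bsub>k\<^esub>}"
      by (rule finite_subset) (use f g in \<open>simp add: FA_simps\<close>)
    then show "f \<oplus>\<^bsub>FA\<^esub> g \<in> carrier FA" using f g by (auto simp: FA_simps)
  qed (auto simp: FA_simps k.a_ac)
  show "Group.monoid FA"
  proof (rule monoidI)
    fix f g h assume f: "f \<in> carrier FA" and g: "g \<in> carrier FA" and h: "h \<in> carrier FA"
    note c = FA_closed[OF f] FA_closed[OF g] FA_closed[OF h]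
    show "f \<otimes>\<^bsub>FA\<^esub> g \<otimes>\<^bsub>FA\<^esub> h = f \<otimes>\<^bsub>FA\<^esub> (g \<otimes>\<^bsub>FA\<^esub> h)"
    proof
      fix w :: "gen list"
      let ?n = "length w"
      let ?F = "\<lambda>j l. f (take j w) \<otimes>\<^bsub>k\<^esub> (g (take l (drop j w)) \<otimes>\<^bsub>k\<^esub> h (drop (l + j) w))"
      have "(f \<otimes>\<^bsub>FA\<^esub> g \<otimes>\<^bsub>FA\<^esub> h) w = (\<Oplus>\<^bsub>k\<^esub> i\<in>{..?n}. \<Oplus>\<^bsub>k\<^esub> j\<in>{..i}. ?F j (i - j))"
        unfolding FA_simps(2)
      proof (rule k.finsum_cong')
        fix i assume i: "i \<in> {..?n}"
        have "(\<Oplus>\<^bsub>k\<^esub> j\<in>{..length (take i w)}. f (take j (take i w)) \<otimes>\<^bsub>k\<^esub> g (drop j (take i w))) \<otimes>\<^bsub>k\<^esub> h (drop i w)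
          = (\<Oplus>\<^bsub>k\<^esub> j\<in>{..i}. f (take j (take i w)) \<otimes>\<^bsub>k\<^esub> g (drop j (take i w)) \<otimes>\<^bsub>k\<^esub> h (drop i w))"
          using i c by (subst k.finsum_ldistr) (auto simp: min_absorb2)
        also have "\<dots> = (\<Oplus>\<^bsub>k\<^esub> j\<in>{..i}. ?F j (i - j))"
          by (rule k.finsum_cong') (use i c in \<open>auto simp: k.m_assoc min_absorb1 drop_take\<close>)
        finally show "(\<Oplus>\<^bsub>k\<^esub> j\<in>{..length (take i w)}. f (take j (take i w)) \<otimes>\<^bsub>k\<^esub> g (drop j (take i w))) \<otimes>\<^bsub>k\<^esub> h (drop i w)
          = (\<Oplus>\<^bsub>k\<^esub> j\<in>{..i}. ?F j (i - j))" .
      qed (use c in \<open>auto intro!: k.finsum_closed\<close>)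
      also have "\<dots> = (\<Oplus>\<^bsub>k\<^esub> j\<in>{..?n}. \<Oplus>\<^bsub>k\<^esub> l\<in>{..?n - j}. ?F j l)"
        by (rule k.finsum_triangle) (use c in auto)
      also have "\<dots> = (f \<otimes>\<^bsub>FA\<^esub> (g \<otimes>\<^bsub>FA\<^esub> h)) w"
        unfolding FA_simps(2)
        by (rule k.finsum_cong') (use c in \<open>auto simp: k.finsum_rdistr intro!: k.finsum_closed\<close>)
      finally show "(f \<otimes>\<^bsub>FA\<^esub> g \<otimes>\<^bsub>FA\<^esub> h) w = (f \<otimes>\<^bsub>FA\<^esub> (g \<otimes>\<^bsub>FA\<^esub> h)) w" .
    qed
  next
    fix f assume f: "f \<in> carrier FA"
    note c = FA_closed[OF f]
    show "\<one>\<^bsub>FA\<^esub> \<otimes>\<^bsub>FA\<^esub> f = f"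
      using f c by (auto simp: fun_eq_iff FA_simps(3) mono_mult_left)
    show "f \<otimes>\<^bsub>FA\<^esub> \<one>\<^bsub>FA\<^esub> = f"
      using f c by (auto simp: fun_eq_iff FA_simps(3) mono_mult_right)
  qed (auto simp: conv_closed FA_simps(3) mono_closed)
next
  fix f g h assume f: "f \<in> carrier FA" and g: "g \<in> carrier FA" and h: "h \<in> carrier FA"
  note c = FA_closed[OF f] FA_closed[OF g] FA_closed[OF h]
  show "(f \<oplus>\<^bsub>FA\<^esub> g) \<otimes>\<^bsub>FA\<^esub> h = f \<otimes>\<^bsub>FA\<^esub> h \<oplus>\<^bsub>FA\<^esub> g \<otimes>\<^bsub>FA\<^esub> h"
    using c by (auto simp: fun_eq_iff FA_simps k.l_distr k.finsum_addf Pi_def)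
  show "h \<otimes>\<^bsub>FA\<^esub> (f \<oplus>\<^bsub>FA\<^esub> g) = h \<otimes>\<^bsub>FA\<^esub> f \<oplus>\<^bsub>FA\<^esub> h \<otimes>\<^bsub>FA\<^esub> g"
    using c by (auto simp: fun_eq_iff FA_simps k.r_distr k.finsum_addf Pi_def)
qed

sublocale FA: ring FA by (rule FA_ring)

text \<open>The predicate \<open>Q\<close> keeps track of a property of the words that occur, in practice of their length, so
  that the rule also applies to homogeneous elements.\<close>

lemma FA_support_induct:
  assumes "f \<in> carrier FA" "\<And>w. f w \<noteq> \<zero>\<^bsub>k\<^esub> \<Longrightarrow> Q w"
    and "U \<zero>\<^bsub>FA\<^esub>" and "\<And>a w. a \<in> carrier k \<Longrightarrow> Q w \<Longrightarrow> U (mono a w)"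
    and add: "\<And>f g. \<lbrakk>f \<in> carrier FA; g \<in> carrier FA; U f; U g\<rbrakk> \<Longrightarrow> U (f \<oplus>\<^bsub>FA\<^esub> g)"
  shows "U f"
proof -
  have "U f" if "finite S" "f \<in> carrier FA" "{w. f w \<noteq> \<zero>\<^bsub>k\<^esub>} = S" "\<And>w. f w \<noteq> \<zero>\<^bsub>k\<^esub> \<Longrightarrow> Q w" for S f
    using that
  proof (induction S arbitrary: f rule: finite_induct)
    case empty
    then have "f = \<zero>\<^bsub>FA\<^esub>" by (auto simp: FA_simps)
    with assms(3) show ?case by simp
  next
    case (insert w S)
    let ?g = "f(w := \<zero>\<^bsub>k\<^esub>)"
    note fc = FA_closed[OF insert.prems(1)]
    have g: "{v. ?g v \<noteq> \<zero>\<^bsub>k\<^esub>} = S" using insert.prems(2) insert.hyps(2) by auto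
    have gc: "?g \<in> carrier FA"
      using g insert.hyps(1) fc unfolding FA_simps(1) by simp
    have "f = mono (f w) w \<oplus>\<^bsub>FA\<^esub> ?g" using fc by (auto simp: FA_simps monomial_def)
    moreover have "U ?g" by (rule insert.IH[OF gc g]) (use insert.prems(3) in \<open>auto split: if_splits\<close>)
    moreover have "Q w" using insert.prems by auto
    ultimately show ?case using add[OF mono_closed gc] assms(4) fc by metis
  qed
  from this[OF _ assms(1) refl assms(2)] show ?thesis using assms(1) by (simp add: FA_simps)
qed

lemma FA_induct [consumes 1, case_names zero mono add]:
  assumes "f \<in> carrier FA" "U \<zero>\<^bsub>FA\<^esub>" "\<And>a w. a \<in> carrier k \<Longrightarrow> U (mono a w)"
    and "\<And>f g. \<lbrakk>f \<in> carrier FA; g \<in> carrier FA; U f; U g\<rbrakk> \<Longrightarrow> U (f \<oplus>\<^bsub>FA\<^esub> g)"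
  shows "U f"
  by (rule FA_support_induct[where Q = "\<lambda>w. True", OF assms(1)]) (use assms in auto)

section \<open>The ring of odd polynomials\<close>

definition homog_part :: "int \<Rightarrow> (gen list \<Rightarrow> 'k) \<Rightarrow> gen list \<Rightarrow> 'k" where
  "homog_part n f = (\<lambda>w. if 2 * int (length w) = n then f w else \<zero>\<^bsub>k\<^esub>)"

lemma homog_part_closed: "f \<in> carrier FA \<Longrightarrow> homog_part n f \<in> carrier FA"
  by (auto simp: FA_simps homog_part_def elim!: rev_finite_subset)

lemma homog_part_add: "homog_part n (f \<oplus>\<^bsub>FA\<^esub> g) = homog_part n f \<oplus>\<^bsub>FA\<^esub> homog_part n g"
  by (auto simp: FA_simps homog_part_def)

lemma homog_part_zero: "homog_part n \<zero>\<^bsub>FA\<^esub> = \<zero>\<^bsub>FA\<^esub>"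
  by (auto simp: FA_simps homog_part_def)

lemma FA_inv: "f \<in> carrier FA \<Longrightarrow> \<ominus>\<^bsub>FA\<^esub> f = (\<lambda>w. \<ominus>\<^bsub>k\<^esub> f w)"
proof (rule FA.minus_equality)
  assume f: "f \<in> carrier FA"
  have "{w. \<ominus>\<^bsub>k\<^esub> f w \<noteq> \<zero>\<^bsub>k\<^esub>} \<subseteq> {w. f w \<noteq> \<zero>\<^bsub>k\<^esub>}" by auto
  then have "finite {w. \<ominus>\<^bsub>k\<^esub> f w \<noteq> \<zero>\<^bsub>k\<^esub>}" using f finite_subset by (auto simp: FA_simps)
  then show "(\<lambda>w. \<ominus>\<^bsub>k\<^esub> f w) \<in> carrier FA" using f by (simp add: FA_simps)
  show "(\<lambda>w. \<ominus>\<^bsub>k\<^esub> f w) \<oplus>\<^bsub>FA\<^esub> f = \<zero>\<^bsub>FA\<^esub>" using f by (auto simp: FA_simps k.l_neg)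
qed

lemma homog_part_minus: "f \<in> carrier FA \<Longrightarrow> homog_part n (\<ominus>\<^bsub>FA\<^esub> f) = \<ominus>\<^bsub>FA\<^esub> homog_part n f"
  by (auto simp: FA_inv homog_part_closed) (auto simp: homog_part_def)

abbreviation relator where
  "relator \<equiv> mono \<one>\<^bsub>k\<^esub> [X1, X2] \<oplus>\<^bsub>FA\<^esub> mono \<one>\<^bsub>k\<^esub> [X2, X1]"

abbreviation I where "I \<equiv> odd_ideal k"

lemma relator_closed: "relator \<in> carrier FA"
  by (simp add: mono_closed)

sublocale I: ideal I FA
  unfolding odd_ideal_def by (rule FA.genideal_ideal) (simp add: relator_closed)

lemma homog_part_mono_left:
  assumes "a \<in> carrier k" "f \<in> carrier FA"
  shows "homog_part n (mono a u \<otimes>\<^bsub>FA\<^esub> f) = mono a u \<otimes>\<^bsub>FA\<^esub> homog_part (n - 2 * int (length u)) f"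
proof
  fix w
  have "2 * int (length w) = n \<longleftrightarrow> 2 * int (length (drop (length u) w)) = n - 2 * int (length u)"
    if "take (length u) w = u"
  proof -
    have "length u \<le> length w" using that by (metis length_take min.cobounded1)
    then show ?thesis by (auto simp: of_nat_diff)
  qed
  then show "homog_part n (mono a u \<otimes>\<^bsub>FA\<^esub> f) w = (mono a u \<otimes>\<^bsub>FA\<^esub> homog_part (n - 2 * int (length u)) f) w"
    using assms by (simp add: mono_mult_left homog_part_closed) (auto simp: homog_part_def mono_mult_left)
qed

lemma homog_part_mono_right:
  assumes "a \<in> carrier k" "f \<in> carrier FA"
  shows "homog_part n (f \<otimes>\<^bsub>FA\<^esub> mono a u) = homog_part (n - 2 * int (length u)) f \<otimes>\<^bsub>FA\<^esub> mono a u"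
proof
  fix w :: "gen list"
  have "2 * int (length w) = n \<longleftrightarrow> 2 * int (length (take (length w - length u) w)) = n - 2 * int (length u)"
    if "length u \<le> length w"
    using that by (auto simp: of_nat_diff)
  then show "homog_part n (f \<otimes>\<^bsub>FA\<^esub> mono a u) w = (homog_part (n - 2 * int (length u)) f \<otimes>\<^bsub>FA\<^esub> mono a u) w"
    using assms by (simp add: mono_mult_right homog_part_closed) (auto simp: homog_part_def mono_mult_right)
qed

text \<open>The ideal contains the homogeneous parts of its elements: the elements with this property
  form an ideal, and the relator, being homogeneous, is one of them.\<close>

lemma homog_part_ideal:
  assumes "f \<in> I"
  shows "homog_part n f \<in> I"
proof -
  let ?J = "{f \<in> carrier FA. \<forall>n. homog_part n f \<in> I}"
  have left: "\<forall>n. homog_part n (a \<otimes>\<^bsub>FA\<^esub> f) \<in> I" if "f \<in> ?J" "a \<in> carrier FA" for f a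
    using that(2)
  proof (induction a rule: FA_induct)
    case (mono c u)
    then show ?case using that(1) by (auto simp: homog_part_mono_left intro!: I.I_l_closed mono_closed)
  next
    case (add a b)
    then show ?case using that(1) by (auto simp: FA.l_distr homog_part_add intro: I.a_closed)
  qed (use that(1) in \<open>auto simp: homog_part_zero\<close>)
  have right: "\<forall>n. homog_part n (f \<otimes>\<^bsub>FA\<^esub> a) \<in> I" if "f \<in> ?J" "a \<in> carrier FA" for f a
    using that(2)
  proof (induction a rule: FA_induct)
    case (mono c u)
    then show ?case using that(1) by (auto simp: homog_part_mono_right intro!: I.I_r_closed mono_closed)
  next
    case (add a b)
    then show ?case using that(1) by (auto simp: FA.r_distr homog_part_add intro: I.a_closed)
  qed (use that(1) in \<open>auto simp: homog_part_zero\<close>)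
  have "ideal ?J FA"
  proof (rule idealI[OF FA_ring])
    have "additive_subgroup ?J FA"
      by (rule additive_subgroupI[OF FA.abelian_group_axioms])
        (auto simp: homog_part_zero homog_part_add homog_part_minus intro: I.a_closed
          additive_subgroup_minus[OF I.additive_subgroup_axioms])
    then show "subgroup ?J (add_monoid FA)" by (rule additive_subgroup.a_subgroup)
  qed (use left right in auto)
  moreover have "relator \<in> ?J"
  proof -
    have "homog_part n relator = (if n = 4 then relator else \<zero>\<^bsub>FA\<^esub>)" for n
      by (auto simp: homog_part_def FA_simps monomial_def fun_eq_iff)
    moreover have "relator \<in> I" unfolding odd_ideal_def by (rule FA.genideal_self') (rule relator_closed)
    ultimately show ?thesis by (simp add: relator_closed)
  qed
  ultimately have "I \<subseteq> ?J" unfolding odd_ideal_def by (intro FA.genideal_minimal) auto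
  with assms show ?thesis by blast
qed

abbreviation R where "R \<equiv> odd_ring k"
abbreviation gr where "gr \<equiv> odd_grading k"
abbreviation x1 where "x1 \<equiv> odd_var k X1"
abbreviation x2 where "x2 \<equiv> odd_var k X2"

definition cls where "cls f = I +>\<^bsub>FA\<^esub> f"

lemma R_ring: "ring R"
  unfolding odd_ring_def by (rule I.quotient_is_ring)

sublocale R: ring R by (rule R_ring)

lemma cls_hom: "cls \<in> ring_hom FA R"
  unfolding odd_ring_def cls_def[abs_def] by (rule I.rcos_ring_hom)

lemma cls_closed: "f \<in> carrier FA \<Longrightarrow> cls f \<in> carrier R"
  and cls_add: "f \<in> carrier FA \<Longrightarrow> g \<in> carrier FA \<Longrightarrow> cls (f \<oplus>\<^bsub>FA\<^esub> g) = cls f \<oplus>\<^bsub>R\<^esub> cls g"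
  and cls_mult: "f \<in> carrier FA \<Longrightarrow> g \<in> carrier FA \<Longrightarrow> cls (f \<otimes>\<^bsub>FA\<^esub> g) = cls f \<otimes>\<^bsub>R\<^esub> cls g"
  and cls_one: "cls \<one>\<^bsub>FA\<^esub> = \<one>\<^bsub>R\<^esub>"
  using cls_hom by (auto simp: ring_hom_def)

lemma cls_add_hom: "add_hom FA R cls"
  by (intro add_homI cls_closed cls_add)

lemma cls_zero: "cls \<zero>\<^bsub>FA\<^esub> = \<zero>\<^bsub>R\<^esub>"
  by (rule add_hom_zero[OF FA.abelian_group_axioms R.abelian_group_axioms cls_add_hom])

lemma cls_minus: "f \<in> carrier FA \<Longrightarrow> cls (\<ominus>\<^bsub>FA\<^esub> f) = \<ominus>\<^bsub>R\<^esub> cls f"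
  by (rule add_hom_minus[OF FA.abelian_group_axioms R.abelian_group_axioms cls_add_hom])

lemma carrier_R: "carrier R = cls ` carrier FA"
  by (auto simp: odd_ring_def cls_def FactRing_def A_RCOSETS_def' )

lemma cls_eq: "f \<in> carrier FA \<Longrightarrow> g \<in> carrier FA \<Longrightarrow> cls f = cls g \<longleftrightarrow> f \<ominus>\<^bsub>FA\<^esub> g \<in> I"
  unfolding cls_def using FA.quotient_eq_iff_same_a_r_cos[OF I.ideal_axioms] by blast

lemma gr_eq: "gr n = cls ` {f \<in> carrier FA. \<forall>w. f w \<noteq> \<zero>\<^bsub>k\<^esub> \<longrightarrow> 2 * int (length w) = n}"
  by (simp add: odd_grading_def cls_def[abs_def])

text \<open>The projection to degree \<open>n\<close>. The choice of the representative is immaterial because the ideal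
  contains the homogeneous parts of its elements.\<close>

definition proj where "proj n x = cls (homog_part n (SOME f. f \<in> carrier FA \<and> cls f = x))"

lemma proj_cls: "f \<in> carrier FA \<Longrightarrow> proj n (cls f) = cls (homog_part n f)"
proof -
  assume f: "f \<in> carrier FA"
  define g where "g = (SOME g. g \<in> carrier FA \<and> cls g = cls f)"
  have g: "g \<in> carrier FA \<and> cls g = cls f"
    unfolding g_def by (rule someI[of _ f]) (simp add: f)
  then have "g \<ominus>\<^bsub>FA\<^esub> f \<in> I" using cls_eq f by blast
  then have "homog_part n (g \<ominus>\<^bsub>FA\<^esub> f) \<in> I" by (rule homog_part_ideal)
  then have "homog_part n g \<ominus>\<^bsub>FA\<^esub> homog_part n f \<in> I"
    using f g by (simp add: a_minus_def homog_part_add homog_part_minus)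
  then show ?thesis using f g cls_eq by (simp add: proj_def g_def[symmetric] homog_part_closed)
qed

lemma gr_mono: "a \<in> carrier k \<Longrightarrow> cls (mono a w) \<in> gr (2 * int (length w))"
  unfolding gr_eq using mono_closed[of a w] by (intro imageI) (auto simp: monomial_def)

lemma graded_group_R: "graded_group R gr"
proof (rule graded_groupI[where pr = proj])
  show "abelian_group R" by (rule R.abelian_group_axioms)
  show "additive_subgroup (gr n) R" for n
  proof (rule additive_subgroupI[OF R.abelian_group_axioms])
    show "gr n \<subseteq> carrier R" by (auto simp: gr_eq cls_closed)
    show "\<zero>\<^bsub>R\<^esub> \<in> gr n" unfolding gr_eq cls_zero[symmetric] by (rule imageI) (simp add: FA_simps(4) del: FA.zero_closed, simp add: FA_simps)
    fix x assume "x \<in> gr n"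
    then obtain f where f: "x = cls f" "f \<in> carrier FA" "\<forall>w. f w \<noteq> \<zero>\<^bsub>k\<^esub> \<longrightarrow> 2 * int (length w) = n"
      by (auto simp: gr_eq)
    have "\<ominus>\<^bsub>FA\<^esub> f \<in> {f \<in> carrier FA. \<forall>w. f w \<noteq> \<zero>\<^bsub>k\<^esub> \<longrightarrow> 2 * int (length w) = n}"
      using f by (auto simp: FA_inv[OF f(2)] simp flip: FA_inv[OF f(2)]) (metis FA_inv k.a_inv_zero)
    then show "\<ominus>\<^bsub>R\<^esub> x \<in> gr n" unfolding gr_eq f(1) cls_minus[OF f(2), symmetric] by (rule imageI)
    fix y assume "y \<in> gr n"
    then obtain g where g: "y = cls g" "g \<in> carrier FA" "\<forall>w. g w \<noteq> \<zero>\<^bsub>k\<^esub> \<longrightarrow> 2 * int (length w) = n"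
      by (auto simp: gr_eq)
    have "f \<oplus>\<^bsub>FA\<^esub> g \<in> {f \<in> carrier FA. \<forall>w. f w \<noteq> \<zero>\<^bsub>k\<^esub> \<longrightarrow> 2 * int (length w) = n}"
      using f g FA.a_closed[OF f(2) g(2)] by (auto simp: FA_simps(5)) (metis k.l_zero k.zero_closed)
    then show "x \<oplus>\<^bsub>R\<^esub> y \<in> gr n" unfolding gr_eq f(1) g(1) cls_add[OF f(2) g(2), symmetric] by (rule imageI)
  qed
  show "add_generates R (\<Union>n. gr n)"
  proof (rule add_generatesI)
    fix U x
    assume H: "\<And>g. g \<in> (\<Union>i. gr i) \<Longrightarrow> U g"
      and sums: "\<And>x y. \<lbrakk>x \<in> carrier R; y \<in> carrier R; U x; U y\<rbrakk> \<Longrightarrow> U (x \<oplus>\<^bsub>R\<^esub> y)"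
      and x: "x \<in> carrier R"
    then obtain f where "x = cls f" "f \<in> carrier FA" by (auto simp: carrier_R)
    moreover have "U (cls f)" if "f \<in> carrier FA" for f using that
    proof (induction f rule: FA_induct)
      case zero
      have "\<zero>\<^bsub>FA\<^esub> = mono \<zero>\<^bsub>k\<^esub> []" by (auto simp: FA_simps monomial_def)
      then show ?case using H gr_mono[of "\<zero>\<^bsub>k\<^esub>" "[]"] by auto
    next
      case (mono a w)
      then show ?case using H gr_mono by blast
    next
      case (add f g)
      then show ?case by (simp add: cls_add cls_closed sums)
    qed
    ultimately show "U x" by simp
  qed
  show "add_hom R R (proj n)" for n
    by (rule add_homI)
      (auto simp: carrier_R proj_cls homog_part_closed homog_part_add proj_cls[OF FA.a_closed] simp flip: cls_add)
  fix m x assume "x \<in> gr m"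
  then obtain f where f: "x = cls f" "f \<in> carrier FA" "\<forall>w. f w \<noteq> \<zero>\<^bsub>k\<^esub> \<longrightarrow> 2 * int (length w) = m"
    by (auto simp: gr_eq)
  then have part: "homog_part n f = (if n = m then f else \<zero>\<^bsub>FA\<^esub>)" for n
    by (auto simp: homog_part_def FA_simps fun_eq_iff)
  then show "proj m x = x" using f by (simp add: proj_cls)
  show "proj n x = \<zero>\<^bsub>R\<^esub>" if "m \<noteq> n" for n using f part that by (simp add: proj_cls cls_zero)
qed

sublocale G: graded_group R gr by (rule graded_group_R)

lemma gr_mult: "x \<in> gr i \<Longrightarrow> y \<in> gr j \<Longrightarrow> x \<otimes>\<^bsub>R\<^esub> y \<in> gr (i + j)"
proof -
  assume "x \<in> gr i" "y \<in> gr j"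
  then obtain f g where f: "x = cls f" "f \<in> carrier FA" "\<And>w. f w \<noteq> \<zero>\<^bsub>k\<^esub> \<Longrightarrow> 2 * int (length w) = i"
    and g: "y = cls g" "g \<in> carrier FA" "\<And>w. g w \<noteq> \<zero>\<^bsub>k\<^esub> \<Longrightarrow> 2 * int (length w) = j"
    by (auto simp: gr_eq)
  have "2 * int (length w) = i + j" if "(f \<otimes>\<^bsub>FA\<^esub> g) w \<noteq> \<zero>\<^bsub>k\<^esub>" for w
  proof (rule ccontr)
    assume w: "2 * int (length w) \<noteq> i + j"
    have "f (take l w) \<otimes>\<^bsub>k\<^esub> g (drop l w) = \<zero>\<^bsub>k\<^esub>" if "l \<le> length w" for l
    proof -
      have "f (take l w) = \<zero>\<^bsub>k\<^esub> \<or> g (drop l w) = \<zero>\<^bsub>k\<^esub>"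
      proof (rule ccontr)
        assume "\<not> ?thesis"
        then have "2 * int (length (take l w)) = i" "2 * int (length (drop l w)) = j"
          using f(3)[of "take l w"] g(3)[of "drop l w"] by blast+
        then show False using w that by (auto simp: of_nat_diff)
      qed
      then show ?thesis using FA_closed[OF f(2)] FA_closed[OF g(2)] by auto
    qed
    then have "(f \<otimes>\<^bsub>FA\<^esub> g) w = \<zero>\<^bsub>k\<^esub>" by (auto simp: FA_simps(2) intro!: k.add.finprod_one_eqI)
    with that show False by simp
  qed
  then show ?thesis unfolding gr_eq f(1) g(1) cls_mult[OF f(2) g(2), symmetric]
    by (intro imageI) (simp add: conv_closed f(2) g(2))
qed

lemma const_eq: "odd_const k a = cls (mono a [])" and var_eq: "odd_var k v = cls (mono \<one>\<^bsub>k\<^esub> [v])"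
  by (simp_all add: odd_const_def odd_var_def cls_def)

lemma const_closed: "a \<in> carrier k \<Longrightarrow> odd_const k a \<in> carrier R" and var_closed: "odd_var k v \<in> carrier R"
  by (simp_all add: const_eq var_eq cls_closed mono_closed)

lemma var_homog: "odd_var k v \<in> gr 2"
  using gr_mono[of "\<one>\<^bsub>k\<^esub>" "[v]"] by (simp add: var_eq)

lemma word_Cons: "a \<in> carrier k \<Longrightarrow> cls (mono a (v # w)) = odd_var k v \<otimes>\<^bsub>R\<^esub> cls (mono a w)"
  by (simp add: var_eq mono_mult_mono mono_closed flip: cls_mult)

lemma homog_word_induct [consumes 1, case_names zero word add]:
  assumes "x \<in> gr n" and "U \<zero>\<^bsub>R\<^esub>"
    and "\<And>a w. a \<in> carrier k \<Longrightarrow> 2 * int (length w) = n \<Longrightarrow> U (cls (mono a w))"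
    and add: "\<And>x y. \<lbrakk>x \<in> carrier R; y \<in> carrier R; U x; U y\<rbrakk> \<Longrightarrow> U (x \<oplus>\<^bsub>R\<^esub> y)"
  shows "U x"
proof -
  obtain f where f: "x = cls f" "f \<in> carrier FA" "\<And>w. f w \<noteq> \<zero>\<^bsub>k\<^esub> \<Longrightarrow> 2 * int (length w) = n"
    using assms(1) by (auto simp: gr_eq)
  have "U (cls f)"
    by (rule FA_support_induct[where U = "\<lambda>f. U (cls f)", OF f(2,3)])
      (auto simp: cls_zero cls_add cls_closed assms)
  then show ?thesis by (simp add: f)
qed

lemma word_induct [consumes 1, case_names const var add]:
  assumes "x \<in> carrier R" and const: "\<And>a. a \<in> carrier k \<Longrightarrow> U (odd_const k a)"
    and var: "\<And>v x. x \<in> carrier R \<Longrightarrow> U x \<Longrightarrow> U (odd_var k v \<otimes>\<^bsub>R\<^esub> x)"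
    and add: "\<And>x y. \<lbrakk>x \<in> carrier R; y \<in> carrier R; U x; U y\<rbrakk> \<Longrightarrow> U (x \<oplus>\<^bsub>R\<^esub> y)"
  shows "U x"
proof -
  have word: "U (cls (mono a w))" if "a \<in> carrier k" for a w
    by (induction w) (use that in \<open>simp_all add: const[unfolded const_eq] var word_Cons cls_closed mono_closed\<close>)
  have "\<zero>\<^bsub>R\<^esub> = cls (mono \<zero>\<^bsub>k\<^esub> [])"
    by (simp add: monomial_def cls_zero[symmetric] FA_simps)
  then have "U \<zero>\<^bsub>R\<^esub>" using word by simp
  from assms(1) show ?thesis
    by (rule G.homog_induct) (use homog_word_induct[of _ _ U] \<open>U \<zero>\<^bsub>R\<^esub>\<close> word add in blast)+
qed

lemma regular: "gr_bimod R gr R gr (odd_regular k)"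
proof -
  have eqs: "carrier (odd_regular k) = carrier R" "ring.zero (odd_regular k) = \<zero>\<^bsub>R\<^esub>"
    "ring.add (odd_regular k) = ring.add R" "homog (odd_regular k) = gr"
    "lact (odd_regular k) = monoid.mult R" "ract (odd_regular k) = monoid.mult R"
    by (simp_all add: regular_bimodule_def)
  have "graded_group (odd_regular k) (homog (odd_regular k))"
    using graded_group_cong_shift[OF eqs(1-3) graded_group_R, of 0] by (simp add: eqs(4))
  then show ?thesis
    by (intro gr_bimod.intro gr_bimod_axioms.intro R_ring)
      (auto simp: eqs R.l_distr R.r_distr R.m_assoc gr_mult G.H_closed)
qed

end

section \<open>The odd Demazure operator\<close>

locale odd_setting = odd_base k for k :: "('k, 'c) ring_scheme" +
  fixes s \<delta> :: "(gen list \<Rightarrow> 'k) set \<Rightarrow> (gen list \<Rightarrow> 'k) set"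
  assumes swap: "odd_swap k s" and demazure: "odd_demazure k s \<delta>"
begin

lemma s_closed: "x \<in> carrier R \<Longrightarrow> s x \<in> carrier R"
  and s_add: "x \<in> carrier R \<Longrightarrow> y \<in> carrier R \<Longrightarrow> s (x \<oplus>\<^bsub>R\<^esub> y) = s x \<oplus>\<^bsub>R\<^esub> s y"
  and s_mult: "x \<in> carrier R \<Longrightarrow> y \<in> carrier R \<Longrightarrow> s (x \<otimes>\<^bsub>R\<^esub> y) = s x \<otimes>\<^bsub>R\<^esub> s y"
  and s_one: "s \<one>\<^bsub>R\<^esub> = \<one>\<^bsub>R\<^esub>"
  and s_const: "a \<in> carrier k \<Longrightarrow> s (odd_const k a) = odd_const k a"
  and s_x1: "s x1 = \<ominus>\<^bsub>R\<^esub> x2" and s_x2: "s x2 = \<ominus>\<^bsub>R\<^esub> x1"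
  using swap by (auto simp: odd_swap_def ring_iso_def ring_hom_def)

lemma s_add_hom: "add_hom R R s"
  by (intro add_homI s_closed s_add)

lemma s_minus: "x \<in> carrier R \<Longrightarrow> s (\<ominus>\<^bsub>R\<^esub> x) = \<ominus>\<^bsub>R\<^esub> s x"
  by (rule add_hom_minus[OF R.abelian_group_axioms R.abelian_group_axioms s_add_hom])

lemma s_zero: "s \<zero>\<^bsub>R\<^esub> = \<zero>\<^bsub>R\<^esub>"
  by (rule add_hom_zero[OF R.abelian_group_axioms R.abelian_group_axioms s_add_hom])

lemma d_closed: "x \<in> carrier R \<Longrightarrow> \<delta> x \<in> carrier R"
  and d_add: "x \<in> carrier R \<Longrightarrow> y \<in> carrier R \<Longrightarrow> \<delta> (x \<oplus>\<^bsub>R\<^esub> y) = \<delta> x \<oplus>\<^bsub>R\<^esub> \<delta> y"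
  and d_linear: "a \<in> carrier k \<Longrightarrow> x \<in> carrier R \<Longrightarrow> \<delta> (odd_const k a \<otimes>\<^bsub>R\<^esub> x) = odd_const k a \<otimes>\<^bsub>R\<^esub> \<delta> x"
  and d_one: "\<delta> \<one>\<^bsub>R\<^esub> = \<zero>\<^bsub>R\<^esub>" and d_x1: "\<delta> x1 = \<one>\<^bsub>R\<^esub>" and d_x2: "\<delta> x2 = \<one>\<^bsub>R\<^esub>"
  and d_mult: "x \<in> carrier R \<Longrightarrow> y \<in> carrier R \<Longrightarrow>
    \<delta> (x \<otimes>\<^bsub>R\<^esub> y) = \<delta> x \<otimes>\<^bsub>R\<^esub> y \<oplus>\<^bsub>R\<^esub> s x \<otimes>\<^bsub>R\<^esub> \<delta> y"
  using demazure by (auto simp: odd_demazure_def)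

lemma d_add_hom: "add_hom R R \<delta>"
  by (intro add_homI d_closed d_add)

lemma d_minus: "x \<in> carrier R \<Longrightarrow> \<delta> (\<ominus>\<^bsub>R\<^esub> x) = \<ominus>\<^bsub>R\<^esub> \<delta> x"
  by (rule add_hom_minus[OF R.abelian_group_axioms R.abelian_group_axioms d_add_hom])

lemma d_zero: "\<delta> \<zero>\<^bsub>R\<^esub> = \<zero>\<^bsub>R\<^esub>"
  by (rule add_hom_zero[OF R.abelian_group_axioms R.abelian_group_axioms d_add_hom])

lemma d_const: "a \<in> carrier k \<Longrightarrow> \<delta> (odd_const k a) = \<zero>\<^bsub>R\<^esub>"
  using d_linear[of a "\<one>\<^bsub>R\<^esub>"] const_closed[of a] by (simp add: d_one)

lemma d_var: "\<delta> (odd_var k v) = \<one>\<^bsub>R\<^esub>"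
  by (cases v) (simp_all add: d_x1 d_x2)

text \<open>The form in which the inductions on words below use \<open>s\<close>. It covers both generators at once, as
  \<open>d_var\<close> does for \<open>\<delta>\<close>.\<close>

lemma s_var: "\<exists>w. s (odd_var k v) = \<ominus>\<^bsub>R\<^esub> odd_var k w \<and> s (odd_var k w) = \<ominus>\<^bsub>R\<^esub> odd_var k v"
  by (cases v) (auto simp: s_x1 s_x2)

lemma s_s: "x \<in> carrier R \<Longrightarrow> s (s x) = x"
proof (induction x rule: word_induct)
  case (var v x)
  obtain w where "s (odd_var k v) = \<ominus>\<^bsub>R\<^esub> odd_var k w" "s (odd_var k w) = \<ominus>\<^bsub>R\<^esub> odd_var k v"
    using s_var by blast
  with var show ?case by (simp add: s_mult s_closed s_minus var_closed)
qed (simp_all add: s_const s_add s_closed)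

lemma d_s: "x \<in> carrier R \<Longrightarrow> \<delta> (s x) = \<ominus>\<^bsub>R\<^esub> s (\<delta> x)"
proof (induction x rule: word_induct)
  case (const a)
  then show ?case by (simp add: s_const d_const s_zero)
next
  case (var v x)
  obtain w where "s (odd_var k v) = \<ominus>\<^bsub>R\<^esub> odd_var k w" "s (odd_var k w) = \<ominus>\<^bsub>R\<^esub> odd_var k v"
    using s_var by blast
  with var show ?case
    by (simp add: s_mult s_closed s_minus s_add d_mult d_minus d_closed d_var var_closed
        R.l_minus R.r_minus R.minus_add)
next
  case (add x y)
  then show ?case by (simp add: s_add d_add s_closed d_closed R.minus_add)
qed

lemma d_d: "x \<in> carrier R \<Longrightarrow> \<delta> (\<delta> x) = \<zero>\<^bsub>R\<^esub>"
proof (induction x rule: word_induct)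
  case (const a)
  then show ?case by (simp add: d_const d_zero)
next
  case (var v x)
  obtain w where "s (odd_var k v) = \<ominus>\<^bsub>R\<^esub> odd_var k w" "s (odd_var k w) = \<ominus>\<^bsub>R\<^esub> odd_var k v"
    using s_var by blast
  with var show ?case
    by (simp add: s_closed s_minus d_add d_mult d_minus d_closed d_var var_closed R.l_minus R.r_neg)
next
  case (add x y)
  then show ?case by (simp add: d_add d_closed)
qed

lemma s_homog: "x \<in> gr n \<Longrightarrow> s x \<in> gr n"
proof (induction x rule: homog_word_induct)
  case zero
  show ?case unfolding s_zero by (rule additive_subgroup_zero[OF G.H_subgroup])
next
  case (word a w)
  have "s (cls (mono a w)) \<in> gr (2 * int (length w))" for w
  proof (induction w)
    case Nil
    show ?case using s_const[OF word(1)] gr_mono[OF word(1), of "[]"] by (simp add: const_eq)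
  next
    case (Cons v w)
    obtain u where u: "s (odd_var k v) = \<ominus>\<^bsub>R\<^esub> odd_var k u" using s_var by blast
    have "\<ominus>\<^bsub>R\<^esub> odd_var k u \<in> gr 2" by (rule additive_subgroup_minus[OF G.H_subgroup var_homog])
    from gr_mult[OF this Cons] show ?case
      using word(1) u by (simp add: word_Cons s_mult var_closed cls_closed mono_closed)
  qed
  with word(2) show ?case by blast
next
  case (add x y)
  then show ?case by (simp add: s_add additive_subgroup_add[OF G.H_subgroup])
qed

lemma d_homog: "x \<in> gr n \<Longrightarrow> \<delta> x \<in> gr (n - 2)"
proof (induction x rule: homog_word_induct)
  case zero
  show ?case unfolding d_zero by (rule additive_subgroup_zero[OF G.H_subgroup])
next
  case (word a w)
  have "\<delta> (cls (mono a w)) \<in> gr (2 * int (length w) - 2)" for w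
  proof (induction w)
    case Nil
    show ?case using d_const[OF word(1)] additive_subgroup_zero[OF G.H_subgroup] by (simp add: const_eq)
  next
    case (Cons v w)
    obtain u where u: "s (odd_var k v) = \<ominus>\<^bsub>R\<^esub> odd_var k u" using s_var by blast
    have "\<ominus>\<^bsub>R\<^esub> odd_var k u \<in> gr 2" by (rule additive_subgroup_minus[OF G.H_subgroup var_homog])
    from additive_subgroup_add[OF G.H_subgroup gr_mono[OF word(1), of w]] gr_mult[OF this Cons]
    show ?case
      using word(1) u by (simp add: word_Cons d_mult d_var var_closed cls_closed mono_closed)
  qed
  with word(2) show ?case by blast
next
  case (add x y)
  then show ?case by (simp add: d_add additive_subgroup_add[OF G.H_subgroup])
qed

subsection \<open>The invariants\<close>

abbreviation S where "S \<equiv> odd_invariants k \<delta>"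
abbreviation grS where "grS \<equiv> \<lambda>i. gr i \<inter> carrier S"

lemma carrier_S: "r \<in> carrier S \<longleftrightarrow> r \<in> carrier R \<and> \<delta> r = \<zero>\<^bsub>R\<^esub>"
  by (simp add: odd_invariants_def)

lemma S_simps [simp]: "monoid.mult S = monoid.mult R" "ring.add S = ring.add R"
  "monoid.one S = monoid.one R" "ring.zero S = ring.zero R"
  by (simp_all add: odd_invariants_def)

lemma S_ring: "ring S"
proof -
  have "subring {f \<in> carrier R. \<delta> f = \<zero>\<^bsub>R\<^esub>} R"
    by (rule R.subringI) (auto simp: d_one d_minus d_mult d_add s_closed d_closed)
  then show ?thesis unfolding odd_invariants_def by (rule R.subring_is_ring)
qed

lemma S_in_R: "r \<in> carrier S \<Longrightarrow> r \<in> carrier R"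
  by (simp add: carrier_S)

lemma s_in_S: "r \<in> carrier S \<Longrightarrow> s r \<in> carrier S"
  by (simp add: carrier_S s_closed d_s s_zero)

lemma d_in_S: "x \<in> carrier R \<Longrightarrow> \<delta> x \<in> carrier S"
  by (simp add: carrier_S d_closed d_d)

lemma d_right: "x \<in> carrier R \<Longrightarrow> r \<in> carrier S \<Longrightarrow> \<delta> (x \<otimes>\<^bsub>R\<^esub> r) = \<delta> x \<otimes>\<^bsub>R\<^esub> r"
  by (simp add: carrier_S d_mult s_closed d_closed)

lemma d_left: "x \<in> carrier R \<Longrightarrow> r \<in> carrier S \<Longrightarrow> \<delta> (r \<otimes>\<^bsub>R\<^esub> x) = s r \<otimes>\<^bsub>R\<^esub> \<delta> x"
  by (simp add: carrier_S d_mult s_closed d_closed)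

text \<open>As \<open>\<delta>\<close> is homogeneous, the components of an invariant are invariant, so the invariants are generated
  by homogeneous elements.\<close>

lemma component_d:
  assumes "x \<in> carrier R"
  shows "\<delta> (component R gr i x) = component R gr (i - 2) (\<delta> x)"
  using assms
proof (induction x rule: G.homog_induct)
  case (homog j x)
  then show ?case
    using G.component_of_homog[OF homog, of i] G.component_of_homog[OF d_homog[OF homog], of "i - 2"]
    by (simp add: d_zero)
next
  case (add x y)
  then show ?case
    by (simp add: add_hom_add[OF G.component_add_hom] G.component_closed d_add d_closed)
qed

lemma component_S: "r \<in> carrier S \<Longrightarrow> component R gr i r \<in> carrier S"
proof -
  assume r: "r \<in> carrier S"
  have "component R gr (i - 2) \<zero>\<^bsub>R\<^esub> = \<zero>\<^bsub>R\<^esub>"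
    by (rule add_hom_zero[OF R.abelian_group_axioms R.abelian_group_axioms G.component_add_hom])
  with r show ?thesis by (simp add: carrier_S G.component_closed component_d)
qed

lemma S_generated: "add_generates S (\<Union>i. grS i)"
proof (rule add_generatesI)
  interpret S: ring S by (rule S_ring)
  fix U r assume H: "\<And>g. g \<in> (\<Union>i. grS i) \<Longrightarrow> U g"
    and add: "\<And>x y. \<lbrakk>x \<in> carrier S; y \<in> carrier S; U x; U y\<rbrakk> \<Longrightarrow> U (x \<oplus>\<^bsub>S\<^esub> y)"
    and r: "r \<in> carrier S"
  let ?c = "\<lambda>i. component R gr i r"
  note rR = S_in_R[OF r]
  have "(\<Oplus>\<^bsub>R\<^esub> i \<in> J. ?c i) \<in> carrier S \<and> U (\<Oplus>\<^bsub>R\<^esub> i \<in> J. ?c i)" if "finite J" for J using that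
  proof (induction J rule: finite_induct)
    case empty
    have "\<zero>\<^bsub>R\<^esub> \<in> gr 0" by (rule additive_subgroup_zero[OF G.H_subgroup])
    then show ?case using H S.zero_closed by auto
  next
    case (insert i J)
    have "?c \<in> J \<rightarrow> carrier R" "?c i \<in> carrier R" using G.component_closed[OF rR] by auto
    moreover have "U (?c i)" "?c i \<in> carrier S" using H G.component_homog[OF rR] component_S[OF r] by blast+
    ultimately show ?case using insert add[of "?c i"] S.a_closed[of "?c i"] by simp
  qed
  from this[OF G.component_finite[OF rR]] show "U r" by (simp add: G.component_sum[OF rR])
qed

sublocale E: graded_extension R gr S grS
  by (rule graded_extension.intro[OF regular G.H_generates S_ring])
    (use S_generated gr_mono[of "\<one>\<^bsub>k\<^esub>" "[]"] in \<open>auto simp: S_in_R cls_one[unfolded FA_simps(3)]\<close>)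

text \<open>As \<open>\<delta> x\<close> is invariant too, every element is a combination of \<open>1\<close> and \<open>x\<^sub>2\<close>, and one of \<open>1\<close> and
  \<open>x\<^sub>1\<close>, with invariant right coefficients. The coefficient of \<open>1\<close> is the one that slides through the
  tensor products below.\<close>

lemma invariant_part_x2: "x \<in> carrier R \<Longrightarrow> x \<ominus>\<^bsub>R\<^esub> x2 \<otimes>\<^bsub>R\<^esub> \<delta> x \<in> carrier S"
  by (simp add: carrier_S var_closed d_closed R.minus_eq d_add d_minus d_mult d_x2 d_d s_closed R.r_neg)

lemma invariant_part_x1: "x \<in> carrier R \<Longrightarrow> x \<ominus>\<^bsub>R\<^esub> x1 \<otimes>\<^bsub>R\<^esub> \<delta> x \<in> carrier S"
  by (simp add: carrier_S var_closed d_closed R.minus_eq d_add d_minus d_mult d_x1 d_d s_closed R.r_neg)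

text \<open>These two identities make the contractions work. For the maps \<open>l (f \<otimes> e \<otimes> g) = s (\<delta> f) g\<close> and
  \<open>l' (f \<otimes> e \<otimes> g) = f \<delta> g\<close> on the twisted bimodule they say \<open>l (x \<Delta>(1)) = - x\<close> and
  \<open>l' (\<Delta>(1) x) = - x\<close>.\<close>

lemma s_d_mult_x2: "x \<in> carrier R \<Longrightarrow> s (\<delta> (x \<otimes>\<^bsub>R\<^esub> x2)) \<oplus>\<^bsub>R\<^esub> s (\<delta> x) \<otimes>\<^bsub>R\<^esub> x1 = x"
  by (simp add: d_mult var_closed d_closed s_closed d_x2 s_add s_mult s_x2 s_s R.r_minus R.a_ac R.r_neg1 R.r_neg2 R.r_neg R.l_neg)

lemma d_x1_mult: "x \<in> carrier R \<Longrightarrow> x2 \<otimes>\<^bsub>R\<^esub> \<delta> x \<oplus>\<^bsub>R\<^esub> \<delta> (x1 \<otimes>\<^bsub>R\<^esub> x) = x"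
  by (simp add: d_mult var_closed d_closed s_closed d_x1 s_x1 R.l_minus R.a_ac R.r_neg1 R.r_neg2 R.r_neg R.l_neg)

subsection \<open>The twisted bimodule\<close>

abbreviation Tw where "Tw \<equiv> twisted_invariants k s \<delta>"

lemma Tw_simps [simp]:
  "carrier Tw = carrier S" "ring.zero Tw = \<zero>\<^bsub>R\<^esub>" "ring.add Tw = ring.add R"
  "lact Tw f g = s f \<otimes>\<^bsub>R\<^esub> g" "ract Tw g f = g \<otimes>\<^bsub>R\<^esub> f" "homog Tw = grS"
  by (simp_all add: twisted_invariants_def)

lemma Tw_bimod: "gr_bimod S grS S grS Tw"
proof -
  interpret S: ring S by (rule S_ring)
  have ab: "abelian_group Tw"
    by (rule abelian_group_cong[OF _ _ _ S.abelian_group_axioms]) simp_all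
  have neg: "\<ominus>\<^bsub>Tw\<^esub> x = \<ominus>\<^bsub>R\<^esub> x" if "x \<in> carrier S" for x
    by (rule abelian_group.minus_equality[OF ab])
      (use that in \<open>simp_all add: S_in_R R.l_neg carrier_S d_minus\<close>)
  have "graded_group Tw (homog Tw)"
  proof (rule graded_groupI[where pr = "component R gr"])
    show "abelian_group Tw" by (rule ab)
    show "additive_subgroup (homog Tw i) Tw" for i
    proof (rule additive_subgroupI[OF ab])
      fix x y assume "x \<in> homog Tw i" "y \<in> homog Tw i"
      then show "x \<oplus>\<^bsub>Tw\<^esub> y \<in> homog Tw i"
        using additive_subgroup_add[OF G.H_subgroup] S.a_closed by simp
    next
      fix x assume "x \<in> homog Tw i"
      then show "\<ominus>\<^bsub>Tw\<^esub> x \<in> homog Tw i"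
        using additive_subgroup_minus[OF G.H_subgroup] by (simp add: neg) (simp add: carrier_S d_minus)
    qed (use S.zero_closed additive_subgroup_zero[OF G.H_subgroup] in auto)
    show "add_generates Tw (\<Union>i. homog Tw i)"
      using S_generated by (simp add: add_generates_def)
    show "add_hom Tw Tw (component R gr i)" for i
      using add_hom_add[OF G.component_add_hom] S_in_R component_S by (intro add_homI) simp_all
  qed (auto simp: G.component_of_homog)
  then show ?thesis
    by (intro gr_bimod.intro gr_bimod_axioms.intro S_ring)
      (auto simp: S_in_R s_in_S s_closed s_add s_mult s_one R.l_distr R.r_distr R.m_assoc gr_mult s_homog
        S.m_closed[simplified])
qed

end

section \<open>The bimodules of the odd Rouquier complexes\<close>

context odd_setting
begin

abbreviation A where "A \<equiv> odd_regular k"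
abbreviation B where "B \<equiv> tensor S A A"
abbreviation ATw where "ATw \<equiv> tensor S A Tw"
abbreviation T where "T \<equiv> tensor S ATw A"
abbreviation b where "b \<equiv> pure_tensor S A A"
abbreviation t where "t \<equiv> odd_twisted_pure k s \<delta>"

lemma A_RS: "gr_bimod R gr S grS A" and A_SR: "gr_bimod S grS R gr A" and A_SS: "gr_bimod S grS S grS A"
  using E.restrict_left E.restrict_right regular by blast+

sublocale B: tensor_pair R gr S grS R gr A A
  by (rule E.tensor_pair_S[OF A_RS A_SR])

sublocale ATw: tensor_pair R gr S grS S grS A Tw
  by (rule E.tensor_pair_S[OF A_RS Tw_bimod])

sublocale T: tensor_pair R gr S grS R gr ATw A
  by (rule E.tensor_pair_S[OF ATw.gr_bimod_T A_SR])

lemma T_bimod: "gr_bimod R gr R gr T" by (rule T.gr_bimod_T)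
lemma B_bimod: "gr_bimod R gr R gr B" by (rule B.gr_bimod_T)

sublocale TT: gr_bimod R gr R gr T by (rule T_bimod)
sublocale BB: gr_bimod R gr R gr B by (rule B_bimod)

lemma one_S: "\<one>\<^bsub>R\<^esub> \<in> carrier S" by (simp add: carrier_S d_one)

lemma t_eq: "t f g = T.pt (ATw.pt f \<one>\<^bsub>R\<^esub>) g"
  by (simp add: odd_twisted_pure_def)

lemma at_closed: "f \<in> carrier R \<Longrightarrow> w \<in> carrier S \<Longrightarrow> ATw.pt f w \<in> carrier ATw"
  by (rule ATw.pure_closed) simp_all

lemma t_closed: "f \<in> carrier R \<Longrightarrow> g \<in> carrier R \<Longrightarrow> t f g \<in> carrier T"
  unfolding t_eq by (intro T.pure_closed at_closed one_S) simp_all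

lemma b_closed: "f \<in> carrier R \<Longrightarrow> g \<in> carrier R \<Longrightarrow> b f g \<in> carrier B"
  by (rule B.pure_closed) simp_all

lemma t_add_left: "f \<in> carrier R \<Longrightarrow> f' \<in> carrier R \<Longrightarrow> g \<in> carrier R \<Longrightarrow>
    t (f \<oplus>\<^bsub>R\<^esub> f') g = t f g \<oplus>\<^bsub>T\<^esub> t f' g"
  unfolding t_eq using ATw.pure_add_left[of f f' "\<one>\<^bsub>R\<^esub>"] at_closed one_S by (simp add: T.pure_add_left)

lemma t_add_right: "f \<in> carrier R \<Longrightarrow> g \<in> carrier R \<Longrightarrow> g' \<in> carrier R \<Longrightarrow>
    t f (g \<oplus>\<^bsub>R\<^esub> g') = t f g \<oplus>\<^bsub>T\<^esub> t f g'"
  unfolding t_eq using T.pure_add_right[of "ATw.pt f \<one>\<^bsub>R\<^esub>" g g'] at_closed one_S by simp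

lemma R_inv_A: "\<ominus>\<^bsub>A\<^esub> f = \<ominus>\<^bsub>R\<^esub> f"
  using a_inv_cong[of A R] by simp

lemma t_minus_left: "f \<in> carrier R \<Longrightarrow> g \<in> carrier R \<Longrightarrow> t (\<ominus>\<^bsub>R\<^esub> f) g = \<ominus>\<^bsub>T\<^esub> t f g"
  unfolding t_eq using ATw.pure_minus_left[of f "\<one>\<^bsub>R\<^esub>"] at_closed one_S
  by (simp add: T.pure_minus_left R_inv_A)

lemma t_diff_left: "f \<in> carrier R \<Longrightarrow> f' \<in> carrier R \<Longrightarrow> g \<in> carrier R \<Longrightarrow>
    t (f \<ominus>\<^bsub>R\<^esub> f') g = t f g \<ominus>\<^bsub>T\<^esub> t f' g"
  by (simp add: a_minus_def t_add_left t_minus_left)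

lemma t_minus_right: "f \<in> carrier R \<Longrightarrow> g \<in> carrier R \<Longrightarrow> t f (\<ominus>\<^bsub>R\<^esub> g) = \<ominus>\<^bsub>T\<^esub> t f g"
  unfolding t_eq using T.pure_minus_right[of "ATw.pt f \<one>\<^bsub>R\<^esub>" g] at_closed one_S by (simp add: R_inv_A)

lemma t_diff_right: "f \<in> carrier R \<Longrightarrow> g \<in> carrier R \<Longrightarrow> g' \<in> carrier R \<Longrightarrow>
    t f (g \<ominus>\<^bsub>R\<^esub> g') = t f g \<ominus>\<^bsub>T\<^esub> t f g'"
  by (simp add: a_minus_def t_add_right t_minus_right)

lemma t_lact: "a \<in> carrier R \<Longrightarrow> f \<in> carrier R \<Longrightarrow> g \<in> carrier R \<Longrightarrow> lact T a (t f g) = t (a \<otimes>\<^bsub>R\<^esub> f) g"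
  unfolding t_eq using at_closed one_S by (simp add: T.lact_pure ATw.lact_pure)

lemma t_ract: "a \<in> carrier R \<Longrightarrow> f \<in> carrier R \<Longrightarrow> g \<in> carrier R \<Longrightarrow> ract T (t f g) a = t f (g \<otimes>\<^bsub>R\<^esub> a)"
  unfolding t_eq using at_closed one_S by (simp add: T.ract_pure)

lemma at_move: "f \<in> carrier R \<Longrightarrow> r \<in> carrier S \<Longrightarrow> ATw.pt (f \<otimes>\<^bsub>R\<^esub> r) \<one>\<^bsub>R\<^esub> = ATw.pt f (s r)"
  using ATw.pure_balanced[of f r "\<one>\<^bsub>R\<^esub>"] one_S by (simp add: S_in_R s_closed)

lemma t_move: "f \<in> carrier R \<Longrightarrow> r \<in> carrier S \<Longrightarrow> g \<in> carrier R \<Longrightarrow>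
    t (f \<otimes>\<^bsub>R\<^esub> r) g = t f (s r \<otimes>\<^bsub>R\<^esub> g)"
  unfolding t_eq
  using at_move[of f r] T.pure_balanced[of "ATw.pt f \<one>\<^bsub>R\<^esub>" "s r" g] at_closed[of f "\<one>\<^bsub>R\<^esub>"] one_S s_in_S[of r]
    ATw.ract_pure[of "s r" f "\<one>\<^bsub>R\<^esub>"]
  by (simp add: S_in_R s_closed)

lemma t_homog: "f \<in> gr i \<Longrightarrow> g \<in> gr j \<Longrightarrow> t f g \<in> homog T (i + j)"
  unfolding t_eq
  using T.homog_pure[OF ATw.homog_pure[of f i "\<one>\<^bsub>R\<^esub>" 0], of g j] E.one_homog one_S by simp

text \<open>The middle factor can be made \<open>1\<close>: \<open>f \<otimes> w = f s(w) \<otimes> 1\<close>, since \<open>s\<close> is an involution.\<close>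

lemma T_generated: "add_generates T {t f g | f g. f \<in> carrier R \<and> g \<in> carrier R}"
proof (rule add_generatesI)
  fix U x
  assume gen: "\<And>x. x \<in> {t f g | f g. f \<in> carrier R \<and> g \<in> carrier R} \<Longrightarrow> U x"
    and sums: "\<And>x y. \<lbrakk>x \<in> carrier T; y \<in> carrier T; U x; U y\<rbrakk> \<Longrightarrow> U (x \<oplus>\<^bsub>T\<^esub> y)"
    and x: "x \<in> carrier T"
  have "U (T.pt u g)" if "u \<in> carrier ATw" "g \<in> carrier R" for u g
    using that(1)
  proof (induction u rule: ATw.tensor_induct)
    case (pure f w)
    then have "ATw.pt f w = ATw.pt (f \<otimes>\<^bsub>R\<^esub> s w) \<one>\<^bsub>R\<^esub>"
      using at_move[of f "s w"] s_in_S[of w] s_s[of w] by (simp add: S_in_R)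
    moreover have "f \<otimes>\<^bsub>R\<^esub> s w \<in> carrier R" using pure by (simp add: s_closed S_in_R)
    then have "U (t (f \<otimes>\<^bsub>R\<^esub> s w) g)" using that(2) gen by blast
    ultimately show ?case by (simp add: t_eq)
  next
    case (add u v)
    then show ?case using that(2) sums
      by (simp add: T.pure_add_left T.pure_closed)
  qed
  with x show "U x" by (induction x rule: T.tensor_induct) (simp_all add: sums)
qed

lemma T_eqI:
  assumes "add_hom T L \<phi>" "add_hom T L \<psi>" "u \<in> carrier T"
    and "\<And>f g. f \<in> carrier R \<Longrightarrow> g \<in> carrier R \<Longrightarrow> \<phi> (t f g) = \<psi> (t f g)"
  shows "\<phi> u = \<psi> u"
  using T_generated assms(3)
  by (induction u rule: add_generates_induct)
    (use assms(4) in \<open>auto simp: add_hom_add[OF assms(1)] add_hom_add[OF assms(2)]\<close>)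

text \<open>A map out of the twisted bimodule that is linear over \<open>R\<close> on the right is determined by its values
  \<open>\<psi> f\<close> on \<open>f \<otimes> e \<otimes> 1\<close>, and the relations through the generator \<open>e\<close> amount to the condition \<open>move\<close>. The
  ring \<open>P\<close> acting on the left will be \<open>S\<close> or \<open>R\<close>.\<close>

lemma T_lift_right:
  assumes L: "gr_bimod P grP R gr L" and AP: "gr_bimod P grP R gr A"
    and hom: "add_hom A L \<psi>"
    and left: "\<And>a f. a \<in> carrier P \<Longrightarrow> f \<in> carrier R \<Longrightarrow> \<psi> (a \<otimes>\<^bsub>R\<^esub> f) = lact L a (\<psi> f)"
    and move: "\<And>f r. f \<in> carrier R \<Longrightarrow> r \<in> carrier S \<Longrightarrow> \<psi> (f \<otimes>\<^bsub>R\<^esub> r) = ract L (\<psi> f) (s r)"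
    and homog: "\<And>f i. f \<in> gr i \<Longrightarrow> \<psi> f \<in> homog L (i + d)"
  shows "\<exists>h \<in> gr_hom P R d T L. \<forall>f \<in> carrier R. \<forall>g \<in> carrier R. h (t f g) = ract L (\<psi> f) g"
proof -
  interpret L: gr_bimod P grP R gr L by fact
  have LS: "gr_bimod P grP S grS L" by (rule E.restrict_right[OF L])
  interpret PA: tensor_pair P grP S grS S grS A Tw
    by (rule E.tensor_pair_S[OF E.restrict_right[OF AP] Tw_bimod])
  interpret PT: tensor_pair P grP S grS R gr ATw A
    by (rule E.tensor_pair_S[OF PA.gr_bimod_T A_SR])
  have \<psi>: "\<psi> f \<in> carrier L" if "f \<in> carrier R" for f using add_hom_closed[OF hom, of f] that by simp
  have \<psi>_add: "\<psi> (f \<oplus>\<^bsub>R\<^esub> f') = \<psi> f \<oplus>\<^bsub>L\<^esub> \<psi> f'" if "f \<in> carrier R" "f' \<in> carrier R" for f f'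
    using add_hom_add[OF hom, of f f'] that by simp
  let ?i = "tensor_lift L (\<lambda>f w. ract L (\<psi> f) w)"
  have \<psi>_homog: "ract L (\<psi> f) w \<in> homog L (i + j + d)" if "f \<in> gr i" "w \<in> gr j" for f w i j
    using L.ract_homog[OF that(2) homog[OF that(1)]] by (simp add: algebra_simps)
  have inner: "?i \<in> gr_hom P S d ATw L" "\<And>f w. f \<in> carrier A \<Longrightarrow> w \<in> carrier Tw \<Longrightarrow> ?i (PA.pt f w) = ract L (\<psi> f) w"
    by (rule PA.tensor_lift_hom[OF LS, where d = d];
      auto simp: \<psi> \<psi>_add \<psi>_homog S_in_R L.ract_closed L.ract_add_left L.ract_add_right
        move s_closed L.ract_assoc left L.lact_ract)+
  let ?o = "tensor_lift L (\<lambda>u g. ract L (?i u) g)"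
  have i_homog: "ract L (?i u) g \<in> homog L (i + j + d)" if "u \<in> homog ATw i" "g \<in> gr j" for u g i j
    using L.ract_homog[OF that(2) gr_hom_homog[OF inner(1) that(1)]] by (simp add: algebra_simps)
  have outer: "?o \<in> gr_hom P R d T L" "\<And>u g. u \<in> carrier ATw \<Longrightarrow> g \<in> carrier A \<Longrightarrow> ?o (PT.pt u g) = ract L (?i u) g"
    by (rule PT.tensor_lift_hom[OF L, where d = d];
      auto simp: i_homog gr_hom_closed[OF inner(1)] gr_hom_add[OF inner(1)] gr_hom_lact[OF inner(1)] gr_hom_ract[OF inner(1)]
          S_in_R L.ract_closed L.ract_add_left L.ract_add_right L.ract_assoc L.lact_ract)+
  show ?thesis
  proof (intro bexI[OF _ outer(1)] ballI)
    fix f g assume fg: "f \<in> carrier R" "g \<in> carrier R"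
    then have "?o (t f g) = ract L (ract L (\<psi> f) \<one>\<^bsub>R\<^esub>) g"
      unfolding t_eq using outer(2)[OF at_closed[OF fg(1) one_S], of g] inner(2)[of f "\<one>\<^bsub>R\<^esub>"] one_S by simp
    then show "?o (t f g) = ract L (\<psi> f) g" using \<psi> fg by (simp add: L.ract_one)
  qed
qed

text \<open>The mirror image: the map is determined by its values \<open>\<psi> g\<close> on \<open>1 \<otimes> e \<otimes> g\<close>. The inner map absorbs
  the middle factor \<open>w\<close> into the left one, as \<open>f s(w)\<close>.\<close>

lemma T_lift_left:
  assumes L: "gr_bimod R gr Q grQ L" and AQ: "gr_bimod R gr Q grQ A"
    and hom: "add_hom A L \<psi>"
    and right: "\<And>a g. a \<in> carrier Q \<Longrightarrow> g \<in> carrier R \<Longrightarrow> \<psi> (g \<otimes>\<^bsub>R\<^esub> a) = ract L (\<psi> g) a"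
    and move: "\<And>g r. g \<in> carrier R \<Longrightarrow> r \<in> carrier S \<Longrightarrow> \<psi> (r \<otimes>\<^bsub>R\<^esub> g) = lact L (s r) (\<psi> g)"
    and homog: "\<And>g i. g \<in> gr i \<Longrightarrow> \<psi> g \<in> homog L (i + d)"
  shows "\<exists>h \<in> gr_hom R Q d T L. \<forall>f \<in> carrier R. \<forall>g \<in> carrier R. h (t f g) = lact L f (\<psi> g)"
proof -
  interpret L: gr_bimod R gr Q grQ L by fact
  interpret TQ: tensor_pair R gr S grS Q grQ ATw A
    by (rule E.tensor_pair_S[OF ATw.gr_bimod_T E.restrict_left[OF AQ]])
  have \<psi>: "\<psi> f \<in> carrier L" if "f \<in> carrier R" for f using add_hom_closed[OF hom, of f] that by simp
  have \<psi>_add: "\<psi> (f \<oplus>\<^bsub>R\<^esub> f') = \<psi> f \<oplus>\<^bsub>L\<^esub> \<psi> f'" if "f \<in> carrier R" "f' \<in> carrier R" for f f'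
    using add_hom_add[OF hom, of f f'] that by simp
  let ?i = "tensor_lift A (\<lambda>f w. f \<otimes>\<^bsub>R\<^esub> s w)"
  have inner: "add_hom ATw A ?i" "\<And>f w. f \<in> carrier A \<Longrightarrow> w \<in> carrier Tw \<Longrightarrow> ?i (ATw.pt f w) = f \<otimes>\<^bsub>R\<^esub> s w"
    by (rule ATw.tensor_lift_add[OF E.A.is_abelian_group];
      auto simp: S_in_R s_closed R.l_distr R.r_distr s_add s_mult s_s R.m_assoc)+
  have ic: "?i u \<in> carrier R" if "u \<in> carrier ATw" for u using add_hom_closed[OF inner(1) that] by simp
  have iadd: "?i (u \<oplus>\<^bsub>ATw\<^esub> v) = ?i u \<oplus>\<^bsub>R\<^esub> ?i v" if "u \<in> carrier ATw" "v \<in> carrier ATw" for u v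
    using add_hom_add[OF inner(1) that] by simp
  have il: "?i (lact ATw a u) = a \<otimes>\<^bsub>R\<^esub> ?i u" if "a \<in> carrier R" "u \<in> carrier ATw" for a u
    using that(2)
    by (induction u rule: ATw.tensor_induct)
      (use that(1) in \<open>simp_all add: ATw.lact_pure inner(2)[simplified] R.m_assoc s_closed S_in_R iadd ic
        add_hom_add[OF ATw.lact_T_add_hom] add_hom_closed[OF ATw.lact_T_add_hom] R.r_distr\<close>)
  have ir: "?i (ract ATw u r) = ?i u \<otimes>\<^bsub>R\<^esub> s r" if "r \<in> carrier S" "u \<in> carrier ATw" for r u
    using that(2)
  proof (induction u rule: ATw.tensor_induct)
    case (pure f w)
    then show ?case using that(1) inner(2)[of f "w \<otimes>\<^bsub>R\<^esub> r"] inner(2)[of f w] ring.ring_simprules(5)[OF S_ring, of w r]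
      by (simp add: ATw.ract_pure R.m_assoc s_closed S_in_R s_mult)
  next
    case (add u v)
    then show ?case using that(1)
      by (simp add: iadd ic add_hom_add[OF ATw.ract_T_add_hom] add_hom_closed[OF ATw.ract_T_add_hom] R.l_distr s_closed S_in_R)
  qed
  have ih: "?i u \<in> gr i" if "u \<in> homog ATw i" for u i
    by (rule ATw.homog_T_induct[OF inner(1) _ E.A.is_abelian_group _ that])
      (use E.A.H_subgroup in \<open>auto simp: inner(2)[simplified] G.H_closed gr_mult s_homog\<close>)
  let ?o = "tensor_lift L (\<lambda>u g. lact L (?i u) (\<psi> g))"
  have outer: "?o \<in> gr_hom R Q d T L" "\<And>u g. u \<in> carrier ATw \<Longrightarrow> g \<in> carrier A \<Longrightarrow> ?o (TQ.pt u g) = lact L (?i u) (\<psi> g)"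
    by (rule TQ.tensor_lift_hom[OF L, where d = d];
      use L.lact_homog[OF ih homog] in
        \<open>auto simp: \<psi> \<psi>_add ic iadd il ir L.lact_closed L.lact_add_left L.lact_add_right L.lact_assoc L.lact_ract
          S_in_R s_closed move right add.assoc\<close>)+
  show ?thesis
  proof (intro bexI[OF _ outer(1)] ballI)
    fix f g assume fg: "f \<in> carrier R" "g \<in> carrier R"
    then have "?o (t f g) = lact L (f \<otimes>\<^bsub>R\<^esub> s \<one>\<^bsub>R\<^esub>) (\<psi> g)"
      unfolding t_eq using outer(2)[OF at_closed[OF fg(1) one_S], of g] inner(2)[of f "\<one>\<^bsub>R\<^esub>"] one_S by simp
    then show "?o (t f g) = lact L f (\<psi> g)" using fg by (simp add: s_one)
  qed
qed

subsection \<open>The two differentials\<close>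

lemma m_hom: "odd_m k \<in> gr_hom R R 0 B A"
  and m_pure: "f \<in> carrier R \<Longrightarrow> g \<in> carrier R \<Longrightarrow> odd_m k (b f g) = f \<otimes>\<^bsub>R\<^esub> g"
proof -
  have eq: "odd_m k = tensor_lift R (monoid.mult R)" by (simp add: fun_eq_iff odd_m_def tensor_lift_def)
  have lift: "add_hom B R (odd_m k)" "\<And>f g. f \<in> carrier A \<Longrightarrow> g \<in> carrier A \<Longrightarrow> odd_m k (b f g) = f \<otimes>\<^bsub>R\<^esub> g"
    unfolding eq
    by (rule B.tensor_lift_add[OF R.abelian_group_axioms]; simp add: R.l_distr R.r_distr R.m_assoc S_in_R)+
  have pure: "odd_m k (b f g) = f \<otimes>\<^bsub>R\<^esub> g" if "f \<in> carrier R" "g \<in> carrier R" for f g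
    using lift(2) that by simp
  then show "f \<in> carrier R \<Longrightarrow> g \<in> carrier R \<Longrightarrow> odd_m k (b f g) = f \<otimes>\<^bsub>R\<^esub> g" .
  have hom: "add_hom B A (odd_m k)" using lift(1) by (simp add: add_hom_def)
  show "odd_m k \<in> gr_hom R R 0 B A"
  proof (rule gr_homI[OF hom])
    fix a x assume ax: "a \<in> carrier R" "x \<in> carrier B"
    show "odd_m k (lact B a x) = lact A a (odd_m k x)"
      by (rule B.add_hom_eqI[OF add_hom_comp[OF B.lact_T_add_hom hom] add_hom_comp[OF hom E.A.lact_add_hom] _ ax(2)])
        (use ax in \<open>simp_all add: B.lact_pure pure R.m_assoc\<close>)
    show "odd_m k (ract B x a) = ract A (odd_m k x) a"
      by (rule B.add_hom_eqI[OF add_hom_comp[OF B.ract_T_add_hom hom] add_hom_comp[OF hom E.A.ract_add_hom] _ ax(2)])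
        (use ax in \<open>simp_all add: B.ract_pure pure R.m_assoc\<close>)
  next
    fix i x assume x: "x \<in> homog B i"
    have "odd_m k x \<in> gr i"
      by (rule B.homog_T_induct[OF lift(1) G.H_subgroup R.abelian_group_axioms _ x])
        (auto simp: pure G.H_closed gr_mult)
    then show "odd_m k x \<in> homog A (i + 0)" by simp
  qed
qed

text \<open>The element \<open>\<Delta>(1)\<close>.\<close>

definition D where "D = t (\<ominus>\<^bsub>R\<^esub> x2) \<one>\<^bsub>R\<^esub> \<ominus>\<^bsub>T\<^esub> t \<one>\<^bsub>R\<^esub> x1"

abbreviation Delta where "Delta \<equiv> odd_Delta k s \<delta>"

lemma Delta_eq: "Delta f = lact T f D"
  by (simp add: odd_Delta_def odd_B_twisted_def D_def a_minus_def)

lemma D_eq: "D = \<ominus>\<^bsub>T\<^esub> t x2 \<one>\<^bsub>R\<^esub> \<ominus>\<^bsub>T\<^esub> t \<one>\<^bsub>R\<^esub> x1"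
  by (simp add: D_def t_minus_left var_closed)

lemma D_closed: "D \<in> carrier T"
  by (simp add: D_eq t_closed var_closed)

lemma D_homog: "D \<in> homog T 2"
proof -
  have "t x2 \<one>\<^bsub>R\<^esub> \<in> homog T 2" "t \<one>\<^bsub>R\<^esub> x1 \<in> homog T 2"
    using t_homog[OF var_homog E.one_homog, of X2] t_homog[OF E.one_homog var_homog, of X1] by simp_all
  then show ?thesis unfolding D_eq a_minus_def
    by (intro additive_subgroup_add[OF TT.H_subgroup] additive_subgroup_minus[OF TT.H_subgroup])
qed

lemma lact_D: "f \<in> carrier R \<Longrightarrow> lact T f D = \<ominus>\<^bsub>T\<^esub> t (f \<otimes>\<^bsub>R\<^esub> x2) \<one>\<^bsub>R\<^esub> \<ominus>\<^bsub>T\<^esub> t f x1"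
  by (simp add: D_eq a_minus_def TT.lact_add_right TT.lact_minus t_closed t_lact var_closed)

lemma ract_D: "f \<in> carrier R \<Longrightarrow> ract T D f = \<ominus>\<^bsub>T\<^esub> t x2 f \<ominus>\<^bsub>T\<^esub> t \<one>\<^bsub>R\<^esub> (x1 \<otimes>\<^bsub>R\<^esub> f)"
  by (simp add: D_eq a_minus_def TT.ract_add_left TT.ract_minus t_closed t_ract var_closed)

lemma const_central: "a \<in> carrier k \<Longrightarrow> x \<in> carrier R \<Longrightarrow> odd_const k a \<otimes>\<^bsub>R\<^esub> x = x \<otimes>\<^bsub>R\<^esub> odd_const k a"
proof -
  assume a: "a \<in> carrier k" and "x \<in> carrier R"
  then obtain f where f: "x = cls f" "f \<in> carrier FA" by (auto simp: carrier_R)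
  have "mono a [] \<otimes>\<^bsub>FA\<^esub> f = f \<otimes>\<^bsub>FA\<^esub> mono a []"
    using a f FA_closed[OF f(2)] by (auto simp: fun_eq_iff mono_mult_left mono_mult_right k.m_comm)
  then show ?thesis using a f by (simp add: const_eq mono_closed flip: cls_mult)
qed

lemma y_S: "x1 \<ominus>\<^bsub>R\<^esub> x2 \<in> carrier S" and x12_S: "x1 \<otimes>\<^bsub>R\<^esub> x2 \<in> carrier S" and x21_S: "x2 \<otimes>\<^bsub>R\<^esub> x1 \<in> carrier S"
  by (simp_all add: carrier_S var_closed R.minus_eq d_add d_minus d_mult d_x1 d_x2 s_x1 s_x2 R.r_neg)

lemma s_y: "s (x1 \<ominus>\<^bsub>R\<^esub> x2) = x1 \<ominus>\<^bsub>R\<^esub> x2"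
  and s_x12: "s (x1 \<otimes>\<^bsub>R\<^esub> x2) = x2 \<otimes>\<^bsub>R\<^esub> x1" and s_x21: "s (x2 \<otimes>\<^bsub>R\<^esub> x1) = x1 \<otimes>\<^bsub>R\<^esub> x2"
  by (simp_all add: var_closed R.minus_eq s_add s_minus s_mult s_x1 s_x2 R.l_minus R.r_minus R.a_comm)

text \<open>The map \<open>\<Delta>\<close> respects the right action precisely because \<open>\<Delta>(1)\<close> commutes with \<open>R\<close>. For the generators
  of \<open>R\<close> this follows by moving across \<open>e\<close> the invariant \<open>x\<^sub>1 - x\<^sub>2\<close>, which \<open>s\<close> fixes, and the invariants
  \<open>x\<^sub>1 x\<^sub>2\<close> and \<open>x\<^sub>2 x\<^sub>1\<close>, which \<open>s\<close> interchanges.\<close>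

lemma x1_D: "lact T x1 D = ract T D x1"
proof -
  note [simp] = var_closed
  have "t (x1 \<ominus>\<^bsub>R\<^esub> x2) x1 = t \<one>\<^bsub>R\<^esub> ((x1 \<ominus>\<^bsub>R\<^esub> x2) \<otimes>\<^bsub>R\<^esub> x1)"
    using t_move[of "\<one>\<^bsub>R\<^esub>" "x1 \<ominus>\<^bsub>R\<^esub> x2" x1] y_S s_y by simp
  then have "t x1 x1 \<ominus>\<^bsub>T\<^esub> t x2 x1 = t \<one>\<^bsub>R\<^esub> (x1 \<otimes>\<^bsub>R\<^esub> x1) \<ominus>\<^bsub>T\<^esub> t \<one>\<^bsub>R\<^esub> (x2 \<otimes>\<^bsub>R\<^esub> x1)"
    by (simp add: t_diff_left t_diff_right R.l_distr R.l_minus a_minus_def[of R] t_add_left t_add_right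
        t_minus_left t_minus_right a_minus_def[of T])
  moreover have "t (x1 \<otimes>\<^bsub>R\<^esub> x2) \<one>\<^bsub>R\<^esub> = t \<one>\<^bsub>R\<^esub> (x2 \<otimes>\<^bsub>R\<^esub> x1)"
    using t_move[of "\<one>\<^bsub>R\<^esub>" "x1 \<otimes>\<^bsub>R\<^esub> x2" "\<one>\<^bsub>R\<^esub>"] x12_S s_x12 by simp
  ultimately show ?thesis
    using T.T.diff_swap[of "t x1 x1" "t x2 x1" "t \<one>\<^bsub>R\<^esub> (x1 \<otimes>\<^bsub>R\<^esub> x1)" "t \<one>\<^bsub>R\<^esub> (x2 \<otimes>\<^bsub>R\<^esub> x1)"]
    by (simp add: lact_D ract_D t_closed)
qed

lemma x2_D: "lact T x2 D = ract T D x2"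
proof -
  note [simp] = var_closed
  have "t (x2 \<otimes>\<^bsub>R\<^esub> (x1 \<ominus>\<^bsub>R\<^esub> x2)) \<one>\<^bsub>R\<^esub> = t x2 (x1 \<ominus>\<^bsub>R\<^esub> x2)"
    using t_move[of x2 "x1 \<ominus>\<^bsub>R\<^esub> x2" "\<one>\<^bsub>R\<^esub>"] y_S s_y by simp
  then have "t x2 x1 \<ominus>\<^bsub>T\<^esub> t x2 x2 = t (x2 \<otimes>\<^bsub>R\<^esub> x1) \<one>\<^bsub>R\<^esub> \<ominus>\<^bsub>T\<^esub> t (x2 \<otimes>\<^bsub>R\<^esub> x2) \<one>\<^bsub>R\<^esub>"
    by (simp add: R.r_distr R.r_minus a_minus_def[of R] t_add_left t_add_right
        t_minus_left t_minus_right a_minus_def[of T])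
  moreover have "t \<one>\<^bsub>R\<^esub> (x1 \<otimes>\<^bsub>R\<^esub> x2) = t (x2 \<otimes>\<^bsub>R\<^esub> x1) \<one>\<^bsub>R\<^esub>"
    using t_move[of "\<one>\<^bsub>R\<^esub>" "x2 \<otimes>\<^bsub>R\<^esub> x1" "\<one>\<^bsub>R\<^esub>"] x21_S s_x21 by simp
  ultimately show ?thesis
    using T.T.diff_swap[of "t x2 x1" "t x2 x2" "t (x2 \<otimes>\<^bsub>R\<^esub> x1) \<one>\<^bsub>R\<^esub>" "t (x2 \<otimes>\<^bsub>R\<^esub> x2) \<one>\<^bsub>R\<^esub>"]
    by (simp add: lact_D ract_D t_closed)
qed

lemma D_central: "f \<in> carrier R \<Longrightarrow> lact T f D = ract T D f"
proof (induction f rule: word_induct)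
  case (const a)
  let ?c = "odd_const k a"
  note c = const_closed[OF const]
  have cS: "?c \<in> carrier S" using c d_const[OF const] by (simp add: carrier_S)
  have "t (?c \<otimes>\<^bsub>R\<^esub> x2) \<one>\<^bsub>R\<^esub> = t x2 ?c"
    using t_move[OF var_closed cS, of "\<one>\<^bsub>R\<^esub>" X2] c const by (simp add: const_central var_closed s_const)
  moreover have "t ?c x1 = t \<one>\<^bsub>R\<^esub> (x1 \<otimes>\<^bsub>R\<^esub> ?c)"
    using t_move[OF R.one_closed cS var_closed, of X1] c const const_central[OF const var_closed, of X1]
    by (simp add: s_const)
  ultimately show ?case using c by (simp add: lact_D ract_D)
next
  case (var v x)
  have v: "lact T (odd_var k v) D = ract T D (odd_var k v)" by (cases v) (simp_all add: x1_D x2_D)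
  have "lact T (odd_var k v \<otimes>\<^bsub>R\<^esub> x) D = lact T (odd_var k v) (ract T D x)"
    using var by (simp add: TT.lact_assoc var_closed D_closed)
  also have "\<dots> = ract T (ract T D (odd_var k v)) x"
    using var v by (simp add: TT.lact_ract[symmetric] var_closed D_closed)
  finally show ?case using var by (simp add: TT.ract_assoc var_closed D_closed)
next
  case (add x y)
  then show ?case by (simp add: TT.lact_add_left TT.ract_add_right D_closed)
qed

lemma Delta_hom: "Delta \<in> gr_hom R R 2 A T"
proof (rule gr_homI)
  show "add_hom A T Delta"
    by (rule add_homI) (simp_all add: Delta_eq TT.lact_closed TT.lact_add_left D_closed)
  show "Delta (lact A a x) = lact T a (Delta x)" if "a \<in> carrier R" "x \<in> carrier A" for a x
    using that by (simp add: Delta_eq TT.lact_assoc D_closed)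
  show "Delta (ract A x a) = ract T (Delta x) a" if "a \<in> carrier R" "x \<in> carrier A" for a x
    using that by (simp add: Delta_eq TT.lact_assoc TT.ract_assoc TT.lact_ract D_central D_closed)
  show "Delta x \<in> homog T (i + 2)" if "x \<in> homog A i" for i x
    using TT.lact_homog[OF _ D_homog, of x i] that by (simp add: Delta_eq)
qed

lemma Delta_ract: "f \<in> carrier R \<Longrightarrow> Delta f = ract T D f"
  by (simp add: Delta_eq D_central)

subsection \<open>Tensor products of the building blocks\<close>

lemma pairs: "tensor_pair R gr R gr R gr B T" "tensor_pair R gr R gr R gr B A" "tensor_pair R gr R gr R gr A T"
  "tensor_pair R gr R gr R gr A A" "tensor_pair R gr R gr R gr T B" "tensor_pair R gr R gr R gr A B"
  "tensor_pair R gr R gr R gr T A"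
  by (intro E.tensor_pair_R T_bimod B_bimod regular)+

sublocale BT: tensor_pair R gr R gr R gr B T by (rule pairs)
sublocale BA: tensor_pair R gr R gr R gr B A by (rule pairs)
sublocale AT: tensor_pair R gr R gr R gr A T by (rule pairs)
sublocale AA: tensor_pair R gr R gr R gr A A by (rule pairs)
sublocale TB: tensor_pair R gr R gr R gr T B by (rule pairs)
sublocale AB: tensor_pair R gr R gr R gr A B by (rule pairs)
sublocale TA: tensor_pair R gr R gr R gr T A by (rule pairs)

lemma b_lact: "a \<in> carrier R \<Longrightarrow> f \<in> carrier R \<Longrightarrow> g \<in> carrier R \<Longrightarrow> lact B a (b f g) = b (a \<otimes>\<^bsub>R\<^esub> f) g"
  and b_ract: "a \<in> carrier R \<Longrightarrow> f \<in> carrier R \<Longrightarrow> g \<in> carrier R \<Longrightarrow> ract B (b f g) a = b f (g \<otimes>\<^bsub>R\<^esub> a)"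
  by (simp_all add: B.lact_pure B.ract_pure)

lemma b_move: "f \<in> carrier R \<Longrightarrow> r \<in> carrier S \<Longrightarrow> g \<in> carrier R \<Longrightarrow> b (f \<otimes>\<^bsub>R\<^esub> r) g = b f (r \<otimes>\<^bsub>R\<^esub> g)"
  using B.pure_balanced[of f r g] by simp

text \<open>These elements generate \<open>B \<otimes> T\<close> and \<open>T \<otimes> B\<close>, because the factor of \<open>B\<close> next to \<open>T\<close> slides across
  the tensor product over \<open>R\<close>.\<close>

definition e where "e f g h = BT.pt (b f \<one>\<^bsub>R\<^esub>) (t g h)"
definition z where "z f g h = TB.pt (t f g) (b \<one>\<^bsub>R\<^esub> h)"

lemma e_closed: "f \<in> carrier R \<Longrightarrow> g \<in> carrier R \<Longrightarrow> h \<in> carrier R \<Longrightarrow> e f g h \<in> carrier BT.T"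
  unfolding e_def by (intro BT.pure_closed b_closed t_closed) simp_all

lemma z_closed: "f \<in> carrier R \<Longrightarrow> g \<in> carrier R \<Longrightarrow> h \<in> carrier R \<Longrightarrow> z f g h \<in> carrier TB.T"
  unfolding z_def by (intro TB.pure_closed b_closed t_closed) simp_all

lemma BT_slide: "f \<in> carrier R \<Longrightarrow> g \<in> carrier R \<Longrightarrow> u \<in> carrier T \<Longrightarrow>
    BT.pt (b f g) u = BT.pt (b f \<one>\<^bsub>R\<^esub>) (lact T g u)"
  using BT.pure_balanced[of "b f \<one>\<^bsub>R\<^esub>" g u] b_closed[of f "\<one>\<^bsub>R\<^esub>"] by (simp add: b_ract)

lemma TB_slide: "f \<in> carrier R \<Longrightarrow> g \<in> carrier R \<Longrightarrow> u \<in> carrier T \<Longrightarrow>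
    TB.pt u (b f g) = TB.pt (ract T u f) (b \<one>\<^bsub>R\<^esub> g)"
  using TB.pure_balanced[of u f "b \<one>\<^bsub>R\<^esub> g"] b_closed[of "\<one>\<^bsub>R\<^esub>" g] by (simp add: b_lact)

lemma BT_eqI:
  assumes "add_hom BT.T L \<phi>" "add_hom BT.T L \<psi>" "x \<in> carrier BT.T"
    and eq: "\<And>f g h. \<lbrakk>f \<in> carrier R; g \<in> carrier R; h \<in> carrier R\<rbrakk> \<Longrightarrow> \<phi> (e f g h) = \<psi> (e f g h)"
  shows "\<phi> x = \<psi> x"
proof (rule BT.add_hom_eqI[OF assms(1,2) _ assms(3)])
  have 1: "\<phi> (BT.pt (b f \<one>\<^bsub>R\<^esub>) u) = \<psi> (BT.pt (b f \<one>\<^bsub>R\<^esub>) u)" if "f \<in> carrier R" "u \<in> carrier T" for f u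
    by (rule T_eqI[OF add_hom_comp[OF BT.pure_add_hom_right assms(1)] add_hom_comp[OF BT.pure_add_hom_right assms(2)] that(2)])
      (use that eq in \<open>auto simp: e_def b_closed\<close>)
  show "\<phi> (BT.pt m u) = \<psi> (BT.pt m u)" if "m \<in> carrier B" and u: "u \<in> carrier T" for m u
  proof (rule B.add_hom_eqI[OF add_hom_comp[OF BT.pure_add_hom_left[OF u] assms(1)]
        add_hom_comp[OF BT.pure_add_hom_left[OF u] assms(2)] _ that(1)])
    fix f g assume "f \<in> carrier A" "g \<in> carrier A"
    then show "\<phi> (BT.pt (b f g) u) = \<psi> (BT.pt (b f g) u)"
      using BT_slide[of f g u] 1[of f "lact T g u"] u TT.lact_closed[of g u] by simp
  qed
qed

lemma TB_eqI:
  assumes "add_hom TB.T L \<phi>" "add_hom TB.T L \<psi>" "x \<in> carrier TB.T"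
    and eq: "\<And>f g h. \<lbrakk>f \<in> carrier R; g \<in> carrier R; h \<in> carrier R\<rbrakk> \<Longrightarrow> \<phi> (z f g h) = \<psi> (z f g h)"
  shows "\<phi> x = \<psi> x"
proof (rule TB.add_hom_eqI[OF assms(1,2) _ assms(3)])
  have 1: "\<phi> (TB.pt u (b \<one>\<^bsub>R\<^esub> h)) = \<psi> (TB.pt u (b \<one>\<^bsub>R\<^esub> h))" if "h \<in> carrier R" "u \<in> carrier T" for h u
    by (rule T_eqI[OF add_hom_comp[OF TB.pure_add_hom_left assms(1)] add_hom_comp[OF TB.pure_add_hom_left assms(2)] that(2)])
      (use that eq in \<open>auto simp: z_def b_closed\<close>)
  show "\<phi> (TB.pt u m) = \<psi> (TB.pt u m)" if u: "u \<in> carrier T" and "m \<in> carrier B" for m u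
  proof (rule B.add_hom_eqI[OF add_hom_comp[OF TB.pure_add_hom_right[OF u] assms(1)]
        add_hom_comp[OF TB.pure_add_hom_right[OF u] assms(2)] _ that(2)])
    fix f g assume "f \<in> carrier A" "g \<in> carrier A"
    then show "\<phi> (TB.pt u (b f g)) = \<psi> (TB.pt u (b f g))"
      using TB_slide[of f g u] 1[of g "ract T u f"] u TT.ract_closed[of f u] by simp
  qed
qed

lemma e_move: "\<lbrakk>f \<in> carrier R; g \<in> carrier R; r \<in> carrier S; h \<in> carrier R\<rbrakk> \<Longrightarrow> e f g (s r \<otimes>\<^bsub>R\<^esub> h) = e f (g \<otimes>\<^bsub>R\<^esub> r) h"
  by (simp add: e_def t_move)

lemma e_invariant: "\<lbrakk>f \<in> carrier R; r \<in> carrier S; h \<in> carrier R\<rbrakk> \<Longrightarrow> e f r h = e (f \<otimes>\<^bsub>R\<^esub> r) \<one>\<^bsub>R\<^esub> h"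
  using BT_slide[of f r "t \<one>\<^bsub>R\<^esub> h"] b_move[of f r "\<one>\<^bsub>R\<^esub>"]
  by (simp add: e_def t_closed t_lact S_in_R)

lemma z_move: "\<lbrakk>f \<in> carrier R; g \<in> carrier R; r \<in> carrier S; h \<in> carrier R\<rbrakk> \<Longrightarrow> z f g (r \<otimes>\<^bsub>R\<^esub> h) = z f (g \<otimes>\<^bsub>R\<^esub> r) h"
  using TB_slide[of r h "t f g"] b_move[of "\<one>\<^bsub>R\<^esub>" r h] by (simp add: z_def t_closed t_ract S_in_R)

lemma z_invariant: "\<lbrakk>f \<in> carrier R; r \<in> carrier S; h \<in> carrier R\<rbrakk> \<Longrightarrow> z f r h = z (f \<otimes>\<^bsub>R\<^esub> s r) \<one>\<^bsub>R\<^esub> h"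
  using t_move[of f "s r" "\<one>\<^bsub>R\<^esub>"] by (simp add: z_def s_in_S s_s S_in_R)

lemma e_diff: "\<lbrakk>f \<in> carrier R; g \<in> carrier R; g' \<in> carrier R; h \<in> carrier R\<rbrakk> \<Longrightarrow>
    e f (g \<ominus>\<^bsub>R\<^esub> g') h = e f g h \<ominus>\<^bsub>BT.T\<^esub> e f g' h"
  unfolding e_def
  by (simp add: t_diff_left a_minus_def[of T] BT.pure_add_right BT.pure_minus_right b_closed t_closed a_minus_def[of BT.T])

lemma z_diff: "\<lbrakk>f \<in> carrier R; g \<in> carrier R; g' \<in> carrier R; h \<in> carrier R\<rbrakk> \<Longrightarrow>
    z f (g \<ominus>\<^bsub>R\<^esub> g') h = z f g h \<ominus>\<^bsub>TB.T\<^esub> z f g' h"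
  unfolding z_def
  by (simp add: t_diff_right a_minus_def[of T] TB.pure_add_left TB.pure_minus_left b_closed t_closed a_minus_def[of TB.T])

subsection \<open>The contracting maps\<close>

text \<open>Linearity over \<open>S\<close> on the left holds since \<open>\<delta> (r f) = s(r) \<delta> f\<close>, and the map respects
  \<open>r e = e s(r)\<close> since \<open>\<delta> (f r) = (\<delta> f) r\<close>, for invariant \<open>r\<close>.\<close>

lemma exists_lambda: "\<exists>l \<in> gr_hom S R (- 2) T A. \<forall>f \<in> carrier R. \<forall>g \<in> carrier R. l (t f g) = s (\<delta> f) \<otimes>\<^bsub>R\<^esub> g"
proof -
  have "\<exists>l \<in> gr_hom S R (- 2) T A. \<forall>f \<in> carrier R. \<forall>g \<in> carrier R. l (t f g) = ract A (s (\<delta> f)) g"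
  proof (rule T_lift_right[OF A_SR A_SR])
    show "add_hom A A (\<lambda>f. s (\<delta> f))"
      by (rule add_homI) (simp_all add: s_closed d_closed d_add s_add)
    show "s (\<delta> f) \<in> homog A (i + - 2)" if "f \<in> gr i" for f i
      using s_homog[OF d_homog[OF that]] by simp
  qed (simp_all add: d_left d_right s_mult s_s d_closed s_closed S_in_R)
  then show ?thesis by simp
qed

text \<open>The twist is now needed on the other side: \<open>\<delta> (r g) = s(r) \<delta> g\<close> makes the map respect \<open>e\<close>, and
  \<open>\<delta> (g r) = (\<delta> g) r\<close> makes it linear over \<open>S\<close> on the right.\<close>

lemma exists_theta: "\<exists>l \<in> gr_hom R S (- 2) T A. \<forall>f \<in> carrier R. \<forall>g \<in> carrier R. l (t f g) = f \<otimes>\<^bsub>R\<^esub> \<delta> g"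
proof -
  have "\<exists>l \<in> gr_hom R S (- 2) T A. \<forall>f \<in> carrier R. \<forall>g \<in> carrier R. l (t f g) = lact A f (\<delta> g)"
  proof (rule T_lift_left[OF A_RS A_RS])
    show "add_hom A A \<delta>"
      by (rule add_homI) (simp_all add: d_closed d_add)
    show "\<delta> f \<in> homog A (i + - 2)" if "f \<in> gr i" for f i
      using d_homog[OF that] by simp
  qed (simp_all add: d_left d_right)
  then show ?thesis by simp
qed

text \<open>The composite of \<open>B \<otimes> T \<rightarrow> R \<otimes>\<^sub>S T\<close>, of the identity tensored with \<open>l\<close>, and of
  \<open>R \<otimes>\<^sub>S R = B \<rightarrow> B \<otimes> R\<close>. The map \<open>l\<close> is part of the conclusion because the value on a general tensor is
  expressed by it.\<close>

lemma exists_kappa1: "\<exists>\<kappa> \<in> gr_hom R R (- 2) BT.T BA.T. \<exists>l \<in> gr_hom S R (- 2) T A.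
    (\<forall>f \<in> carrier R. \<forall>g \<in> carrier R. l (t f g) = s (\<delta> f) \<otimes>\<^bsub>R\<^esub> g) \<and>
    (\<forall>f \<in> carrier R. \<forall>g \<in> carrier R. \<forall>u \<in> carrier T. \<kappa> (BT.pt (b f g) u) = BA.pt (b f (l (lact T g u))) \<one>\<^bsub>R\<^esub>)"
proof -
  obtain l where l: "l \<in> gr_hom S R (- 2) T A" "\<forall>f \<in> carrier R. \<forall>g \<in> carrier R. l (t f g) = s (\<delta> f) \<otimes>\<^bsub>R\<^esub> g"
    using exists_lambda by blast
  interpret ST: tensor_pair R gr S grS R gr A T
    by (rule E.tensor_pair_S[OF A_RS E.restrict_left[OF T_bimod]])
  obtain c where c: "c \<in> gr_hom R R 0 BT.T ST.T"
    "\<forall>f \<in> carrier A. \<forall>g \<in> carrier R. \<forall>u \<in> carrier T. c (BT.pt (b f g) u) = ST.pt f (lact T g u)"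
    using E.tensor_cancel_left[OF A_RS T_bimod] by (rule bexE)
  note map = ST.tensor_map_hom[OF B.tensor_pair_axioms gr_hom_id l(1)]
  let ?\<kappa> = "\<lambda>x. BA.pt (tensor_map S A A (\<lambda>x. x) l (c x)) \<one>\<^bsub>R\<^esub>"
  have "?\<kappa> \<in> gr_hom R R (- 2) BT.T BA.T"
    using gr_hom_comp[OF gr_hom_comp[OF c(1) map(1)] E.insert_one_right[OF B_bimod]] by simp
  moreover have pure: "?\<kappa> (BT.pt (b f g) u) = BA.pt (b f (l (lact T g u))) \<one>\<^bsub>R\<^esub>"
    if "f \<in> carrier R" "g \<in> carrier R" "u \<in> carrier T" for f g u
    using that c(2) map(2)[of f "lact T g u"] by (simp add: TT.lact_closed)
  ultimately show ?thesis
    by (intro bexI[of _ ?\<kappa>] bexI[OF _ l(1)] conjI l(2) ballI pure)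
qed

lemma exists_kappa2: "\<exists>\<kappa> \<in> gr_hom R R (- 2) TB.T AB.T. \<exists>l \<in> gr_hom R S (- 2) T A.
    (\<forall>f \<in> carrier R. \<forall>g \<in> carrier R. l (t f g) = f \<otimes>\<^bsub>R\<^esub> \<delta> g) \<and>
    (\<forall>f \<in> carrier R. \<forall>g \<in> carrier R. \<forall>u \<in> carrier T. \<kappa> (TB.pt u (b f g)) = AB.pt \<one>\<^bsub>R\<^esub> (b (l (ract T u f)) g))"
proof -
  obtain l where l: "l \<in> gr_hom R S (- 2) T A" "\<forall>f \<in> carrier R. \<forall>g \<in> carrier R. l (t f g) = f \<otimes>\<^bsub>R\<^esub> \<delta> g"
    using exists_theta by blast
  interpret ST: tensor_pair R gr S grS R gr T A
    by (rule E.tensor_pair_S[OF E.restrict_right[OF T_bimod] A_SR])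
  obtain c where c: "c \<in> gr_hom R R 0 TB.T ST.T"
    "\<forall>g \<in> carrier A. \<forall>f \<in> carrier R. \<forall>u \<in> carrier T. c (TB.pt u (b f g)) = ST.pt (ract T u f) g"
    using E.tensor_cancel_right[OF A_SR T_bimod] by (rule bexE)
  note map = ST.tensor_map_hom[OF B.tensor_pair_axioms l(1) gr_hom_id]
  let ?\<kappa> = "\<lambda>x. AB.pt \<one>\<^bsub>R\<^esub> (tensor_map S A A l (\<lambda>x. x) (c x))"
  have "?\<kappa> \<in> gr_hom R R (- 2) TB.T AB.T"
    using gr_hom_comp[OF gr_hom_comp[OF c(1) map(1)] E.insert_one_left[OF B_bimod]] by simp
  moreover have pure: "?\<kappa> (TB.pt u (b f g)) = AB.pt \<one>\<^bsub>R\<^esub> (b (l (ract T u f)) g)"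
    if "f \<in> carrier R" "g \<in> carrier R" "u \<in> carrier T" for f g u
    using that c(2) map(2)[of "ract T u f" g] by (simp add: TT.ract_closed)
  ultimately show ?thesis
    by (intro bexI[of _ ?\<kappa>] bexI[OF _ l(1)] conjI l(2) ballI pure)
qed

text \<open>In terms of \<open>R \<otimes> T = T\<close> and \<open>B \<otimes> T = R \<otimes>\<^sub>S T\<close> this is \<open>f \<otimes> e \<otimes> h \<mapsto> f \<otimes> (1 \<otimes> e \<otimes> h)\<close>. An invariant
  moves freely between the two places \<open>f\<close> and \<open>1\<close>, so that the map respects the relations through \<open>e\<close>.\<close>

lemma exists_sigma1: "\<exists>\<sigma> \<in> gr_hom R R 0 AT.T BT.T.
    \<forall>a \<in> carrier R. \<forall>g \<in> carrier R. \<forall>h \<in> carrier R. \<sigma> (AT.pt a (t g h)) = e (a \<otimes>\<^bsub>R\<^esub> g) \<one>\<^bsub>R\<^esub> h"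
proof -
  interpret Y: gr_bimod R gr R gr BT.T by (rule BT.gr_bimod_T)
  have "\<exists>n \<in> gr_hom R R 0 T BT.T. \<forall>f \<in> carrier R. \<forall>g \<in> carrier R. n (t f g) = ract BT.T (e f \<one>\<^bsub>R\<^esub> \<one>\<^bsub>R\<^esub>) g"
  proof (rule T_lift_right[OF BT.gr_bimod_T regular])
    show "add_hom A BT.T (\<lambda>f. e f \<one>\<^bsub>R\<^esub> \<one>\<^bsub>R\<^esub>)"
    proof (rule add_homI)
      fix x y assume "x \<in> carrier A" "y \<in> carrier A"
      then show "e (x \<oplus>\<^bsub>A\<^esub> y) \<one>\<^bsub>R\<^esub> \<one>\<^bsub>R\<^esub> = e x \<one>\<^bsub>R\<^esub> \<one>\<^bsub>R\<^esub> \<oplus>\<^bsub>BT.T\<^esub> e y \<one>\<^bsub>R\<^esub> \<one>\<^bsub>R\<^esub>"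
        using B.pure_add_left[of x y "\<one>\<^bsub>R\<^esub>"]
        by (simp add: e_def BT.pure_add_left b_closed t_closed)
    qed (simp add: e_closed)
    show "e (a \<otimes>\<^bsub>R\<^esub> f) \<one>\<^bsub>R\<^esub> \<one>\<^bsub>R\<^esub> = lact BT.T a (e f \<one>\<^bsub>R\<^esub> \<one>\<^bsub>R\<^esub>)" if "a \<in> carrier R" "f \<in> carrier R" for a f
      using that by (simp add: e_def BT.lact_pure b_closed t_closed b_lact)
    show "e (f \<otimes>\<^bsub>R\<^esub> r) \<one>\<^bsub>R\<^esub> \<one>\<^bsub>R\<^esub> = ract BT.T (e f \<one>\<^bsub>R\<^esub> \<one>\<^bsub>R\<^esub>) (s r)" if "f \<in> carrier R" "r \<in> carrier S" for f r
    proof -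
      have "e f r \<one>\<^bsub>R\<^esub> = e f \<one>\<^bsub>R\<^esub> (s r)"
        using e_move[of f "\<one>\<^bsub>R\<^esub>" r "\<one>\<^bsub>R\<^esub>"] that by (simp add: S_in_R s_closed)
      moreover have "ract BT.T (e f \<one>\<^bsub>R\<^esub> \<one>\<^bsub>R\<^esub>) (s r) = e f \<one>\<^bsub>R\<^esub> (s r)"
        using that by (simp add: e_def BT.ract_pure b_closed t_closed t_ract S_in_R s_closed)
      ultimately show ?thesis using e_invariant[of f r "\<one>\<^bsub>R\<^esub>"] that by simp
    qed
    show "e f \<one>\<^bsub>R\<^esub> \<one>\<^bsub>R\<^esub> \<in> homog BT.T (i + 0)" if "f \<in> gr i" for f i
      using BT.homog_pure[OF B.homog_pure[of f i "\<one>\<^bsub>R\<^esub>" 0] t_homog[OF E.one_homog E.one_homog]] that E.one_homog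
      by (simp add: e_def)
  qed
  then obtain n where n: "n \<in> gr_hom R R 0 T BT.T"
    "\<forall>f \<in> carrier R. \<forall>g \<in> carrier R. n (t f g) = ract BT.T (e f \<one>\<^bsub>R\<^esub> \<one>\<^bsub>R\<^esub>) g" by blast
  obtain c where c: "c \<in> gr_hom R R 0 AT.T T" "\<forall>a \<in> carrier R. \<forall>u \<in> carrier T. c (AT.pt a u) = lact T a u"
    using E.tensor_unit_left[OF T_bimod] by blast
  show ?thesis
  proof (intro bexI[of _ "\<lambda>x. n (c x)"] ballI)
    show "(\<lambda>x. n (c x)) \<in> gr_hom R R 0 AT.T BT.T" using gr_hom_comp[OF c(1) n(1)] by simp
    fix a g h assume "a \<in> carrier R" "g \<in> carrier R" "h \<in> carrier R"
    then show "n (c (AT.pt a (t g h))) = e (a \<otimes>\<^bsub>R\<^esub> g) \<one>\<^bsub>R\<^esub> h"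
      using c(2) n(2) by (simp add: t_closed t_lact e_def BT.ract_pure b_closed t_ract)
  qed
qed

lemma exists_sigma2: "\<exists>\<sigma> \<in> gr_hom R R 0 TA.T TB.T.
    \<forall>a \<in> carrier R. \<forall>g \<in> carrier R. \<forall>h \<in> carrier R. \<sigma> (TA.pt (t g h) a) = z g \<one>\<^bsub>R\<^esub> (h \<otimes>\<^bsub>R\<^esub> a)"
proof -
  interpret Y: gr_bimod R gr R gr TB.T by (rule TB.gr_bimod_T)
  have "\<exists>n \<in> gr_hom R R 0 T TB.T. \<forall>f \<in> carrier R. \<forall>g \<in> carrier R. n (t f g) = lact TB.T f (z \<one>\<^bsub>R\<^esub> \<one>\<^bsub>R\<^esub> g)"
  proof (rule T_lift_left[OF TB.gr_bimod_T regular])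
    show "add_hom A TB.T (z \<one>\<^bsub>R\<^esub> \<one>\<^bsub>R\<^esub>)"
    proof (rule add_homI)
      fix x y assume "x \<in> carrier A" "y \<in> carrier A"
      then show "z \<one>\<^bsub>R\<^esub> \<one>\<^bsub>R\<^esub> (x \<oplus>\<^bsub>A\<^esub> y) = z \<one>\<^bsub>R\<^esub> \<one>\<^bsub>R\<^esub> x \<oplus>\<^bsub>TB.T\<^esub> z \<one>\<^bsub>R\<^esub> \<one>\<^bsub>R\<^esub> y"
        using B.pure_add_right[of "\<one>\<^bsub>R\<^esub>" x y]
        by (simp add: z_def TB.pure_add_right b_closed t_closed)
    qed (simp add: z_closed)
    show "z \<one>\<^bsub>R\<^esub> \<one>\<^bsub>R\<^esub> (g \<otimes>\<^bsub>R\<^esub> a) = ract TB.T (z \<one>\<^bsub>R\<^esub> \<one>\<^bsub>R\<^esub> g) a" if "a \<in> carrier R" "g \<in> carrier R" for a g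
      using that by (simp add: z_def TB.ract_pure b_closed t_closed b_ract)
    show "z \<one>\<^bsub>R\<^esub> \<one>\<^bsub>R\<^esub> (r \<otimes>\<^bsub>R\<^esub> g) = lact TB.T (s r) (z \<one>\<^bsub>R\<^esub> \<one>\<^bsub>R\<^esub> g)" if "g \<in> carrier R" "r \<in> carrier S" for g r
    proof -
      have "z \<one>\<^bsub>R\<^esub> \<one>\<^bsub>R\<^esub> (r \<otimes>\<^bsub>R\<^esub> g) = z \<one>\<^bsub>R\<^esub> r g"
        using z_move[of "\<one>\<^bsub>R\<^esub>" "\<one>\<^bsub>R\<^esub>" r g] that by (simp add: S_in_R)
      also have "\<dots> = z (s r) \<one>\<^bsub>R\<^esub> g" using z_invariant[of "\<one>\<^bsub>R\<^esub>" r g] that by (simp add: S_in_R s_closed)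
      also have "\<dots> = lact TB.T (s r) (z \<one>\<^bsub>R\<^esub> \<one>\<^bsub>R\<^esub> g)"
        using that by (simp add: z_def TB.lact_pure b_closed t_closed t_lact S_in_R s_closed)
      finally show ?thesis .
    qed
    show "z \<one>\<^bsub>R\<^esub> \<one>\<^bsub>R\<^esub> g \<in> homog TB.T (i + 0)" if "g \<in> gr i" for g i
      using TB.homog_pure[OF t_homog[OF E.one_homog E.one_homog] B.homog_pure[of "\<one>\<^bsub>R\<^esub>" 0 g i]] that E.one_homog
      by (simp add: z_def)
  qed
  then obtain n where n: "n \<in> gr_hom R R 0 T TB.T"
    "\<forall>f \<in> carrier R. \<forall>g \<in> carrier R. n (t f g) = lact TB.T f (z \<one>\<^bsub>R\<^esub> \<one>\<^bsub>R\<^esub> g)" by blast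
  obtain c where c: "c \<in> gr_hom R R 0 TA.T T" "\<forall>u \<in> carrier T. \<forall>a \<in> carrier R. c (TA.pt u a) = ract T u a"
    using E.tensor_unit_right[OF T_bimod] by blast
  show ?thesis
  proof (intro bexI[of _ "\<lambda>x. n (c x)"] ballI)
    show "(\<lambda>x. n (c x)) \<in> gr_hom R R 0 TA.T TB.T" using gr_hom_comp[OF c(1) n(1)] by simp
    fix a g h assume "a \<in> carrier R" "g \<in> carrier R" "h \<in> carrier R"
    then show "n (c (TA.pt (t g h) a)) = z g \<one>\<^bsub>R\<^esub> (h \<otimes>\<^bsub>R\<^esub> a)"
      using c(2) n(2) by (simp add: t_closed t_ract z_def TB.lact_pure b_closed t_lact)
  qed
qed

lemma unit_iso: "\<exists>u \<in> gr_hom R R 0 AA.T A. \<exists>v \<in> gr_hom R R 0 A AA.T.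
    (\<forall>a \<in> carrier R. u (v a) = a) \<and> (\<forall>x \<in> carrier AA.T. v (u x) = x)"
proof -
  obtain u where u: "u \<in> gr_hom R R 0 AA.T A" "\<forall>a \<in> carrier R. \<forall>c \<in> carrier A. u (AA.pt a c) = lact A a c"
    using E.tensor_unit_left[OF regular] by blast
  note v = E.insert_one_left[OF regular]
  have "AA.pt \<one>\<^bsub>R\<^esub> (u x) = x" if "x \<in> carrier AA.T" for x
  proof (rule AA.gr_hom_eqI[OF gr_hom_comp[OF u(1) v] gr_hom_id _ that])
    fix m n assume "m \<in> carrier A" "n \<in> carrier A"
    then show "AA.pt \<one>\<^bsub>R\<^esub> (u (AA.pt m n)) = AA.pt m n"
      using u(2) AA.pure_balanced[of "\<one>\<^bsub>R\<^esub>" m n] by simp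
  qed
  then show ?thesis
    by (intro bexI[OF _ u(1)] bexI[OF _ v]) (use u(2) in simp)
qed

lemma AT_eqI:
  assumes "add_hom AT.T L \<phi>" "add_hom AT.T L \<psi>" "x \<in> carrier AT.T"
    and eq: "\<And>a g h. \<lbrakk>a \<in> carrier R; g \<in> carrier R; h \<in> carrier R\<rbrakk> \<Longrightarrow> \<phi> (AT.pt a (t g h)) = \<psi> (AT.pt a (t g h))"
  shows "\<phi> x = \<psi> x"
proof (rule AT.add_hom_eqI[OF assms(1,2) _ assms(3)])
  fix a u assume a: "a \<in> carrier A" and u: "u \<in> carrier T"
  show "\<phi> (AT.pt a u) = \<psi> (AT.pt a u)"
    by (rule T_eqI[OF add_hom_comp[OF AT.pure_add_hom_right[OF a] assms(1)]
          add_hom_comp[OF AT.pure_add_hom_right[OF a] assms(2)] u])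
      (use a eq in simp)
qed

lemma TA_eqI:
  assumes "add_hom TA.T L \<phi>" "add_hom TA.T L \<psi>" "x \<in> carrier TA.T"
    and eq: "\<And>a g h. \<lbrakk>a \<in> carrier R; g \<in> carrier R; h \<in> carrier R\<rbrakk> \<Longrightarrow> \<phi> (TA.pt (t g h) a) = \<psi> (TA.pt (t g h) a)"
  shows "\<phi> x = \<psi> x"
proof (rule TA.add_hom_eqI[OF assms(1,2) _ assms(3)])
  fix u a assume u: "u \<in> carrier T" and a: "a \<in> carrier A"
  show "\<phi> (TA.pt u a) = \<psi> (TA.pt u a)"
    by (rule T_eqI[OF add_hom_comp[OF TA.pure_add_hom_left[OF a] assms(1)]
          add_hom_comp[OF TA.pure_add_hom_left[OF a] assms(2)] u])
      (use a eq in simp)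
qed

lemma hom_minus: "f \<in> gr_hom P Q d T A \<Longrightarrow> u \<in> carrier T \<Longrightarrow> f (\<ominus>\<^bsub>T\<^esub> u) = \<ominus>\<^bsub>R\<^esub> f u"
  using add_hom_minus[OF T.T_abelian E.A.is_abelian_group gr_hom_add_hom, of f P Q d u] by (simp add: R_inv_A)

lemma m_shift_hom: "odd_m k \<in> gr_hom R R 0 (shift (- 1) B) (shift (- 1) A)"
  using m_hom by (simp add: gr_hom_shift)

lemma Delta_shift_hom: "Delta \<in> gr_hom R R 0 (shift 1 A) (shift (- 1) T)"
  using Delta_hom by (simp add: gr_hom_shift)

lemma Delta_one: "Delta \<one>\<^bsub>R\<^esub> = D"
  by (simp add: Delta_eq TT.lact_one D_closed)

text \<open>The three relations between \<open>\<kappa>\<close>, \<open>\<sigma>\<close>, \<open>\<alpha>\<close> and \<open>\<gamma>\<close> are checked on generators. Since \<open>l (x \<Delta>(1)) = - x\<close>,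
  \<open>\<kappa> \<alpha> = - 1\<close>; since \<open>\<delta> 1 = 0\<close>, \<open>\<kappa> \<sigma> = 0\<close>; and up to elements of the image of \<open>\<sigma>\<close>, \<open>1 + \<alpha> \<kappa>\<close> replaces \<open>g\<close> by its invariant part \<open>g - x\<^sub>2 \<delta> g\<close>.\<close>

theorem rouquier_tensor_inverse:
  "homotopy_equivalent_complexes R gr (tensor_complex R (odd_rouquier k \<delta>) (odd_rouquier' k s \<delta>)) (concentrated A)"
proof -
  interpret tp: two_term_pair R gr 0 "shift (- 1) B" "shift (- 1) A" "odd_m k" "- 1" "shift 1 A" "shift (- 1) T" Delta
    by (intro two_term_pair.intro two_term_complex.intro two_term_pair_axioms.intro gr_bimod_shift B_bimod T_bimod
        regular m_shift_hom Delta_shift_hom G.H_generates) simp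
  obtain \<kappa> l where \<kappa>: "\<kappa> \<in> gr_hom R R (- 2) BT.T BA.T" and l: "l \<in> gr_hom S R (- 2) T A"
    "\<And>f g. f \<in> carrier R \<Longrightarrow> g \<in> carrier R \<Longrightarrow> l (t f g) = s (\<delta> f) \<otimes>\<^bsub>R\<^esub> g"
    and \<kappa>_pure: "\<And>f g u. f \<in> carrier R \<Longrightarrow> g \<in> carrier R \<Longrightarrow> u \<in> carrier T \<Longrightarrow>
      \<kappa> (BT.pt (b f g) u) = BA.pt (b f (l (lact T g u))) \<one>\<^bsub>R\<^esub>"
    using exists_kappa1 by metis
  obtain \<sigma> where \<sigma>: "\<sigma> \<in> gr_hom R R 0 AT.T BT.T"
    and \<sigma>_pure: "\<And>a g h. a \<in> carrier R \<Longrightarrow> g \<in> carrier R \<Longrightarrow> h \<in> carrier R \<Longrightarrow>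
      \<sigma> (AT.pt a (t g h)) = e (a \<otimes>\<^bsub>R\<^esub> g) \<one>\<^bsub>R\<^esub> h"
    using exists_sigma1 by metis
  obtain u v where u: "u \<in> gr_hom R R 0 AA.T A" and v: "v \<in> gr_hom R R 0 A AA.T"
    and uv: "\<And>a. a \<in> carrier R \<Longrightarrow> u (v a) = a" "\<And>x. x \<in> carrier AA.T \<Longrightarrow> v (u x) = x"
    using unit_iso by metis
  note \<kappa>_add = gr_hom_add_hom[OF \<kappa>] and \<sigma>_add = gr_hom_add_hom[OF \<sigma>]
  have \<alpha>_add: "add_hom BA.T BT.T tp.\<alpha>"
    using gr_hom_add_hom[OF tp.alpha_hom] by (simp only: tensor_shift add_hom_shift)
  have \<alpha>_pure: "tp.\<alpha> (BA.pt m a) = BT.pt m (Delta a)" if "m \<in> carrier B" "a \<in> carrier R" for m a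
    using tp.alpha_pure[of m a] that by (simp add: pure_tensor_shift)
  have \<gamma>_add: "add_hom BT.T AT.T tp.\<gamma>"
    using gr_hom_add_hom[OF tp.gamma_hom] by (simp only: tensor_shift add_hom_shift)
  have \<gamma>_pure: "tp.\<gamma> (BT.pt m w) = AT.pt (odd_m k m) w" if "m \<in> carrier B" "w \<in> carrier T" for m w
    using tp.gamma_pure[of m w] that by (simp add: pure_tensor_shift)
  have l_closed: "l w \<in> carrier R" if "w \<in> carrier T" for w using gr_hom_closed[OF l(1) that] by simp
  have l_D: "l (lact T x D) = \<ominus>\<^bsub>R\<^esub> x" if x: "x \<in> carrier R" for x
  proof -
    have "l (lact T x D) = \<ominus>\<^bsub>R\<^esub> s (\<delta> (x \<otimes>\<^bsub>R\<^esub> x2)) \<oplus>\<^bsub>R\<^esub> \<ominus>\<^bsub>R\<^esub> (s (\<delta> x) \<otimes>\<^bsub>R\<^esub> x1)"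
      using x gr_hom_add[OF l(1)]
      by (simp add: lact_D a_minus_def[of T] hom_minus[OF l(1)] t_closed var_closed l(2) s_closed d_closed)
    also have "\<dots> = \<ominus>\<^bsub>R\<^esub> (s (\<delta> (x \<otimes>\<^bsub>R\<^esub> x2)) \<oplus>\<^bsub>R\<^esub> s (\<delta> x) \<otimes>\<^bsub>R\<^esub> x1)"
      using x by (simp add: R.minus_add s_closed d_closed var_closed)
    finally show ?thesis using s_d_mult_x2[OF x] by simp
  qed
  have \<kappa>_\<alpha>: "\<kappa> (tp.\<alpha> x) = \<ominus>\<^bsub>BA.T\<^esub> x" if x: "x \<in> carrier BA.T" for x
  proof (rule BA.add_hom_eqI[OF add_hom_comp[OF \<alpha>_add \<kappa>_add] add_hom_neg[OF BA.T_abelian add_hom_id] _ x])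
    fix m a assume m: "m \<in> carrier B" and a: "a \<in> carrier A"
    show "\<kappa> (tp.\<alpha> (BA.pt m a)) = \<ominus>\<^bsub>BA.T\<^esub> BA.pt m a"
    proof (rule B.add_hom_eqI[OF add_hom_comp[OF add_hom_comp[OF BA.pure_add_hom_left[OF a] \<alpha>_add] \<kappa>_add]
          add_hom_neg[OF BA.T_abelian BA.pure_add_hom_left[OF a]] _ m])
      fix f g assume "f \<in> carrier A" "g \<in> carrier A"
      then have fg: "f \<in> carrier R" "g \<in> carrier R" "a \<in> carrier R" using a by simp_all
      have "lact T g (lact T a D) = lact T (g \<otimes>\<^bsub>R\<^esub> a) D" using fg by (simp add: TT.lact_assoc D_closed)
      then have "\<kappa> (tp.\<alpha> (BA.pt (b f g) a)) = BA.pt (b f (\<ominus>\<^bsub>R\<^esub> (g \<otimes>\<^bsub>R\<^esub> a))) \<one>\<^bsub>R\<^esub>"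
        using fg l_D[of "g \<otimes>\<^bsub>R\<^esub> a"]
        by (simp add: \<alpha>_pure \<kappa>_pure b_closed Delta_eq TT.lact_closed D_closed)
      also have "\<dots> = \<ominus>\<^bsub>BA.T\<^esub> BA.pt (b f (g \<otimes>\<^bsub>R\<^esub> a)) \<one>\<^bsub>R\<^esub>"
        using fg B.pure_minus_right[of f "g \<otimes>\<^bsub>R\<^esub> a"] BA.pure_minus_left[of "b f (g \<otimes>\<^bsub>R\<^esub> a)" "\<one>\<^bsub>R\<^esub>"]
        by (simp add: R_inv_A b_closed)
      also have "BA.pt (b f (g \<otimes>\<^bsub>R\<^esub> a)) \<one>\<^bsub>R\<^esub> = BA.pt (b f g) a"
        using fg BA.pure_balanced[of "b f g" a "\<one>\<^bsub>R\<^esub>"] by (simp add: b_ract b_closed)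
      finally show "\<kappa> (tp.\<alpha> (BA.pt (b f g) a)) = \<ominus>\<^bsub>BA.T\<^esub> BA.pt (b f g) a" .
    qed
  qed
  have \<gamma>_e: "tp.\<gamma> (e f \<one>\<^bsub>R\<^esub> h) = AT.pt f (t \<one>\<^bsub>R\<^esub> h)" if "f \<in> carrier R" "h \<in> carrier R" for f h
    using that by (simp add: e_def \<gamma>_pure b_closed t_closed m_pure)
  have \<gamma>_\<sigma>: "tp.\<gamma> (\<sigma> x) = x" if x: "x \<in> carrier AT.T" for x
  proof (rule AT_eqI[OF add_hom_comp[OF \<sigma>_add \<gamma>_add] add_hom_id x])
    fix a g h assume "a \<in> carrier R" "g \<in> carrier R" "h \<in> carrier R"
    then show "tp.\<gamma> (\<sigma> (AT.pt a (t g h))) = AT.pt a (t g h)"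
      using AT.pure_balanced[of a g "t \<one>\<^bsub>R\<^esub> h"] by (simp add: \<sigma>_pure \<gamma>_e t_closed t_lact)
  qed
  have \<kappa>_e: "\<kappa> (e f g h) = BA.pt (b f (s (\<delta> g) \<otimes>\<^bsub>R\<^esub> h)) \<one>\<^bsub>R\<^esub>"
    if "f \<in> carrier R" "g \<in> carrier R" "h \<in> carrier R" for f g h
    using that by (simp add: e_def \<kappa>_pure t_closed TT.lact_one l(2))
  have \<kappa>_\<sigma>: "\<kappa> (\<sigma> x) = \<zero>\<^bsub>BA.T\<^esub>" if x: "x \<in> carrier AT.T" for x
  proof (rule AT_eqI[OF add_hom_comp[OF \<sigma>_add \<kappa>_add] add_hom_zero_map[OF BA.T_abelian] x])
    fix a g h assume "a \<in> carrier R" "g \<in> carrier R" "h \<in> carrier R"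
    then show "\<kappa> (\<sigma> (AT.pt a (t g h))) = \<zero>\<^bsub>BA.T\<^esub>"
      using B.pure_zero_right[of "a \<otimes>\<^bsub>R\<^esub> g"] BA.pure_zero_left[of "\<one>\<^bsub>R\<^esub>"]
      by (simp add: \<sigma>_pure \<kappa>_e d_one s_zero)
  qed
  have homotopy: "\<sigma> (tp.\<gamma> (x \<oplus>\<^bsub>BT.T\<^esub> tp.\<alpha> (\<kappa> x))) = x \<oplus>\<^bsub>BT.T\<^esub> tp.\<alpha> (\<kappa> x)" if x: "x \<in> carrier BT.T" for x
  proof -
    note one_plus = add_hom_plus[OF BT.T_abelian add_hom_id add_hom_comp[OF \<kappa>_add \<alpha>_add]]
    show ?thesis
    proof (rule BT_eqI[OF add_hom_comp[OF add_hom_comp[OF one_plus \<gamma>_add] \<sigma>_add] one_plus x])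
      fix f g h assume f: "f \<in> carrier R" and g: "g \<in> carrier R" and h: "h \<in> carrier R"
      define p where "p = s (\<delta> g)"
      define c where "c = g \<ominus>\<^bsub>R\<^esub> x2 \<otimes>\<^bsub>R\<^esub> \<delta> g"
      have p: "p \<in> carrier R" using g by (simp add: p_def s_closed d_closed)
      have c: "c \<in> carrier S" "c \<in> carrier R" using invariant_part_x2[OF g] S_in_R by (simp_all add: c_def)
      note [simp] = f g h p c(2) var_closed d_closed[OF g]
      have "tp.\<alpha> (\<kappa> (e f g h)) = BT.pt (b f (p \<otimes>\<^bsub>R\<^esub> h)) D"
        by (simp add: \<kappa>_e \<alpha>_pure b_closed Delta_one flip: p_def)
      also have "\<dots> = BT.pt (b f \<one>\<^bsub>R\<^esub>) (ract T D (p \<otimes>\<^bsub>R\<^esub> h))"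
        using BT_slide[of f "p \<otimes>\<^bsub>R\<^esub> h" D] D_central[of "p \<otimes>\<^bsub>R\<^esub> h"] by (simp add: D_closed)
      also have "\<dots> = \<ominus>\<^bsub>BT.T\<^esub> e f x2 (p \<otimes>\<^bsub>R\<^esub> h) \<oplus>\<^bsub>BT.T\<^esub> \<ominus>\<^bsub>BT.T\<^esub> e f \<one>\<^bsub>R\<^esub> (x1 \<otimes>\<^bsub>R\<^esub> (p \<otimes>\<^bsub>R\<^esub> h))"
        by (simp add: ract_D a_minus_def[of T] e_def BT.pure_add_right BT.pure_minus_right b_closed t_closed)
      also have "e f x2 (p \<otimes>\<^bsub>R\<^esub> h) = e f (x2 \<otimes>\<^bsub>R\<^esub> \<delta> g) h"
        unfolding p_def by (rule e_move) (simp_all add: d_in_S)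
      \<comment> \<open>The term that comes from \<open>x\<^sub>2\<close> reduces \<open>g\<close> to its invariant part \<open>c\<close>, which slides to the left
        factor; then only elements with \<open>1\<close> in the second place remain, and \<open>\<sigma>\<close> after \<open>\<gamma>\<close> fixes these.\<close>
      finally have "e f g h \<oplus>\<^bsub>BT.T\<^esub> tp.\<alpha> (\<kappa> (e f g h)) =
          (e f g h \<ominus>\<^bsub>BT.T\<^esub> e f (x2 \<otimes>\<^bsub>R\<^esub> \<delta> g) h) \<oplus>\<^bsub>BT.T\<^esub> \<ominus>\<^bsub>BT.T\<^esub> e f \<one>\<^bsub>R\<^esub> (x1 \<otimes>\<^bsub>R\<^esub> (p \<otimes>\<^bsub>R\<^esub> h))"
        by (simp add: a_minus_def[of BT.T] BT.T.a_assoc e_closed)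
      also have "e f g h \<ominus>\<^bsub>BT.T\<^esub> e f (x2 \<otimes>\<^bsub>R\<^esub> \<delta> g) h = e (f \<otimes>\<^bsub>R\<^esub> c) \<one>\<^bsub>R\<^esub> h"
        using e_diff[of f g "x2 \<otimes>\<^bsub>R\<^esub> \<delta> g" h] e_invariant[OF f c(1) h] by (simp flip: c_def)
      finally have y: "e f g h \<oplus>\<^bsub>BT.T\<^esub> tp.\<alpha> (\<kappa> (e f g h)) =
          e (f \<otimes>\<^bsub>R\<^esub> c) \<one>\<^bsub>R\<^esub> h \<oplus>\<^bsub>BT.T\<^esub> \<ominus>\<^bsub>BT.T\<^esub> e f \<one>\<^bsub>R\<^esub> (x1 \<otimes>\<^bsub>R\<^esub> (p \<otimes>\<^bsub>R\<^esub> h))" .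
      have fixed_pure: "\<sigma> (tp.\<gamma> (e f' \<one>\<^bsub>R\<^esub> h')) = e f' \<one>\<^bsub>R\<^esub> h'" if "f' \<in> carrier R" "h' \<in> carrier R" for f' h'
        using that by (simp add: \<gamma>_e \<sigma>_pure)
      note \<gamma>\<sigma> = add_hom_comp[OF \<gamma>_add \<sigma>_add]
      show "\<sigma> (tp.\<gamma> (e f g h \<oplus>\<^bsub>BT.T\<^esub> tp.\<alpha> (\<kappa> (e f g h)))) = e f g h \<oplus>\<^bsub>BT.T\<^esub> tp.\<alpha> (\<kappa> (e f g h))"
        unfolding y
        by (simp add: add_hom_add[OF \<gamma>\<sigma>] add_hom_minus[OF BT.T_abelian BT.T_abelian \<gamma>\<sigma>] fixed_pure e_closed)
    qed
  qed
  have "homotopy_equivalent_complexes R gr tp.K (concentrated A)"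
  proof (rule tp.contract_even[where z = u and z' = v and \<kappa> = \<kappa> and \<sigma> = \<sigma>])
    show "u \<in> gr_hom R R 0 tp.NM.T A" "v \<in> gr_hom R R 0 A tp.NM.T"
      using u v by (simp_all add: tensor_shift)
    show "\<kappa> \<in> gr_hom R R 0 tp.MN.T tp.MM.T" using \<kappa> by (simp add: tensor_shift gr_hom_shift_source)
    show "\<sigma> \<in> gr_hom R R 0 tp.NN.T tp.MN.T" using \<sigma> by (simp add: tensor_shift gr_hom_shift)
  qed (simp_all add: tensor_shift regular uv \<kappa>_\<alpha> \<gamma>_\<sigma> \<kappa>_\<sigma> homotopy)
  then show ?thesis
    by (simp add: odd_rouquier_def odd_rouquier'_def odd_B_def odd_B_twisted_def)
qed

text \<open>Mirror image of the preceding proof, with \<open>x\<^sub>1\<close> in place of \<open>x\<^sub>2\<close> and \<open>f \<otimes> e \<otimes> g \<mapsto> f \<delta> g\<close> as the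
  contracting map.\<close>

theorem inverse_tensor_rouquier:
  "homotopy_equivalent_complexes R gr (tensor_complex R (odd_rouquier' k s \<delta>) (odd_rouquier k \<delta>)) (concentrated A)"
proof -
  interpret tp: two_term_pair R gr "- 1" "shift 1 A" "shift (- 1) T" Delta 0 "shift (- 1) B" "shift (- 1) A" "odd_m k"
    by (intro two_term_pair.intro two_term_complex.intro two_term_pair_axioms.intro gr_bimod_shift B_bimod T_bimod
        regular m_shift_hom Delta_shift_hom G.H_generates) simp
  obtain \<kappa> l where \<kappa>: "\<kappa> \<in> gr_hom R R (- 2) TB.T AB.T" and l: "l \<in> gr_hom R S (- 2) T A"
    "\<And>f g. f \<in> carrier R \<Longrightarrow> g \<in> carrier R \<Longrightarrow> l (t f g) = f \<otimes>\<^bsub>R\<^esub> \<delta> g"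
    and \<kappa>_pure: "\<And>f g u. f \<in> carrier R \<Longrightarrow> g \<in> carrier R \<Longrightarrow> u \<in> carrier T \<Longrightarrow>
      \<kappa> (TB.pt u (b f g)) = AB.pt \<one>\<^bsub>R\<^esub> (b (l (ract T u f)) g)"
    using exists_kappa2 by metis
  obtain \<sigma> where \<sigma>: "\<sigma> \<in> gr_hom R R 0 TA.T TB.T"
    and \<sigma>_pure: "\<And>a g h. a \<in> carrier R \<Longrightarrow> g \<in> carrier R \<Longrightarrow> h \<in> carrier R \<Longrightarrow>
      \<sigma> (TA.pt (t g h) a) = z g \<one>\<^bsub>R\<^esub> (h \<otimes>\<^bsub>R\<^esub> a)"
    using exists_sigma2 by metis
  obtain u v where u: "u \<in> gr_hom R R 0 AA.T A" and v: "v \<in> gr_hom R R 0 A AA.T"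
    and uv: "\<And>a. a \<in> carrier R \<Longrightarrow> u (v a) = a" "\<And>x. x \<in> carrier AA.T \<Longrightarrow> v (u x) = x"
    using unit_iso by metis
  note \<kappa>_add = gr_hom_add_hom[OF \<kappa>] and \<sigma>_add = gr_hom_add_hom[OF \<sigma>]
  have \<beta>_add: "add_hom AB.T TB.T tp.\<beta>"
    using gr_hom_add_hom[OF tp.beta_hom] by (simp only: tensor_shift add_hom_shift)
  have \<beta>_pure: "tp.\<beta> (AB.pt a m) = TB.pt (Delta a) m" if "m \<in> carrier B" "a \<in> carrier R" for m a
    using tp.beta_pure[of a m] that by (simp add: pure_tensor_shift)
  have \<eta>_add: "add_hom TB.T TA.T tp.\<eta>"
    using gr_hom_add_hom[OF tp.eta_hom] by (simp only: tensor_shift add_hom_shift)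
  have \<eta>_pure: "tp.\<eta> (TB.pt w m) = TA.pt w (odd_m k m)" if "m \<in> carrier B" "w \<in> carrier T" for m w
    using tp.eta_pure[of w m] that by (simp add: pure_tensor_shift)
  have l_D: "l (ract T D x) = \<ominus>\<^bsub>R\<^esub> x" if x: "x \<in> carrier R" for x
  proof -
    have "l (ract T D x) = \<ominus>\<^bsub>R\<^esub> (x2 \<otimes>\<^bsub>R\<^esub> \<delta> x) \<oplus>\<^bsub>R\<^esub> \<ominus>\<^bsub>R\<^esub> \<delta> (x1 \<otimes>\<^bsub>R\<^esub> x)"
      using x gr_hom_add[OF l(1)]
      by (simp add: ract_D a_minus_def[of T] hom_minus[OF l(1)] t_closed var_closed l(2) d_closed)
    also have "\<dots> = \<ominus>\<^bsub>R\<^esub> (x2 \<otimes>\<^bsub>R\<^esub> \<delta> x \<oplus>\<^bsub>R\<^esub> \<delta> (x1 \<otimes>\<^bsub>R\<^esub> x))"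
      using x by (simp add: R.minus_add d_closed var_closed)
    finally show ?thesis using d_x1_mult[OF x] by simp
  qed
  have \<kappa>_\<beta>: "\<kappa> (tp.\<beta> x) = \<ominus>\<^bsub>AB.T\<^esub> x" if x: "x \<in> carrier AB.T" for x
  proof (rule AB.add_hom_eqI[OF add_hom_comp[OF \<beta>_add \<kappa>_add] add_hom_neg[OF AB.T_abelian add_hom_id] _ x])
    fix a m assume a: "a \<in> carrier A" and m: "m \<in> carrier B"
    show "\<kappa> (tp.\<beta> (AB.pt a m)) = \<ominus>\<^bsub>AB.T\<^esub> AB.pt a m"
    proof (rule B.add_hom_eqI[OF add_hom_comp[OF add_hom_comp[OF AB.pure_add_hom_right[OF a] \<beta>_add] \<kappa>_add]
          add_hom_neg[OF AB.T_abelian AB.pure_add_hom_right[OF a]] _ m])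
      fix f g assume "f \<in> carrier A" "g \<in> carrier A"
      then have fg: "f \<in> carrier R" "g \<in> carrier R" "a \<in> carrier R" using a by simp_all
      have "ract T (ract T D a) f = ract T D (a \<otimes>\<^bsub>R\<^esub> f)" using fg by (simp add: TT.ract_assoc D_closed)
      then have "\<kappa> (tp.\<beta> (AB.pt a (b f g))) = AB.pt \<one>\<^bsub>R\<^esub> (b (\<ominus>\<^bsub>R\<^esub> (a \<otimes>\<^bsub>R\<^esub> f)) g)"
        using fg l_D[of "a \<otimes>\<^bsub>R\<^esub> f"]
        by (simp add: \<beta>_pure \<kappa>_pure b_closed Delta_ract TT.ract_closed D_closed)
      also have "\<dots> = \<ominus>\<^bsub>AB.T\<^esub> AB.pt \<one>\<^bsub>R\<^esub> (b (a \<otimes>\<^bsub>R\<^esub> f) g)"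
        using fg B.pure_minus_left[of "a \<otimes>\<^bsub>R\<^esub> f" g] AB.pure_minus_right[of "\<one>\<^bsub>R\<^esub>" "b (a \<otimes>\<^bsub>R\<^esub> f) g"]
        by (simp add: R_inv_A b_closed)
      also have "AB.pt \<one>\<^bsub>R\<^esub> (b (a \<otimes>\<^bsub>R\<^esub> f) g) = AB.pt a (b f g)"
        using fg AB.pure_balanced[of "\<one>\<^bsub>R\<^esub>" a "b f g"] by (simp add: b_lact b_closed)
      finally show "\<kappa> (tp.\<beta> (AB.pt a (b f g))) = \<ominus>\<^bsub>AB.T\<^esub> AB.pt a (b f g)" .
    qed
  qed
  have \<eta>_z: "tp.\<eta> (z f \<one>\<^bsub>R\<^esub> h) = TA.pt (t f \<one>\<^bsub>R\<^esub>) h" if "f \<in> carrier R" "h \<in> carrier R" for f h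
    using that by (simp add: z_def \<eta>_pure b_closed t_closed m_pure)
  have \<eta>_\<sigma>: "tp.\<eta> (\<sigma> x) = x" if x: "x \<in> carrier TA.T" for x
  proof (rule TA_eqI[OF add_hom_comp[OF \<sigma>_add \<eta>_add] add_hom_id x])
    fix a g h assume "a \<in> carrier R" "g \<in> carrier R" "h \<in> carrier R"
    then show "tp.\<eta> (\<sigma> (TA.pt (t g h) a)) = TA.pt (t g h) a"
      using TA.pure_balanced[of "t g \<one>\<^bsub>R\<^esub>" h a] by (simp add: \<sigma>_pure \<eta>_z t_closed t_ract)
  qed
  have \<kappa>_z: "\<kappa> (z f g h) = AB.pt \<one>\<^bsub>R\<^esub> (b (f \<otimes>\<^bsub>R\<^esub> \<delta> g) h)"
    if "f \<in> carrier R" "g \<in> carrier R" "h \<in> carrier R" for f g h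
    using that by (simp add: z_def \<kappa>_pure t_closed TT.ract_one l(2))
  have \<kappa>_\<sigma>: "\<kappa> (\<sigma> x) = \<zero>\<^bsub>AB.T\<^esub>" if x: "x \<in> carrier TA.T" for x
  proof (rule TA_eqI[OF add_hom_comp[OF \<sigma>_add \<kappa>_add] add_hom_zero_map[OF AB.T_abelian] x])
    fix a g h assume "a \<in> carrier R" "g \<in> carrier R" "h \<in> carrier R"
    then show "\<kappa> (\<sigma> (TA.pt (t g h) a)) = \<zero>\<^bsub>AB.T\<^esub>"
      using B.pure_zero_left[of "h \<otimes>\<^bsub>R\<^esub> a"] AB.pure_zero_right[of "\<one>\<^bsub>R\<^esub>"]
      by (simp add: \<sigma>_pure \<kappa>_z d_one)
  qed
  have homotopy: "\<sigma> (tp.\<eta> (x \<oplus>\<^bsub>TB.T\<^esub> tp.\<beta> (\<kappa> x))) = x \<oplus>\<^bsub>TB.T\<^esub> tp.\<beta> (\<kappa> x)" if x: "x \<in> carrier TB.T" for x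
  proof -
    note one_plus = add_hom_plus[OF TB.T_abelian add_hom_id add_hom_comp[OF \<kappa>_add \<beta>_add]]
    show ?thesis
    proof (rule TB_eqI[OF add_hom_comp[OF add_hom_comp[OF one_plus \<eta>_add] \<sigma>_add] one_plus x])
      fix f g h assume f: "f \<in> carrier R" and g: "g \<in> carrier R" and h: "h \<in> carrier R"
      define w where "w = \<delta> g \<otimes>\<^bsub>R\<^esub> h"
      define c where "c = g \<ominus>\<^bsub>R\<^esub> x1 \<otimes>\<^bsub>R\<^esub> \<delta> g"
      have c: "c \<in> carrier S" "c \<in> carrier R" using invariant_part_x1[OF g] S_in_R by (simp_all add: c_def)
      note [simp] = f g h c(2) var_closed d_closed[OF g]
      have w [simp]: "w \<in> carrier R" by (simp add: w_def)
      have "tp.\<beta> (\<kappa> (z f g h)) = TB.pt D (b f w)"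
        using b_move[OF f d_in_S[OF g] h] by (simp add: \<kappa>_z \<beta>_pure b_closed Delta_one w_def)
      also have "\<dots> = TB.pt (lact T f D) (b \<one>\<^bsub>R\<^esub> w)"
        using TB_slide[of f w D] D_central[of f] by (simp add: D_closed)
      also have "\<dots> = \<ominus>\<^bsub>TB.T\<^esub> z (f \<otimes>\<^bsub>R\<^esub> x2) \<one>\<^bsub>R\<^esub> w \<oplus>\<^bsub>TB.T\<^esub> \<ominus>\<^bsub>TB.T\<^esub> z f x1 w"
        by (simp add: lact_D a_minus_def[of T] z_def TB.pure_add_left TB.pure_minus_left b_closed t_closed)
      also have "z f x1 w = z f (x1 \<otimes>\<^bsub>R\<^esub> \<delta> g) h"
        unfolding w_def by (rule z_move) (simp_all add: d_in_S)
      \<comment> \<open>Here the term that comes from \<open>x\<^sub>1\<close> reduces \<open>g\<close> to its invariant part \<open>c\<close>, which is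
        twisted by \<open>s\<close> on its way across \<open>e\<close>.\<close>
      finally have "z f g h \<oplus>\<^bsub>TB.T\<^esub> tp.\<beta> (\<kappa> (z f g h)) =
          (z f g h \<ominus>\<^bsub>TB.T\<^esub> z f (x1 \<otimes>\<^bsub>R\<^esub> \<delta> g) h) \<oplus>\<^bsub>TB.T\<^esub> \<ominus>\<^bsub>TB.T\<^esub> z (f \<otimes>\<^bsub>R\<^esub> x2) \<one>\<^bsub>R\<^esub> w"
        by (simp add: a_minus_def[of TB.T] TB.T.a_ac z_closed)
      also have "z f g h \<ominus>\<^bsub>TB.T\<^esub> z f (x1 \<otimes>\<^bsub>R\<^esub> \<delta> g) h = z (f \<otimes>\<^bsub>R\<^esub> s c) \<one>\<^bsub>R\<^esub> h"
        using z_diff[of f g "x1 \<otimes>\<^bsub>R\<^esub> \<delta> g" h] z_invariant[OF f c(1) h] by (simp flip: c_def)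
      finally have y: "z f g h \<oplus>\<^bsub>TB.T\<^esub> tp.\<beta> (\<kappa> (z f g h)) =
          z (f \<otimes>\<^bsub>R\<^esub> s c) \<one>\<^bsub>R\<^esub> h \<oplus>\<^bsub>TB.T\<^esub> \<ominus>\<^bsub>TB.T\<^esub> z (f \<otimes>\<^bsub>R\<^esub> x2) \<one>\<^bsub>R\<^esub> w" .
      have fixed_pure: "\<sigma> (tp.\<eta> (z f' \<one>\<^bsub>R\<^esub> h')) = z f' \<one>\<^bsub>R\<^esub> h'" if "f' \<in> carrier R" "h' \<in> carrier R" for f' h'
        using that by (simp add: \<eta>_z \<sigma>_pure)
      note \<eta>\<sigma> = add_hom_comp[OF \<eta>_add \<sigma>_add]
      show "\<sigma> (tp.\<eta> (z f g h \<oplus>\<^bsub>TB.T\<^esub> tp.\<beta> (\<kappa> (z f g h)))) = z f g h \<oplus>\<^bsub>TB.T\<^esub> tp.\<beta> (\<kappa> (z f g h))"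
        unfolding y
        by (simp add: add_hom_add[OF \<eta>\<sigma>] add_hom_minus[OF TB.T_abelian TB.T_abelian \<eta>\<sigma>] fixed_pure z_closed s_closed)
    qed
  qed
  have "homotopy_equivalent_complexes R gr tp.K (concentrated A)"
  proof (rule tp.contract_odd[where z = u and z' = v and \<kappa> = \<kappa> and \<sigma> = \<sigma>])
    show "u \<in> gr_hom R R 0 tp.MN.T A" "v \<in> gr_hom R R 0 A tp.MN.T"
      using u v by (simp_all add: tensor_shift)
    show "\<kappa> \<in> gr_hom R R 0 tp.NM.T tp.MM.T" using \<kappa> by (simp add: tensor_shift gr_hom_shift_source)
    show "\<sigma> \<in> gr_hom R R 0 tp.NN.T tp.NM.T" using \<sigma> by (simp add: tensor_shift gr_hom_shift)
  qed (simp_all add: tensor_shift regular uv \<kappa>_\<beta> \<eta>_\<sigma> \<kappa>_\<sigma> homotopy)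
  then show ?thesis
    by (simp add: odd_rouquier_def odd_rouquier'_def odd_B_def odd_B_twisted_def)
qed

end

theorem theorem4p1:
  fixes k :: "('k, 'c) ring_scheme"
    and s \<delta> :: "(gen list \<Rightarrow> 'k) set \<Rightarrow> (gen list \<Rightarrow> 'k) set"
  assumes "cring k"
    and "odd_swap k s"
    and "odd_demazure k s \<delta>"
  shows "homotopy_equivalent_complexes (odd_ring k) (odd_grading k)
           (tensor_complex (odd_ring k) (odd_rouquier k \<delta>) (odd_rouquier' k s \<delta>))
           (concentrated (odd_regular k)) \<and>
         homotopy_equivalent_complexes (odd_ring k) (odd_grading k)
           (tensor_complex (odd_ring k) (odd_rouquier' k s \<delta>) (odd_rouquier k \<delta>))
           (concentrated (odd_regular k))"
proof -
  interpret odd_setting k s \<delta>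
    using assms by (intro odd_setting.intro odd_base.intro odd_setting_axioms.intro)
  show ?thesis using rouquier_tensor_inverse inverse_tensor_rouquier by blast
qed

end
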